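(* Let $M$ be a smooth manifold and let $\alpha$ be a flat connection on $M$ with values in a filtered differential graded Lie algebra $\mathfrak g$. Then the diagram $$\begin{array}{ccc} C_\bullet(M)&\xrightarrow{\ \mathsf{hol}^\infty_\alpha\ }&\hat{\mathsf B}\,\hat{\mathbb U}_\infty(\mathfrak g)\\ &{\scriptstyle\mathsf{hol}_\alpha}\searrow&\downarrow{\scriptstyle\hat{\mathsf B}\hat{\mathbb U}(\rho)}\\ &&\hat{\mathsf B}\,\hat{\mathbb U}(\mathfrak g)\end{array}$$ commutes, i.e. $\hat{\mathsf B}\hat{\mathbb U}(\rho)\circ\mathsf{hol}^\infty_\alpha=\mathsf{hol}_\alpha$.
   Context: **Conventions.** All vector spaces are over $\mathbb R$, graded means $\mathbb Z$-graded, differentials have degree $+1$, and the Koszul sign rule is used. $(\mathsf sV)^k=V^{k+1}$, $(\mathsf uV)^k=V^{k-1}$. Dg algebras are unital, dg coalgebras counital. $\mathsf S(V)\subset\mathsf TV$ is the coalgebra of graded-symmetric tensors, with the deconcatenation coproduct; a bar over $\mathsf S,\mathsf T$ denotes the part of positive tensor degree. **$L_\infty$-algebras.** An $L_\infty$-algebra structure on $\mathfrak g$ is a square-zero degree $+1$ coderivation, vanishing on $1$, of $\mathsf S(\mathsf s\mathfrak g)$; write $\mathsf{CE}(\mathfrak g)$ for the resulting co-augmented cocommutative dg coalgebra and $\mu_k:\mathsf S^k(\mathsf s\mathfrak g)\to\mathsf s\mathfrak g$ for its components. The brackets $[x_1,\dots,x_k]$ are obtained from $\mu_k$ by graded symmetrization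 over the symmetric group, so that $[\alpha,\dots,\alpha]$ corresponds to $k!\,\mu_k((\mathsf s\alpha)^{\otimes k})$ for $|\alpha|=1$. A morphism $\phi:\mathfrak g\to\mathfrak h$ is a morphism $\mathsf{CE}(\mathfrak g)\to\mathsf{CE}(\mathfrak h)$ of co-augmented dg coalgebras, with components $\phi_k:\mathsf S^k(\mathsf s\mathfrak g)\to\mathsf s\mathfrak h$. Dg Lie algebras are $L_\infty$-algebras in the usual way. A Maurer--Cartan element of a complete $L_\infty$-algebra is a degree $1$ element with $\sum_{k\ge1}\frac1{k!}[\alpha,\dots,\alpha]=0$; for a dg algebra the condition is $d\alpha+\alpha\cdot\alpha=0$, $|\alpha|=1$. **Strictification and enveloping algebra.** For a (connected) co-augmented cocommutative dg coalgebra $C$ with reduced part $\overline C$ and reduced coproduct $\overline\Delta$, $\mathsf L(C)$ is the free graded Lie algebra on $\mathsf u\overline C$ with the differential $\delta(\mathsf ux)=\mathsf u\,dx-\sum_i(-1)^{|x_i|}\mathsf ux_i\otimes\mathsf uy_i$ if $\overline\Delta x=\sum_ix_i\otimes y_i$. $\mathsf L$ is left adjoint to $\mathsf{CE}$ on dg Lie algebras. Set $\mathbb S(\mathfrak g)=\mathsf L(\mathsf{CE}(\mathfrak g))$, let $\eta:\mathfrak g\to\mathbb S(\mathfrak g)$ be the $L_\infty$-morphism given by the unit $\mathsf{CE}(\mathfrak g)\to\mathsf{CE}(\mathsf L(\mathsf{CE}(\mathfrak g)))$, and $\mathbb U_\infty(\mathfrak g)=\mathbb U(\mathbb S(\mathfrak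 g))$ where $\mathbb U$ is the usual enveloping algebra of a dg Lie algebra. For a dg Lie algebra $\mathfrak g$, $\rho:\mathbb S(\mathfrak g)\to\mathfrak g$ is the morphism of dg Lie algebras corresponding to $\mathrm{id}_{\mathsf{CE}(\mathfrak g)}$ under the adjunction, and it induces $\mathbb U(\rho):\mathbb U_\infty(\mathfrak g)\to\mathbb U(\mathfrak g)$ and its completion $\hat{\mathbb U}(\rho)$. **Filtrations.** An ideal of $\mathfrak g$ is a graded subspace $I$ with $[x_1,\dots,x_k]\in I$ whenever some $x_i\in I$. A filtration on $\mathfrak g$ is a decreasing sequence of ideals $\mathfrak g=F_1\supseteq F_2\supseteq\cdots$ with $\bigcap_kF_k=0$ and $[x_1,\dots,x_k]\in F_{l_1+\dots+l_k}$ whenever $x_i\in F_{l_i}$; a morphism $\phi$ is filtered if $x_i\in F_{l_i}$ implies $\phi_k(x_1,\dots,x_k)\in F_{l_1+\dots+l_k}$. The completion is $\hat{\mathfrak g}=\varprojlim\mathfrak g/F_k$. A filtration of an augmented dg algebra is a filtration of its augmentation ideal. If $\mathfrak g$ is filtered, $\mathsf u\overline{\mathsf S}(\mathsf s\mathfrak g)$ is filtered by total weight, $\mathbb S(\mathfrak g)$ by letting $F_k$ be spanned by Lie monomials of total weight $\ge k$, and, for a filtered dg Lie algebra $\mathfrak h$, the augmentation ideal of $\mathbb U(\mathfrak h)$ by the image of the weight filtration of $\overline{\mathsf T}\mathfrak h$. Hats denote completions, in particular $\hat{\mathbb U}(\mathfrak g)$ and $\hat{\mathbb U}_\infty(\mathfrak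 g)$. For filtered $X$, $X\otimes A$ has filtration $F_k(X)\otimes A$ and completion $X\hat\otimes A$. **Tensor products.** For a commutative dg algebra $A$, $\mathfrak g\otimes A$ is an $L_\infty$-algebra with $[x\otimes a]=[x]\otimes a+(-1)^{|x|+1}x\otimes da$ and $[x_1\otimes a_1,\dots,x_k\otimes a_k]=(-1)^{\sum_{i<j}|a_i|(|x_j|+1)}[x_1,\dots,x_k]\otimes a_1\cdots a_k$ for $k\ne1$. For an $L_\infty$-morphism $\gamma$, $\gamma\otimes\mathrm{id}_A$ has components $(\mathsf sx_1\otimes a_1)\otimes\cdots\otimes(\mathsf sx_k\otimes a_k)\mapsto(-1)^{\sum_{i<j}|a_i|(|x_j|+1)}\gamma_k(\mathsf sx_1\otimes\cdots\otimes\mathsf sx_k)\otimes a_1\cdots a_k$. For a dg algebra $B$, $B\otimes\Omega(M)$ is the tensor product of $B$ with $(\Omega(M),-d,\wedge)$, and $B\otimes C^\bullet(M)$ that with the smooth singular cochains $(C^\bullet(M),\delta,\cup)$. $C_\bullet(M)$ (smooth singular chains with Alexander--Whitney coproduct) is placed in non-positive degrees, and signs in $C^\bullet(M)$ are such that $B\otimes C^\bullet(M)\hookrightarrow\mathrm{Hom}(C_\bullet(M),B)$ is a morphism of dg algebras (convolution product on the right). A filtered $L_\infty$-morphism $\phi$ of complete algebras induces $\phi_*(\alpha)=\sum_k\phi_k(\alpha^{\otimes k})$; the same formula is used for $A_\infty$-morphisms. **Gugenheim's $A_\infty$-morphism.** Let $\Delta_k=\{1\ge t_1\ge\cdots\ge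 t_k\ge0\}\subset\mathbb R^k$, $I=[0,1]$, and let $\mathsf PM$ be the path space. Let $\mathrm{ev}:\mathsf PM\times\Delta_k\to M^k$, $(\gamma,(t_i))\mapsto(\gamma(t_1),\dots,\gamma(t_k))$, $\pi:\mathsf PM\times\Delta_k\to\mathsf PM$ the projection ($\pi_*$ is fibre integration), $p_i:M^k\to M$ the projections. Chen's map is $\mathsf C(\mathsf sa_1\otimes\cdots\otimes\mathsf sa_k)=(-1)^{\sum_i[a_i](k-i)}\pi_*\mathrm{ev}^*(p_1^*a_1\wedge\cdots\wedge p_k^*a_k)$, $[a_i]=|\mathsf sa_i|$. Let $\pi_k:I^k\to\Delta_k$, $t_i=\max\{x_i,\dots,x_k\}$; let $\lambda_{(k)}:I^{k-1}\to\mathsf PI^k$ send $(x_1,\dots,x_{k-1})$ to the piecewise linear path with value $x_1e_1+\dots+x_je_j$ at time $\frac{k-j}k$, $j=0,\dots,k$, where $x_k=1$; $\Theta_{(k)}=\mathsf P\pi_k\circ\lambda_{(k)}:I^{k-1}\to\mathsf P\Delta_k$. Let $\mathsf S:\Omega(\mathsf PM)\to\mathsf sC^\bullet(M)$ be (the suspension of) $\beta\mapsto(\sigma\mapsto\int_{I^{k-1}}\Theta_{(k)}^*(\mathsf P\sigma)^*\beta)$ for $\sigma:\Delta_k\to M$. Put $\psi_1(\mathsf sa)(\sigma:\Delta_k\to M)=(-1)^k\int_{\Delta_k}\sigma^*a$ and $\psi_n=\mathsf S\circ\mathsf C$ on $(\mathsf s\Omega(M))^{\otimes n}$ for $n>1$.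 By Gugenheim, $\psi=(\psi_n)$ is an $A_\infty$-quasi-isomorphism from $(\Omega(M),-d,\wedge)$ to $(C^\bullet(M),\delta,\cup)$, natural in $M$. For a dg algebra $B$, $\mathrm{id}\otimes\psi:B\otimes\Omega(M)\to B\otimes C^\bullet(M)$ is the $A_\infty$-morphism which multiplies the $B$-factors and applies $\psi_n$ to the form factors, with Koszul signs. **Holonomies.** A connection on $M$ with values in $\mathfrak g$ is a degree $1$ element $\alpha\in\mathfrak g\hat\otimes\Omega(M)$; it is flat if it is Maurer--Cartan. The element $\mathsf{hol}^\infty_\alpha$ is the image of $\alpha$ under $$\mathfrak g\hat\otimes\Omega(M)\xrightarrow{(\eta\otimes\mathrm{id})_*}\mathbb S(\mathfrak g)\hat\otimes\Omega(M)\longrightarrow\mathbb U_\infty(\mathfrak g)\hat\otimes\Omega(M)\xrightarrow{(\mathrm{id}\otimes\psi)_*}\mathbb U_\infty(\mathfrak g)\hat\otimes C^\bullet(M),$$ with middle map induced by $\mathbb S(\mathfrak g)\subset\mathbb U(\mathbb S(\mathfrak g))$. For a filtered dg Lie algebra $\mathfrak g$, the element $\mathsf{hol}_\alpha$ is the image of $\alpha$ under $$\mathfrak g\hat\otimes\Omega(M)\longrightarrow\mathbb U(\mathfrak g)\hat\otimes\Omega(M)\xrightarrow{(\mathrm{id}\otimes\psi)_*}\mathbb U(\mathfrak g)\hat\otimes C^\bullet(M),$$ with first map induced by $\mathfrak g\subset\mathbb U(\mathfrak g)$. Via the completions of $B\otimes C^\bullet(M)\hookrightarrow\mathrm{Hom}(C_\bullet(M),B)$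 these are regarded as linear maps from $C_\bullet(M)$ to the augmentation ideals of $\hat{\mathbb U}_\infty(\mathfrak g)$ and $\hat{\mathbb U}(\mathfrak g)$. **Completed bar complex.** For an augmented dg algebra $A$ with augmentation ideal $\underline A$, $\mathsf BA=\mathsf T(\mathsf s\underline A)$ is the bar coalgebra with coderivation $\delta(\mathsf sx_1\otimes\cdots\otimes\mathsf sx_k)=-\sum_i(-1)^{n_i}\mathsf sx_1\otimes\cdots\otimes\mathsf sdx_i\otimes\cdots\otimes\mathsf sx_k+\sum_{i\ge2}(-1)^{n_i}\mathsf sx_1\otimes\cdots\otimes\mathsf s(x_{i-1}x_i)\otimes\cdots\otimes\mathsf sx_k$, $n_i=|\mathsf sx_1|+\dots+|\mathsf sx_{i-1}|$. $\hat{\mathsf B}A$ is its completion for the filtration by tensor degree $\ge k$. A linear map $f:C\to\underline A$ of degree $1$ determines $c\mapsto\epsilon(c)+f(c)+f^{\otimes2}(\Delta c)+f^{\otimes3}(\Delta^2c)+\cdots$ from $C$ to $\hat{\mathsf B}A$, where $f$ is viewed as a degree $0$ map to $\mathsf s\underline A$ (by $c\mapsto-\mathsf sf(c)$, for the stated signs in the coderivation $\delta$ of $\mathsf BA$). The maps $\mathsf{hol}^\infty_\alpha$ and $\mathsf{hol}_\alpha$ of the claim are determined in this way by the elements $\mathsf{hol}^\infty_\alpha\in\mathbb U_\infty(\mathfrak g)\hat\otimes C^\bullet(M)$ and $\mathsf{hol}_\alpha\in\mathbb U(\mathfrak g)\hat\otimes C^\bullet(M)$, respectively; for flat $\alpha$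 they are morphisms of dg coalgebras. $\hat{\mathsf B}$ of an algebra morphism $g$ is induced by $\mathsf T(\mathsf sg)$. *)

theory Defs
  imports "HOL-Analysis.Analysis" "HOL-Algebra.Ideal" "HOL-Algebra.Module" "HOL-Library.Poly_Mapping"
begin

section \<open>Graded vector spaces with a differential and a product\<close>

text \<open>
  A dg object is a module over the reals in the sense of HOL-Algebra, with its homogeneous
  components and its differential (of degree +1).  The product field is the multiplication of a
  dg algebra and the bracket of a dg Lie algebra.  The shifts \<open>sV\<close> and \<open>uV\<close> have the same elements
  as \<open>V\<close>; only the components are renumbered.
\<close>

record 'a dg = "(real, 'a) module" +
  grade :: "int \<Rightarrow> 'a set"
  dif :: "'a \<Rightarrow> 'a"

definition real_ring :: "real ring" where
  "real_ring = \<lparr>carrier = UNIV, mult = (*), one = 1, ring.zero = 0, add = (+)\<rparr>"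

definition sg :: "int \<Rightarrow> real" where
  "sg k = (if even k then 1 else -1)"

definition homog :: "('a, 'm) dg_scheme \<Rightarrow> 'a set" where
  "homog V = (\<Union>k. grade V k)"

text \<open>The degree of a homogeneous element; it is meaningless for 0.\<close>

definition deg :: "('a, 'm) dg_scheme \<Rightarrow> 'a \<Rightarrow> int" where
  "deg V x = (SOME k. x \<in> grade V k)"

abbreviation subsp :: "'a set \<Rightarrow> ('a, 'm) dg_scheme \<Rightarrow> bool" where
  "subsp W V \<equiv> submodule W real_ring V"

definition vspan :: "('a, 'm) dg_scheme \<Rightarrow> 'a set \<Rightarrow> 'a set" where
  "vspan V S = \<Inter>{W. subsp W V \<and> S \<subseteq> W}"

definition graded_space :: "('a, 'm) dg_scheme \<Rightarrow> bool" where
  "graded_space V \<longleftrightarrow> module real_ring V \<and> (\<forall>k. subsp (grade V k) V) \<and>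
     (\<forall>x\<in>carrier V. \<exists>!c. (\<forall>k. c k \<in> grade V k) \<and> finite {k. c k \<noteq> \<zero>\<^bsub>V\<^esub>} \<and>
        x = (\<Oplus>\<^bsub>V\<^esub>k\<in>{k. c k \<noteq> \<zero>\<^bsub>V\<^esub>}. c k))"

definition graded_subspace :: "'a set \<Rightarrow> ('a, 'm) dg_scheme \<Rightarrow> bool" where
  "graded_subspace W V \<longleftrightarrow> subsp W V \<and> W = vspan V (W \<inter> homog V)"

definition susp :: "'a dg \<Rightarrow> 'a dg" where
  "susp V = V\<lparr>grade := (\<lambda>k. grade V (k + 1))\<rparr>"

definition desusp :: "'a dg \<Rightarrow> 'a dg" where
  "desusp V = V\<lparr>grade := (\<lambda>k. grade V (k - 1))\<rparr>"

definition restr :: "'a dg \<Rightarrow> 'a set \<Rightarrow> 'a dg" where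
  "restr V W = V\<lparr>carrier := W, grade := (\<lambda>k. grade V k \<inter> W)\<rparr>"

text \<open>The set of \<open>f x + N\<close> for \<open>x\<close> in a coset \<open>X\<close>: the map of quotients induced by \<open>f\<close>.\<close>

definition cmap :: "('b, 'm) dg_scheme \<Rightarrow> 'b set \<Rightarrow> ('a \<Rightarrow> 'b) \<Rightarrow> 'a set \<Rightarrow> 'b set" where
  "cmap V N f X = (\<Union>x\<in>X. N +>\<^bsub>V\<^esub> f x)"

definition quot :: "'a dg \<Rightarrow> 'a set \<Rightarrow> 'a set dg" where
  "quot V N = \<lparr>carrier = (\<lambda>x. N +>\<^bsub>V\<^esub> x) ` carrier V,
     mult = (\<lambda>X Y. \<Union>x\<in>X. \<Union>y\<in>Y. N +>\<^bsub>V\<^esub> (x \<otimes>\<^bsub>V\<^esub> y)),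
     one = N +>\<^bsub>V\<^esub> \<one>\<^bsub>V\<^esub>, ring.zero = N, add = (\<lambda>X Y. X <+>\<^bsub>V\<^esub> Y),
     smult = (\<lambda>c. cmap V N (\<lambda>x. c \<odot>\<^bsub>V\<^esub> x)),
     grade = (\<lambda>k. (\<lambda>x. N +>\<^bsub>V\<^esub> x) ` grade V k), dif = cmap V N (dif V)\<rparr>"

definition psc :: "real \<Rightarrow> ('w \<Rightarrow>\<^sub>0 real) \<Rightarrow> ('w \<Rightarrow>\<^sub>0 real)" where
  "psc c p = Poly_Mapping.map ((*) c) p"

text \<open>Linear extension of a map defined on a basis, with values in a free vector space
  and in an arbitrary one.\<close>

definition pext :: "('w \<Rightarrow> ('v \<Rightarrow>\<^sub>0 real)) \<Rightarrow> ('w \<Rightarrow>\<^sub>0 real) \<Rightarrow> ('v \<Rightarrow>\<^sub>0 real)" where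
  "pext f p = (\<Sum>w\<in>Poly_Mapping.keys p. psc (Poly_Mapping.lookup p w) (f w))"

definition lext :: "('a, 'm) dg_scheme \<Rightarrow> ('w \<Rightarrow> 'a) \<Rightarrow> ('w \<Rightarrow>\<^sub>0 real) \<Rightarrow> 'a" where
  "lext V f p = (\<Oplus>\<^bsub>V\<^esub>w\<in>Poly_Mapping.keys p. Poly_Mapping.lookup p w \<odot>\<^bsub>V\<^esub> f w)"

text \<open>Free vector space on \<open>S\<close>; product, unit, degree and differential are given on the basis.\<close>

definition free_dg :: "'w set \<Rightarrow> ('w \<Rightarrow> 'w \<Rightarrow> ('w \<Rightarrow>\<^sub>0 real)) \<Rightarrow> ('w \<Rightarrow>\<^sub>0 real) \<Rightarrow> ('w \<Rightarrow> int) \<Rightarrow>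
    ('w \<Rightarrow> ('w \<Rightarrow>\<^sub>0 real)) \<Rightarrow> ('w \<Rightarrow>\<^sub>0 real) dg" where
  "free_dg S m e d D = \<lparr>carrier = {p. Poly_Mapping.keys p \<subseteq> S},
     mult = (\<lambda>p q. pext (\<lambda>v. pext (m v) q) p), one = e, ring.zero = 0, add = (+), smult = psc,
     grade = (\<lambda>k. {p. Poly_Mapping.keys p \<subseteq> {w\<in>S. d w = k}}), dif = pext D\<rparr>"

section \<open>Tensor algebra, symmetric tensors, enveloping algebra\<close>

text \<open>
  \<open>T(V)\<close> is the free vector space on lists of homogeneous elements modulo the multilinear
  relations.  Lists of homogeneous elements span, and all Koszul signs make sense on them.
\<close>

type_synonym 'a tens = "('a list \<Rightarrow>\<^sub>0 real) set"

definition wdeg :: "'a dg \<Rightarrow> 'a list \<Rightarrow> int" where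
  "wdeg V w = (\<Sum>x\<leftarrow>w. deg V x)"

definition tword :: "'a dg \<Rightarrow> ('a list \<Rightarrow>\<^sub>0 real) dg" where
  "tword V = free_dg (lists (homog V)) (\<lambda>v w. Poly_Mapping.single (v @ w) 1)
     (Poly_Mapping.single [] 1) (wdeg V)
     (\<lambda>w. \<Sum>i<length w. Poly_Mapping.single (w[i := dif V (w ! i)]) (sg (wdeg V (take i w))))"

definition trel :: "'a dg \<Rightarrow> ('a list \<Rightarrow>\<^sub>0 real) set" where
  "trel V = vspan (tword V)
     ({Poly_Mapping.single (u @ [x \<oplus>\<^bsub>V\<^esub> y] @ v) 1 - Poly_Mapping.single (u @ [x] @ v) 1
         - Poly_Mapping.single (u @ [y] @ v) 1 | u v x y k.
         u \<in> lists (homog V) \<and> v \<in> lists (homog V) \<and> x \<in> grade V k \<and> y \<in> grade V k} \<union>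
      {Poly_Mapping.single (u @ [c \<odot>\<^bsub>V\<^esub> x] @ v) 1 - Poly_Mapping.single (u @ [x] @ v) c | u v x c.
         u \<in> lists (homog V) \<and> v \<in> lists (homog V) \<and> x \<in> homog V})"

definition tens_alg :: "'a dg \<Rightarrow> 'a tens dg" where
  "tens_alg V = quot (tword V) (trel V)"

definition tcls :: "'a dg \<Rightarrow> ('a list \<Rightarrow>\<^sub>0 real) \<Rightarrow> 'a tens" where
  "tcls V p = trel V +>\<^bsub>tword V\<^esub> p"

definition tmap :: "'b dg \<Rightarrow> ('a \<Rightarrow> 'b) \<Rightarrow> 'a tens \<Rightarrow> 'b tens" where
  "tmap V f = cmap (tword V) (trel V) (pext (\<lambda>w. Poly_Mapping.single (map f w) 1))"

definition tlen :: "'a dg \<Rightarrow> nat \<Rightarrow> 'a tens set" where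
  "tlen V n = vspan (tens_alg V)
     {tcls V (Poly_Mapping.single w 1) | w. w \<in> lists (homog V) \<and> n \<le> length w}"

definition twt :: "'a dg \<Rightarrow> (nat \<Rightarrow> 'a set) \<Rightarrow> nat \<Rightarrow> 'a tens set" where
  "twt V F k = vspan (tens_alg V) {tcls V (Poly_Mapping.single w 1) | w. w \<in> lists (homog V) \<and>
     (\<exists>l. length l = length w \<and> (\<forall>i<length w. w ! i \<in> F (l ! i)) \<and> k \<le> sum_list l)}"

definition swapw :: "'a dg \<Rightarrow> nat \<Rightarrow> 'a list \<Rightarrow> ('a list \<Rightarrow>\<^sub>0 real)" where
  "swapw V i w = (if Suc i < length w
     then Poly_Mapping.single (w[i := w ! Suc i, Suc i := w ! i]) (sg (deg V (w ! i) * deg V (w ! Suc i)))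
     else Poly_Mapping.single w 1)"

text \<open>Graded-symmetric tensors: those fixed by all adjacent transpositions.\<close>

definition sym_tens :: "'a dg \<Rightarrow> 'a tens set" where
  "sym_tens V = {X \<in> carrier (tens_alg V). \<forall>i. cmap (tword V) (trel V) (pext (swapw V i)) X = X}"

definition rsym_tens :: "'a dg \<Rightarrow> 'a tens set" where
  "rsym_tens V = sym_tens V \<inter> tlen V 1"

text \<open>Projection of \<open>T(V)\<close> onto \<open>V\<close>, and of \<open>x\<^sub>1 \<otimes> \<dots> \<otimes> x\<^sub>k\<close> onto the symmetric tensors.\<close>

definition pr1 :: "'a dg \<Rightarrow> 'a tens \<Rightarrow> 'a" where
  "pr1 V X = the_elem (lext V (\<lambda>w. if length w = 1 then hd w else \<zero>\<^bsub>V\<^esub>) ` X)"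

definition symz :: "'a dg \<Rightarrow> 'a list \<Rightarrow> 'a tens" where
  "symz V w = tcls V (\<Sum>\<pi> | \<pi> permutes {..<length w}.
     Poly_Mapping.single (map (\<lambda>i. w ! \<pi> i) [0..<length w])
       (sg (\<Sum>(i, j)\<in>{(i, j). i < j \<and> j < length w \<and> \<pi> j < \<pi> i}. deg V (w ! \<pi> i) * deg V (w ! \<pi> j))
        / fact (length w)))"

definition urel :: "'a dg \<Rightarrow> 'a tens set" where
  "urel h = Idl\<^bsub>tens_alg h\<^esub>
     {tcls h (Poly_Mapping.single [x, y] 1 - Poly_Mapping.single [y, x] (sg (deg h x * deg h y))
        - Poly_Mapping.single [x \<otimes>\<^bsub>h\<^esub> y] 1) | x y. x \<in> homog h \<and> y \<in> homog h}"

definition env :: "'a dg \<Rightarrow> 'a tens set dg" where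
  "env h = quot (tens_alg h) (urel h)"

text \<open>The map from homogeneous elements of \<open>h\<close> to its enveloping algebra.\<close>

definition to_env :: "'a dg \<Rightarrow> 'a \<Rightarrow> 'a tens set" where
  "to_env h x = urel h +>\<^bsub>tens_alg h\<^esub> tcls h (Poly_Mapping.single [x] 1)"

definition env_map :: "'b dg \<Rightarrow> ('a \<Rightarrow> 'b) \<Rightarrow> 'a tens set \<Rightarrow> 'b tens set" where
  "env_map h f = cmap (tens_alg h) (urel h) (tmap h f)"

text \<open>Index 0 is the whole algebra and index 1 the augmentation ideal.\<close>

definition env_fil :: "'a dg \<Rightarrow> (nat \<Rightarrow> 'a set) \<Rightarrow> nat \<Rightarrow> 'a tens set set" where
  "env_fil h F k = (\<lambda>X. urel h +>\<^bsub>tens_alg h\<^esub> X) ` twt h F k"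

section \<open>Tensor products\<close>

type_synonym ('a, 'b) prd = "(('a \<times> 'b) \<Rightarrow>\<^sub>0 real) set"

definition pword :: "'a dg \<Rightarrow> 'b dg \<Rightarrow> (('a \<times> 'b) \<Rightarrow>\<^sub>0 real) dg" where
  "pword X A = free_dg (homog X \<times> homog A)
     (\<lambda>(x, a) (y, b). Poly_Mapping.single (x \<otimes>\<^bsub>X\<^esub> y, a \<otimes>\<^bsub>A\<^esub> b) (sg (deg A a * deg X y)))
     (Poly_Mapping.single (\<one>\<^bsub>X\<^esub>, \<one>\<^bsub>A\<^esub>) 1) (\<lambda>(x, a). deg X x + deg A a)
     (\<lambda>(x, a). Poly_Mapping.single (dif X x, a) 1 + Poly_Mapping.single (x, dif A a) (sg (deg X x)))"

definition prel :: "'a dg \<Rightarrow> 'b dg \<Rightarrow> (('a \<times> 'b) \<Rightarrow>\<^sub>0 real) set" where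
  "prel X A = vspan (pword X A)
     ({Poly_Mapping.single (x \<oplus>\<^bsub>X\<^esub> y, a) 1 - Poly_Mapping.single (x, a) 1 - Poly_Mapping.single (y, a) 1
         | x y a k. x \<in> grade X k \<and> y \<in> grade X k \<and> a \<in> homog A} \<union>
      {Poly_Mapping.single (x, a \<oplus>\<^bsub>A\<^esub> b) 1 - Poly_Mapping.single (x, a) 1 - Poly_Mapping.single (x, b) 1
         | x a b k. x \<in> homog X \<and> a \<in> grade A k \<and> b \<in> grade A k} \<union>
      {Poly_Mapping.single (c \<odot>\<^bsub>X\<^esub> x, a) 1 - Poly_Mapping.single (x, a) c
         | x a c. x \<in> homog X \<and> a \<in> homog A} \<union>
      {Poly_Mapping.single (x, c \<odot>\<^bsub>A\<^esub> a) 1 - Poly_Mapping.single (x, a) c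
         | x a c. x \<in> homog X \<and> a \<in> homog A})"

definition tprod :: "'a dg \<Rightarrow> 'b dg \<Rightarrow> ('a, 'b) prd dg" where
  "tprod X A = quot (pword X A) (prel X A)"

definition pcls :: "'a dg \<Rightarrow> 'b dg \<Rightarrow> (('a \<times> 'b) \<Rightarrow>\<^sub>0 real) \<Rightarrow> ('a, 'b) prd" where
  "pcls X A p = prel X A +>\<^bsub>pword X A\<^esub> p"

definition pmap :: "'b dg \<Rightarrow> 'c dg \<Rightarrow> ('a \<Rightarrow> 'b) \<Rightarrow> ('a, 'c) prd \<Rightarrow> ('b, 'c) prd" where
  "pmap X A f = cmap (pword X A) (prel X A) (pext (\<lambda>(x, a). Poly_Mapping.single (f x, a) 1))"

definition pfil :: "'a dg \<Rightarrow> 'b dg \<Rightarrow> (nat \<Rightarrow> 'a set) \<Rightarrow> nat \<Rightarrow> ('a, 'b) prd set" where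
  "pfil X A F k = vspan (tprod X A)
     {pcls X A (Poly_Mapping.single (x, a) 1) | x a. x \<in> homog X \<inter> F k \<and> a \<in> homog A}"

section \<open>Completions\<close>

text \<open>
  A point of the inverse limit of the \<open>V / F n\<close> is a decreasing sequence of cosets.
  The limit is taken in the category of graded vector spaces, that is, degree by degree.
\<close>

definition hat :: "'a dg \<Rightarrow> (nat \<Rightarrow> 'a set) \<Rightarrow> (nat \<Rightarrow> 'a set) dg" where
  "hat V F = \<lparr>carrier = {s. (\<forall>n. s n \<in> carrier (quot V (F n)) \<and> s (Suc n) \<subseteq> s n) \<and>
       (\<exists>K. finite K \<and> (\<forall>n. s n \<inter> vspan V (\<Union>k\<in>K. grade V k) \<noteq> {}))},
     mult = (\<lambda>s t n. s n \<otimes>\<^bsub>quot V (F n)\<^esub> t n), one = (\<lambda>n. \<one>\<^bsub>quot V (F n)\<^esub>),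
     ring.zero = (\<lambda>n. \<zero>\<^bsub>quot V (F n)\<^esub>), add = (\<lambda>s t n. s n \<oplus>\<^bsub>quot V (F n)\<^esub> t n),
     smult = (\<lambda>c s n. c \<odot>\<^bsub>quot V (F n)\<^esub> s n),
     grade = (\<lambda>k. {s. \<forall>n. s n \<in> grade (quot V (F n)) k \<and> s (Suc n) \<subseteq> s n}),
     dif = (\<lambda>s n. dif (quot V (F n)) (s n))\<rparr>"

definition hat_map :: "'b dg \<Rightarrow> (nat \<Rightarrow> 'b set) \<Rightarrow> ('a \<Rightarrow> 'b) \<Rightarrow> (nat \<Rightarrow> 'a set) \<Rightarrow> (nat \<Rightarrow> 'b set)" where
  "hat_map W G f s = (\<lambda>n. cmap W (G n) f (s n))"

text \<open>Augmentation ideal of the completion of an algebra whose index 1 is the augmentation ideal.\<close>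

definition hat_aug :: "'a dg \<Rightarrow> (nat \<Rightarrow> 'a set) \<Rightarrow> (nat \<Rightarrow> 'a set) dg" where
  "hat_aug A F = restr (hat A F) {s \<in> carrier (hat A F). s 1 = F 1}"

text \<open>
  \<open>\<phi>\<^sub>*(\<alpha>) = \<Sum>\<^sub>k \<phi>\<^sub>k(\<alpha>\<^sup>k)\<close>, for \<open>\<phi>\<close> given by its values \<open>f\<close> on lists of pure tensors
  \<open>x\<^sub>1 \<otimes> a\<^sub>1, \<dots>, x\<^sub>k \<otimes> a\<^sub>k\<close>.  Since \<open>\<phi>\<^sub>k\<close> takes values in \<open>G k\<close> on elements of \<open>F 1\<close>, the terms
  with \<open>k > n\<close> do not contribute to the coset modulo \<open>G n\<close>.
\<close>

definition tpow :: "nat \<Rightarrow> ('u \<Rightarrow>\<^sub>0 real) \<Rightarrow> ('u list \<Rightarrow> ('v \<Rightarrow>\<^sub>0 real)) \<Rightarrow> ('v \<Rightarrow>\<^sub>0 real)" where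
  "tpow k p f = (\<Sum>w | length w = k \<and> set w \<subseteq> Poly_Mapping.keys p.
     psc (\<Prod>x\<leftarrow>w. Poly_Mapping.lookup p x) (f w))"

definition mc_push :: "'b dg \<Rightarrow> 'c dg \<Rightarrow> (nat \<Rightarrow> ('b, 'c) prd set) \<Rightarrow> ('u list \<Rightarrow> (('b \<times> 'c) \<Rightarrow>\<^sub>0 real)) \<Rightarrow>
    (nat \<Rightarrow> ('u \<Rightarrow>\<^sub>0 real) set set) \<Rightarrow> (nat \<Rightarrow> ('b, 'c) prd set)" where
  "mc_push Y A G f \<alpha> = (\<lambda>n. \<Union>X\<in>\<alpha> n. \<Union>p\<in>X. G n +>\<^bsub>tprod Y A\<^esub> pcls Y A (\<Sum>k = 1..n. tpow k p f))"

section \<open>Filtered dg Lie algebras and strictification\<close>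

definition dg_lie :: "'g dg \<Rightarrow> bool" where
  "dg_lie g \<longleftrightarrow> graded_space g \<and>
     (\<forall>x\<in>carrier g. \<forall>y\<in>carrier g. x \<otimes>\<^bsub>g\<^esub> y \<in> carrier g \<and> dif g (x \<oplus>\<^bsub>g\<^esub> y) = dif g x \<oplus>\<^bsub>g\<^esub> dif g y \<and>
        (\<forall>c. dif g (c \<odot>\<^bsub>g\<^esub> x) = c \<odot>\<^bsub>g\<^esub> dif g x \<and>
             (c \<odot>\<^bsub>g\<^esub> x) \<otimes>\<^bsub>g\<^esub> y = c \<odot>\<^bsub>g\<^esub> (x \<otimes>\<^bsub>g\<^esub> y) \<and> x \<otimes>\<^bsub>g\<^esub> (c \<odot>\<^bsub>g\<^esub> y) = c \<odot>\<^bsub>g\<^esub> (x \<otimes>\<^bsub>g\<^esub> y)) \<and>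
        (\<forall>z\<in>carrier g. (x \<oplus>\<^bsub>g\<^esub> y) \<otimes>\<^bsub>g\<^esub> z = (x \<otimes>\<^bsub>g\<^esub> z) \<oplus>\<^bsub>g\<^esub> (y \<otimes>\<^bsub>g\<^esub> z) \<and>
             z \<otimes>\<^bsub>g\<^esub> (x \<oplus>\<^bsub>g\<^esub> y) = (z \<otimes>\<^bsub>g\<^esub> x) \<oplus>\<^bsub>g\<^esub> (z \<otimes>\<^bsub>g\<^esub> y))) \<and>
     (\<forall>i. \<forall>x\<in>grade g i. dif g x \<in> grade g (i + 1) \<and> dif g (dif g x) = \<zero>\<^bsub>g\<^esub>) \<and>
     (\<forall>i j. \<forall>x\<in>grade g i. \<forall>y\<in>grade g j. x \<otimes>\<^bsub>g\<^esub> y \<in> grade g (i + j) \<and>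
        x \<otimes>\<^bsub>g\<^esub> y = (- sg (i * j)) \<odot>\<^bsub>g\<^esub> (y \<otimes>\<^bsub>g\<^esub> x) \<and>
        dif g (x \<otimes>\<^bsub>g\<^esub> y) = (dif g x \<otimes>\<^bsub>g\<^esub> y) \<oplus>\<^bsub>g\<^esub> sg i \<odot>\<^bsub>g\<^esub> (x \<otimes>\<^bsub>g\<^esub> dif g y) \<and>
        (\<forall>z\<in>homog g. x \<otimes>\<^bsub>g\<^esub> (y \<otimes>\<^bsub>g\<^esub> z) = ((x \<otimes>\<^bsub>g\<^esub> y) \<otimes>\<^bsub>g\<^esub> z) \<oplus>\<^bsub>g\<^esub> sg (i * j) \<odot>\<^bsub>g\<^esub> (y \<otimes>\<^bsub>g\<^esub> (x \<otimes>\<^bsub>g\<^esub> z))))"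

text \<open>Filtrations start at index 1; \<open>F 0\<close> is set to the whole algebra.\<close>

definition lie_filtration :: "'g dg \<Rightarrow> (nat \<Rightarrow> 'g set) \<Rightarrow> bool" where
  "lie_filtration g F \<longleftrightarrow> F 0 = carrier g \<and> F 1 = carrier g \<and> (\<forall>k. F (Suc k) \<subseteq> F k) \<and>
     (\<forall>k. graded_subspace (F k) g \<and> (\<forall>x\<in>F k. dif g x \<in> F k \<and>
        (\<forall>y\<in>carrier g. x \<otimes>\<^bsub>g\<^esub> y \<in> F k \<and> y \<otimes>\<^bsub>g\<^esub> x \<in> F k))) \<and>
     (\<Inter>k. F k) = {\<zero>\<^bsub>g\<^esub>} \<and>
     (\<forall>i j. \<forall>x\<in>F i. \<forall>y\<in>F j. x \<otimes>\<^bsub>g\<^esub> y \<in> F (i + j))"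

text \<open>
  The coalgebra \<open>CE(g)\<close> has components \<open>\<mu>\<^sub>1(sx) = s dx\<close> and
  \<open>\<mu>\<^sub>2(\<Sum> sx \<otimes> sy) = 1/2 \<Sum> (-1)\<^bsup>|sx|\<^esup> s[x,y]\<close> on symmetric tensors: this is the convention for which
  a coalgebra map \<open>C \<rightarrow> CE(h)\<close> with corestriction \<open>f\<close> commutes with the differentials if and only if
  \<open>ux \<mapsto> s\<^sup>-\<^sup>1 f(x)\<close> does so on \<open>L(C)\<close>, and for which Maurer-Cartan elements are the solutions of
  \<open>d\<alpha> + 1/2 [\<alpha>,\<alpha>] = 0\<close>.  A coderivation of \<open>S \<subset> T\<close> is the restriction of the coderivation of \<open>T\<close>
  that inserts its components at all positions.
\<close>

definition ce_dif_word :: "'g dg \<Rightarrow> 'g list \<Rightarrow> ('g list \<Rightarrow>\<^sub>0 real)" where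
  "ce_dif_word g w =
     (\<Sum>i<length w. Poly_Mapping.single (w[i := dif g (w ! i)]) (sg (wdeg (susp g) (take i w)))) +
     (\<Sum>i<length w - 1. Poly_Mapping.single (take i w @ [w ! i \<otimes>\<^bsub>g\<^esub> w ! Suc i] @ drop (i + 2) w)
        (sg (wdeg (susp g) (take (Suc i) w)) / 2))"

definition ce :: "'g dg \<Rightarrow> 'g tens dg" where
  "ce g = (restr (tens_alg (susp g)) (sym_tens (susp g)))
     \<lparr>dif := cmap (tword (susp g)) (trel (susp g)) (pext (ce_dif_word g))\<rparr>"

definition rce :: "'g dg \<Rightarrow> 'g tens dg" where
  "rce g = restr (ce g) (rsym_tens (susp g))"

definition ce_rcoprod :: "'g dg \<Rightarrow> 'g tens \<Rightarrow> ('g tens, 'g tens) prd" where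
  "ce_rcoprod g X = cmap (pword (tens_alg (susp g)) (tens_alg (susp g)))
     (prel (tens_alg (susp g)) (tens_alg (susp g)))
     (pext (\<lambda>w. \<Sum>j\<in>{0<..<length w}. Poly_Mapping.single
        (tcls (susp g) (Poly_Mapping.single (take j w) 1), tcls (susp g) (Poly_Mapping.single (drop j w) 1)) 1)) X"

text \<open>Free graded Lie algebra on \<open>V\<close>: bracketed words in homogeneous elements, modulo linearity in the
  letters, graded antisymmetry and the graded Jacobi identity.\<close>

datatype 'a lword = Gen 'a | Br "'a lword" "'a lword"

type_synonym 'a lie = "('a lword \<Rightarrow>\<^sub>0 real) set"

primrec ldeg :: "'a dg \<Rightarrow> 'a lword \<Rightarrow> int" where
  "ldeg V (Gen x) = deg V x"
| "ldeg V (Br u v) = ldeg V u + ldeg V v"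

primrec lder :: "'a dg \<Rightarrow> ('a \<Rightarrow> ('a lword \<Rightarrow>\<^sub>0 real)) \<Rightarrow> 'a lword \<Rightarrow> ('a lword \<Rightarrow>\<^sub>0 real)" where
  "lder V D (Gen x) = D x"
| "lder V D (Br u v) = pext (\<lambda>u'. Poly_Mapping.single (Br u' v) 1) (lder V D u) +
     psc (sg (ldeg V u)) (pext (\<lambda>v'. Poly_Mapping.single (Br u v') 1) (lder V D v))"

definition lfree :: "'a dg \<Rightarrow> ('a \<Rightarrow> ('a lword \<Rightarrow>\<^sub>0 real)) \<Rightarrow> ('a lword \<Rightarrow>\<^sub>0 real) dg" where
  "lfree V D = free_dg {w. set_lword w \<subseteq> homog V} (\<lambda>u v. Poly_Mapping.single (Br u v) 1) 0
     (ldeg V) (lder V D)"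

definition lrel :: "'a dg \<Rightarrow> ('a \<Rightarrow> ('a lword \<Rightarrow>\<^sub>0 real)) \<Rightarrow> ('a lword \<Rightarrow>\<^sub>0 real) set" where
  "lrel V D = \<Inter>{W. subsp W (lfree V D) \<and>
     (\<forall>p\<in>W. \<forall>q\<in>carrier (lfree V D). p \<otimes>\<^bsub>lfree V D\<^esub> q \<in> W \<and> q \<otimes>\<^bsub>lfree V D\<^esub> p \<in> W) \<and>
     (\<forall>k. \<forall>x\<in>grade V k. \<forall>y\<in>grade V k.
        Poly_Mapping.single (Gen (x \<oplus>\<^bsub>V\<^esub> y)) 1 - Poly_Mapping.single (Gen x) 1 - Poly_Mapping.single (Gen y) 1 \<in> W) \<and>
     (\<forall>c. \<forall>x\<in>homog V. Poly_Mapping.single (Gen (c \<odot>\<^bsub>V\<^esub> x)) 1 - Poly_Mapping.single (Gen x) c \<in> W) \<and>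
     (\<forall>u v. set_lword u \<subseteq> homog V \<and> set_lword v \<subseteq> homog V \<longrightarrow>
        Poly_Mapping.single (Br u v) 1 + Poly_Mapping.single (Br v u) (sg (ldeg V u * ldeg V v)) \<in> W) \<and>
     (\<forall>u v w. set_lword u \<subseteq> homog V \<and> set_lword v \<subseteq> homog V \<and> set_lword w \<subseteq> homog V \<longrightarrow>
        Poly_Mapping.single (Br u (Br v w)) 1 - Poly_Mapping.single (Br (Br u v) w) 1
          - Poly_Mapping.single (Br v (Br u w)) (sg (ldeg V u * ldeg V v)) \<in> W)}"

definition free_lie :: "'a dg \<Rightarrow> ('a \<Rightarrow> ('a lword \<Rightarrow>\<^sub>0 real)) \<Rightarrow> 'a lie dg" where
  "free_lie V D = quot (lfree V D) (lrel V D)"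

definition lcls :: "'a dg \<Rightarrow> ('a \<Rightarrow> ('a lword \<Rightarrow>\<^sub>0 real)) \<Rightarrow> ('a lword \<Rightarrow>\<^sub>0 real) \<Rightarrow> 'a lie" where
  "lcls V D p = lrel V D +>\<^bsub>lfree V D\<^esub> p"

text \<open>
  The generators of \<open>L(CE(g))\<close> and the differential on them.  By cocommutativity the element
  \<open>\<Sum> (-1)\<^bsup>|x|\<^esup> ux \<otimes> uy\<close> is \<open>1/2 \<Sum> (-1)\<^bsup>|x|\<^esup> [ux, uy]\<close>, for any presentation
  of the reduced coproduct as a sum of \<open>x \<otimes> y\<close> with \<open>x\<close> and \<open>y\<close> symmetric.
\<close>

definition str_gen :: "'g dg \<Rightarrow> 'g tens dg" where
  "str_gen g = desusp (rce g)"

definition str_dif_gen :: "'g dg \<Rightarrow> 'g tens \<Rightarrow> ('g tens lword \<Rightarrow>\<^sub>0 real)" where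
  "str_dif_gen g X = (let q = (SOME q. Poly_Mapping.keys q \<subseteq> homog (rce g) \<times> homog (rce g) \<and>
        pcls (tens_alg (susp g)) (tens_alg (susp g)) q = ce_rcoprod g X)
     in Poly_Mapping.single (Gen (dif (ce g) X)) 1 -
        pext (\<lambda>(x, y). Poly_Mapping.single (Br (Gen x) (Gen y)) (sg (deg (rce g) x) / 2)) q)"

definition strict :: "'g dg \<Rightarrow> 'g tens lie dg" where
  "strict g = free_lie (str_gen g) (str_dif_gen g)"

primrec lwt :: "(nat \<Rightarrow> 'a set) \<Rightarrow> 'a lword \<Rightarrow> nat \<Rightarrow> bool" where
  "lwt F (Gen x) = (\<lambda>k. x \<in> F k)"
| "lwt F (Br u v) = (\<lambda>k. \<exists>i j. k \<le> i + j \<and> lwt F u i \<and> lwt F v j)"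

definition str_fil :: "'g dg \<Rightarrow> (nat \<Rightarrow> 'g set) \<Rightarrow> nat \<Rightarrow> 'g tens lie set" where
  "str_fil g F k = vspan (strict g)
     {lcls (str_gen g) (str_dif_gen g) (Poly_Mapping.single w 1) | w. set_lword w \<subseteq> homog (str_gen g) \<and>
        lwt (\<lambda>k. rsym_tens (susp g) \<inter> twt (susp g) F k) w k}"

text \<open>
  The unit of the adjunction has corestriction \<open>x \<mapsto> s(ux)\<close>.  Its component in arity \<open>k\<close>, defined on
  symmetric tensors, is extended to all tensors through the symmetrization; in the tensor product
  with a commutative algebra, \<open>\<alpha>\<^sup>k\<close> only involves symmetric tensors.
\<close>

definition eta :: "'g dg \<Rightarrow> 'g list \<Rightarrow> 'g tens lie" where
  "eta g w = lcls (str_gen g) (str_dif_gen g) (Poly_Mapping.single (Gen (symz (susp g) w)) 1)"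

text \<open>The adjoint of the identity of \<open>CE(g)\<close>: the morphism of Lie algebras with
  \<open>ux \<mapsto> s\<^sup>-\<^sup>1 pr\<^sub>1(x)\<close>.\<close>

primrec leval :: "'g dg \<Rightarrow> ('a \<Rightarrow> 'g) \<Rightarrow> 'a lword \<Rightarrow> 'g" where
  "leval g f (Gen x) = f x"
| "leval g f (Br u v) = leval g f u \<otimes>\<^bsub>g\<^esub> leval g f v"

definition rho :: "'g dg \<Rightarrow> 'g tens lie \<Rightarrow> 'g" where
  "rho g X = the_elem (lext g (leval g (pr1 (susp g))) ` X)"

section \<open>Smooth manifolds and differential forms\<close>

text \<open>Points of \<open>\<real>\<^sup>n\<close> are sequences that vanish from index \<open>n\<close> on, as in \<^const>\<open>Euclidean_space\<close>.\<close>

type_synonym pt = "nat \<Rightarrow> real"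

definition partial :: "nat \<Rightarrow> (pt \<Rightarrow> real) \<Rightarrow> pt \<Rightarrow> real" where
  "partial i f x = deriv (\<lambda>s. f (x(i := s))) (x i)"

primrec partials :: "nat list \<Rightarrow> (pt \<Rightarrow> real) \<Rightarrow> pt \<Rightarrow> real" where
  "partials [] f = f"
| "partials (i # is) f = partial i (partials is f)"

definition smooth_fn :: "nat \<Rightarrow> pt set \<Rightarrow> (pt \<Rightarrow> real) \<Rightarrow> bool" where
  "smooth_fn n W f \<longleftrightarrow> (\<forall>is\<in>lists {..<n}.
     continuous_map (subtopology (Euclidean_space n) W) euclideanreal (partials is f) \<and>
     (\<forall>i<n. \<forall>x\<in>W. (\<lambda>s. partials is f (x(i := s))) field_differentiable (at (x i))))"

type_synonym 'm chart = "'m set \<times> ('m \<Rightarrow> pt)"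

record 'm manifold =
  mtop :: "'m topology"
  mdim :: nat
  atlas :: "'m chart set"

definition smooth_manifold :: "'m manifold \<Rightarrow> bool" where
  "smooth_manifold M \<longleftrightarrow> Hausdorff_space (mtop M) \<and> second_countable (mtop M) \<and>
     (\<Union>c\<in>atlas M. fst c) = topspace (mtop M) \<and>
     (\<forall>(U, \<phi>)\<in>atlas M. openin (mtop M) U \<and> openin (Euclidean_space (mdim M)) (\<phi> ` U) \<and>
        homeomorphic_map (subtopology (mtop M) U) (subtopology (Euclidean_space (mdim M)) (\<phi> ` U)) \<phi>) \<and>
     (\<forall>(U, \<phi>)\<in>atlas M. \<forall>(V, \<psi>)\<in>atlas M. \<forall>i<mdim M.
        smooth_fn (mdim M) (\<phi> ` (U \<inter> V)) (\<lambda>y. \<psi> (inv_into U \<phi> y) i))"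

text \<open>
  A form \<open>a\<close> on an open subset of \<open>\<real>\<^sup>n\<close> is given by its coefficients
  \<open>a [j\<^sub>1, \<dots>, j\<^sub>k] x = a\<^sub>x(\<partial>\<^sub>j\<^sub>1, \<dots>, \<partial>\<^sub>j\<^sub>k)\<close>, for all \<open>k\<close> at once.
\<close>

type_synonym lform = "nat list \<Rightarrow> pt \<Rightarrow> real"

definition lpull :: "nat \<Rightarrow> (pt \<Rightarrow> pt) \<Rightarrow> lform \<Rightarrow> lform" where
  "lpull n F a js x = (\<Sum>is | set is \<subseteq> {..<n} \<and> length is = length js.
     a is (F x) * (\<Prod>r<length js. partial (js ! r) (\<lambda>y. F y (is ! r)) x))"

definition lwedge :: "lform \<Rightarrow> lform \<Rightarrow> lform" where
  "lwedge a b js x = (\<Sum>S\<in>Pow {..<length js}.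
     (-1) ^ card {(i, j). i \<in> S \<and> j \<in> {..<length js} - S \<and> j < i} *
     a (nths js S) x * b (nths js (- S)) x)"

definition lone :: lform where
  "lone js x = (if js = [] then 1 else 0)"

definition ldiff :: "lform \<Rightarrow> lform" where
  "ldiff a js x = (\<Sum>r<length js. (-1) ^ r * partial (js ! r) (a (take r js @ drop (Suc r) js)) x)"

text \<open>A form on \<open>M\<close> is a family of forms in the charts, compatible with the transition maps
  and extended by 0.\<close>

type_synonym 'm form = "'m chart \<Rightarrow> lform"

definition in_chart :: "'m manifold \<Rightarrow> 'm chart \<Rightarrow> nat list \<Rightarrow> pt \<Rightarrow> bool" where
  "in_chart M c js x \<longleftrightarrow> c \<in> atlas M \<and> set js \<subseteq> {..<mdim M} \<and> x \<in> snd c ` fst c"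

definition is_form :: "'m manifold \<Rightarrow> 'm form \<Rightarrow> bool" where
  "is_form M a \<longleftrightarrow>
     (\<forall>c js x. \<not> in_chart M c js x \<longrightarrow> a c js x = 0) \<and>
     (\<forall>c js x i. Suc i < length js \<longrightarrow> a c (js[i := js ! Suc i, Suc i := js ! i]) x = - a c js x) \<and>
     (\<forall>c\<in>atlas M. \<forall>js. smooth_fn (mdim M) (snd c ` fst c) (a c js)) \<and>
     (\<forall>c\<in>atlas M. \<forall>c'\<in>atlas M. \<forall>p\<in>fst c \<inter> fst c'. \<forall>js. set js \<subseteq> {..<mdim M} \<longrightarrow>
        a c js (snd c p) =
          lpull (mdim M) (\<lambda>y. snd c' (inv_into (fst c) (snd c) y)) (a c') js (snd c p))"

text \<open>The dg algebra \<open>(\<Omega>(M), -d, \<and>)\<close>; note the sign of the differential.\<close>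

definition Omega :: "'m manifold \<Rightarrow> 'm form dg" where
  "Omega M = \<lparr>carrier = {a. is_form M a}, mult = (\<lambda>a b c. lwedge (a c) (b c)),
     one = (\<lambda>c js x. if in_chart M c js x then lone js x else 0),
     ring.zero = (\<lambda>_ _ _. 0), add = (\<lambda>a b c js x. a c js x + b c js x), smult = (\<lambda>r a c js x. r * a c js x),
     grade = (\<lambda>k. {a. is_form M a \<and> (\<forall>c js x. a c js x \<noteq> 0 \<longrightarrow> int (length js) = k)}),
     dif = (\<lambda>a c js x. if in_chart M c js x then - ldiff (a c) js x else 0)\<rparr>"

text \<open>Pull-back of a form on \<open>M\<close> along a map \<open>F\<close> from a Euclidean space to \<open>M\<close>,
  at a point where \<open>F\<close> is smooth.\<close>

definition pull :: "'m manifold \<Rightarrow> (pt \<Rightarrow> 'm) \<Rightarrow> 'm form \<Rightarrow> lform" where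
  "pull M F a js x = (let c = (SOME c. c \<in> atlas M \<and> F x \<in> fst c)
     in lpull (mdim M) (\<lambda>y. snd c (F y)) (a c) js x)"

section \<open>Smooth singular chains and cochains\<close>

text \<open>\<open>osimp k\<close> constrains only the first \<open>k\<close> coordinates, since the points of product measure spaces
  are not 0 but undefined beyond them; \<open>trunc\<close> restores the points of \<open>\<real>\<^sup>k\<close>.\<close>

definition osimp :: "nat \<Rightarrow> pt set" where
  "osimp k = {t. (\<forall>i<k. 0 \<le> t i \<and> t i \<le> 1) \<and> (\<forall>i j. i < j \<and> j < k \<longrightarrow> t j \<le> t i)}"

definition ocube :: "nat \<Rightarrow> pt set" where
  "ocube k = {x. \<forall>i<k. 0 \<le> x i \<and> x i \<le> 1}"

definition std_simp :: "nat \<Rightarrow> pt set" where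
  "std_simp k = osimp k \<inter> topspace (Euclidean_space k)"

definition trunc :: "nat \<Rightarrow> pt \<Rightarrow> pt" where
  "trunc k t = (\<lambda>i. if i < k then t i else 0)"

definition leb :: "nat \<Rightarrow> pt measure" where
  "leb k = completion (Pi\<^sub>M {..<k} (\<lambda>_. lborel))"

type_synonym 'm simp = "nat \<times> (pt \<Rightarrow> 'm)"

text \<open>The smooth simplices: those that extend smoothly to a neighbourhood of the simplex.\<close>

definition simps :: "'m manifold \<Rightarrow> 'm simp set" where
  "simps M = {(k, \<sigma>). \<sigma> \<in> extensional (std_simp k) \<and>
     (\<exists>W \<tau>. openin (Euclidean_space k) W \<and> std_simp k \<subseteq> W \<and> (\<forall>t\<in>std_simp k. \<tau> t = \<sigma> t) \<and>
        continuous_map (subtopology (Euclidean_space k) W) (mtop M) \<tau> \<and>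
        (\<forall>(U, \<phi>)\<in>atlas M. \<forall>i<mdim M. smooth_fn k {x\<in>W. \<tau> x \<in> U} (\<lambda>x. \<phi> (\<tau> x) i)))}"

text \<open>
  The vertices of the simplex are \<open>v\<^sub>i = e\<^sub>1 + \<dots> + e\<^sub>i\<close>.  The front face of dimension \<open>i\<close> is
  spanned by \<open>v\<^sub>0, \<dots>, v\<^sub>i\<close>; the back face that complements it, by \<open>v\<^sub>i, \<dots>, v\<^sub>k\<close>;
  and \<open>face i\<close> omits \<open>v\<^sub>i\<close>.
\<close>

definition front_face :: "nat \<Rightarrow> 'm simp \<Rightarrow> 'm simp" where
  "front_face i s = (i, restrict (snd s) (std_simp i))"

definition back_face :: "nat \<Rightarrow> 'm simp \<Rightarrow> 'm simp" where
  "back_face i s = (fst s - i, restrict (\<lambda>t. snd s (\<lambda>j. if j < i then 1 else t (j - i))) (std_simp (fst s - i)))"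

definition face :: "nat \<Rightarrow> 'm simp \<Rightarrow> 'm simp" where
  "face i s = (fst s - 1, restrict (\<lambda>t. snd s
     (\<lambda>j. if j < i then t j else if j = 0 then 1 else t (j - 1))) (std_simp (fst s - 1)))"

definition bdry :: "'m simp \<Rightarrow> ('m simp \<Rightarrow>\<^sub>0 real)" where
  "bdry s = (if fst s = 0 then 0 else \<Sum>i\<le>fst s. Poly_Mapping.single (face i s) ((-1) ^ i))"

definition chains :: "'m manifold \<Rightarrow> ('m simp \<Rightarrow>\<^sub>0 real) dg" where
  "chains M = free_dg (simps M) (\<lambda>_ _. 0) 0 (\<lambda>s. - int (fst s)) bdry"

text \<open>Counit (for \<open>n = 0\<close>), identity, and iterated Alexander-Whitney coproduct \<open>\<Delta>\<^sup>n\<^sup>-\<^sup>1\<close>.\<close>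

primrec aw :: "nat \<Rightarrow> 'm simp \<Rightarrow> ('m simp list \<Rightarrow>\<^sub>0 real)" where
  "aw 0 s = (if fst s = 0 then Poly_Mapping.single [] 1 else 0)"
| "aw (Suc n) s = (\<Sum>i\<le>fst s. pext (\<lambda>w. Poly_Mapping.single (front_face i s # w) 1) (aw n (back_face i s)))"

definition cochains :: "'m manifold \<Rightarrow> ('m simp \<Rightarrow> real) dg" where
  "cochains M = \<lparr>carrier = {f. (\<forall>s. f s \<noteq> 0 \<longrightarrow> s \<in> simps M) \<and> (\<exists>N. \<forall>s. f s \<noteq> 0 \<longrightarrow> fst s \<le> N)},
     mult = (\<lambda>f g s. if s \<in> simps M then \<Sum>i\<le>fst s. f (front_face i s) * g (back_face i s) else 0),
     one = (\<lambda>s. if s \<in> simps M \<and> fst s = 0 then 1 else 0),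
     ring.zero = (\<lambda>_. 0), add = (\<lambda>f g s. f s + g s), smult = (\<lambda>r f s. r * f s),
     grade = (\<lambda>k. {f. \<forall>s. f s \<noteq> 0 \<longrightarrow> s \<in> simps M \<and> int (fst s) = k}),
     dif = (\<lambda>f s. if s \<in> simps M then \<Sum>s'\<in>Poly_Mapping.keys (bdry s). Poly_Mapping.lookup (bdry s) s' * f s' else 0)\<rparr>"

section \<open>Gugenheim's morphism\<close>

text \<open>
  A form on the path space is given by its pull-backs to plots \<open>P\<close>, where \<open>P x\<close> is a path for
  each \<open>x\<close> in the parameter space.  In \<open>P \<times> \<Delta>\<^sub>n\<close> the fibre coordinates come first: fibre integration
  maps \<open>dt\<^sub>1 \<dots> dt\<^sub>n \<and> \<beta>\<close> to the integral of \<open>\<beta>\<close>, which is the convention that makes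
  \<open>\<psi>\<close> an A-infinity morphism.
\<close>

type_synonym 'm pform = "(pt \<Rightarrow> real \<Rightarrow> 'm) \<Rightarrow> lform"

definition fib_int :: "nat \<Rightarrow> lform \<Rightarrow> lform" where
  "fib_int n \<omega> js x = (LINT t:osimp n|leb n.
     \<omega> ([0..<n] @ map (\<lambda>j. n + j) js) (\<lambda>i. if i < n then t i else x (i - n)))"

definition chen :: "'m manifold \<Rightarrow> 'm form list \<Rightarrow> 'm pform" where
  "chen M as P js x = (let n = length as in
     sg (\<Sum>i<n. (deg (Omega M) (as ! i) - 1) * int (n - 1 - i)) *
     fib_int n (foldr lwedge (map (\<lambda>i. pull M (\<lambda>z. P (\<lambda>j. z (n + j)) (z i)) (as ! i)) [0..<n]) lone) js x)"

text \<open>The \<open>i\<close>-th coordinate, counted from 0, of the path \<open>\<lambda>\<^bsub>(k)\<^esub>(x)\<close> at time \<open>t\<close>;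
  it is linear in \<open>t\<close> between the breakpoints of the lemma below.\<close>

definition lam :: "nat \<Rightarrow> pt \<Rightarrow> real \<Rightarrow> pt" where
  "lam k x t i = (if i < k then (if i = k - 1 then 1 else x i) * max 0 (min 1 (real k * (1 - t) - real i)) else 0)"

lemma lam_at_breakpoint:
  assumes "j \<le> k" "0 < k"
  shows "lam k x ((real k - real j) / real k) i =
    (if i < j then if i = k - 1 then 1 else x i else 0)"
proof -
  have e: "real k * (1 - (real k - real j) / real k) = real j"
    using assms by (simp add: field_simps)
  show ?thesis
    unfolding lam_def e using assms by (auto simp: max_def min_def)
qed

definition theta :: "nat \<Rightarrow> pt \<Rightarrow> real \<Rightarrow> pt" where
  "theta k x t l = (if l < k then Max (lam k x t ` {l..<k}) else 0)"

definition path_int :: "'m pform \<Rightarrow> 'm simp \<Rightarrow> real" where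
  "path_int \<beta> s = (case s of (k, \<sigma>) \<Rightarrow> if k = 0 then 0 else
     LINT x:ocube (k - 1)|leb (k - 1). \<beta> (\<lambda>y t. \<sigma> (theta k y t)) [0..<k - 1] x)"

definition psi :: "'m manifold \<Rightarrow> 'm form list \<Rightarrow> 'm simp \<Rightarrow> real" where
  "psi M as s = (if s \<notin> simps M \<or> as = [] then 0
     else if length as = 1 then
       (-1) ^ fst s * (LINT t:osimp (fst s)|leb (fst s). pull M (snd s) (hd as) [0..<fst s] (trunc (fst s) t))
     else path_int (chen M as) s)"

section \<open>Bar construction and holonomies\<close>

definition bar_dif_word :: "'a dg \<Rightarrow> 'a list \<Rightarrow> ('a list \<Rightarrow>\<^sub>0 real)" where
  "bar_dif_word A w =
     (\<Sum>i\<in>{1..<length w}. Poly_Mapping.single (take (i - 1) w @ [w ! (i - 1) \<otimes>\<^bsub>A\<^esub> w ! i] @ drop (Suc i) w)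
        (sg (wdeg (susp A) (take i w)))) -
     (\<Sum>i<length w. Poly_Mapping.single (w[i := dif A (w ! i)]) (sg (wdeg (susp A) (take i w))))"

text \<open>Here \<open>A\<close> is the augmentation ideal; the bar complex is completed by tensor degree.\<close>

definition bar :: "'a dg \<Rightarrow> 'a tens dg" where
  "bar A = (tens_alg (susp A))\<lparr>dif := cmap (tword (susp A)) (trel (susp A)) (pext (bar_dif_word A))\<rparr>"

definition hbar :: "'a dg \<Rightarrow> (nat \<Rightarrow> 'a tens set) dg" where
  "hbar A = hat (bar A) (tlen (susp A))"

definition hbar_map :: "'b dg \<Rightarrow> ('a \<Rightarrow> 'b) \<Rightarrow> (nat \<Rightarrow> 'a tens set) \<Rightarrow> (nat \<Rightarrow> 'b tens set)" where
  "hbar_map A f = hat_map (bar A) (tlen (susp A)) (tmap (susp A) f)"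

text \<open>The map from chains to the completed bar complex determined by a linear map \<open>f\<close> from chains to \<open>A\<close>,
  given by its values on simplices; \<open>f\<close> enters as \<open>c \<mapsto> -s f(c)\<close>.\<close>

definition to_hbar :: "'a dg \<Rightarrow> ('m simp \<Rightarrow> 'a) \<Rightarrow> ('m simp \<Rightarrow>\<^sub>0 real) \<Rightarrow> (nat \<Rightarrow> 'a tens set)" where
  "to_hbar A f c = (\<lambda>n. tlen (susp A) n +>\<^bsub>bar A\<^esub> tcls (susp A)
     (\<Sum>m<n. pext (\<lambda>s. pext (\<lambda>w. Poly_Mapping.single (map (\<lambda>s. (-1) \<odot>\<^bsub>A\<^esub> f s) w) 1) (aw m s)) c))"

abbreviation conn_space :: "'m manifold \<Rightarrow> 'g dg \<Rightarrow> (nat \<Rightarrow> 'g set) \<Rightarrow> (nat \<Rightarrow> ('g, 'm form) prd set) dg" where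
  "conn_space M g F \<equiv> hat (tprod g (Omega M)) (pfil g (Omega M) F)"

text \<open>For a dg Lie algebra the L-infinity structure on the tensor product with
  \<open>\<Omega>(M)\<close> is its dg Lie algebra structure as the tensor product with \<open>(\<Omega>(M), -d, \<and>)\<close>.\<close>

definition flat_connection :: "'m manifold \<Rightarrow> 'g dg \<Rightarrow> (nat \<Rightarrow> 'g set) \<Rightarrow> (nat \<Rightarrow> ('g, 'm form) prd set) \<Rightarrow> bool" where
  "flat_connection M g F \<alpha> \<longleftrightarrow> (let H = conn_space M g F in
     \<alpha> \<in> grade H 1 \<and> dif H \<alpha> \<oplus>\<^bsub>H\<^esub> (1 / 2) \<odot>\<^bsub>H\<^esub> (\<alpha> \<otimes>\<^bsub>H\<^esub> \<alpha>) = \<zero>\<^bsub>H\<^esub>)"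

text \<open>The values on lists of pure tensors of \<open>\<eta> \<otimes> id\<close> and \<open>id \<otimes> \<psi>\<close>; the sign of
  the latter is the Koszul sign of moving the form factors \<open>sa\<^sub>i\<close> past the later \<open>b\<^sub>j\<close>.\<close>

definition eta_word :: "'m manifold \<Rightarrow> 'g dg \<Rightarrow> ('g \<times> 'm form) list \<Rightarrow> (('g tens lie \<times> 'm form) \<Rightarrow>\<^sub>0 real)" where
  "eta_word M g w = Poly_Mapping.single
     (eta g (map fst w), foldr (mult (Omega M)) (map snd w) \<one>\<^bsub>Omega M\<^esub>)
     (sg (\<Sum>(i, j)\<in>{(i, j). i < j \<and> j < length w}.
        deg (Omega M) (snd (w ! i)) * (deg g (fst (w ! j)) + 1)))"

definition psi_word :: "'m manifold \<Rightarrow> 'b dg \<Rightarrow> ('b \<times> 'm form) list \<Rightarrow> (('b \<times> ('m simp \<Rightarrow> real)) \<Rightarrow>\<^sub>0 real)" where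
  "psi_word M B w = Poly_Mapping.single
     (foldr (mult B) (map fst w) \<one>\<^bsub>B\<^esub>, psi M (map snd w))
     (sg (\<Sum>(i, j)\<in>{(i, j). i < j \<and> j < length w}.
        (deg (Omega M) (snd (w ! i)) - 1) * deg B (fst (w ! j))))"

definition psi_star :: "'m manifold \<Rightarrow> 'b dg \<Rightarrow> (nat \<Rightarrow> 'b set) \<Rightarrow>
    (nat \<Rightarrow> ('b, 'm form) prd set) \<Rightarrow> (nat \<Rightarrow> ('b, 'm simp \<Rightarrow> real) prd set)" where
  "psi_star M B G = mc_push B (cochains M) (pfil B (cochains M) G) (psi_word M B)"

text \<open>
  A cochain of degree \<open>k\<close> is regarded as a functional on chains with the sign \<open>(-1)\<^bsup>k(k+1)/2\<^esup>\<close>.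
  The chains carry the usual boundary and Alexander-Whitney coproduct without signs, and \<open>\<psi>\<close>
  is a morphism into the cochains with \<open>\<delta>f = f \<circ> \<partial>\<close> and the cup product without signs;
  with this sign \<open>B \<otimes> C\<^sup>\<bullet>(M) \<rightarrow> Hom(C\<^sub>\<bullet>(M), B)\<close> is a morphism of dg algebras.
\<close>

definition pairing :: "'b dg \<Rightarrow> (nat \<Rightarrow> 'b set) \<Rightarrow> (nat \<Rightarrow> ('b, 'm simp \<Rightarrow> real) prd set) \<Rightarrow> 'm simp \<Rightarrow> (nat \<Rightarrow> 'b set)" where
  "pairing B G h s = (\<lambda>n. \<Union>X\<in>h n. \<Union>p\<in>X. G n +>\<^bsub>B\<^esub>
     lext B (\<lambda>(b, f). (sg (int (fst s * (fst s + 1) div 2)) * f s) \<odot>\<^bsub>B\<^esub> b) p)"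

definition hol_elem :: "'m manifold \<Rightarrow> 'g dg \<Rightarrow> (nat \<Rightarrow> 'g set) \<Rightarrow> (nat \<Rightarrow> ('g, 'm form) prd set) \<Rightarrow>
    (nat \<Rightarrow> ('g tens set, 'm simp \<Rightarrow> real) prd set)" where
  "hol_elem M g F \<alpha> = psi_star M (env g) (env_fil g F)
     (hat_map (tprod (env g) (Omega M)) (pfil (env g) (Omega M) (env_fil g F))
        (pmap (env g) (Omega M) (to_env g)) \<alpha>)"

text \<open>Since \<open>U\<^sub>\<infinity>(g) = U(S(g))\<close>, the last two maps are those of the previous definition for
  the dg Lie algebra \<open>S(g)\<close>.\<close>

definition hol_inf_elem :: "'m manifold \<Rightarrow> 'g dg \<Rightarrow> (nat \<Rightarrow> 'g set) \<Rightarrow> (nat \<Rightarrow> ('g, 'm form) prd set) \<Rightarrow>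
    (nat \<Rightarrow> ('g tens lie tens set, 'm simp \<Rightarrow> real) prd set)" where
  "hol_inf_elem M g F \<alpha> = hol_elem M (strict g) (str_fil g F)
     (mc_push (strict g) (Omega M) (pfil (strict g) (Omega M) (str_fil g F)) (eta_word M g) \<alpha>)"

definition hat_env :: "'g dg \<Rightarrow> (nat \<Rightarrow> 'g set) \<Rightarrow> (nat \<Rightarrow> 'g tens set set) dg" where
  "hat_env g F = hat_aug (env g) (env_fil g F)"

definition hol :: "'m manifold \<Rightarrow> 'g dg \<Rightarrow> (nat \<Rightarrow> 'g set) \<Rightarrow> (nat \<Rightarrow> ('g, 'm form) prd set) \<Rightarrow>
    ('m simp \<Rightarrow>\<^sub>0 real) \<Rightarrow> (nat \<Rightarrow> (nat \<Rightarrow> 'g tens set set) tens set)" where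
  "hol M g F \<alpha> = to_hbar (hat_env g F) (pairing (env g) (env_fil g F) (hol_elem M g F \<alpha>))"

definition hol_inf :: "'m manifold \<Rightarrow> 'g dg \<Rightarrow> (nat \<Rightarrow> 'g set) \<Rightarrow> (nat \<Rightarrow> ('g, 'm form) prd set) \<Rightarrow>
    ('m simp \<Rightarrow>\<^sub>0 real) \<Rightarrow> (nat \<Rightarrow> (nat \<Rightarrow> 'g tens lie tens set set) tens set)" where
  "hol_inf M g F \<alpha> = to_hbar (hat_env (strict g) (str_fil g F))
     (pairing (env (strict g)) (env_fil (strict g) (str_fil g F)) (hol_inf_elem M g F \<alpha>))"

definition hat_env_rho :: "'g dg \<Rightarrow> (nat \<Rightarrow> 'g set) \<Rightarrow> (nat \<Rightarrow> 'g tens lie tens set set) \<Rightarrow> (nat \<Rightarrow> 'g tens set set)" where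
  "hat_env_rho g F = hat_map (env g) (env_fil g F) (env_map g (rho g))"

end

theory Submission
  imports Defs
begin

text \<open>The holonomy is natural in the dg Lie algebra: \<open>id \<otimes> \<psi>\<close> uses the algebra \<open>U(h)\<close> only through its product and,
for the Koszul signs, its degrees, and \<open>U(f)\<close> is a morphism of graded algebras for every morphism \<open>f\<close> of graded
Lie algebras (\<open>Uf_hol_val\<close>).  Applied to \<open>\<rho> : S(g) \<rightarrow> g\<close>, this turns the holonomy in \<open>U(S(g))\<close> into the
holonomy of \<open>\<rho>\<^sub>*\<eta>\<^sub>*\<alpha>\<close>.  The arity \<open>k\<close> component of \<open>\<eta>\<close> takes values in the generators of \<open>S(g)\<close> that come
from tensors of length \<open>k\<close>, and \<open>\<rho>\<close> projects the generators to length 1; so \<open>\<rho> \<circ> \<eta>\<close> is the identity in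
arity 1 and 0 in the higher arities (\<open>rho_eta\<close>), and \<open>\<rho>\<^sub>*\<eta>\<^sub>*\<alpha> = \<alpha>\<close> (\<open>rho_eta_push\<close>).  This is the equality on
simplices (\<open>hat_env_rho_pairing\<close>); it passes to the bar complex by functoriality (\<open>hbar_map_to_hbar\<close>).

The formal proof has to turn this into an equality of sets.  A point of a completion is a sequence of cosets, and
at index \<open>n\<close> the value \<open>\<phi>\<^sub>*(\<alpha>)\<close> is the union of the cosets of \<open>\<Sum>\<^sub>k \<phi>\<^sub>k(p\<^sup>k)\<close> over \<^emph>\<open>all\<close> combinations \<open>p\<close> of pure
tensors that represent \<open>\<alpha>\<close> modulo the \<open>n\<close>-th step of the filtration.  The holonomy on a simplex is therefore a
union indexed by representatives (\<open>pairing_hol_elem\<close>), and the values of \<open>\<psi>\<close> enter only as coefficients.  One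
inclusion says that \<open>U(\<rho>) \<otimes> id\<close> maps representatives to representatives.  The other one says that it is
\<^emph>\<open>onto\<close> the representatives of the filtration of \<open>U(g) \<otimes> \<Omega>(M)\<close> (\<open>pw1_pfil_rep_onto\<close>); for this, elements of
\<open>U(g)\<close> are lifted along \<open>U(\<rho>)\<close> with their degree and filtration index, letter by letter through
\<open>x \<mapsto> \<eta>\<^sub>1(x)\<close> (\<open>Uf_lift\<close>).

The element 0 requires care throughout: it lies in every graded component, so the degree chosen for it, and any
sign computed from it, is arbitrary.  Words with a letter 0 represent 0 (\<open>zero_word_trel\<close>), products with a
factor 0 vanish (\<open>hol_val_zero_letters\<close>), and for other elements of \<open>U(g)\<close> the degree is unique
(\<open>deg_unique_env\<close>), because the relations of \<open>U(g)\<close> are homogeneous (\<open>deg_part_urels\<close>).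

That all maps are well defined on quotients amounts to: \<open>\<rho>\<close> kills the relations of the free Lie algebra
(\<open>lie_ideal_kernel\<close>), \<open>U(f)\<close> respects those of the enveloping algebra (\<open>fw_urels\<close>), symmetrizations are symmetric
tensors (\<open>symz_word_symmetric\<close>), and forms are closed under linear combinations (\<open>is_form_combination\<close>).\<close>

abbreviation "single \<equiv> Poly_Mapping.single"
abbreviation "keys \<equiv> Poly_Mapping.keys"
abbreviation "lookup \<equiv> Poly_Mapping.lookup"

section \<open>Real vector spaces as modules, quotients and spans\<close>

lemma real_ring_simps [simp]:
  "carrier real_ring = UNIV" "\<one>\<^bsub>real_ring\<^esub> = 1" "\<zero>\<^bsub>real_ring\<^esub> = 0"
  "x \<otimes>\<^bsub>real_ring\<^esub> y = x * y" "x \<oplus>\<^bsub>real_ring\<^esub> y = x + y"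
  by (simp_all add: real_ring_def)

lemma cring_real_ring: "cring real_ring"
proof (rule cringI)
  show "abelian_group real_ring"
    by (rule abelian_groupI) (auto intro: exI[where x = "- x" for x :: real])
  show "comm_monoid real_ring"
    by (rule comm_monoidI) auto
qed (auto simp: algebra_simps)

lemma real_ring_minus [simp]: "\<ominus>\<^bsub>real_ring\<^esub> x = - x"
proof -
  interpret cring real_ring by (rule cring_real_ring)
  show ?thesis by (rule minus_equality) auto
qed

abbreviation vsp :: "('a, 'm) dg_scheme \<Rightarrow> bool" where
  "vsp V \<equiv> module real_ring V"

lemma vspI:
  assumes "\<And>x y. x \<in> carrier V \<Longrightarrow> y \<in> carrier V \<Longrightarrow> x \<oplus>\<^bsub>V\<^esub> y \<in> carrier V"
    and "\<zero>\<^bsub>V\<^esub> \<in> carrier V"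
    and "\<And>x y z. x \<in> carrier V \<Longrightarrow> y \<in> carrier V \<Longrightarrow> z \<in> carrier V \<Longrightarrow>
          (x \<oplus>\<^bsub>V\<^esub> y) \<oplus>\<^bsub>V\<^esub> z = x \<oplus>\<^bsub>V\<^esub> (y \<oplus>\<^bsub>V\<^esub> z)"
    and "\<And>x y. x \<in> carrier V \<Longrightarrow> y \<in> carrier V \<Longrightarrow> x \<oplus>\<^bsub>V\<^esub> y = y \<oplus>\<^bsub>V\<^esub> x"
    and "\<And>x. x \<in> carrier V \<Longrightarrow> \<zero>\<^bsub>V\<^esub> \<oplus>\<^bsub>V\<^esub> x = x"
    and c: "\<And>c x. x \<in> carrier V \<Longrightarrow> c \<odot>\<^bsub>V\<^esub> x \<in> carrier V"
    and "\<And>c d x. x \<in> carrier V \<Longrightarrow> (c + d) \<odot>\<^bsub>V\<^esub> x = c \<odot>\<^bsub>V\<^esub> x \<oplus>\<^bsub>V\<^esub> d \<odot>\<^bsub>V\<^esub> x"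
    and "\<And>c x y. x \<in> carrier V \<Longrightarrow> y \<in> carrier V \<Longrightarrow> c \<odot>\<^bsub>V\<^esub> (x \<oplus>\<^bsub>V\<^esub> y) = c \<odot>\<^bsub>V\<^esub> x \<oplus>\<^bsub>V\<^esub> c \<odot>\<^bsub>V\<^esub> y"
    and "\<And>c d x. x \<in> carrier V \<Longrightarrow> (c * d) \<odot>\<^bsub>V\<^esub> x = c \<odot>\<^bsub>V\<^esub> (d \<odot>\<^bsub>V\<^esub> x)"
    and "\<And>x. x \<in> carrier V \<Longrightarrow> 1 \<odot>\<^bsub>V\<^esub> x = x"
    and z: "\<And>x. x \<in> carrier V \<Longrightarrow> 0 \<odot>\<^bsub>V\<^esub> x = \<zero>\<^bsub>V\<^esub>"
  shows "vsp V"
proof (rule moduleI[OF cring_real_ring])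
  show "abelian_group V"
  proof (rule abelian_groupI)
    fix x assume x: "x \<in> carrier V"
    have "(-1) \<odot>\<^bsub>V\<^esub> x \<oplus>\<^bsub>V\<^esub> x = \<zero>\<^bsub>V\<^esub>"
      using assms(7)[OF x, of "-1" 1] assms(10)[OF x] z[OF x] by simp
    then show "\<exists>y\<in>carrier V. y \<oplus>\<^bsub>V\<^esub> x = \<zero>\<^bsub>V\<^esub>"
      using c[OF x] by blast
  qed (use assms in auto)
qed (use assms in auto)

lemma vsp_simps:
  assumes "vsp V"
  shows vsp_zero: "\<zero>\<^bsub>V\<^esub> \<in> carrier V"
    and vsp_add: "\<And>x y. x \<in> carrier V \<Longrightarrow> y \<in> carrier V \<Longrightarrow> x \<oplus>\<^bsub>V\<^esub> y \<in> carrier V"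
    and vsp_smult: "\<And>c x. x \<in> carrier V \<Longrightarrow> c \<odot>\<^bsub>V\<^esub> x \<in> carrier V"
    and vsp_assoc: "\<And>x y z. x \<in> carrier V \<Longrightarrow> y \<in> carrier V \<Longrightarrow> z \<in> carrier V \<Longrightarrow>
          (x \<oplus>\<^bsub>V\<^esub> y) \<oplus>\<^bsub>V\<^esub> z = x \<oplus>\<^bsub>V\<^esub> (y \<oplus>\<^bsub>V\<^esub> z)"
    and vsp_comm: "\<And>x y. x \<in> carrier V \<Longrightarrow> y \<in> carrier V \<Longrightarrow> x \<oplus>\<^bsub>V\<^esub> y = y \<oplus>\<^bsub>V\<^esub> x"
    and vsp_lcomm: "\<And>x y z. x \<in> carrier V \<Longrightarrow> y \<in> carrier V \<Longrightarrow> z \<in> carrier V \<Longrightarrow>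
          x \<oplus>\<^bsub>V\<^esub> (y \<oplus>\<^bsub>V\<^esub> z) = y \<oplus>\<^bsub>V\<^esub> (x \<oplus>\<^bsub>V\<^esub> z)"
    and vsp_l_zero: "\<And>x. x \<in> carrier V \<Longrightarrow> \<zero>\<^bsub>V\<^esub> \<oplus>\<^bsub>V\<^esub> x = x"
    and vsp_r_zero: "\<And>x. x \<in> carrier V \<Longrightarrow> x \<oplus>\<^bsub>V\<^esub> \<zero>\<^bsub>V\<^esub> = x"
    and vsp_distl: "\<And>c d x. x \<in> carrier V \<Longrightarrow> (c + d) \<odot>\<^bsub>V\<^esub> x = c \<odot>\<^bsub>V\<^esub> x \<oplus>\<^bsub>V\<^esub> d \<odot>\<^bsub>V\<^esub> x"
    and vsp_distr: "\<And>c x y. x \<in> carrier V \<Longrightarrow> y \<in> carrier V \<Longrightarrow> c \<odot>\<^bsub>V\<^esub> (x \<oplus>\<^bsub>V\<^esub> y) = c \<odot>\<^bsub>V\<^esub> x \<oplus>\<^bsub>V\<^esub> c \<odot>\<^bsub>V\<^esub> y"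
    and vsp_mult: "\<And>c d x. x \<in> carrier V \<Longrightarrow> c \<odot>\<^bsub>V\<^esub> (d \<odot>\<^bsub>V\<^esub> x) = (c * d) \<odot>\<^bsub>V\<^esub> x"
    and vsp_one: "\<And>x. x \<in> carrier V \<Longrightarrow> 1 \<odot>\<^bsub>V\<^esub> x = x"
    and vsp_null: "\<And>x. x \<in> carrier V \<Longrightarrow> 0 \<odot>\<^bsub>V\<^esub> x = \<zero>\<^bsub>V\<^esub>"
    and vsp_rnull: "\<And>c. c \<odot>\<^bsub>V\<^esub> \<zero>\<^bsub>V\<^esub> = \<zero>\<^bsub>V\<^esub>"
    and vsp_neg: "\<And>x. x \<in> carrier V \<Longrightarrow> (-1) \<odot>\<^bsub>V\<^esub> x \<oplus>\<^bsub>V\<^esub> x = \<zero>\<^bsub>V\<^esub>"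
    and vsp_neg2: "\<And>x. x \<in> carrier V \<Longrightarrow> x \<oplus>\<^bsub>V\<^esub> (-1) \<odot>\<^bsub>V\<^esub> x = \<zero>\<^bsub>V\<^esub>"
    and vsp_minus: "\<And>x. x \<in> carrier V \<Longrightarrow> \<ominus>\<^bsub>V\<^esub> x = (-1) \<odot>\<^bsub>V\<^esub> x"
proof -
  interpret M: module real_ring V by fact
  note [simp] = M.smult_closed[simplified]
  show "\<zero>\<^bsub>V\<^esub> \<in> carrier V" by simp
  show "x \<oplus>\<^bsub>V\<^esub> y \<in> carrier V" if "x \<in> carrier V" "y \<in> carrier V" for x y using that by simp
  show "c \<odot>\<^bsub>V\<^esub> x \<in> carrier V" if "x \<in> carrier V" for c x using that by simp
  show "(x \<oplus>\<^bsub>V\<^esub> y) \<oplus>\<^bsub>V\<^esub> z = x \<oplus>\<^bsub>V\<^esub> (y \<oplus>\<^bsub>V\<^esub> z)" if "x \<in> carrier V" "y \<in> carrier V" "z \<in> carrier V" for x y z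
    using that by (rule M.a_assoc)
  show "x \<oplus>\<^bsub>V\<^esub> y = y \<oplus>\<^bsub>V\<^esub> x" if "x \<in> carrier V" "y \<in> carrier V" for x y
    using that by (rule M.a_comm)
  show "x \<oplus>\<^bsub>V\<^esub> (y \<oplus>\<^bsub>V\<^esub> z) = y \<oplus>\<^bsub>V\<^esub> (x \<oplus>\<^bsub>V\<^esub> z)" if "x \<in> carrier V" "y \<in> carrier V" "z \<in> carrier V" for x y z
    using that by (rule M.a_lcomm)
  show "\<zero>\<^bsub>V\<^esub> \<oplus>\<^bsub>V\<^esub> x = x" "x \<oplus>\<^bsub>V\<^esub> \<zero>\<^bsub>V\<^esub> = x" if "x \<in> carrier V" for x using that by simp_all
  show *: "(c + d) \<odot>\<^bsub>V\<^esub> x = c \<odot>\<^bsub>V\<^esub> x \<oplus>\<^bsub>V\<^esub> d \<odot>\<^bsub>V\<^esub> x" if "x \<in> carrier V" for c d x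
    using M.smult_l_distr[of c d x] that by simp
  show "c \<odot>\<^bsub>V\<^esub> (x \<oplus>\<^bsub>V\<^esub> y) = c \<odot>\<^bsub>V\<^esub> x \<oplus>\<^bsub>V\<^esub> c \<odot>\<^bsub>V\<^esub> y" if "x \<in> carrier V" "y \<in> carrier V" for c x y
    using M.smult_r_distr[of c x y] that by simp
  show "c \<odot>\<^bsub>V\<^esub> (d \<odot>\<^bsub>V\<^esub> x) = (c * d) \<odot>\<^bsub>V\<^esub> x" if "x \<in> carrier V" for c d x
    using M.smult_assoc1[of c d x] that by simp
  show o: "1 \<odot>\<^bsub>V\<^esub> x = x" if "x \<in> carrier V" for x using M.smult_one[of x] that by simp
  show n: "0 \<odot>\<^bsub>V\<^esub> x = \<zero>\<^bsub>V\<^esub>" if "x \<in> carrier V" for x using M.smult_l_null[of x] that by simp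
  show "c \<odot>\<^bsub>V\<^esub> \<zero>\<^bsub>V\<^esub> = \<zero>\<^bsub>V\<^esub>" for c using M.smult_r_null[of c] by simp
  show m: "(-1) \<odot>\<^bsub>V\<^esub> x \<oplus>\<^bsub>V\<^esub> x = \<zero>\<^bsub>V\<^esub>" if "x \<in> carrier V" for x
    using *[OF that, of "-1" 1] o[OF that] n[OF that] by simp
  then show "x \<oplus>\<^bsub>V\<^esub> (-1) \<odot>\<^bsub>V\<^esub> x = \<zero>\<^bsub>V\<^esub>" if "x \<in> carrier V" for x
    using that by (metis M.a_comm M.smult_closed UNIV_I real_ring_simps(1))
  show "\<ominus>\<^bsub>V\<^esub> x = (-1) \<odot>\<^bsub>V\<^esub> x" if "x \<in> carrier V" for x
    using m[OF that] that by (intro M.minus_equality) auto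
qed

lemma subspI:
  assumes "vsp V" "W \<subseteq> carrier V" "\<zero>\<^bsub>V\<^esub> \<in> W"
    and "\<And>x y. x \<in> W \<Longrightarrow> y \<in> W \<Longrightarrow> x \<oplus>\<^bsub>V\<^esub> y \<in> W"
    and "\<And>c x. x \<in> W \<Longrightarrow> c \<odot>\<^bsub>V\<^esub> x \<in> W"
  shows "subsp W V"
  using assms vsp_minus[OF assms(1)] by (intro module.submoduleI) (auto simp: subset_iff)

lemma subspD:
  assumes "vsp V" "subsp W V"
  shows subsp_sub: "W \<subseteq> carrier V" and subsp_zero: "\<zero>\<^bsub>V\<^esub> \<in> W"
    and subsp_add: "\<And>x y. x \<in> W \<Longrightarrow> y \<in> W \<Longrightarrow> x \<oplus>\<^bsub>V\<^esub> y \<in> W"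
    and subsp_smult: "\<And>c x. x \<in> W \<Longrightarrow> c \<odot>\<^bsub>V\<^esub> x \<in> W"
proof -
  note E = module.submoduleE[OF assms]
  show s: "W \<subseteq> carrier V" by (rule E(1))
  show c: "\<And>c x. x \<in> W \<Longrightarrow> c \<odot>\<^bsub>V\<^esub> x \<in> W" using E(4) by simp
  show "\<And>x y. x \<in> W \<Longrightarrow> y \<in> W \<Longrightarrow> x \<oplus>\<^bsub>V\<^esub> y \<in> W" by (rule E(5))
  obtain w where "w \<in> W" using E(2) by blast
  then show "\<zero>\<^bsub>V\<^esub> \<in> W" using c[of w 0] vsp_null[OF assms(1), of w] s by auto
qed

lemma subsp_carrier: "vsp V \<Longrightarrow> subsp (carrier V) V"
  by (rule subspI) (auto simp: vsp_simps)

lemma vspan_subsp: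
  assumes "vsp V" "S \<subseteq> carrier V"
  shows "subsp (vspan V S) V"
proof (rule subspI[OF assms(1)])
  note D = subspD[OF assms(1)]
  show "vspan V S \<subseteq> carrier V"
    using subsp_carrier[OF assms(1)] assms(2) by (auto simp: vspan_def)
  show "\<zero>\<^bsub>V\<^esub> \<in> vspan V S" using D(2) by (auto simp: vspan_def)
  show "x \<oplus>\<^bsub>V\<^esub> y \<in> vspan V S" if "x \<in> vspan V S" "y \<in> vspan V S" for x y
    using that D(3) by (auto simp: vspan_def)
  show "c \<odot>\<^bsub>V\<^esub> x \<in> vspan V S" if "x \<in> vspan V S" for c x
    using that D(4) by (auto simp: vspan_def)
qed

lemma vspan_base: "x \<in> S \<Longrightarrow> x \<in> vspan V S"
  by (auto simp: vspan_def)

lemma vspan_least: "subsp W V \<Longrightarrow> S \<subseteq> W \<Longrightarrow> vspan V S \<subseteq> W"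
  by (auto simp: vspan_def)

lemma vspan_mono: "vsp V \<Longrightarrow> S \<subseteq> T \<Longrightarrow> T \<subseteq> carrier V \<Longrightarrow> vspan V S \<subseteq> vspan V T"
  by (rule vspan_least[OF vspan_subsp]) (auto intro: vspan_base)

definition lin :: "('a, 'm) dg_scheme \<Rightarrow> ('b, 'n) dg_scheme \<Rightarrow> ('a \<Rightarrow> 'b) \<Rightarrow> bool" where
  "lin V W f \<longleftrightarrow> vsp V \<and> vsp W \<and> f \<in> carrier V \<rightarrow> carrier W \<and>
     (\<forall>x\<in>carrier V. \<forall>y\<in>carrier V. f (x \<oplus>\<^bsub>V\<^esub> y) = f x \<oplus>\<^bsub>W\<^esub> f y) \<and>
     (\<forall>c. \<forall>x\<in>carrier V. f (c \<odot>\<^bsub>V\<^esub> x) = c \<odot>\<^bsub>W\<^esub> f x)"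

lemma linI:
  assumes "vsp V" "vsp W" "\<And>x. x \<in> carrier V \<Longrightarrow> f x \<in> carrier W"
    and "\<And>x y. x \<in> carrier V \<Longrightarrow> y \<in> carrier V \<Longrightarrow> f (x \<oplus>\<^bsub>V\<^esub> y) = f x \<oplus>\<^bsub>W\<^esub> f y"
    and "\<And>c x. x \<in> carrier V \<Longrightarrow> f (c \<odot>\<^bsub>V\<^esub> x) = c \<odot>\<^bsub>W\<^esub> f x"
  shows "lin V W f"
  using assms by (auto simp: lin_def)

lemma linD:
  assumes "lin V W f"
  shows lin_dom: "vsp V" and lin_cod: "vsp W"
    and lin_in: "\<And>x. x \<in> carrier V \<Longrightarrow> f x \<in> carrier W"
    and lin_add: "\<And>x y. x \<in> carrier V \<Longrightarrow> y \<in> carrier V \<Longrightarrow> f (x \<oplus>\<^bsub>V\<^esub> y) = f x \<oplus>\<^bsub>W\<^esub> f y"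
    and lin_smult: "\<And>c x. x \<in> carrier V \<Longrightarrow> f (c \<odot>\<^bsub>V\<^esub> x) = c \<odot>\<^bsub>W\<^esub> f x"
  using assms by (auto simp: lin_def)

lemma lin_zero:
  assumes "lin V W f" shows "f \<zero>\<^bsub>V\<^esub> = \<zero>\<^bsub>W\<^esub>"
  using lin_smult[OF assms, of "\<zero>\<^bsub>V\<^esub>" 0] lin_in[OF assms, of "\<zero>\<^bsub>V\<^esub>"]
  by (simp add: vsp_simps[OF lin_dom[OF assms]] vsp_simps[OF lin_cod[OF assms]])

lemma lin_compose: "lin V W f \<Longrightarrow> lin W U h \<Longrightarrow> lin V U (\<lambda>x. h (f x))"
  by (auto simp: lin_def Pi_iff)

lemma lin_preimage_subsp:
  assumes "lin V W f" "subsp U W"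
  shows "subsp {x \<in> carrier V. f x \<in> U} V"
proof -
  note V = lin_dom[OF assms(1)] and W = lin_cod[OF assms(1)]
  show ?thesis
    using lin_zero[OF assms(1)] linD(3-5)[OF assms(1)] subspD[OF W assms(2)]
    by (intro subspI[OF V]) (auto simp: vsp_simps[OF V])
qed

lemma lin_image_subsp:
  assumes "lin V W f" "subsp U V"
  shows "subsp (f ` U) W"
proof (rule subspI)
  note U = subspD[OF lin_dom[OF assms(1)] assms(2)] and f = linD[OF assms(1)]
  show "vsp W" by fact
  show "f ` U \<subseteq> carrier W" using U(1) f(3) by auto
  show "\<zero>\<^bsub>W\<^esub> \<in> f ` U" using U(2) lin_zero[OF assms(1)] by force
  show "x \<oplus>\<^bsub>W\<^esub> y \<in> f ` U" if xy: "x \<in> f ` U" "y \<in> f ` U" for x y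
  proof -
    obtain a b where "a \<in> U" "b \<in> U" "x = f a" "y = f b" using xy by auto
    then have "x \<oplus>\<^bsub>W\<^esub> y = f (a \<oplus>\<^bsub>V\<^esub> b)" "a \<oplus>\<^bsub>V\<^esub> b \<in> U" using U(1,3) f(4)[of a b] by (auto simp: subset_iff)
    then show ?thesis by blast
  qed
  show "c \<odot>\<^bsub>W\<^esub> x \<in> f ` U" if x: "x \<in> f ` U" for c x
  proof -
    obtain a where "a \<in> U" "x = f a" using x by auto
    then have "c \<odot>\<^bsub>W\<^esub> x = f (c \<odot>\<^bsub>V\<^esub> a)" "c \<odot>\<^bsub>V\<^esub> a \<in> U" using U(1,4) f(5)[of a c] by (auto simp: subset_iff)
    then show ?thesis by blast
  qed
qed

lemma vspan_image:
  assumes f: "lin V W f" and S: "S \<subseteq> carrier V"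
  shows "f ` vspan V S = vspan W (f ` S)"
proof
  have fS: "f ` S \<subseteq> carrier W" using lin_in[OF f] S by auto
  note sub = vspan_subsp[OF lin_cod[OF f] fS]
  have "vspan V S \<subseteq> {x \<in> carrier V. f x \<in> vspan W (f ` S)}"
    using S by (intro vspan_least lin_preimage_subsp[OF f sub]) (auto intro: vspan_base)
  then show "f ` vspan V S \<subseteq> vspan W (f ` S)" by auto
  show "vspan W (f ` S) \<subseteq> f ` vspan V S"
    by (intro vspan_least lin_image_subsp[OF f] vspan_subsp[OF lin_dom[OF f] S]) (auto intro: vspan_base)
qed

lemma lin_vspan_into:
  assumes "lin V W f" "S \<subseteq> carrier V" "subsp U W" "f ` S \<subseteq> U" "x \<in> vspan V S"
  shows "f x \<in> U"
proof -
  have "f x \<in> vspan W (f ` S)" using vspan_image[OF assms(1,2)] assms(5) by auto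
  then show ?thesis using vspan_least[OF assms(3,4)] by auto
qed

lemma lin_eq_on_vspan:
  assumes "lin V W f" "lin V W h" "S \<subseteq> carrier V" "\<And>x. x \<in> S \<Longrightarrow> f x = h x" "x \<in> vspan V S"
  shows "f x = h x"
proof -
  note f = linD[OF assms(1)] and h = linD[OF assms(2)]
  note V = vsp_simps[OF f(1)]
  have "subsp {x \<in> carrier V. f x = h x} V"
    by (rule subspI) (auto simp: f h V lin_zero[OF assms(1)] lin_zero[OF assms(2)])
  then have "vspan V S \<subseteq> {x \<in> carrier V. f x = h x}"
    by (rule vspan_least) (use assms in auto)
  then show ?thesis using assms by auto
qed

subsection \<open>Cosets\<close>

lemma coset_eq: "N +>\<^bsub>V\<^esub> x = {n \<oplus>\<^bsub>V\<^esub> x | n. n \<in> N}"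
  by (auto simp: a_r_coset_def r_coset_def)

lemma set_add_eq: "A <+>\<^bsub>V\<^esub> B = {a \<oplus>\<^bsub>V\<^esub> b | a b. a \<in> A \<and> b \<in> B}"
  by (auto simp: set_add_def set_mult_def)

context
  fixes V :: "('a, 'm) dg_scheme" and N :: "'a set"
  assumes V: "vsp V" and N: "subsp N V"
begin

interpretation M: module real_ring V by (rule V)
private lemmas VS = vsp_simps[OF V] and NS = subspD[OF V N]

lemma subsp_abelian_subgroup: "abelian_subgroup N V"
  using N by (intro abelian_subgroupI3 additive_subgroup.intro)
    (auto simp: submodule_def M.abelian_group_axioms)

interpretation N: abelian_subgroup N V by (rule subsp_abelian_subgroup)

lemma coset_self: "x \<in> carrier V \<Longrightarrow> x \<in> N +>\<^bsub>V\<^esub> x"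
  by (rule N.a_rcos_self)

lemma coset_sub: "x \<in> carrier V \<Longrightarrow> N +>\<^bsub>V\<^esub> x \<subseteq> carrier V"
  using NS by (auto simp: coset_eq VS)

lemma coset_mem: "n \<in> N \<Longrightarrow> x \<in> carrier V \<Longrightarrow> N +>\<^bsub>V\<^esub> (n \<oplus>\<^bsub>V\<^esub> x) = N +>\<^bsub>V\<^esub> x"
  by (rule N.a_repr_independence'[symmetric]) (auto simp: coset_eq)

lemma coset_add: "x \<in> carrier V \<Longrightarrow> y \<in> carrier V \<Longrightarrow>
    (N +>\<^bsub>V\<^esub> x) <+>\<^bsub>V\<^esub> (N +>\<^bsub>V\<^esub> y) = N +>\<^bsub>V\<^esub> (x \<oplus>\<^bsub>V\<^esub> y)"
  by (rule N.a_rcos_sum)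

lemma coset_zero: "n \<in> N \<Longrightarrow> N +>\<^bsub>V\<^esub> n = N"
  by (rule M.a_coset_join2) (use NS(1) N in \<open>auto simp: submodule_def\<close>)

lemma coset_zero_iff: "x \<in> carrier V \<Longrightarrow> N +>\<^bsub>V\<^esub> x = N \<longleftrightarrow> x \<in> N"
  using coset_zero coset_self by blast

lemma cmap_coset_gen:
  assumes "x \<in> carrier V" "\<And>n. n \<in> N \<Longrightarrow> N' +>\<^bsub>W\<^esub> f (n \<oplus>\<^bsub>V\<^esub> x) = N' +>\<^bsub>W\<^esub> f x"
  shows "cmap W N' f (N +>\<^bsub>V\<^esub> x) = N' +>\<^bsub>W\<^esub> f x"
proof -
  have "cmap W N' f (N +>\<^bsub>V\<^esub> x) = (\<Union>n\<in>N. N' +>\<^bsub>W\<^esub> f (n \<oplus>\<^bsub>V\<^esub> x))"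
    unfolding cmap_def coset_eq[of V N x] by blast
  moreover have "N \<noteq> {}" using NS(2) by blast
  ultimately show ?thesis by (simp add: assms(2))
qed

end

lemma cmap_coset:
  assumes f: "lin V W f" and N: "subsp N V" and N': "subsp N' W"
    and fN: "\<And>n. n \<in> N \<Longrightarrow> f n \<in> N'" and x: "x \<in> carrier V"
  shows "cmap W N' f (N +>\<^bsub>V\<^esub> x) = N' +>\<^bsub>W\<^esub> f x"
proof (rule cmap_coset_gen[OF lin_dom[OF f] N x])
  fix n assume n: "n \<in> N"
  have "n \<in> carrier V" using n subsp_sub[OF lin_dom[OF f] N] by auto
  then show "N' +>\<^bsub>W\<^esub> f (n \<oplus>\<^bsub>V\<^esub> x) = N' +>\<^bsub>W\<^esub> f x"
    using n x by (simp add: lin_add[OF f] coset_mem[OF lin_cod[OF f] N'] fN lin_in[OF f])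
qed

lemma quot_simps:
  "carrier (quot V N) = (\<lambda>x. N +>\<^bsub>V\<^esub> x) ` carrier V" "\<zero>\<^bsub>quot V N\<^esub> = N"
  "X \<oplus>\<^bsub>quot V N\<^esub> Y = X <+>\<^bsub>V\<^esub> Y" "c \<odot>\<^bsub>quot V N\<^esub> X = cmap V N (\<lambda>x. c \<odot>\<^bsub>V\<^esub> x) X"
  "grade (quot V N) k = (\<lambda>x. N +>\<^bsub>V\<^esub> x) ` grade V k"
  "\<one>\<^bsub>quot V N\<^esub> = N +>\<^bsub>V\<^esub> \<one>\<^bsub>V\<^esub>"
  "X \<otimes>\<^bsub>quot V N\<^esub> Y = (\<Union>x\<in>X. \<Union>y\<in>Y. N +>\<^bsub>V\<^esub> (x \<otimes>\<^bsub>V\<^esub> y))"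
  by (simp_all add: quot_def)

lemma lin_smult_map: "vsp V \<Longrightarrow> lin V V (\<lambda>x. c \<odot>\<^bsub>V\<^esub> x)"
  by (rule linI) (auto simp: vsp_simps mult.commute)

lemma quot_smult:
  assumes "vsp V" "subsp N V" "x \<in> carrier V"
  shows "c \<odot>\<^bsub>quot V N\<^esub> (N +>\<^bsub>V\<^esub> x) = N +>\<^bsub>V\<^esub> (c \<odot>\<^bsub>V\<^esub> x)"
  unfolding quot_simps
  by (rule cmap_coset[OF lin_smult_map]) (use assms subspD[OF assms(1,2)] in auto)

lemma vsp_quot:
  assumes V: "vsp V" and N: "subsp N V"
  shows "vsp (quot V N)"
proof -
  note VS = vsp_simps[OF V] and c = coset_add[OF V N] quot_smult[OF V N]
  note z = coset_zero[OF V N subsp_zero[OF V N], symmetric]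
  have q: "\<And>X. X \<in> carrier (quot V N) \<Longrightarrow> \<exists>x\<in>carrier V. X = N +>\<^bsub>V\<^esub> x"
    and qz: "\<zero>\<^bsub>quot V N\<^esub> = N +>\<^bsub>V\<^esub> \<zero>\<^bsub>V\<^esub>"
    and qi: "\<And>x. x \<in> carrier V \<Longrightarrow> N +>\<^bsub>V\<^esub> x \<in> carrier (quot V N)"
    using z by (auto simp: quot_simps(1,2))
  note r = qz quot_simps(3) c
  show ?thesis
  proof (rule vspI)
    show "X \<oplus>\<^bsub>quot V N\<^esub> Y \<in> carrier (quot V N)" if "X \<in> carrier (quot V N)" "Y \<in> carrier (quot V N)" for X Y
      using q[OF that(1)] q[OF that(2)] by (auto simp: r qi VS)
    show "\<zero>\<^bsub>quot V N\<^esub> \<in> carrier (quot V N)" by (simp add: r qi VS)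
    show "X \<oplus>\<^bsub>quot V N\<^esub> Y \<oplus>\<^bsub>quot V N\<^esub> Z = X \<oplus>\<^bsub>quot V N\<^esub> (Y \<oplus>\<^bsub>quot V N\<^esub> Z)"
      if "X \<in> carrier (quot V N)" "Y \<in> carrier (quot V N)" "Z \<in> carrier (quot V N)" for X Y Z
      using q[OF that(1)] q[OF that(2)] q[OF that(3)] by (auto simp: r VS(2,4))
    show "X \<oplus>\<^bsub>quot V N\<^esub> Y = Y \<oplus>\<^bsub>quot V N\<^esub> X" if XY: "X \<in> carrier (quot V N)" "Y \<in> carrier (quot V N)" for X Y
    proof -
      obtain x y where "x \<in> carrier V" "y \<in> carrier V" "X = N +>\<^bsub>V\<^esub> x" "Y = N +>\<^bsub>V\<^esub> y"
        using q[OF XY(1)] q[OF XY(2)] by blast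
      then show ?thesis using VS(5)[of x y] by (simp add: r)
    qed
    fix X assume "X \<in> carrier (quot V N)"
    then obtain x where x: "x \<in> carrier V" and X: "X = N +>\<^bsub>V\<^esub> x" using q by blast
    show "\<zero>\<^bsub>quot V N\<^esub> \<oplus>\<^bsub>quot V N\<^esub> X = X" using x by (simp add: X r VS(1,7))
    show "c \<odot>\<^bsub>quot V N\<^esub> X \<in> carrier (quot V N)" for c using x by (simp add: X r qi VS(3))
    show "(c + d) \<odot>\<^bsub>quot V N\<^esub> X = c \<odot>\<^bsub>quot V N\<^esub> X \<oplus>\<^bsub>quot V N\<^esub> d \<odot>\<^bsub>quot V N\<^esub> X" for c d
      using x by (simp add: X r VS(3,9))
    show "(c * d) \<odot>\<^bsub>quot V N\<^esub> X = c \<odot>\<^bsub>quot V N\<^esub> (d \<odot>\<^bsub>quot V N\<^esub> X)" for c d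
      using x by (simp add: X r VS(3,11))
    show "1 \<odot>\<^bsub>quot V N\<^esub> X = X" "0 \<odot>\<^bsub>quot V N\<^esub> X = \<zero>\<^bsub>quot V N\<^esub>"
      using x by (simp_all add: X r VS(12,13))
    show "c \<odot>\<^bsub>quot V N\<^esub> (X \<oplus>\<^bsub>quot V N\<^esub> Y) = c \<odot>\<^bsub>quot V N\<^esub> X \<oplus>\<^bsub>quot V N\<^esub> c \<odot>\<^bsub>quot V N\<^esub> Y"
      if "Y \<in> carrier (quot V N)" for c Y
      using q[OF that] x by (auto simp: X r VS(2,3,10))
  qed
qed

lemma lin_quot:
  assumes V: "vsp V" and N: "subsp N V"
  shows "lin V (quot V N) (\<lambda>x. N +>\<^bsub>V\<^esub> x)"
  by (rule linI[OF V vsp_quot[OF V N]])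
    (simp_all add: quot_simps(1-3) coset_add[OF V N] quot_smult[OF V N])

lemma lin_cmap:
  assumes f: "lin V W f" and N: "subsp N V" and N': "subsp N' W"
    and fN: "\<And>n. n \<in> N \<Longrightarrow> f n \<in> N'"
  shows "lin (quot V N) (quot W N') (cmap W N' f)"
proof -
  note V = lin_dom[OF f] and W = lin_cod[OF f]
  note c = cmap_coset[OF f N N' fN]
  show ?thesis
    by (rule linI[OF vsp_quot[OF V N] vsp_quot[OF W N']])
      (auto simp: quot_simps(1,3) coset_add[OF V N] coset_add[OF W N'] quot_smult[OF V N] quot_smult[OF W N']
         c vsp_add[OF V] vsp_smult[OF V] linD(3-5)[OF f])
qed

lemma vspan_quot:
  assumes "vsp V" "subsp N V" "S \<subseteq> carrier V"
  shows "vspan (quot V N) ((\<lambda>x. N +>\<^bsub>V\<^esub> x) ` S) = (\<lambda>x. N +>\<^bsub>V\<^esub> x) ` vspan V S"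
  using vspan_image[OF lin_quot[OF assms(1,2)] assms(3)] by simp

text \<open>A span in a quotient is the image of a span upstairs, so its cosets fill the span together with the relations.\<close>

lemma Union_vspan_quot:
  assumes V: "vsp V" and A: "A \<subseteq> carrier V" and S: "S \<subseteq> carrier V"
  shows "\<Union>(vspan (quot V (vspan V A)) ((\<lambda>x. vspan V A +>\<^bsub>V\<^esub> x) ` S)) = vspan V (A \<union> S)"
proof -
  let ?N = "vspan V A"
  note N = vspan_subsp[OF V A] and SS = vspan_subsp[OF V S]
  have AS: "A \<union> S \<subseteq> carrier V" using A S by auto
  note U = subspD[OF V vspan_subsp[OF V AS]]
  note VS = vsp_simps[OF V] and ND = subspD[OF V N] and SD = subspD[OF V SS]
  have "\<Union>(vspan (quot V ?N) ((\<lambda>x. ?N +>\<^bsub>V\<^esub> x) ` S)) = {n \<oplus>\<^bsub>V\<^esub> x | n x. n \<in> ?N \<and> x \<in> vspan V S}" (is "_ = ?P")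
    unfolding vspan_quot[OF V N S] by (auto simp: coset_eq)
  also have "?P = vspan V (A \<union> S)"
  proof
    show "?P \<subseteq> vspan V (A \<union> S)"
      using U(3) vspan_mono[OF V _ AS, of A] vspan_mono[OF V _ AS, of S] by (auto simp: subset_iff)
    have "subsp ?P V"
    proof (rule subspI[OF V])
      show "?P \<subseteq> carrier V" using ND(1) SD(1) by (auto simp: VS subset_iff)
      show "\<zero>\<^bsub>V\<^esub> \<in> ?P" using ND(2) SD(2) vsp_l_zero[OF V vsp_zero[OF V]] by force
      show "x \<oplus>\<^bsub>V\<^esub> y \<in> ?P" if xy: "x \<in> ?P" "y \<in> ?P" for x y
      proof -
        obtain a b c d where *: "a \<in> ?N" "b \<in> vspan V S" "c \<in> ?N" "d \<in> vspan V S" "x = a \<oplus>\<^bsub>V\<^esub> b" "y = c \<oplus>\<^bsub>V\<^esub> d"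
          using xy by auto
        then have C: "a \<in> carrier V" "b \<in> carrier V" "c \<in> carrier V" "d \<in> carrier V" using ND(1) SD(1) by auto
        have "x \<oplus>\<^bsub>V\<^esub> y = (a \<oplus>\<^bsub>V\<^esub> c) \<oplus>\<^bsub>V\<^esub> (b \<oplus>\<^bsub>V\<^esub> d)"
          using C * by (simp add: VS(2-7))
        then show ?thesis using * ND(3) SD(3) by blast
      qed
      show "c \<odot>\<^bsub>V\<^esub> x \<in> ?P" if x: "x \<in> ?P" for c x
      proof -
        obtain a b where *: "a \<in> ?N" "b \<in> vspan V S" "x = a \<oplus>\<^bsub>V\<^esub> b" using x by auto
        then have "c \<odot>\<^bsub>V\<^esub> x = c \<odot>\<^bsub>V\<^esub> a \<oplus>\<^bsub>V\<^esub> c \<odot>\<^bsub>V\<^esub> b"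
          using ND(1) SD(1) by (auto intro!: vsp_distr[OF V])
        then show ?thesis using * ND(4) SD(4) by blast
      qed
    qed
    moreover have "A \<union> S \<subseteq> ?P"
    proof
      fix x assume x: "x \<in> A \<union> S"
      then have c: "x \<in> carrier V" using AS by auto
      have "\<exists>n y. x = n \<oplus>\<^bsub>V\<^esub> y \<and> n \<in> ?N \<and> y \<in> vspan V S"
      proof (cases "x \<in> A")
        case True
        show ?thesis
          by (rule exI[of _ x], rule exI[of _ "\<zero>\<^bsub>V\<^esub>"]) (simp add: True c SD(2) vspan_base vsp_r_zero[OF V])
      next
        case False
        show ?thesis using x False
          by (intro exI[of _ "\<zero>\<^bsub>V\<^esub>"] exI[of _ x]) (simp add: c ND(2) vspan_base vsp_l_zero[OF V])
      qed
      then show "x \<in> ?P" by auto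
    qed
    ultimately show "vspan V (A \<union> S) \<subseteq> ?P" by (rule vspan_least)
  qed
  finally show ?thesis .
qed

section \<open>Free vector spaces\<close>

lemma lookup_psc [simp]: "lookup (psc c p) w = c * lookup p w"
  by (simp add: psc_def Poly_Mapping.map.rep_eq when_def)

lemma psc_simps [simp]:
  "psc 0 p = 0" "psc 1 p = p" "psc c 0 = 0" "psc c (psc d p) = psc (c * d) p"
  "psc c (single w d) = single w (c * d)"
  by (rule poly_mapping_eqI; simp add: lookup_single when_def)+

lemma psc_add: "psc c (p + q) = psc c p + psc c q" "psc (c + d) p = psc c p + psc d p"
  by (rule poly_mapping_eqI; simp add: lookup_add algebra_simps)+

lemma psc_minus_one [simp]: "psc (- 1) p = - p"
  by (rule poly_mapping_eqI) simp

lemma psc_sum: "psc c (sum f A) = (\<Sum>a\<in>A. psc c (f a))"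
  by (induction A rule: infinite_finite_induct) (simp_all add: psc_add)

lemma keys_psc: "keys (psc c p) \<subseteq> keys p"
  by (auto simp: in_keys_iff)

lemma keys_psc_sub: "keys p \<subseteq> S \<Longrightarrow> keys (psc c p) \<subseteq> S"
  using keys_psc[of c p] by (rule order_trans)

lemma keys_add_sub: "keys p \<subseteq> S \<Longrightarrow> keys q \<subseteq> S \<Longrightarrow> keys (p + q) \<subseteq> S"
  using keys_add[of p q] by auto

lemma pext_superset:
  assumes "finite A" "keys p \<subseteq> A"
  shows "pext f p = (\<Sum>w\<in>A. psc (lookup p w) (f w))"
  unfolding pext_def using assms
  by (intro sum.mono_neutral_left) (auto simp: in_keys_iff)

lemma pext_add: "pext f (p + q) = pext f p + pext f q"
proof -
  let ?A = "keys p \<union> keys q"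
  have "pext f (p + q) = (\<Sum>w\<in>?A. psc (lookup (p + q) w) (f w))"
    by (rule pext_superset) (use keys_add[of p q] in auto)
  also have "\<dots> = pext f p + pext f q"
    by (simp add: lookup_add psc_add sum.distrib pext_superset[of ?A p] pext_superset[of ?A q])
  finally show ?thesis .
qed

lemma pext_psc: "pext f (psc c p) = psc c (pext f p)"
  using pext_superset[OF _ keys_psc, of p f c]
  by (simp add: pext_superset[of "keys p" p] psc_sum)

lemma pext_single [simp]: "pext f (single w c) = psc c (f w)"
  by (simp add: pext_def)

lemma pext_zero [simp]: "pext f 0 = 0"
  by (simp add: pext_def)

lemma pext_uminus: "pext f (- p) = - pext f p"
  using pext_psc[of f "-1" p] by simp

lemma pext_diff: "pext f (p - q) = pext f p - pext f q"
  using pext_add[of f p "- q"] by (simp add: pext_uminus)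

lemma pext_sum: "pext f (sum p I) = (\<Sum>i\<in>I. pext f (p i))"
  by (induction I rule: infinite_finite_induct) (simp_all add: pext_add)

lemma pext_id: "pext (\<lambda>w. single w 1) p = p"
proof (rule poly_mapping_eqI)
  fix w
  have *: "(\<Sum>v\<in>keys p. lookup (single v (lookup p v)) w)
      = (\<Sum>v\<in>keys p. if v = w then lookup p w else 0)"
    by (rule sum.cong) (auto simp: lookup_single when_def)
  show "lookup (pext (\<lambda>w. single w 1) p) w = lookup p w"
    unfolding pext_def lookup_sum psc_simps mult_1_right * by (auto simp: sum.delta in_keys_iff)
qed

lemma pext_cong: "(\<And>w. w \<in> keys p \<Longrightarrow> f w = h w) \<Longrightarrow> pext f p = pext h p"
  by (simp add: pext_def)

lemma pext_pext: "pext f (pext h p) = pext (\<lambda>w. pext f (h w)) p"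
  by (simp add: pext_def[of h] pext_sum pext_psc) (simp add: pext_def)

lemma pext_plus: "pext (\<lambda>w. f w + h w) p = pext f p + pext h p"
  by (simp add: pext_def psc_add sum.distrib)

lemma pext_const_psc: "pext (\<lambda>w. psc c (f w)) p = psc c (pext f p)"
  by (simp add: pext_def psc_sum mult.commute)

lemma pext_zero_fun: "(\<And>w. w \<in> keys p \<Longrightarrow> f w = 0) \<Longrightarrow> pext f p = 0"
  by (simp add: pext_def)

lemma keys_pext: "keys (pext f p) \<subseteq> (\<Union>w\<in>keys p. keys (f w))"
  unfolding pext_def by (rule order_trans[OF keys_sum]) (intro UN_mono subset_refl keys_psc)

lemma keys_pext_sub: "(\<And>w. w \<in> keys p \<Longrightarrow> keys (f w) \<subseteq> S) \<Longrightarrow> keys (pext f p) \<subseteq> S"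
  using keys_pext[of f p] by blast

lemma keys_sum_sub: "(\<And>i. i \<in> I \<Longrightarrow> keys (f i) \<subseteq> S) \<Longrightarrow> keys (sum f I) \<subseteq> S"
  using keys_sum[of f I] by blast

lemma keys_minus_sub: "keys p \<subseteq> S \<Longrightarrow> keys q \<subseteq> S \<Longrightarrow>
    keys (p - q :: 'w \<Rightarrow>\<^sub>0 real) \<subseteq> S"
proof
  fix w assume p: "keys p \<subseteq> S" and q: "keys q \<subseteq> S" and w: "w \<in> keys (p - q)"
  then have "w \<in> keys p \<or> w \<in> keys q"
    by (auto simp: in_keys_iff lookup_minus)
  then show "w \<in> S" using p q by blast
qed

lemma free_dg_simps [simp]:
  "carrier (free_dg S m e d D) = {p. keys p \<subseteq> S}"
  "p \<oplus>\<^bsub>free_dg S m e d D\<^esub> q = p + q" "\<zero>\<^bsub>free_dg S m e d D\<^esub> = 0"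
  "c \<odot>\<^bsub>free_dg S m e d D\<^esub> p = psc c p"
  "p \<otimes>\<^bsub>free_dg S m e d D\<^esub> q = pext (\<lambda>v. pext (m v) q) p"
  "\<one>\<^bsub>free_dg S m e d D\<^esub> = e"
  "grade (free_dg S m e d D) k = {p. keys p \<subseteq> {w\<in>S. d w = k}}"
  by (simp_all add: free_dg_def)

lemma vsp_free: "vsp (free_dg S m e d D)"
  by (rule vspI) (simp_all add: keys_add_sub keys_psc_sub psc_add add_ac)

lemma subsp_free_iff:
  "subsp W (free_dg S m e d D) \<longleftrightarrow> W \<subseteq> {p. keys p \<subseteq> S} \<and> 0 \<in> W \<and>
     (\<forall>p\<in>W. \<forall>q\<in>W. p + q \<in> W) \<and> (\<forall>c. \<forall>p\<in>W. psc c p \<in> W)"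
  (is "?L \<longleftrightarrow> ?R")
proof
  assume ?L
  from subspD[OF vsp_free this] show ?R by simp
next
  assume ?R
  then show ?L by (intro subspI[OF vsp_free]) simp_all
qed

lemma subsp_keys: "T \<subseteq> S \<Longrightarrow> subsp {p. keys p \<subseteq> T} (free_dg S m e d D)"
  unfolding subsp_free_iff by (simp add: keys_add_sub keys_psc_sub) blast

lemma subsp_grade_free: "subsp (grade (free_dg S m e d D) k) (free_dg S m e d D)"
  unfolding free_dg_simps by (rule subsp_keys) blast

lemma subsp_free_sum:
  "subsp W (free_dg S m e d D) \<Longrightarrow> (\<And>i. i \<in> I \<Longrightarrow> f i \<in> W) \<Longrightarrow> sum f I \<in> W"
  by (induction I rule: infinite_finite_induct) (auto simp: subsp_free_iff)

lemma subsp_free_diff: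
  assumes "subsp W (free_dg S m e d D)" "p \<in> W" "q \<in> W" shows "p - q \<in> W" "- p \<in> W"
proof -
  have *: "- x \<in> W" if "x \<in> W" for x
    using assms(1) that unfolding subsp_free_iff by (metis psc_minus_one)
  show "- p \<in> W" using * assms by blast
  have "p + (- q) \<in> W" using *[OF assms(3)] assms(1,2) unfolding subsp_free_iff by blast
  then show "p - q \<in> W" by simp
qed

lemma free_in_subsp:
  assumes "subsp W (free_dg S m e d D)" "\<And>w. w \<in> keys p \<Longrightarrow> single w 1 \<in> W"
  shows "p \<in> W"
proof -
  have "pext (\<lambda>w. single w 1) p \<in> W"
    unfolding pext_def by (rule subsp_free_sum[OF assms(1)]) (use assms in \<open>auto simp: subsp_free_iff simp del: psc_simps(5)\<close>)
  then show ?thesis by (simp add: pext_id)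
qed

lemma pext_in_subsp:
  assumes "subsp W (free_dg S m e d D)" "\<And>w. w \<in> keys p \<Longrightarrow> f w \<in> W"
  shows "pext f p \<in> W"
  unfolding pext_def by (rule subsp_free_sum[OF assms(1)]) (use assms in \<open>auto simp: subsp_free_iff\<close>)

lemma vspan_free_basis:
  assumes "T \<subseteq> S"
  shows "vspan (free_dg S m e d D) {single w 1 | w. w \<in> T} = {p. keys p \<subseteq> T}"
    (is "vspan ?V ?A = _")
proof
  have A: "?A \<subseteq> carrier ?V" using assms by auto
  show "{p. keys p \<subseteq> T} \<subseteq> vspan ?V ?A"
    using free_in_subsp[OF vspan_subsp[OF vsp_free A]] vspan_base[of _ ?A ?V] by blast
  have "subsp {p. keys p \<subseteq> T} ?V"
    by (rule subsp_keys[OF assms])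
  then show "vspan ?V ?A \<subseteq> {p. keys p \<subseteq> T}"
    by (rule vspan_least) auto
qed

lemma lin_pext:
  assumes "\<And>w. w \<in> S \<Longrightarrow> keys (f w) \<subseteq> S'"
  shows "lin (free_dg S m e d D) (free_dg S' m' e' d' D') (pext f)"
proof (rule linI[OF vsp_free vsp_free]; unfold free_dg_simps mem_Collect_eq)
  show "keys (pext f p) \<subseteq> S'" if "keys p \<subseteq> S" for p
    by (rule keys_pext_sub) (use assms that in blast)
qed (simp_all add: pext_add pext_psc)

lemma lin_free_eq:
  assumes "lin (free_dg S m e d D) V f" "lin (free_dg S m e d D) V h"
    and "\<And>w. w \<in> keys p \<Longrightarrow> f (single w 1) = h (single w 1)"
    and "keys p \<subseteq> S"
  shows "f p = h p"
proof (rule lin_eq_on_vspan[OF assms(1,2), of "{single w 1 | w. w \<in> keys p}"])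
  show "p \<in> vspan (free_dg S m e d D) {single w 1 | w. w \<in> keys p}"
    unfolding vspan_free_basis[OF assms(4)] by simp
qed (use assms in auto)

subsection \<open>Linear extension to an arbitrary vector space\<close>

lemma lext_superset:
  assumes V: "vsp V" and "finite A" "keys p \<subseteq> A" "\<And>w. w \<in> A \<Longrightarrow> f w \<in> carrier V"
  shows "lext V f p = (\<Oplus>\<^bsub>V\<^esub>w\<in>A. lookup p w \<odot>\<^bsub>V\<^esub> f w)"
proof -
  interpret M: module real_ring V by (rule V)
  show ?thesis
    unfolding lext_def using assms
    by (intro M.add.finprod_mono_neutral_cong_left) (auto simp: in_keys_iff vsp_null[OF V] vsp_smult[OF V])
qed

lemma lin_lext:
  assumes V: "vsp V" and f: "\<And>w. w \<in> S \<Longrightarrow> f w \<in> carrier V"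
  shows "lin (free_dg S m e d D) V (lext V f)"
proof (rule linI[OF vsp_free V]; (unfold free_dg_simps mem_Collect_eq)?)
  interpret M: module real_ring V by (rule V)
  note VS = vsp_simps[OF V]
  show "lext V f p \<in> carrier V" if "keys p \<subseteq> S" for p
    unfolding lext_def using f that VS by (intro M.finsum_closed) auto
  show "lext V f (p + q) = lext V f p \<oplus>\<^bsub>V\<^esub> lext V f q" if p: "keys p \<subseteq> S" and q: "keys q \<subseteq> S" for p q
  proof -
    let ?A = "keys p \<union> keys q"
    have A: "\<And>w. w \<in> ?A \<Longrightarrow> f w \<in> carrier V" using f p q by blast
    have "lext V f (p + q) = (\<Oplus>\<^bsub>V\<^esub>w\<in>?A. lookup (p + q) w \<odot>\<^bsub>V\<^esub> f w)"
      by (rule lext_superset[OF V]) (use A keys_add[of p q] in auto)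
    also have "\<dots> = (\<Oplus>\<^bsub>V\<^esub>w\<in>?A. lookup p w \<odot>\<^bsub>V\<^esub> f w \<oplus>\<^bsub>V\<^esub> lookup q w \<odot>\<^bsub>V\<^esub> f w)"
      by (rule M.finsum_cong') (use A VS in \<open>auto simp: lookup_add\<close>)
    also have "\<dots> = (\<Oplus>\<^bsub>V\<^esub>w\<in>?A. lookup p w \<odot>\<^bsub>V\<^esub> f w) \<oplus>\<^bsub>V\<^esub> (\<Oplus>\<^bsub>V\<^esub>w\<in>?A. lookup q w \<odot>\<^bsub>V\<^esub> f w)"
      by (rule M.finsum_addf) (use A VS in auto)
    also have "(\<Oplus>\<^bsub>V\<^esub>w\<in>?A. lookup p w \<odot>\<^bsub>V\<^esub> f w) = lext V f p"
      by (rule lext_superset[OF V, symmetric]) (use A in auto)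
    also have "(\<Oplus>\<^bsub>V\<^esub>w\<in>?A. lookup q w \<odot>\<^bsub>V\<^esub> f w) = lext V f q"
      by (rule lext_superset[OF V, symmetric]) (use A in auto)
    finally show ?thesis .
  qed
  show "lext V f (psc c p) = c \<odot>\<^bsub>V\<^esub> lext V f p" if p: "keys p \<subseteq> S" for c p
  proof -
    have A: "\<And>w. w \<in> keys p \<Longrightarrow> f w \<in> carrier V" using f p by blast
    have "lext V f (psc c p) = (\<Oplus>\<^bsub>V\<^esub>w\<in>keys p. lookup (psc c p) w \<odot>\<^bsub>V\<^esub> f w)"
      by (rule lext_superset[OF V]) (use A keys_psc[of c p] in auto)
    also have "\<dots> = (\<Oplus>\<^bsub>V\<^esub>w\<in>keys p. c \<odot>\<^bsub>V\<^esub> (lookup p w \<odot>\<^bsub>V\<^esub> f w))"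
      by (rule M.finsum_cong') (use A VS in auto)
    also have "\<dots> = c \<odot>\<^bsub>V\<^esub> lext V f p"
      unfolding lext_def using A VS by (subst M.finsum_smult_ldistr) auto
    finally show ?thesis .
  qed
qed

lemma lext_single:
  assumes "vsp V" "f w \<in> carrier V"
  shows "lext V f (single w c) = c \<odot>\<^bsub>V\<^esub> f w"
proof -
  interpret M: module real_ring V by (rule assms(1))
  show ?thesis
    using lext_superset[OF assms(1), of "{w}" "single w c" f] assms(2)
    by (simp add: vsp_smult[OF assms(1)])
qed

lemma lext_zero: "vsp V \<Longrightarrow> lext V f 0 = \<zero>\<^bsub>V\<^esub>"
  by (subst lext_superset[of V "{}"]) (simp_all add: abelian_monoid.finsum_empty module_def abelian_group_def)

lemma lext_in_subsp:
  assumes "vsp V" "subsp W V" "\<And>w. w \<in> keys p \<Longrightarrow> f w \<in> W"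
  shows "lext V f p \<in> W"
proof -
  have c: "\<And>w. w \<in> keys p \<Longrightarrow> f w \<in> carrier V" using assms subsp_sub by blast
  have 1: "lin (free_dg (keys p) (\<lambda>_ _. 0) 0 (\<lambda>_. 0) (\<lambda>_. 0)) V (lext V f)" (is "lin ?F _ _")
    by (rule lin_lext[OF assms(1) c])
  show ?thesis
  proof (rule lin_vspan_into[OF 1 _ assms(2)])
    show "p \<in> vspan ?F {single w 1 | w. w \<in> keys p}"
      by (subst vspan_free_basis) auto
  qed (use c assms in \<open>auto simp: lext_single vsp_one\<close>)
qed

lemma lin_lext_comp:
  assumes f: "lin V W f" and h: "\<And>w. w \<in> keys p \<Longrightarrow> h w \<in> carrier V"
  shows "f (lext V h p) = lext W (\<lambda>w. f (h w)) p"
proof -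
  let ?F = "free_dg (keys p) (\<lambda>_ _. 0) 0 (\<lambda>_. 0) (\<lambda>_. 0)"
  have 1: "lin ?F W (\<lambda>p. f (lext V h p))" by (rule lin_compose[OF lin_lext[OF lin_dom[OF f] h] f])
  have 2: "lin ?F W (lext W (\<lambda>w. f (h w)))" by (rule lin_lext[OF lin_cod[OF f] lin_in[OF f h]])
  show ?thesis
    by (rule lin_free_eq[OF 1 2])
      (simp_all add: lext_single linD[OF f] h vsp_one)
qed

lemma lext_pext:
  assumes V: "vsp V" and f: "\<And>w. w \<in> S \<Longrightarrow> f w \<in> carrier V"
    and h: "\<And>w. w \<in> keys p \<Longrightarrow> keys (h w) \<subseteq> S"
  shows "lext V f (pext h p) = lext V (\<lambda>w. lext V f (h w)) p"
proof -
  let ?F = "\<lambda>S. free_dg S (\<lambda>_ _. 0) 0 (\<lambda>_. 0) (\<lambda>_. 0)"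
  note L = lin_lext[OF V f, of S]
  have 1: "lin (?F (keys p)) V (\<lambda>p. lext V f (pext h p))"
    by (rule lin_compose[OF lin_pext L]) (use h in auto)
  have c: "\<And>w. w \<in> keys p \<Longrightarrow> lext V f (h w) \<in> carrier V"
    using lin_in[OF L] h by auto
  have 2: "lin (?F (keys p)) V (lext V (\<lambda>w. lext V f (h w)))" by (rule lin_lext[OF V c])
  show ?thesis
    by (rule lin_free_eq[OF 1 2]) (simp_all add: lext_single[OF V] c vsp_one[OF V])
qed

lemma lext_cong:
  assumes "vsp V" "\<And>w. w \<in> keys p \<Longrightarrow> f w = h w" "\<And>w. w \<in> keys p \<Longrightarrow> h w \<in> carrier V"
  shows "lext V f p = lext V h p"
proof -
  interpret M: module real_ring V by (rule assms(1))
  show ?thesis unfolding lext_def using assms vsp_smult[OF assms(1)] by (intro M.finsum_cong') auto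
qed

section \<open>Algebras and their quotients\<close>

text \<open>A bilinear product, possibly not associative: the instances include brackets and the algebra of bracketed words
that covers a free Lie algebra.\<close>

definition valg :: "('a, 'm) dg_scheme \<Rightarrow> bool" where
  "valg V \<longleftrightarrow> vsp V \<and> (\<forall>x\<in>carrier V. \<forall>y\<in>carrier V. x \<otimes>\<^bsub>V\<^esub> y \<in> carrier V \<and>
     (\<forall>z\<in>carrier V. (x \<oplus>\<^bsub>V\<^esub> y) \<otimes>\<^bsub>V\<^esub> z = (x \<otimes>\<^bsub>V\<^esub> z) \<oplus>\<^bsub>V\<^esub> (y \<otimes>\<^bsub>V\<^esub> z) \<and>
        z \<otimes>\<^bsub>V\<^esub> (x \<oplus>\<^bsub>V\<^esub> y) = (z \<otimes>\<^bsub>V\<^esub> x) \<oplus>\<^bsub>V\<^esub> (z \<otimes>\<^bsub>V\<^esub> y)) \<and>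
     (\<forall>c. (c \<odot>\<^bsub>V\<^esub> x) \<otimes>\<^bsub>V\<^esub> y = c \<odot>\<^bsub>V\<^esub> (x \<otimes>\<^bsub>V\<^esub> y) \<and> x \<otimes>\<^bsub>V\<^esub> (c \<odot>\<^bsub>V\<^esub> y) = c \<odot>\<^bsub>V\<^esub> (x \<otimes>\<^bsub>V\<^esub> y)))"

lemma valgD:
  assumes "valg V"
  shows valg_vsp: "vsp V"
    and valg_mult: "\<And>x y. x \<in> carrier V \<Longrightarrow> y \<in> carrier V \<Longrightarrow> x \<otimes>\<^bsub>V\<^esub> y \<in> carrier V"
    and valg_distl: "\<And>x y z. x \<in> carrier V \<Longrightarrow> y \<in> carrier V \<Longrightarrow> z \<in> carrier V \<Longrightarrow>
        (x \<oplus>\<^bsub>V\<^esub> y) \<otimes>\<^bsub>V\<^esub> z = (x \<otimes>\<^bsub>V\<^esub> z) \<oplus>\<^bsub>V\<^esub> (y \<otimes>\<^bsub>V\<^esub> z)"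
    and valg_distr: "\<And>x y z. x \<in> carrier V \<Longrightarrow> y \<in> carrier V \<Longrightarrow> z \<in> carrier V \<Longrightarrow>
        z \<otimes>\<^bsub>V\<^esub> (x \<oplus>\<^bsub>V\<^esub> y) = (z \<otimes>\<^bsub>V\<^esub> x) \<oplus>\<^bsub>V\<^esub> (z \<otimes>\<^bsub>V\<^esub> y)"
    and valg_smultl: "\<And>c x y. x \<in> carrier V \<Longrightarrow> y \<in> carrier V \<Longrightarrow> (c \<odot>\<^bsub>V\<^esub> x) \<otimes>\<^bsub>V\<^esub> y = c \<odot>\<^bsub>V\<^esub> (x \<otimes>\<^bsub>V\<^esub> y)"
    and valg_smultr: "\<And>c x y. x \<in> carrier V \<Longrightarrow> y \<in> carrier V \<Longrightarrow> x \<otimes>\<^bsub>V\<^esub> (c \<odot>\<^bsub>V\<^esub> y) = c \<odot>\<^bsub>V\<^esub> (x \<otimes>\<^bsub>V\<^esub> y)"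
  using assms by (simp_all add: valg_def)

lemma valgI:
  assumes "vsp V"
    and "\<And>x y. x \<in> carrier V \<Longrightarrow> y \<in> carrier V \<Longrightarrow> x \<otimes>\<^bsub>V\<^esub> y \<in> carrier V"
    and "\<And>x y z. x \<in> carrier V \<Longrightarrow> y \<in> carrier V \<Longrightarrow> z \<in> carrier V \<Longrightarrow>
        (x \<oplus>\<^bsub>V\<^esub> y) \<otimes>\<^bsub>V\<^esub> z = (x \<otimes>\<^bsub>V\<^esub> z) \<oplus>\<^bsub>V\<^esub> (y \<otimes>\<^bsub>V\<^esub> z)"
    and "\<And>x y z. x \<in> carrier V \<Longrightarrow> y \<in> carrier V \<Longrightarrow> z \<in> carrier V \<Longrightarrow>
        z \<otimes>\<^bsub>V\<^esub> (x \<oplus>\<^bsub>V\<^esub> y) = (z \<otimes>\<^bsub>V\<^esub> x) \<oplus>\<^bsub>V\<^esub> (z \<otimes>\<^bsub>V\<^esub> y)"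
    and "\<And>c x y. x \<in> carrier V \<Longrightarrow> y \<in> carrier V \<Longrightarrow> (c \<odot>\<^bsub>V\<^esub> x) \<otimes>\<^bsub>V\<^esub> y = c \<odot>\<^bsub>V\<^esub> (x \<otimes>\<^bsub>V\<^esub> y)"
    and "\<And>c x y. x \<in> carrier V \<Longrightarrow> y \<in> carrier V \<Longrightarrow> x \<otimes>\<^bsub>V\<^esub> (c \<odot>\<^bsub>V\<^esub> y) = c \<odot>\<^bsub>V\<^esub> (x \<otimes>\<^bsub>V\<^esub> y)"
  shows "valg V"
  using assms by (simp add: valg_def)

lemma lin_mult_left: "valg V \<Longrightarrow> z \<in> carrier V \<Longrightarrow> lin V V (\<lambda>x. z \<otimes>\<^bsub>V\<^esub> x)"
  by (rule linI) (simp_all add: valgD)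

lemma lin_mult_right: "valg V \<Longrightarrow> z \<in> carrier V \<Longrightarrow> lin V V (\<lambda>x. x \<otimes>\<^bsub>V\<^esub> z)"
  by (rule linI) (simp_all add: valgD)

lemma valg_zero:
  assumes "valg V" "x \<in> carrier V"
  shows "\<zero>\<^bsub>V\<^esub> \<otimes>\<^bsub>V\<^esub> x = \<zero>\<^bsub>V\<^esub>" "x \<otimes>\<^bsub>V\<^esub> \<zero>\<^bsub>V\<^esub> = \<zero>\<^bsub>V\<^esub>"
  using lin_zero[OF lin_mult_left[OF assms]] lin_zero[OF lin_mult_right[OF assms]] by auto

definition videal :: "'a set \<Rightarrow> ('a, 'm) dg_scheme \<Rightarrow> bool" where
  "videal N V \<longleftrightarrow> subsp N V \<and> (\<forall>n\<in>N. \<forall>x\<in>carrier V. x \<otimes>\<^bsub>V\<^esub> n \<in> N \<and> n \<otimes>\<^bsub>V\<^esub> x \<in> N)"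

lemma videalD:
  assumes "videal N V"
  shows "subsp N V" "\<And>n x. n \<in> N \<Longrightarrow> x \<in> carrier V \<Longrightarrow> x \<otimes>\<^bsub>V\<^esub> n \<in> N"
    "\<And>n x. n \<in> N \<Longrightarrow> x \<in> carrier V \<Longrightarrow> n \<otimes>\<^bsub>V\<^esub> x \<in> N"
  using assms by (auto simp: videal_def)

text \<open>In a quotient the product of two cosets is the union over all representatives.  All products of
representatives lie in one coset, because \<open>(n + x)(m + y) - xy = n(m + y) + xm\<close> is in the ideal.\<close>

lemma quot_mult:
  assumes V: "valg V" and N: "videal N V" and x: "x \<in> carrier V" and y: "y \<in> carrier V"
  shows "(N +>\<^bsub>V\<^esub> x) \<otimes>\<^bsub>quot V N\<^esub> (N +>\<^bsub>V\<^esub> y) = N +>\<^bsub>V\<^esub> (x \<otimes>\<^bsub>V\<^esub> y)"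
proof -
  note VV = valg_vsp[OF V] and ND = videalD[OF N]
  have eq: "N +>\<^bsub>V\<^esub> ((n \<oplus>\<^bsub>V\<^esub> x) \<otimes>\<^bsub>V\<^esub> (m \<oplus>\<^bsub>V\<^esub> y)) = N +>\<^bsub>V\<^esub> (x \<otimes>\<^bsub>V\<^esub> y)" if n: "n \<in> N" and m: "m \<in> N" for n m
  proof -
    have nc: "n \<in> carrier V" "m \<in> carrier V" using subsp_sub[OF VV ND(1)] n m by auto
    let ?k = "n \<otimes>\<^bsub>V\<^esub> (m \<oplus>\<^bsub>V\<^esub> y) \<oplus>\<^bsub>V\<^esub> x \<otimes>\<^bsub>V\<^esub> m"
    have k: "?k \<in> N"
      by (intro subsp_add[OF VV ND(1)] ND(2,3) n m x vsp_add[OF VV] nc y)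
    have "(n \<oplus>\<^bsub>V\<^esub> x) \<otimes>\<^bsub>V\<^esub> (m \<oplus>\<^bsub>V\<^esub> y) = n \<otimes>\<^bsub>V\<^esub> (m \<oplus>\<^bsub>V\<^esub> y) \<oplus>\<^bsub>V\<^esub> (x \<otimes>\<^bsub>V\<^esub> m \<oplus>\<^bsub>V\<^esub> x \<otimes>\<^bsub>V\<^esub> y)"
      using nc x y by (simp add: valg_distl[OF V] valg_distr[OF V, of m y x] vsp_add[OF VV])
    also have "\<dots> = ?k \<oplus>\<^bsub>V\<^esub> x \<otimes>\<^bsub>V\<^esub> y"
      using nc x y by (simp add: vsp_assoc[OF VV] valg_mult[OF V] vsp_add[OF VV])
    finally show ?thesis using coset_mem[OF VV ND(1) k valg_mult[OF V x y]] by simp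
  qed
  have "(N +>\<^bsub>V\<^esub> x) \<otimes>\<^bsub>quot V N\<^esub> (N +>\<^bsub>V\<^esub> y) = (\<Union>n\<in>N. \<Union>m\<in>N. N +>\<^bsub>V\<^esub> ((n \<oplus>\<^bsub>V\<^esub> x) \<otimes>\<^bsub>V\<^esub> (m \<oplus>\<^bsub>V\<^esub> y)))"
    unfolding quot_simps coset_eq[of V N x] coset_eq[of V N y] by blast
  also have "\<dots> = (\<Union>n\<in>N. \<Union>m\<in>N. N +>\<^bsub>V\<^esub> (x \<otimes>\<^bsub>V\<^esub> y))" by (simp add: eq)
  also have "\<dots> = N +>\<^bsub>V\<^esub> (x \<otimes>\<^bsub>V\<^esub> y)" using subsp_zero[OF VV ND(1)] by auto
  finally show ?thesis .
qed

lemma valg_quot: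
  assumes V: "valg V" and N: "videal N V"
  shows "valg (quot V N)"
proof -
  note VV = valg_vsp[OF V] and NN = videalD(1)[OF N]
  note r = quot_mult[OF V N] quot_smult[OF VV NN] quot_simps(3) coset_add[OF VV NN]
    valgD[OF V] vsp_add[OF VV] vsp_smult[OF VV]
  show ?thesis
    unfolding valg_def quot_simps(1) by (auto simp: r vsp_quot[OF VV NN])
qed

definition ualg :: "('a, 'm) dg_scheme \<Rightarrow> bool" where
  "ualg V \<longleftrightarrow> valg V \<and> \<one>\<^bsub>V\<^esub> \<in> carrier V \<and>
     (\<forall>x\<in>carrier V. \<one>\<^bsub>V\<^esub> \<otimes>\<^bsub>V\<^esub> x = x \<and> x \<otimes>\<^bsub>V\<^esub> \<one>\<^bsub>V\<^esub> = x \<and>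
        (\<forall>y\<in>carrier V. \<forall>z\<in>carrier V. (x \<otimes>\<^bsub>V\<^esub> y) \<otimes>\<^bsub>V\<^esub> z = x \<otimes>\<^bsub>V\<^esub> (y \<otimes>\<^bsub>V\<^esub> z)))"

lemma ualg_valg: "ualg V \<Longrightarrow> valg V"
  by (simp add: ualg_def)

lemma ualg_ring: "ualg V \<Longrightarrow> ring V"
  by (rule ringI)
    (auto simp: ualg_def valg_def module_def intro!: monoidI)

lemma ualg_quot:
  assumes V: "ualg V" and N: "videal N V"
  shows "ualg (quot V N)"
  using valg_quot[OF ualg_valg[OF V] N] V valg_mult[OF ualg_valg[OF V]]
  unfolding ualg_def quot_simps(1,6) by (auto simp: quot_mult[OF ualg_valg[OF V] N])

lemma videal_ideal:
  assumes V: "ualg V" and N: "videal N V"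
  shows "ideal N V"
  using videalD[OF N] by (intro idealI ualg_ring[OF V]) (auto simp: submodule_def)

lemma ideal_videal:
  assumes V: "ualg V" and N: "ideal N V"
  shows "videal N V"
proof -
  interpret ideal N V by fact
  note VV = ualg_valg[OF V] and VS = valg_vsp[OF ualg_valg[OF V]]
  have o: "\<one>\<^bsub>V\<^esub> \<in> carrier V" using V by (simp add: ualg_def)
  have "c \<odot>\<^bsub>V\<^esub> x \<in> N" if "x \<in> N" for c x
  proof -
    have x: "x \<in> carrier V" using that a_subset by auto
    have "c \<odot>\<^bsub>V\<^esub> x = (c \<odot>\<^bsub>V\<^esub> \<one>\<^bsub>V\<^esub>) \<otimes>\<^bsub>V\<^esub> x"
      using x o by (simp add: valgD[OF VV])
    then show ?thesis using I_l_closed[OF that vsp_smult[OF VS o]] by simp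
  qed
  then have "subsp N V"
    using a_subset by (intro subspI[OF VS]) auto
  then show ?thesis using I_l_closed I_r_closed by (simp add: videal_def)
qed

text \<open>Ideals of a quotient come from ideals upstairs; for the enveloping algebra, from ideals of combinations of words.\<close>

lemma videal_quot_image:
  assumes V: "valg V" and N: "videal N V" and I: "videal I V"
  shows "videal ((\<lambda>x. N +>\<^bsub>V\<^esub> x) ` I) (quot V N)"
proof -
  note VV = valg_vsp[OF V] and NN = videalD(1)[OF N] and ID = videalD[OF I]
  have "I \<subseteq> carrier V" by (rule subsp_sub[OF VV ID(1)])
  then show ?thesis
    unfolding videal_def quot_simps(1)
    using lin_image_subsp[OF lin_quot[OF VV NN] ID(1)] ID(2,3)
    by (auto simp: quot_mult[OF V N] subset_iff)
qed

lemma valg_free: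
  assumes "\<And>v w. v \<in> S \<Longrightarrow> w \<in> S \<Longrightarrow> keys (m v w) \<subseteq> S"
  shows "valg (free_dg S m e d D)"
proof (rule valgI[OF vsp_free]; unfold free_dg_simps mem_Collect_eq)
  show "keys (pext (\<lambda>v. pext (m v) q) p) \<subseteq> S"
    if "keys p \<subseteq> S" "keys q \<subseteq> S" for p q
    by (intro keys_pext_sub) (use that assms in blast)
qed (simp_all add: pext_add pext_plus pext_psc pext_const_psc)

lemma foldr_mult_closed:
  "ualg V \<Longrightarrow> set xs \<subseteq> carrier V \<Longrightarrow> foldr (mult V) xs \<one>\<^bsub>V\<^esub> \<in> carrier V"
  by (induction xs) (auto simp: ualg_def valg_mult)

lemma foldr_mult_zero:
  "ualg V \<Longrightarrow> set xs \<subseteq> carrier V \<Longrightarrow> \<zero>\<^bsub>V\<^esub> \<in> set xs \<Longrightarrow> foldr (mult V) xs \<one>\<^bsub>V\<^esub> = \<zero>\<^bsub>V\<^esub>"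
  by (induction xs) (auto simp: valg_zero[OF ualg_valg] foldr_mult_closed)

section \<open>Homogeneous elements and the tensor algebra\<close>

text \<open>The relations of a tensor construction are stated for sums and multiples of homogeneous elements.  Under this
hypothesis they are combinations of words in homogeneous letters.  If one were not, no subspace of the space of
words would contain them all, and their span, then an intersection over an empty family, would be everything.\<close>

definition graded_closed :: "('a, 'm) dg_scheme \<Rightarrow> bool" where
  "graded_closed V \<longleftrightarrow> (\<forall>k. \<forall>x\<in>grade V k. (\<forall>y\<in>grade V k. x \<oplus>\<^bsub>V\<^esub> y \<in> grade V k) \<and> (\<forall>c. c \<odot>\<^bsub>V\<^esub> x \<in> grade V k))"

lemma graded_closedD:
  assumes "graded_closed V"
  shows "\<And>x y k. x \<in> grade V k \<Longrightarrow> y \<in> grade V k \<Longrightarrow> x \<oplus>\<^bsub>V\<^esub> y \<in> grade V k"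
    "\<And>x c k. x \<in> grade V k \<Longrightarrow> c \<odot>\<^bsub>V\<^esub> x \<in> grade V k"
    "\<And>x c. x \<in> homog V \<Longrightarrow> c \<odot>\<^bsub>V\<^esub> x \<in> homog V"
  using assms unfolding graded_closed_def homog_def by blast+

lemma homogI: "x \<in> grade V k \<Longrightarrow> x \<in> homog V"
  by (auto simp: homog_def)

lemma deg_mem: "x \<in> homog V \<Longrightarrow> x \<in> grade V (deg V x)"
  unfolding homog_def deg_def by (auto intro: someI)

lemma wdeg_simps [simp]:
  "wdeg V [] = 0" "wdeg V (x # w) = deg V x + wdeg V w" "wdeg V (u @ v) = wdeg V u + wdeg V v"
  by (simp_all add: wdeg_def)

definition tgens :: "'a dg \<Rightarrow> ('a list \<Rightarrow>\<^sub>0 real) set" where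
  "tgens V = {single (u @ [x \<oplus>\<^bsub>V\<^esub> y] @ v) 1 - single (u @ [x] @ v) 1
         - single (u @ [y] @ v) 1 | u v x y k.
         u \<in> lists (homog V) \<and> v \<in> lists (homog V) \<and> x \<in> grade V k \<and> y \<in> grade V k} \<union>
      {single (u @ [c \<odot>\<^bsub>V\<^esub> x] @ v) 1 - single (u @ [x] @ v) c | u v x c.
         u \<in> lists (homog V) \<and> v \<in> lists (homog V) \<and> x \<in> homog V}"

lemma trel_eq: "trel V = vspan (tword V) (tgens V)"
  by (simp add: trel_def tgens_def)

lemma tgens_cases [consumes 1, case_names add smult]:
  assumes "p \<in> tgens V"
  obtains u v x y k where "u \<in> lists (homog V)" "v \<in> lists (homog V)" "x \<in> grade V k" "y \<in> grade V k"
      "p = single (u @ [x \<oplus>\<^bsub>V\<^esub> y] @ v) 1 - single (u @ [x] @ v) 1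
         - single (u @ [y] @ v) 1"
    | u v x c where "u \<in> lists (homog V)" "v \<in> lists (homog V)" "x \<in> homog V"
      "p = single (u @ [c \<odot>\<^bsub>V\<^esub> x] @ v) 1 - single (u @ [x] @ v) c"
  using assms unfolding tgens_def by fast

lemma tgens_addI:
  "u \<in> lists (homog V) \<Longrightarrow> v \<in> lists (homog V) \<Longrightarrow> x \<in> grade V k \<Longrightarrow> y \<in> grade V k \<Longrightarrow>
    single (u @ [x \<oplus>\<^bsub>V\<^esub> y] @ v) 1 - single (u @ [x] @ v) 1
         - single (u @ [y] @ v) 1 \<in> tgens V"
  unfolding tgens_def by blast

lemma tgens_smultI:
  "u \<in> lists (homog V) \<Longrightarrow> v \<in> lists (homog V) \<Longrightarrow> x \<in> homog V \<Longrightarrow>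
    single (u @ [c \<odot>\<^bsub>V\<^esub> x] @ v) 1 - single (u @ [x] @ v) c \<in> tgens V"
  unfolding tgens_def by blast

lemma tword_simps [simp]:
  "carrier (tword V) = {p. keys p \<subseteq> lists (homog V)}"
  "p \<oplus>\<^bsub>tword V\<^esub> q = p + q" "\<zero>\<^bsub>tword V\<^esub> = 0" "c \<odot>\<^bsub>tword V\<^esub> p = psc c p"
  "p \<otimes>\<^bsub>tword V\<^esub> q = pext (\<lambda>v. pext (\<lambda>w. single (v @ w) 1) q) p"
  "\<one>\<^bsub>tword V\<^esub> = single [] 1"
  "grade (tword V) k = {p. keys p \<subseteq> {w\<in>lists (homog V). wdeg V w = k}}"
  by (simp_all add: tword_def)

lemma vsp_tword: "vsp (tword V)"
  unfolding tword_def by (rule vsp_free)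

lemma subsp_grade_tword: "subsp (grade (tword V) k) (tword V)"
  unfolding tword_def by (rule subsp_grade_free)

lemma valg_tword: "valg (tword V)"
  unfolding tword_def by (rule valg_free) auto

lemma ualg_tword: "ualg (tword V)"
  unfolding ualg_def using valg_tword by (auto simp: pext_pext pext_id)

lemma keys_diff_single:
  "u \<in> S \<Longrightarrow> v \<in> S \<Longrightarrow> keys (single u a - single v b :: 'w \<Rightarrow>\<^sub>0 real) \<subseteq> S"
  by (intro keys_minus_sub) auto

lemma tgens_sub: "graded_closed V \<Longrightarrow> tgens V \<subseteq> carrier (tword V)"
proof
  fix p assume V: "graded_closed V" and p: "p \<in> tgens V"
  note D = graded_closedD[OF V]
  from p show "p \<in> carrier (tword V)"
  proof (cases rule: tgens_cases)
    case (add u v x y k)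
    then have "x \<in> homog V" "y \<in> homog V" "x \<oplus>\<^bsub>V\<^esub> y \<in> homog V" using D(1) homogI by fast+
    then have "keys p \<subseteq> lists (homog V)"
      unfolding add(5) by (intro keys_minus_sub) (use add(1,2) in auto)
    then show ?thesis by simp
  next
    case (smult u v x c)
    then have "keys p \<subseteq> lists (homog V)"
      unfolding smult(4) by (intro keys_minus_sub) (use D(3) in auto)
    then show ?thesis by simp
  qed
qed

lemma subsp_trel: "graded_closed V \<Longrightarrow> subsp (trel V) (tword V)"
  unfolding trel_eq by (rule vspan_subsp[OF vsp_tword tgens_sub])

lemma tgens_trel: "p \<in> tgens V \<Longrightarrow> p \<in> trel V"
  unfolding trel_eq by (rule vspan_base)

lemma lin_pext_tword:
  "(\<And>w. w \<in> lists (homog V) \<Longrightarrow> keys (f w) \<subseteq> lists (homog W)) \<Longrightarrow> lin (tword V) (tword W) (pext f)"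
  unfolding tword_def by (rule lin_pext)

text \<open>To see that a span is a two-sided ideal, it suffices to multiply its generators by single words.\<close>

lemma mult_words_in:
  assumes I: "subsp I (tword V)" "p \<in> I" and G: "I = vspan (tword V) G" "G \<subseteq> carrier (tword V)"
    and l: "\<And>p w. p \<in> G \<Longrightarrow> w \<in> lists (homog V) \<Longrightarrow> pext (\<lambda>v. single (w @ v) 1) p \<in> I"
    and r: "\<And>p w. p \<in> G \<Longrightarrow> w \<in> lists (homog V) \<Longrightarrow> pext (\<lambda>v. single (v @ w) 1) p \<in> I"
    and q: "q \<in> carrier (tword V)"
  shows "q \<otimes>\<^bsub>tword V\<^esub> p \<in> I" "p \<otimes>\<^bsub>tword V\<^esub> q \<in> I"
proof -
  have L: "pext (\<lambda>v. single (w @ v) 1) p \<in> I" "pext (\<lambda>v. single (v @ w) 1) p \<in> I"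
    if w: "w \<in> lists (homog V)" for w
  proof -
    have "lin (tword V) (tword V) (pext (\<lambda>v. single (w @ v) 1))"
      "lin (tword V) (tword V) (pext (\<lambda>v. single (v @ w) 1))"
      by (rule lin_pext_tword; use w in simp)+
    then show "pext (\<lambda>v. single (w @ v) 1) p \<in> I" "pext (\<lambda>v. single (v @ w) 1) p \<in> I"
      using lin_vspan_into[OF _ G(2) I(1) _ I(2)[unfolded G(1)]] l[OF _ w] r[OF _ w] by blast+
  qed
  show "q \<otimes>\<^bsub>tword V\<^esub> p \<in> I"
    unfolding tword_simps by (rule pext_in_subsp[OF I(1)[unfolded tword_def]]) (use L(1) q in auto)
  have "p \<otimes>\<^bsub>tword V\<^esub> q = pext (\<lambda>w. pext (\<lambda>v. single (v @ w) 1) p) q"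
    unfolding tword_simps pext_def psc_sum psc_simps by (subst sum.swap) (simp add: mult.commute)
  also have "\<dots> \<in> I"
    by (rule pext_in_subsp[OF I(1)[unfolded tword_def]]) (use L(2) q in auto)
  finally show "p \<otimes>\<^bsub>tword V\<^esub> q \<in> I" .
qed

lemma tgens_mult:
  assumes "p \<in> tgens V" "w \<in> lists (homog V)"
  shows "pext (\<lambda>v. single (w @ v) 1) p \<in> tgens V \<and>
    pext (\<lambda>v. single (v @ w) 1) p \<in> tgens V"
  using assms(1)
proof (cases rule: tgens_cases)
  case (add u v x y k)
  then show ?thesis
    using tgens_addI[of "w @ u" V v x k y] tgens_addI[of "u" V "v @ w" x k y] assms(2)
    by (simp_all add: pext_diff)
next
  case (smult u v x c)
  then show ?thesis
    using tgens_smultI[of "w @ u" V v x c] tgens_smultI[of "u" V "v @ w" x c] assms(2)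
    by (simp_all add: pext_diff)
qed

lemma videal_trel:
  assumes "graded_closed V"
  shows "videal (trel V) (tword V)"
  unfolding videal_def
  using subsp_trel[OF assms] mult_words_in[OF subsp_trel[OF assms] _ trel_eq tgens_sub[OF assms]]
    tgens_mult[of _ V] tgens_trel[of _ V] by blast

lemma tens_alg_simps [simp]:
  "X \<oplus>\<^bsub>tens_alg V\<^esub> Y = X <+>\<^bsub>tword V\<^esub> Y" "\<zero>\<^bsub>tens_alg V\<^esub> = trel V"
  "carrier (tens_alg V) = tcls V ` {p. keys p \<subseteq> lists (homog V)}"
  "grade (tens_alg V) k = tcls V ` grade (tword V) k"
  "\<one>\<^bsub>tens_alg V\<^esub> = tcls V (single [] 1)"
  by (simp_all only: tens_alg_def quot_simps tcls_def[abs_def] tword_simps)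

lemma ualg_tens: "graded_closed V \<Longrightarrow> ualg (tens_alg V)"
  unfolding tens_alg_def by (rule ualg_quot[OF ualg_tword videal_trel])

lemma tcls_mult:
  "graded_closed V \<Longrightarrow> keys p \<subseteq> lists (homog V) \<Longrightarrow> keys q \<subseteq> lists (homog V) \<Longrightarrow>
    tcls V p \<otimes>\<^bsub>tens_alg V\<^esub> tcls V q = tcls V (p \<otimes>\<^bsub>tword V\<^esub> q)"
  unfolding tens_alg_def tcls_def by (rule quot_mult[OF valg_tword videal_trel]) auto

lemma lin_tcls: "graded_closed V \<Longrightarrow> lin (tword V) (tens_alg V) (tcls V)"
  unfolding tens_alg_def tcls_def[abs_def] by (rule lin_quot[OF vsp_tword subsp_trel])

lemma vsp_tens: "graded_closed V \<Longrightarrow> vsp (tens_alg V)"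
  by (rule lin_cod[OF lin_tcls])

lemma tcls_eq: "tcls V p = {t + p | t. t \<in> trel V}"
  by (simp add: tcls_def coset_eq)

lemma tcls_add:
  assumes "graded_closed V" shows "tcls V p <+>\<^bsub>tword V\<^esub> tcls V q = tcls V (p + q)"
proof -
  note T = subsp_trel[OF assms, unfolded tword_def subsp_free_iff]
  show ?thesis
  proof
    show "tcls V p <+>\<^bsub>tword V\<^esub> tcls V q \<subseteq> tcls V (p + q)"
    proof
      fix r assume "r \<in> tcls V p <+>\<^bsub>tword V\<^esub> tcls V q"
      then obtain s t where "s \<in> trel V" "t \<in> trel V" "r = (s + p) + (t + q)"
        unfolding tcls_eq set_add_eq tword_simps by blast
      then show "r \<in> tcls V (p + q)" using T by (auto simp: tcls_eq algebra_simps intro!: exI[of _ "s + t"])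
    qed
    show "tcls V (p + q) \<subseteq> tcls V p <+>\<^bsub>tword V\<^esub> tcls V q"
    proof
      fix r assume "r \<in> tcls V (p + q)"
      then obtain t where t: "t \<in> trel V" "r = t + (p + q)" by (auto simp: tcls_eq)
      have "0 + q \<in> tcls V q" "t + p \<in> tcls V p" using T t(1) by (auto simp: tcls_eq simp del: add_0)
      moreover have "r = (t + p) + (0 + q)" using t by simp
      ultimately show "r \<in> tcls V p <+>\<^bsub>tword V\<^esub> tcls V q" unfolding set_add_eq tword_simps by blast
    qed
  qed
qed

lemma tcls_cong: "graded_closed V \<Longrightarrow> p - q \<in> trel V \<Longrightarrow> tcls V p = tcls V q"
proof -
  assume V: "graded_closed V" and pq: "p - q \<in> trel V"
  note T = subsp_trel[OF V, unfolded tword_def]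
  have "q - p \<in> trel V" using subsp_free_diff(2)[OF T pq pq] by simp
  have *: "tcls V p \<subseteq> tcls V q" if "p - q \<in> trel V" for p q
  proof
    fix r assume "r \<in> tcls V p"
    then obtain t where t: "t \<in> trel V" "r = t + p" by (auto simp: tcls_eq)
    then have "t + (p - q) \<in> trel V" "r = (t + (p - q)) + q" using T that by (auto simp: subsp_free_iff)
    then show "r \<in> tcls V q" unfolding tcls_eq by blast
  qed
  show ?thesis using *[OF pq] *[OF \<open>q - p \<in> trel V\<close>] by blast
qed

text \<open>The scalar 0 can be moved out of the letter 0.  Hence words with a letter 0, whose degree is an arbitrary
choice, may be added or discarded.\<close>

lemma zero_word_trel:
  assumes V: "vsp V" "graded_closed V" and w: "w \<in> lists (homog V)" "\<zero>\<^bsub>V\<^esub> \<in> set w"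
  shows "single w c \<in> trel V"
proof -
  obtain u v where uv: "w = u @ [\<zero>\<^bsub>V\<^esub>] @ v" using w(2) by (metis append_Cons append_Nil split_list)
  have z: "0 \<odot>\<^bsub>V\<^esub> \<zero>\<^bsub>V\<^esub> = \<zero>\<^bsub>V\<^esub>" using V(1) by (rule vsp_rnull)
  have "single (u @ [0 \<odot>\<^bsub>V\<^esub> \<zero>\<^bsub>V\<^esub>] @ v) 1 - single (u @ [\<zero>\<^bsub>V\<^esub>] @ v) 0 \<in> tgens V"
    by (rule tgens_smultI) (use w uv in auto)
  then have "single w 1 \<in> trel V" by (auto simp: z uv dest: tgens_trel)
  then have "psc c (single w 1) \<in> trel V"
    using subsp_trel[OF V(2)] unfolding tword_def subsp_free_iff by blast
  then show ?thesis by simp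
qed

text \<open>Words have only homogeneous letters, so a map of graded spaces matters on homogeneous elements alone, and there
sums make sense within one degree.\<close>

definition hlin :: "('a, 'm) dg_scheme \<Rightarrow> ('b, 'n) dg_scheme \<Rightarrow> ('a \<Rightarrow> 'b) \<Rightarrow> bool" where
  "hlin V W f \<longleftrightarrow> (\<forall>k. \<forall>x\<in>grade V k. f x \<in> grade W k \<and>
     (\<forall>y\<in>grade V k. f (x \<oplus>\<^bsub>V\<^esub> y) = f x \<oplus>\<^bsub>W\<^esub> f y) \<and> (\<forall>c. f (c \<odot>\<^bsub>V\<^esub> x) = c \<odot>\<^bsub>W\<^esub> f x))"

lemma hlinD:
  assumes "hlin V W f"
  shows "\<And>x k. x \<in> grade V k \<Longrightarrow> f x \<in> grade W k"
    "\<And>x. x \<in> homog V \<Longrightarrow> f x \<in> homog W"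
    "\<And>x y k. x \<in> grade V k \<Longrightarrow> y \<in> grade V k \<Longrightarrow> f (x \<oplus>\<^bsub>V\<^esub> y) = f x \<oplus>\<^bsub>W\<^esub> f y"
    "\<And>x c. x \<in> homog V \<Longrightarrow> f (c \<odot>\<^bsub>V\<^esub> x) = c \<odot>\<^bsub>W\<^esub> f x"
  using assms by (auto simp: hlin_def homog_def)

lemma lists_map_hlin: "hlin V W f \<Longrightarrow> w \<in> lists (homog V) \<Longrightarrow> map f w \<in> lists (homog W)"
  using hlinD(2)[of V W f] by (induction w) auto

lemma lin_tmap_words:
  "hlin V W f \<Longrightarrow> lin (tword V) (tword W) (pext (\<lambda>w. single (map f w) 1))"
  by (rule lin_pext_tword) (auto dest!: lists_map_hlin)

text \<open>A linear map of degree 0, applied to each letter, sends multilinear relations to multilinear relations; this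
is the induced map of tensor algebras on representatives.\<close>

lemma tmap_trel:
  assumes f: "hlin V W f" and V: "graded_closed V" and W: "graded_closed W" and p: "p \<in> trel V"
  shows "pext (\<lambda>w. single (map f w) 1) p \<in> trel W"
proof (rule lin_vspan_into[OF lin_tmap_words[OF f] tgens_sub[OF V] subsp_trel[OF W] _ p[unfolded trel_eq]])
  show "pext (\<lambda>w. single (map f w) 1) ` tgens V \<subseteq> trel W"
  proof safe
    fix p assume "p \<in> tgens V"
    then show "pext (\<lambda>w. single (map f w) 1) p \<in> trel W"
    proof (cases rule: tgens_cases)
      case (add u v x y k)
      then show ?thesis
        using tgens_addI[of "map f u" W "map f v" "f x" k "f y"] lists_map_hlin[OF f] hlinD[OF f]
        by (simp add: pext_diff tgens_trel)
    next
      case (smult u v x c)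
      then show ?thesis
        using tgens_smultI[of "map f u" W "map f v" "f x" c] lists_map_hlin[OF f] hlinD[OF f]
        by (simp add: pext_diff tgens_trel)
    qed
  qed
qed

lemma tmap_tcls:
  assumes f: "hlin V W f" and V: "graded_closed V" and W: "graded_closed W"
  shows "tmap W f (tcls V p) = tcls W (pext (\<lambda>w. single (map f w) 1) p)"
proof -
  note T = subsp_trel[OF W, unfolded tword_def subsp_free_iff] subsp_trel[OF V, unfolded tword_def subsp_free_iff]
  let ?f = "pext (\<lambda>w. single (map f w) 1)"
  have "tcls W (?f (t + p)) = tcls W (?f p)" if "t \<in> trel V" for t
    by (rule tcls_cong[OF W]) (simp add: pext_add tmap_trel[OF f V W that])
  then have "(\<Union>t\<in>trel V. tcls W (?f (t + p))) = tcls W (?f p)" using T(2) by auto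
  moreover have "tmap W f (tcls V p) = (\<Union>t\<in>trel V. tcls W (?f (t + p)))"
    unfolding tmap_def cmap_def tcls_eq[of V p] by (auto simp: tcls_def)
  ultimately show ?thesis by simp
qed

lemma lin_tmap:
  assumes f: "hlin V W f" and V: "graded_closed V" and W: "graded_closed W"
  shows "lin (tens_alg V) (tens_alg W) (tmap W f)"
  unfolding tens_alg_def tmap_def
  by (rule lin_cmap[OF lin_tmap_words[OF f] subsp_trel[OF V] subsp_trel[OF W] tmap_trel[OF f V W]])

section \<open>The enveloping algebra in terms of words\<close>

text \<open>The properties of a graded Lie algebra that place the relations of its enveloping algebra in the space of
words.  Free Lie algebras have them as quotients of a graded non-associative algebra.\<close>

definition glie :: "('a, 'm) dg_scheme \<Rightarrow> bool" where
  "glie h \<longleftrightarrow> vsp h \<and> graded_closed h \<and> (\<forall>k. grade h k \<subseteq> carrier h) \<and>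
     (\<forall>i j. \<forall>x\<in>grade h i. \<forall>y\<in>grade h j. x \<otimes>\<^bsub>h\<^esub> y \<in> grade h (i + j))"

lemma glieD:
  assumes "glie h"
  shows glie_vsp: "vsp h" and glie_closed: "graded_closed h"
    and glie_homog_sub: "homog h \<subseteq> carrier h"
    and glie_mult: "\<And>x y i j. x \<in> grade h i \<Longrightarrow> y \<in> grade h j \<Longrightarrow> x \<otimes>\<^bsub>h\<^esub> y \<in> grade h (i + j)"
    and glie_mult_homog: "\<And>x y. x \<in> homog h \<Longrightarrow> y \<in> homog h \<Longrightarrow> x \<otimes>\<^bsub>h\<^esub> y \<in> homog h"
proof -
  show m: "\<And>x y i j. x \<in> grade h i \<Longrightarrow> y \<in> grade h j \<Longrightarrow> x \<otimes>\<^bsub>h\<^esub> y \<in> grade h (i + j)"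
    using assms unfolding glie_def by blast
  show "x \<otimes>\<^bsub>h\<^esub> y \<in> homog h" if "x \<in> homog h" "y \<in> homog h" for x y
    using m[OF deg_mem[OF that(1)] deg_mem[OF that(2)]] by (rule homogI)
  show "vsp h" "graded_closed h" "homog h \<subseteq> carrier h"
    using assms unfolding glie_def homog_def by blast+
qed

definition ugens :: "'a dg \<Rightarrow> ('a list \<Rightarrow>\<^sub>0 real) set" where
  "ugens h = {single (u @ [x, y] @ v) 1 - single (u @ [y, x] @ v) (sg (deg h x * deg h y))
     - single (u @ [x \<otimes>\<^bsub>h\<^esub> y] @ v) 1 | u v x y.
     u \<in> lists (homog h) \<and> v \<in> lists (homog h) \<and> x \<in> homog h \<and> y \<in> homog h}"

text \<open>The two-sided ideal of relations pulled back to combinations of words.  Since \<open>ugens\<close> contains words on both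
sides of each relation, a linear span is enough.\<close>

definition urels :: "'a dg \<Rightarrow> ('a list \<Rightarrow>\<^sub>0 real) set" where
  "urels h = vspan (tword h) (tgens h \<union> ugens h)"

lemma ugensE:
  assumes "p \<in> ugens h"
  obtains u v x y where "u \<in> lists (homog h)" "v \<in> lists (homog h)" "x \<in> homog h" "y \<in> homog h"
    "p = single (u @ [x, y] @ v) 1 - single (u @ [y, x] @ v) (sg (deg h x * deg h y))
     - single (u @ [x \<otimes>\<^bsub>h\<^esub> y] @ v) 1"
  using assms unfolding ugens_def by fast

lemma ugensI:
  "u \<in> lists (homog h) \<Longrightarrow> v \<in> lists (homog h) \<Longrightarrow> x \<in> homog h \<Longrightarrow> y \<in> homog h \<Longrightarrow>
   single (u @ [x, y] @ v) 1 - single (u @ [y, x] @ v) (sg (deg h x * deg h y))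
     - single (u @ [x \<otimes>\<^bsub>h\<^esub> y] @ v) 1 \<in> ugens h"
  unfolding ugens_def by blast

definition ecls :: "'a dg \<Rightarrow> ('a list \<Rightarrow>\<^sub>0 real) \<Rightarrow> 'a tens set" where
  "ecls h p = urel h +>\<^bsub>tens_alg h\<^esub> tcls h p"

lemma to_env_eq: "to_env h x = ecls h (single [x] 1)"
  by (simp add: to_env_def ecls_def)

lemma env_simps:
  "carrier (env h) = ecls h ` {p. keys p \<subseteq> lists (homog h)}"
  "grade (env h) k = ecls h ` {p. keys p \<subseteq> {w \<in> lists (homog h). wdeg h w = k}}"
  "\<one>\<^bsub>env h\<^esub> = ecls h (single [] 1)"
  by (simp_all add: env_def quot_simps ecls_def image_image)

definition wt_words :: "'a dg \<Rightarrow> (nat \<Rightarrow> 'a set) \<Rightarrow> nat \<Rightarrow> 'a list set" where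
  "wt_words h F n = {w \<in> lists (homog h). \<exists>l. length l = length w \<and> (\<forall>i<length w. w ! i \<in> F (l ! i)) \<and> n \<le> sum_list l}"

lemma tens_span_words:
  assumes V: "graded_closed V" and T: "T \<subseteq> lists (homog V)"
  shows "vspan (tens_alg V) {tcls V (single w 1) | w. w \<in> T} = tcls V ` {p. keys p \<subseteq> T}"
proof -
  have "{tcls V (single w 1) | w. w \<in> T} = tcls V ` {single w 1 | w. w \<in> T}" by auto
  also have "vspan (tens_alg V) \<dots> = tcls V ` vspan (tword V) {single w 1 | w. w \<in> T}"
    by (rule vspan_image[OF lin_tcls[OF V], symmetric]) (use T in auto)
  also have "vspan (tword V) {single w 1 | w. w \<in> T} = {p. keys p \<subseteq> T}"
    unfolding tword_def by (rule vspan_free_basis[OF T])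
  finally show ?thesis .
qed

lemma twt_eq:
  assumes "graded_closed V"
  shows "twt V F n = tcls V ` {p. keys p \<subseteq> wt_words V F n}"
proof -
  have "twt V F n = vspan (tens_alg V) {tcls V (single w 1) | w. w \<in> wt_words V F n}"
    unfolding twt_def wt_words_def by (rule arg_cong[of _ _ "vspan (tens_alg V)"]) auto
  also have "\<dots> = tcls V ` {p. keys p \<subseteq> wt_words V F n}"
    by (rule tens_span_words[OF assms]) (auto simp: wt_words_def)
  finally show ?thesis .
qed

lemma tlen_eq:
  assumes "graded_closed V"
  shows "tlen V n = tcls V ` {p. keys p \<subseteq> {w \<in> lists (homog V). n \<le> length w}}"
proof -
  have "tlen V n = vspan (tens_alg V) {tcls V (single w 1) | w. w \<in> {w \<in> lists (homog V). n \<le> length w}}"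
    unfolding tlen_def by (rule arg_cong[of _ _ "vspan (tens_alg V)"]) auto
  also have "\<dots> = tcls V ` {p. keys p \<subseteq> {w \<in> lists (homog V). n \<le> length w}}"
    by (rule tens_span_words[OF assms]) auto
  finally show ?thesis .
qed

context
  fixes h :: "'a dg"
  assumes h: "glie h"
begin

private lemmas hlD = glieD[OF h]

lemma ugens_sub: "ugens h \<subseteq> carrier (tword h)"
proof
  fix p assume "p \<in> ugens h"
  then obtain u v x y where p: "u \<in> lists (homog h)" "v \<in> lists (homog h)" "x \<in> homog h" "y \<in> homog h"
    "p = single (u @ [x, y] @ v) 1 - single (u @ [y, x] @ v) (sg (deg h x * deg h y))
     - single (u @ [x \<otimes>\<^bsub>h\<^esub> y] @ v) 1" by (rule ugensE)
  have "keys p \<subseteq> lists (homog h)"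
    unfolding p(5) by (intro keys_minus_sub) (use p(1-4) hlD(5) in auto)
  then show "p \<in> carrier (tword h)" by simp
qed

lemma urels_gens_sub: "tgens h \<union> ugens h \<subseteq> carrier (tword h)"
  using ugens_sub tgens_sub[OF hlD(2)] by simp

lemma subsp_urels: "subsp (urels h) (tword h)"
  unfolding urels_def by (rule vspan_subsp[OF vsp_tword urels_gens_sub])

lemma ugens_mult:
  assumes "p \<in> tgens h \<union> ugens h" "w \<in> lists (homog h)"
  shows "pext (\<lambda>v. single (w @ v) 1) p \<in> tgens h \<union> ugens h \<and>
    pext (\<lambda>v. single (v @ w) 1) p \<in> tgens h \<union> ugens h"
proof (cases "p \<in> tgens h")
  case True
  then show ?thesis using tgens_mult assms(2) by blast
next
  case False
  then have "p \<in> ugens h" using assms by simp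
  then obtain u v x y where p: "u \<in> lists (homog h)" "v \<in> lists (homog h)" "x \<in> homog h" "y \<in> homog h"
    "p = single (u @ [x, y] @ v) 1 - single (u @ [y, x] @ v) (sg (deg h x * deg h y))
     - single (u @ [x \<otimes>\<^bsub>h\<^esub> y] @ v) 1" by (rule ugensE)
  have "w @ u \<in> lists (homog h)" "v @ w \<in> lists (homog h)" using p assms(2) by auto
  from ugensI[OF this(1) p(2-4)] ugensI[OF p(1) this(2) p(3,4)] show ?thesis
    unfolding p(5) by (simp add: pext_diff)
qed

lemma videal_urels: "videal (urels h) (tword h)"
proof -
  have gen: "p \<in> urels h" if "p \<in> tgens h \<union> ugens h" for p
    unfolding urels_def by (rule vspan_base[OF that])
  show ?thesis
    unfolding videal_def
    using subsp_urels mult_words_in[OF subsp_urels _ urels_def urels_gens_sub] ugens_mult gen by blast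
qed

lemma trel_sub_urels: "trel h \<subseteq> urels h"
  unfolding trel_eq urels_def by (rule vspan_mono[OF vsp_tword _ urels_gens_sub]) simp

text \<open>Both sides are the smallest ideal that contains the generating relations: the image of \<open>urels\<close> is an ideal
because \<open>urels\<close> is one, and an ideal of the tensor algebra contains all multiples of its generators by words.\<close>

lemma urel_eq: "urel h = tcls h ` urels h"
proof -
  let ?T = "tens_alg h"
  let ?G = "{tcls h (single [x, y] 1 - single [y, x] (sg (deg h x * deg h y))
        - single [x \<otimes>\<^bsub>h\<^esub> y] 1) | x y. x \<in> homog h \<and> y \<in> homog h}"
  note U = ualg_tens[OF hlD(2)]
  interpret R: ring ?T by (rule ualg_ring[OF U])
  have gen: "single [x, y] 1 - single [y, x] (sg (deg h x * deg h y))
        - single [x \<otimes>\<^bsub>h\<^esub> y] 1 \<in> ugens h" if "x \<in> homog h" "y \<in> homog h" for x y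
    using ugensI[of "[]" h "[]"] that by simp
  have Gc: "?G \<subseteq> carrier ?T"
  proof (rule subsetI)
    fix X assume "X \<in> ?G"
    then obtain x y where xy: "x \<in> homog h" "y \<in> homog h"
      and X: "X = tcls h (single [x, y] 1 - single [y, x] (sg (deg h x * deg h y))
        - single [x \<otimes>\<^bsub>h\<^esub> y] 1)" by blast
    show "X \<in> carrier ?T"
      unfolding X tens_alg_simps by (rule imageI) (use subsetD[OF ugens_sub gen[OF xy]] in simp)
  qed
  have I: "ideal (urel h) ?T" unfolding urel_def by (rule R.genideal_ideal[OF Gc])
  have sub: "?G \<subseteq> urel h" unfolding urel_def by (rule R.genideal_self[OF Gc])
  note VI = ideal_videal[OF U I]
  show ?thesis
  proof
    have "videal (tcls h ` urels h) ?T"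
      unfolding tcls_def[abs_def] tens_alg_def
      by (rule videal_quot_image[OF valg_tword videal_trel[OF hlD(2)] videal_urels])
    then have *: "ideal (tcls h ` urels h) ?T" by (rule videal_ideal[OF U])
    show "urel h \<subseteq> tcls h ` urels h"
      unfolding urel_def
    proof (rule R.genideal_minimal[OF *])
      show "?G \<subseteq> tcls h ` urels h"
        using gen by (auto simp: urels_def intro!: imageI vspan_base)
    qed
    show "tcls h ` urels h \<subseteq> urel h"
    proof
      fix X assume "X \<in> tcls h ` urels h"
      then obtain p where p: "p \<in> urels h" "X = tcls h p" by auto
      have "tcls h p \<in> urel h"
      proof (rule lin_vspan_into[OF lin_tcls[OF hlD(2)] urels_gens_sub videalD(1)[OF VI] _ p(1)[unfolded urels_def]])
        show "tcls h ` (tgens h \<union> ugens h) \<subseteq> urel h"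
        proof safe
          fix p assume "p \<in> tgens h"
          then have "tcls h p = tcls h 0" by (intro tcls_cong[OF hlD(2)]) (simp add: tgens_trel)
          also have "\<dots> = \<zero>\<^bsub>?T\<^esub>" by (simp add: tcls_eq)
          finally show "tcls h p \<in> urel h"
            using subsp_zero[OF vsp_tens[OF hlD(2)] videalD(1)[OF VI]] by simp
        next
          fix p assume "p \<in> ugens h"
          then obtain u v x y where p: "u \<in> lists (homog h)" "v \<in> lists (homog h)" "x \<in> homog h" "y \<in> homog h"
            "p = single (u @ [x, y] @ v) 1 - single (u @ [y, x] @ v) (sg (deg h x * deg h y))
             - single (u @ [x \<otimes>\<^bsub>h\<^esub> y] @ v) 1" by (rule ugensE)
          let ?r = "single [x, y] 1 - single [y, x] (sg (deg h x * deg h y))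
             - single [x \<otimes>\<^bsub>h\<^esub> y] 1"
          let ?u = "single u (1::real)" and ?v = "single v (1::real)"
          have k: "keys ?r \<subseteq> lists (homog h)" "keys ?u \<subseteq> lists (homog h)"
            "keys ?v \<subseteq> lists (homog h)" using gen[OF p(3,4)] ugens_sub p(1,2) by auto
          have k2: "keys (?r \<otimes>\<^bsub>tword h\<^esub> ?v) \<subseteq> lists (homog h)"
            using valg_mult[OF valg_tword, of ?r h ?v] k by simp
          have "tcls h ?u \<otimes>\<^bsub>?T\<^esub> (tcls h ?r \<otimes>\<^bsub>?T\<^esub> tcls h ?v) = tcls h (?u \<otimes>\<^bsub>tword h\<^esub> (?r \<otimes>\<^bsub>tword h\<^esub> ?v))"
            by (simp only: tcls_mult[OF hlD(2)] k k2)
          also have "?u \<otimes>\<^bsub>tword h\<^esub> (?r \<otimes>\<^bsub>tword h\<^esub> ?v) = p"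
            unfolding p(5) by (simp add: pext_diff)
          finally have e: "tcls h p = tcls h ?u \<otimes>\<^bsub>?T\<^esub> (tcls h ?r \<otimes>\<^bsub>?T\<^esub> tcls h ?v)" ..
          have "tcls h ?r \<in> urel h" using sub p(3,4) by blast
          moreover have "tcls h ?u \<in> carrier ?T" "tcls h ?v \<in> carrier ?T"
            unfolding tens_alg_simps by (rule imageI, use k in simp)+
          ultimately show "tcls h p \<in> urel h"
            unfolding e by (intro videalD(2,3)[OF VI])
        qed
      qed
      then show "X \<in> urel h" using p by simp
    qed
  qed
qed

lemma videal_urel: "videal (urel h) (tens_alg h)"
  unfolding urel_eq unfolding tcls_def[abs_def] tens_alg_def
  by (rule videal_quot_image[OF valg_tword videal_trel[OF hlD(2)] videal_urels])

lemma ualg_env: "ualg (env h)"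
  unfolding env_def by (rule ualg_quot[OF ualg_tens[OF hlD(2)] videal_urel])

lemma lin_ecls: "lin (tword h) (env h) (ecls h)"
  unfolding env_def ecls_def[abs_def]
  by (rule lin_compose[OF lin_tcls[OF hlD(2)] lin_quot[OF vsp_tens[OF hlD(2)] videalD(1)[OF videal_urel]]])

lemma vsp_env: "vsp (env h)"
  by (rule lin_cod[OF lin_ecls])

lemma ecls_mult:
  assumes "keys p \<subseteq> lists (homog h)" "keys q \<subseteq> lists (homog h)"
  shows "ecls h p \<otimes>\<^bsub>env h\<^esub> ecls h q = ecls h (p \<otimes>\<^bsub>tword h\<^esub> q)"
proof -
  have "tcls h p \<in> carrier (tens_alg h)" "tcls h q \<in> carrier (tens_alg h)" using assms by auto
  then show ?thesis
    unfolding env_def ecls_def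
    by (simp only: quot_mult[OF ualg_valg[OF ualg_tens[OF hlD(2)]] videal_urel] tcls_mult[OF hlD(2) assms])
qed

text \<open>This replaces the two-step quotient (tensor algebra, then enveloping algebra) by a single one.\<close>

lemma ecls_eq_iff:
  assumes p: "keys p \<subseteq> lists (homog h)" and q: "keys q \<subseteq> lists (homog h)"
  shows "ecls h p = ecls h q \<longleftrightarrow> p - q \<in> urels h"
proof -
  note T = vsp_tens[OF hlD(2)] and UI = videalD(1)[OF videal_urel]
  note lt = lin_tcls[OF hlD(2)] and S = subsp_urels[unfolded tword_def]
  note le = linD(3-5)[OF lin_ecls, unfolded tword_simps mem_Collect_eq]
  have pq: "keys (p - q) \<subseteq> lists (homog h)" using p q by (rule keys_minus_sub)
  have mem: "ecls h r = urel h \<longleftrightarrow> r \<in> urels h" if r: "keys r \<subseteq> lists (homog h)" for r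
  proof -
    have rc: "tcls h r \<in> carrier (tens_alg h)" using r by auto
    have "ecls h r = urel h \<longleftrightarrow> tcls h r \<in> urel h"
      unfolding ecls_def by (rule coset_zero_iff[OF T UI rc])
    also have "\<dots> \<longleftrightarrow> r \<in> urels h"
    proof
      assume "tcls h r \<in> urel h"
      then obtain s where s: "s \<in> urels h" "tcls h r = tcls h s" unfolding urel_eq by auto
      have "r \<in> tcls h r" using subsp_trel[OF hlD(2)] by (auto simp: tcls_eq tword_def subsp_free_iff)
      then obtain t where "t \<in> trel h" "r = t + s" unfolding s(2) by (auto simp: tcls_eq)
      then show "r \<in> urels h" using s trel_sub_urels S by (auto simp: subsp_free_iff)
    qed (auto simp: urel_eq)
    finally show ?thesis .
  qed
  have z: "\<zero>\<^bsub>env h\<^esub> = urel h" by (simp add: env_def quot_simps)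
  have e: "ecls h p = ecls h (p - q) \<oplus>\<^bsub>env h\<^esub> ecls h q"
    using le(2)[OF pq q] by simp
  have c: "ecls h (p - q) \<in> carrier (env h)" "ecls h q \<in> carrier (env h)" using le(1) pq q by auto
  have d: "ecls h (p - q) = ecls h p \<oplus>\<^bsub>env h\<^esub> (-1) \<odot>\<^bsub>env h\<^esub> ecls h q"
    using le(2)[OF p, of "psc (-1) q"] le(3)[OF q, of "-1"] keys_psc_sub[OF q, of "-1"] by simp
  show ?thesis
  proof
    assume a: "ecls h p = ecls h q"
    have "ecls h (p - q) = urel h"
      unfolding d a by (simp add: vsp_neg2[OF vsp_env] c z)
    then show "p - q \<in> urels h" using mem[OF pq] by simp
  next
    assume "p - q \<in> urels h"
    then have "ecls h (p - q) = \<zero>\<^bsub>env h\<^esub>" using mem[OF pq] z by simp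
    then show "ecls h p = ecls h q" unfolding e by (simp add: vsp_l_zero[OF vsp_env] c)
  qed
qed

lemma graded_closed_env: "graded_closed (env h)"
proof -
  have *: "subsp (grade (env h) k) (env h)" for k
    using lin_image_subsp[OF lin_ecls subsp_grade_tword]
    unfolding tword_simps env_simps .
  show ?thesis unfolding graded_closed_def using subspD(3,4)[OF vsp_env *] by blast
qed

lemma homog_env_sub: "homog (env h) \<subseteq> carrier (env h)"
  unfolding homog_def env_simps by blast

lemma to_env_homog: "x \<in> homog h \<Longrightarrow> to_env h x \<in> grade (env h) (deg h x)"
  unfolding to_env_eq env_simps by (rule imageI) simp

lemma env_fil_eq: "env_fil h F n = ecls h ` {p. keys p \<subseteq> wt_words h F n}"
  unfolding env_fil_def twt_eq[OF hlD(2)] ecls_def by (simp add: image_image)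

lemma wt_words_sub: "wt_words h F n \<subseteq> lists (homog h)"
  by (auto simp: wt_words_def)

lemma subsp_env_fil: "subsp (env_fil h F n) (env h)"
  unfolding env_fil_eq
  by (rule lin_image_subsp[OF lin_ecls]) (unfold tword_def, rule subsp_keys[OF wt_words_sub])

lemma env_fil_decreasing: "env_fil h F (Suc n) \<subseteq> env_fil h F n"
  unfolding env_fil_eq by (intro image_mono Collect_mono impI) (auto simp: wt_words_def dest!: subsetD dest: Suc_leD)

end

text \<open>Keeps only the words whose degree is determined by their letters.\<close>

definition drop_zero :: "'a dg \<Rightarrow> ('a list \<Rightarrow>\<^sub>0 real) \<Rightarrow> ('a list \<Rightarrow>\<^sub>0 real)" where
  "drop_zero h = pext (\<lambda>w. if \<zero>\<^bsub>h\<^esub> \<in> set w then 0 else single w 1)"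

lemma keys_drop_zero: "keys (drop_zero h p) \<subseteq> {w \<in> keys p. \<zero>\<^bsub>h\<^esub> \<notin> set w}"
  unfolding drop_zero_def by (rule keys_pext_sub) auto

lemma drop_zero_trel:
  assumes "vsp h" "graded_closed h" "keys p \<subseteq> lists (homog h)"
  shows "p - drop_zero h p \<in> trel h"
proof -
  have "p - drop_zero h p = pext (\<lambda>w. single w 1) p - drop_zero h p"
    by (simp add: pext_id)
  also have "\<dots> = pext (\<lambda>w. single w 1 + psc (-1) (if \<zero>\<^bsub>h\<^esub> \<in> set w then 0 else single w 1)) p"
    unfolding pext_plus pext_const_psc drop_zero_def by simp
  also have "\<dots> \<in> trel h"
  proof (rule pext_in_subsp[OF subsp_trel[OF assms(2), unfolded tword_def]])
    fix w assume "w \<in> keys p"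
    then have "w \<in> lists (homog h)" using assms(3) by auto
    then show "single w 1 + psc (-1) (if \<zero>\<^bsub>h\<^esub> \<in> set w then 0 else single w 1) \<in> trel h"
      using zero_word_trel[OF assms(1,2), of w 1] subsp_trel[OF assms(2)]
      by (auto simp: tword_def subsp_free_iff)
  qed
  finally show ?thesis .
qed

lemma ecls_drop_zero:
  assumes "glie h" "keys p \<subseteq> lists (homog h)"
  shows "ecls h (drop_zero h p) = ecls h p"
proof -
  have "p - drop_zero h p \<in> urels h"
    using drop_zero_trel[OF glieD(1,2)[OF assms(1)] assms(2)] trel_sub_urels[OF assms(1)] by auto
  then show ?thesis
    using ecls_eq_iff[OF assms(1,2), of "drop_zero h p"] keys_drop_zero[of h p] assms(2) by auto
qed

subsection \<open>Degrees\<close>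

text \<open>The element 0 is exempt because it lies in every component.\<close>

definition deg_unique :: "('a, 'm) dg_scheme \<Rightarrow> bool" where
  "deg_unique h \<longleftrightarrow> (\<forall>x i j. x \<in> grade h i \<longrightarrow> x \<in> grade h j \<longrightarrow> x \<noteq> \<zero>\<^bsub>h\<^esub> \<longrightarrow> i = j)"

lemma deg_eq: "deg_unique h \<Longrightarrow> x \<in> grade h k \<Longrightarrow> x \<noteq> \<zero>\<^bsub>h\<^esub> \<Longrightarrow> deg h x = k"
  using deg_mem[OF homogI, of x h k] by (auto simp: deg_unique_def)

definition deg_part :: "'a dg \<Rightarrow> int \<Rightarrow> ('a list \<Rightarrow>\<^sub>0 real) \<Rightarrow> ('a list \<Rightarrow>\<^sub>0 real)" where
  "deg_part h k = pext (\<lambda>w. if wdeg h w = k then single w 1 else 0)"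

lemma keys_deg_part: "keys (deg_part h k p) \<subseteq> {w \<in> keys p. wdeg h w = k}"
  unfolding deg_part_def by (rule keys_pext_sub) auto

lemma deg_part_id:
  assumes "keys p \<subseteq> {w. wdeg h w = k}"
  shows "deg_part h k p = p"
proof -
  have "deg_part h k p = pext (\<lambda>w. single w 1) p"
    unfolding deg_part_def by (rule pext_cong) (use assms in auto)
  then show ?thesis by (simp add: pext_id)
qed

lemma deg_part_zero: "keys p \<subseteq> {w. wdeg h w = i} \<Longrightarrow> i \<noteq> j \<Longrightarrow> deg_part h j p = 0"
  unfolding deg_part_def by (rule pext_zero_fun) auto

context
  fixes g :: "'a dg"
  assumes g: "glie g" "valg g" "deg_unique g"
begin

private lemmas glD = glieD[OF g(1)]

text \<open>Each generating relation is homogeneous of some degree, up to words with a letter 0, which are relations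
themselves; its part of degree \<open>k\<close> is thus congruent to the relation or to 0.\<close>

lemma deg_part_urels:
  assumes p: "p \<in> urels g"
  shows "deg_part g k p \<in> urels g"
proof -
  note S = subsp_urels[OF g(1), unfolded tword_def]
  have hom: "deg_part g k p \<in> urels g"
    if p: "p \<in> urels g" and d: "keys p \<subseteq> {w \<in> lists (homog g). \<zero>\<^bsub>g\<^esub> \<in> set w \<or> wdeg g w = d}" for p d
  proof -
    let ?c = "if d = k then 1 else 0 :: real"
    let ?f = "\<lambda>w. if wdeg g w = k then single w 1 else 0"
    have "deg_part g k p - psc ?c p = deg_part g k p - psc ?c (pext (\<lambda>w. single w 1) p)"
      by (simp add: pext_id)
    also have "\<dots> = pext (\<lambda>w. ?f w + psc (- ?c) (single w 1)) p"
      unfolding pext_plus pext_const_psc deg_part_def by simp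
    also have "\<dots> \<in> urels g"
    proof (rule pext_in_subsp[OF S])
      fix w assume "w \<in> keys p"
      then have w: "w \<in> lists (homog g)" "\<zero>\<^bsub>g\<^esub> \<in> set w \<or> wdeg g w = d" using d by auto
      have 0: "single w 1 \<in> urels g" if "\<zero>\<^bsub>g\<^esub> \<in> set w"
        using zero_word_trel[OF glD(1,2) w(1) that] trel_sub_urels[OF g(1)] by auto
      show "?f w + psc (- ?c) (single w 1) \<in> urels g"
        using w(2) 0 S subsp_free_diff[OF S, OF 0 0]
        by (cases "\<zero>\<^bsub>g\<^esub> \<in> set w") (auto simp: subsp_free_iff simp flip: single_uminus single_add)
    qed
    finally have "deg_part g k p - psc ?c p \<in> urels g" .
    moreover have "psc ?c p \<in> urels g" using S p by (auto simp only: subsp_free_iff)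
    ultimately have "deg_part g k p - psc ?c p + psc ?c p \<in> urels g"
      using S by (auto simp only: subsp_free_iff)
    then show ?thesis by simp
  qed
  have lin: "lin (tword g) (tword g) (deg_part g k)"
    unfolding deg_part_def by (rule lin_pext_tword) auto
  show ?thesis
  proof (rule lin_vspan_into[OF lin urels_gens_sub[OF g(1)] subsp_urels[OF g(1)] _ p[unfolded urels_def]])
    show "deg_part g k ` (tgens g \<union> ugens g) \<subseteq> urels g"
    proof (rule image_subsetI)
      fix p assume p: "p \<in> tgens g \<union> ugens g"
      then have pu: "p \<in> urels g" unfolding urels_def by (rule vspan_base)
      have pc: "keys p \<subseteq> lists (homog g)" using urels_gens_sub[OF g(1)] p by auto
      \<comment> \<open>The results of the operations in a relation may be 0, and then their degree is not the expected one.\<close>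
      have "\<exists>d. keys p \<subseteq> {w. \<zero>\<^bsub>g\<^esub> \<in> set w \<or> wdeg g w = d}"
      proof (cases "p \<in> tgens g")
        case True
        then show ?thesis
        proof (cases rule: tgens_cases)
          case (add u v x y j)
          have "x \<oplus>\<^bsub>g\<^esub> y \<in> grade g j" using graded_closedD(1)[OF glD(2)] add by blast
          then have "keys p \<subseteq> {w. \<zero>\<^bsub>g\<^esub> \<in> set w \<or> wdeg g w = wdeg g u + (j + wdeg g v)}"
            unfolding add(5) by (intro keys_minus_sub) (use add(3,4) deg_eq[OF g(3)] in auto)
          then show ?thesis by blast
        next
          case (smult u v x c)
          have "c \<odot>\<^bsub>g\<^esub> x \<in> grade g (deg g x)" using graded_closedD(2)[OF glD(2)] deg_mem[OF smult(3)] by blast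
          then have "keys p \<subseteq> {w. \<zero>\<^bsub>g\<^esub> \<in> set w \<or> wdeg g w = wdeg g u + (deg g x + wdeg g v)}"
            unfolding smult(4) by (intro keys_minus_sub) (use deg_eq[OF g(3)] in auto)
          then show ?thesis by blast
        qed
      next
        case False
        then have "p \<in> ugens g" using p by simp
        then obtain u v x y where p: "u \<in> lists (homog g)" "v \<in> lists (homog g)" "x \<in> homog g" "y \<in> homog g"
          "p = single (u @ [x, y] @ v) 1 - single (u @ [y, x] @ v) (sg (deg g x * deg g y))
           - single (u @ [x \<otimes>\<^bsub>g\<^esub> y] @ v) 1" by (rule ugensE)
        have "x \<otimes>\<^bsub>g\<^esub> y \<in> grade g (deg g x + deg g y)" by (rule glD(4)[OF deg_mem[OF p(3)] deg_mem[OF p(4)]])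
        then have "keys p \<subseteq> {w. \<zero>\<^bsub>g\<^esub> \<in> set w \<or> wdeg g w = wdeg g u + (deg g x + (deg g y + wdeg g v))}"
          unfolding p(5) by (intro keys_minus_sub) (use deg_eq[OF g(3)] in auto)
        then show ?thesis by blast
      qed
      then obtain d where "keys p \<subseteq> {w. \<zero>\<^bsub>g\<^esub> \<in> set w \<or> wdeg g w = d}" ..
      then have "keys p \<subseteq> {w \<in> lists (homog g). \<zero>\<^bsub>g\<^esub> \<in> set w \<or> wdeg g w = d}"
        using pc by blast
      then show "deg_part g k p \<in> urels g" by (rule hom[OF pu])
    qed
  qed
qed

text \<open>An element of degree \<open>k\<close> has a representative in degree \<open>k\<close>; by homogeneity of the relations, projecting any other representative gives one as well.\<close>

lemma ecls_deg_part:
  assumes p: "keys p \<subseteq> lists (homog g)" and e: "ecls g p \<in> grade (env g) k"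
  shows "ecls g (deg_part g k p) = ecls g p"
proof -
  obtain q where q: "keys q \<subseteq> {w \<in> lists (homog g). wdeg g w = k}" "ecls g p = ecls g q"
    using e unfolding env_simps by auto
  have qc: "keys q \<subseteq> lists (homog g)" using q by auto
  have "deg_part g k (p - q) \<in> urels g"
    using q(2) ecls_eq_iff[OF g(1) p qc] deg_part_urels by auto
  moreover have "deg_part g k (p - q) = deg_part g k p - q"
    using deg_part_id[of q g k] q(1) by (auto simp: deg_part_def pext_diff)
  ultimately show ?thesis
    using ecls_eq_iff[OF g(1) _ qc, of "deg_part g k p"] keys_deg_part[of g k p] p q(2) by auto
qed

text \<open>A representative of degree \<open>i\<close> has no part of degree \<open>j\<close>, so an element of both degrees is represented by 0.\<close>

lemma deg_unique_env: "deg_unique (env g)"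
  unfolding deg_unique_def
proof (intro allI impI; rule ccontr)
  fix y i j assume y: "y \<in> grade (env g) i" "y \<in> grade (env g) j" "y \<noteq> \<zero>\<^bsub>env g\<^esub>" and ij: "i \<noteq> j"
  obtain p where p: "keys p \<subseteq> {w \<in> lists (homog g). wdeg g w = i}" "y = ecls g p"
    using y(1) unfolding env_simps by auto
  have "y = ecls g (deg_part g j p)" using ecls_deg_part[of p j] p y(2) by auto
  also have "deg_part g j p = 0" by (rule deg_part_zero[OF _ ij]) (use p in auto)
  also have "ecls g 0 = \<zero>\<^bsub>env g\<^esub>" using lin_zero[OF lin_ecls[OF g(1)]] by simp
  finally show False using y(3) by simp
qed

end

subsection \<open>Functoriality\<close>

text \<open>A morphism of graded Lie algebras and the induced morphism \<open>Uf\<close> of enveloping algebras, computed by \<open>fw\<close> on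
combinations of words.  Unique degrees and a bilinear bracket in the target control the words in which \<open>f\<close> sends
a letter to 0.\<close>

locale env_functor =
  fixes h :: "'a dg" and g :: "'b dg" and f :: "'a \<Rightarrow> 'b"
  assumes h: "glie h" and g: "glie g" "valg g" "deg_unique g" and f: "hlin h g f"
    and f_mult: "\<And>x y. x \<in> homog h \<Longrightarrow> y \<in> homog h \<Longrightarrow> f (x \<otimes>\<^bsub>h\<^esub> y) = f x \<otimes>\<^bsub>g\<^esub> f y"
begin

abbreviation fw :: "('a list \<Rightarrow>\<^sub>0 real) \<Rightarrow> ('b list \<Rightarrow>\<^sub>0 real)" where
  "fw \<equiv> pext (\<lambda>w. single (map f w) 1)"

abbreviation Uf :: "'a tens set \<Rightarrow> 'b tens set" where
  "Uf \<equiv> env_map g f"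

lemmas hD = glieD[OF h] and gD = glieD[OF g(1)] and fD = hlinD[OF f]

lemma fw_in: "keys p \<subseteq> lists (homog h) \<Longrightarrow> keys (fw p) \<subseteq> lists (homog g)"
  using lin_in[OF lin_tmap_words[OF f], of p] by simp

text \<open>The sign in a commutation relation is preserved because \<open>f\<close> preserves the degrees of \<open>x\<close> and \<open>y\<close>, unless
\<open>f x\<close> or \<open>f y\<close> is 0; then so is the bracket, and all three words contain a letter 0.\<close>

lemma fw_urels:
  assumes p: "p \<in> urels h"
  shows "fw p \<in> urels g"
proof (rule lin_vspan_into[OF lin_tmap_words[OF f] urels_gens_sub[OF h] subsp_urels[OF g(1)] _ p[unfolded urels_def]])
  note T = trel_sub_urels[OF g(1)]
  show "fw ` (tgens h \<union> ugens h) \<subseteq> urels g"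
  proof (rule image_subsetI)
    fix p assume p: "p \<in> tgens h \<union> ugens h"
    show "fw p \<in> urels g"
    proof (cases "p \<in> tgens h")
      case True
      then show ?thesis using tmap_trel[OF f hD(2) gD(2) tgens_trel] T by blast
    next
      case False
      then have "p \<in> ugens h" using p by simp
      then obtain u v x y where p: "u \<in> lists (homog h)" "v \<in> lists (homog h)" "x \<in> homog h" "y \<in> homog h"
        "p = single (u @ [x, y] @ v) 1 - single (u @ [y, x] @ v) (sg (deg h x * deg h y))
         - single (u @ [x \<otimes>\<^bsub>h\<^esub> y] @ v) 1" by (rule ugensE)
      note w = lists_map_hlin[OF f p(1)] lists_map_hlin[OF f p(2)] fD(2)[OF p(3)] fD(2)[OF p(4)]
      have fp: "fw p = single (map f u @ [f x, f y] @ map f v) 1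
         - single (map f u @ [f y, f x] @ map f v) (sg (deg h x * deg h y))
         - single (map f u @ [f x \<otimes>\<^bsub>g\<^esub> f y] @ map f v) 1"
        unfolding p(5) using p(3,4) by (simp add: pext_diff f_mult)
      show ?thesis
      proof (cases "f x = \<zero>\<^bsub>g\<^esub> \<or> f y = \<zero>\<^bsub>g\<^esub>")
        case True
        have fc: "f x \<in> carrier g" "f y \<in> carrier g" using w(3,4) gD(3) by auto
        have "f x \<otimes>\<^bsub>g\<^esub> f y = \<zero>\<^bsub>g\<^esub>" using True valg_zero[OF g(2)] fc by auto
        moreover have "single z c \<in> urels g" if "z \<in> lists (homog g)" "\<zero>\<^bsub>g\<^esub> \<in> set z" for z c
          using zero_word_trel[OF gD(1,2) that] T by blast
        moreover have "map f u @ [f x, f y] @ map f v \<in> lists (homog g)" "map f u @ [f y, f x] @ map f v \<in> lists (homog g)"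
          "map f u @ [f x \<otimes>\<^bsub>g\<^esub> f y] @ map f v \<in> lists (homog g)"
          using w gD(5)[OF w(3,4)] by (simp_all del: in_lists_conv_set)
        moreover have "\<zero>\<^bsub>g\<^esub> \<in> set (map f u @ [f x, f y] @ map f v)" "\<zero>\<^bsub>g\<^esub> \<in> set (map f u @ [f y, f x] @ map f v)"
          "\<zero>\<^bsub>g\<^esub> \<in> set (map f u @ [f x \<otimes>\<^bsub>g\<^esub> f y] @ map f v)"
          using True \<open>f x \<otimes>\<^bsub>g\<^esub> f y = \<zero>\<^bsub>g\<^esub>\<close> by auto
        ultimately show ?thesis
          unfolding fp by (intro subsp_free_diff(1)[OF subsp_urels[OF g(1), unfolded tword_def]]) blast+
      next
        case False
        have "deg g (f x) = deg h x" "deg g (f y) = deg h y"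
          using False fD(1)[OF deg_mem[OF p(3)]] fD(1)[OF deg_mem[OF p(4)]] deg_eq[OF g(3)] by auto
        then have "fw p \<in> ugens g" unfolding fp using ugensI[OF w] by simp
        then show ?thesis unfolding urels_def by (intro vspan_base) simp
      qed
    qed
  qed
qed

lemma Uf_ecls:
  assumes "keys p \<subseteq> lists (homog h)"
  shows "Uf (ecls h p) = ecls g (fw p)"
proof -
  note lt = lin_tmap[OF f hD(2) gD(2)] and tt = tmap_tcls[OF f hD(2) gD(2)]
  have "cmap (tens_alg g) (urel g) (tmap g f) (urel h +>\<^bsub>tens_alg h\<^esub> tcls h p) = urel g +>\<^bsub>tens_alg g\<^esub> tmap g f (tcls h p)"
    by (rule cmap_coset[OF lt videalD(1)[OF videal_urel[OF h]] videalD(1)[OF videal_urel[OF g(1)]]])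
      (use fw_urels assms in \<open>auto simp: urel_eq[OF h] urel_eq[OF g(1)] tt\<close>)
  then show ?thesis by (simp add: env_map_def ecls_def tt)
qed

lemma lin_Uf: "lin (env h) (env g) Uf"
  unfolding env_def env_map_def[abs_def]
  by (rule lin_cmap[OF lin_tmap[OF f hD(2) gD(2)] videalD(1)[OF videal_urel[OF h]] videalD(1)[OF videal_urel[OF g(1)]]])
    (use fw_urels in \<open>auto simp: urel_eq[OF h] urel_eq[OF g(1)] tmap_tcls[OF f hD(2) gD(2)]\<close>)

lemma Uf_mult:
  assumes "x \<in> carrier (env h)" "y \<in> carrier (env h)"
  shows "Uf (x \<otimes>\<^bsub>env h\<^esub> y) = Uf x \<otimes>\<^bsub>env g\<^esub> Uf y"
proof -
  obtain p q where pq: "x = ecls h p" "keys p \<subseteq> lists (homog h)" "y = ecls h q" "keys q \<subseteq> lists (homog h)"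
    using assms unfolding env_simps by auto
  have k: "keys (p \<otimes>\<^bsub>tword h\<^esub> q) \<subseteq> lists (homog h)"
    using valg_mult[OF valg_tword, of p h q] pq by simp
  have "fw (p \<otimes>\<^bsub>tword h\<^esub> q) = fw p \<otimes>\<^bsub>tword g\<^esub> fw q"
    by (simp add: pext_pext)
  then show ?thesis
    by (simp only: pq ecls_mult[OF h pq(2,4)] Uf_ecls k ecls_mult[OF g(1) fw_in fw_in])
qed

lemma Uf_one: "Uf \<one>\<^bsub>env h\<^esub> = \<one>\<^bsub>env g\<^esub>"
  unfolding env_simps by (subst Uf_ecls) auto

lemma Uf_foldr:
  "set xs \<subseteq> carrier (env h) \<Longrightarrow> Uf (foldr (mult (env h)) xs \<one>\<^bsub>env h\<^esub>) = foldr (mult (env g)) (map Uf xs) \<one>\<^bsub>env g\<^esub>"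
  by (induction xs) (simp_all add: Uf_one Uf_mult foldr_mult_closed[OF ualg_env[OF h]])

text \<open>A word keeps its degree under \<open>f\<close> as long as no letter becomes 0, and the other words can be dropped.\<close>

lemma Uf_grade:
  assumes "x \<in> grade (env h) k"
  shows "Uf x \<in> grade (env g) k"
proof -
  obtain p where p: "x = ecls h p" "keys p \<subseteq> {w \<in> lists (homog h). wdeg h w = k}"
    using assms unfolding env_simps by auto
  have pc: "keys p \<subseteq> lists (homog h)" using p by auto
  have "Uf x = ecls g (drop_zero g (fw p))"
    unfolding p(1) Uf_ecls[OF pc] by (rule ecls_drop_zero[OF g(1) fw_in[OF pc], symmetric])
  moreover have "keys (drop_zero g (fw p)) \<subseteq> {w \<in> lists (homog g). wdeg g w = k}"
    unfolding drop_zero_def pext_pext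
  proof (rule keys_pext_sub)
    fix w assume "w \<in> keys p"
    then have w: "w \<in> lists (homog h)" "wdeg h w = k" using p by auto
    have *: "wdeg g (map f w) = wdeg h w" if "w \<in> lists (homog h)" "\<zero>\<^bsub>g\<^esub> \<notin> f ` set w" for w
      using that
    proof (induction w)
      case (Cons x w)
      then have "deg g (f x) = deg h x" by (intro deg_eq[OF g(3)] fD(1) deg_mem) auto
      then show ?case using Cons by auto
    qed simp
    show "keys (pext (\<lambda>w. if \<zero>\<^bsub>g\<^esub> \<in> set w then 0 else single w 1)
        (single (map f w) 1)) \<subseteq> {w \<in> lists (homog g). wdeg g w = k}"
      using lists_map_hlin[OF f w(1)] *[OF w(1)] w(2) by auto
  qed
  ultimately show ?thesis unfolding env_simps by auto
qed

lemma Uf_fil: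
  assumes F: "\<And>x l. x \<in> homog h \<Longrightarrow> x \<in> F l \<Longrightarrow> f x \<in> F' l" and x: "x \<in> env_fil h F n"
  shows "Uf x \<in> env_fil g F' n"
proof -
  obtain p where p: "x = ecls h p" "keys p \<subseteq> wt_words h F n"
    using x unfolding env_fil_eq[OF h] by auto
  have "keys (fw p) \<subseteq> wt_words g F' n"
  proof (rule keys_pext_sub)
    fix w assume "w \<in> keys p"
    then have w: "w \<in> wt_words h F n" using p(2) by auto
    then obtain l where l: "length l = length w" "\<forall>i<length w. w ! i \<in> F (l ! i)" "n \<le> sum_list l"
      and wh: "w \<in> lists (homog h)" by (auto simp: wt_words_def)
    have "\<forall>i<length w. f (w ! i) \<in> F' (l ! i)" using l(2) wh by (auto intro!: F dest: nth_mem)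
    then have "map f w \<in> wt_words g F' n"
      unfolding wt_words_def using l lists_map_hlin[OF f wh] by (auto intro!: exI[of _ l])
    then show "keys (single (map f w) (1::real)) \<subseteq> wt_words g F' n" by simp
  qed
  moreover have "Uf x = ecls g (fw p)" unfolding p(1) by (rule Uf_ecls) (use p(2) wt_words_sub[OF h] in blast)
  ultimately show ?thesis unfolding env_fil_eq[OF g(1)] by blast
qed

lemma Uf_to_env: "x \<in> homog h \<Longrightarrow> Uf (to_env h x) = to_env g (f x)"
  unfolding to_env_eq by (subst Uf_ecls) auto

text \<open>Let \<open>s\<close> be a section of \<open>f\<close> on homogeneous elements that respects the filtrations, a map of sets that is
applied to the letters of one chosen representative.  Degree and weight are kept
at the same time by starting from a representative of the given weight, projecting it to degree \<open>k\<close> and removing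
the words with a letter 0.\<close>

lemma Uf_lift:
  assumes s: "\<And>x. x \<in> homog g \<Longrightarrow> s x \<in> homog h" "\<And>x. x \<in> homog g \<Longrightarrow> f (s x) = x"
    and F: "\<And>x l. x \<in> homog g \<Longrightarrow> x \<in> F' l \<Longrightarrow> s x \<in> F l"
    and y: "y \<in> grade (env g) k" "y \<in> env_fil g F' n"
  shows "\<exists>x \<in> grade (env h) k \<inter> env_fil h F n. Uf x = y"
proof -
  obtain q where q: "y = ecls g q" "keys q \<subseteq> wt_words g F' n"
    using y(2) unfolding env_fil_eq[OF g(1)] by auto
  have qc: "keys q \<subseteq> lists (homog g)" using q wt_words_sub[OF g(1)] by blast
  define r where "r = drop_zero g (deg_part g k q)"
  have dc: "keys (deg_part g k q) \<subseteq> lists (homog g)" using keys_deg_part[of g k q] qc by auto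
  have yr: "y = ecls g r"
    unfolding r_def ecls_drop_zero[OF g(1) dc] using ecls_deg_part[OF g qc] y(1) q(1) by simp
  have rk: "keys r \<subseteq> {w \<in> wt_words g F' n. wdeg g w = k \<and> \<zero>\<^bsub>g\<^esub> \<notin> set w}"
    unfolding r_def using keys_drop_zero[of g "deg_part g k q"] keys_deg_part[of g k q] q(2) by auto
  let ?s = "pext (\<lambda>w. single (map s w) 1) r"
  have "keys ?s \<subseteq> {w \<in> wt_words h F n. wdeg h w = k}"
  proof (rule keys_pext_sub)
    fix w assume "w \<in> keys r"
    then have w: "w \<in> wt_words g F' n" "wdeg g w = k" "\<zero>\<^bsub>g\<^esub> \<notin> set w" using rk by auto
    then obtain l where l: "length l = length w" "\<forall>i<length w. w ! i \<in> F' (l ! i)" "n \<le> sum_list l"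
      and wh: "w \<in> lists (homog g)" by (auto simp: wt_words_def)
    have "\<forall>i<length w. s (w ! i) \<in> F (l ! i)" using l(2) wh by (auto intro!: F dest: nth_mem)
    then have "map s w \<in> wt_words h F n"
      unfolding wt_words_def using l s(1) wh by (auto intro!: exI[of _ l])
    moreover have "wdeg h (map s w) = wdeg g w" using wh w(3)
    proof (induction w)
      case (Cons x w)
      then have x: "x \<in> homog g" "x \<noteq> \<zero>\<^bsub>g\<^esub>" by auto
      have "x \<in> grade g (deg h (s x))" using fD(1)[OF deg_mem[OF s(1)[OF x(1)]]] s(2)[OF x(1)] by simp
      then have "deg h (s x) = deg g x" using deg_eq[OF g(3) _ x(2)] by simp
      then show ?case using Cons by auto
    qed simp
    ultimately show "keys (single (map s w) (1::real)) \<subseteq> {w \<in> wt_words h F n. wdeg h w = k}"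
      using w(2) by simp
  qed
  then have k: "keys ?s \<subseteq> wt_words h F n" "keys ?s \<subseteq> {w \<in> lists (homog h). wdeg h w = k}"
    "keys ?s \<subseteq> lists (homog h)"
    using wt_words_sub[OF h, of F n] by blast+
  have "fw ?s = pext (\<lambda>w. single w 1) r"
    unfolding pext_pext
  proof (rule pext_cong)
    fix w assume "w \<in> keys r"
    then have "w \<in> lists (homog g)" using rk wt_words_sub[OF g(1)] by blast
    then have "map f (map s w) = w" using s(2) by (induction w) auto
    then show "pext (\<lambda>w. single (map f w) 1) (single (map s w) 1) = single w (1::real)"
      by simp
  qed
  then have "Uf (ecls h ?s) = y" unfolding Uf_ecls[OF k(3)] yr by (simp add: pext_id)
  then show ?thesis using k unfolding env_fil_eq[OF h] env_simps by blast
qed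

end

section \<open>Dg Lie algebras and symmetric tensors\<close>

lemma vsp_cong:
  assumes "vsp V" "carrier W = carrier V" "add W = add V" "\<zero>\<^bsub>W\<^esub> = \<zero>\<^bsub>V\<^esub>" "smult W = smult V"
  shows "vsp W"
  by (rule vspI) (use assms(2-5) in \<open>simp_all add: vsp_simps[OF assms(1)] del: One_nat_def\<close>)

text \<open>A nonzero element of two different degrees would have two decompositions into homogeneous parts.\<close>

lemma deg_unique_graded_space:
  assumes g: "graded_space g"
  shows "deg_unique g"
  unfolding deg_unique_def
proof (intro allI impI; rule ccontr)
  fix x i j assume x: "x \<in> grade g i" "x \<in> grade g j" "x \<noteq> \<zero>\<^bsub>g\<^esub>" "i \<noteq> j"
  have V: "vsp g" and G: "\<And>k. subsp (grade g k) g"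
    and u: "\<And>x. x \<in> carrier g \<Longrightarrow> \<exists>!c. (\<forall>k. c k \<in> grade g k) \<and> finite {k. c k \<noteq> \<zero>\<^bsub>g\<^esub>} \<and>
        x = (\<Oplus>\<^bsub>g\<^esub>k\<in>{k. c k \<noteq> \<zero>\<^bsub>g\<^esub>}. c k)"
    using g unfolding graded_space_def by blast+
  interpret M: module real_ring g by (rule V)
  have xc: "x \<in> carrier g" using subsp_sub[OF V G] x(1) by blast
  let ?c = "\<lambda>i k. if k = i then x else \<zero>\<^bsub>g\<^esub>"
  have c: "(\<forall>k. ?c i k \<in> grade g k) \<and> finite {k. ?c i k \<noteq> \<zero>\<^bsub>g\<^esub>} \<and> x = (\<Oplus>\<^bsub>g\<^esub>k\<in>{k. ?c i k \<noteq> \<zero>\<^bsub>g\<^esub>}. ?c i k)"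
    if "x \<in> grade g i" for i
  proof -
    have s: "{k. ?c i k \<noteq> \<zero>\<^bsub>g\<^esub>} = {i}" using x(3) by auto
    show ?thesis unfolding s using that subsp_zero[OF V G] xc by simp
  qed
  obtain d where d: "\<forall>c. (\<forall>k. c k \<in> grade g k) \<and> finite {k. c k \<noteq> \<zero>\<^bsub>g\<^esub>} \<and>
        x = (\<Oplus>\<^bsub>g\<^esub>k\<in>{k. c k \<noteq> \<zero>\<^bsub>g\<^esub>}. c k) \<longrightarrow> c = d"
    using u[OF xc] by (elim ex1E) (erule that)
  have "?c i = ?c j" using d[rule_format, OF c[OF x(1)]] d[rule_format, OF c[OF x(2)]] by (rule trans[OF _ sym])
  then have "?c i i = ?c j i" by (rule fun_cong)
  then show False using x(3,4) by simp
qed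

lemma dg_lieD:
  assumes "dg_lie g"
  shows dg_lie_vsp: "vsp g" and dg_lie_grade: "\<And>k. subsp (grade g k) g"
    and dg_lie_valg: "valg g" and dg_lie_unique: "deg_unique g" and dg_lie_glie: "glie g"
    and dg_lie_antisym: "\<And>i j x y. x \<in> grade g i \<Longrightarrow> y \<in> grade g j \<Longrightarrow> x \<otimes>\<^bsub>g\<^esub> y = (- sg (i * j)) \<odot>\<^bsub>g\<^esub> (y \<otimes>\<^bsub>g\<^esub> x)"
    and dg_lie_jacobi: "\<And>i j x y z. x \<in> grade g i \<Longrightarrow> y \<in> grade g j \<Longrightarrow> z \<in> homog g \<Longrightarrow>
      x \<otimes>\<^bsub>g\<^esub> (y \<otimes>\<^bsub>g\<^esub> z) = ((x \<otimes>\<^bsub>g\<^esub> y) \<otimes>\<^bsub>g\<^esub> z) \<oplus>\<^bsub>g\<^esub> sg (i * j) \<odot>\<^bsub>g\<^esub> (y \<otimes>\<^bsub>g\<^esub> (x \<otimes>\<^bsub>g\<^esub> z))"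
proof -
  have gs: "graded_space g" using assms by (simp add: dg_lie_def)
  show V: "vsp g" and G: "\<And>k. subsp (grade g k) g" using gs unfolding graded_space_def by blast+
  show "deg_unique g" by (rule deg_unique_graded_space[OF gs])
  show "valg g" by (rule valgI[OF V]) (use assms in \<open>simp_all add: dg_lie_def\<close>)
  have m: "x \<otimes>\<^bsub>g\<^esub> y \<in> grade g (i + j)" if "x \<in> grade g i" "y \<in> grade g j" for x y i j
    using assms that unfolding dg_lie_def by blast
  show "glie g"
    unfolding glie_def graded_closed_def using V m subsp_sub[OF V G] subsp_add[OF V G] subsp_smult[OF V G] by simp
  show "x \<otimes>\<^bsub>g\<^esub> y = (- sg (i * j)) \<odot>\<^bsub>g\<^esub> (y \<otimes>\<^bsub>g\<^esub> x)" if "x \<in> grade g i" "y \<in> grade g j" for x y i j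
    using assms that unfolding dg_lie_def by blast
  show "x \<otimes>\<^bsub>g\<^esub> (y \<otimes>\<^bsub>g\<^esub> z) = ((x \<otimes>\<^bsub>g\<^esub> y) \<otimes>\<^bsub>g\<^esub> z) \<oplus>\<^bsub>g\<^esub> sg (i * j) \<odot>\<^bsub>g\<^esub> (y \<otimes>\<^bsub>g\<^esub> (x \<otimes>\<^bsub>g\<^esub> z))"
    if "x \<in> grade g i" "y \<in> grade g j" "z \<in> homog g" for x y z i j
    using assms that unfolding dg_lie_def by blast
qed

lemma susp_simps [simp]:
  "carrier (susp V) = carrier V" "add (susp V) = add V" "\<zero>\<^bsub>susp V\<^esub> = \<zero>\<^bsub>V\<^esub>" "smult (susp V) = smult V"
  "grade (susp V) k = grade V (k + 1)"
  by (simp_all add: susp_def)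

lemma homog_susp [simp]: "homog (susp V) = homog V"
proof -
  have "x \<in> homog V \<Longrightarrow> x \<in> homog (susp V)" for x
    using homogI[of x "susp V" "deg V x - 1"] deg_mem[of x V] by simp
  then show ?thesis by (auto simp: homog_def)
qed

lemma susp_props:
  shows "vsp V \<Longrightarrow> vsp (susp V)" "graded_closed V \<Longrightarrow> graded_closed (susp V)"
    "deg_unique V \<Longrightarrow> deg_unique (susp V)"
  by (auto intro: vsp_cong[of V] simp: graded_closed_def deg_unique_def)
    (metis add_right_imp_eq)

subsection \<open>Symmetrization\<close>

lemma sg_add: "sg (a + b) = sg a * sg b"
  by (simp add: sg_def)

lemma sg_minus: "sg (- a) = sg a"
  by (simp add: sg_def)

lemma swapw_at: "swapw V (length a) (a @ p # q # b) = single (a @ q # p # b) (sg (deg V p * deg V q))"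
  by (simp add: swapw_def nth_append list_update_append)

text \<open>The terms of a multilinear relation differ in a single letter, of a fixed degree.  A transposition moves this
letter to the same place in all of them, and with a sign that depends on the degree only.\<close>

lemma swapw_letter:
  "\<exists>u' v' e. set u' \<union> set v' \<subseteq> set u \<union> set v \<and>
     (\<forall>z. swapw V i (u @ [z] @ v) = single (u' @ [z] @ v') (e (deg V z)))"
proof -
  consider "Suc i < length u" | "Suc i = length u" | "i = length u" "0 < length v" | "length u < i" "i < length u + length v"
    | "length u + length v \<le> i" by linarith
  then show ?thesis
  proof cases
    case 1
    then have u: "u = take i u @ u ! i # u ! Suc i # drop (Suc (Suc i)) u"
      by (metis Cons_nth_drop_Suc Suc_lessD append_take_drop_id)
    define a p q b where "a = take i u" "p = u ! i" "q = u ! Suc i" "b = drop (Suc (Suc i)) u"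
    then have ab: "u = a @ p # q # b" "i = length a" using u 1 by auto
    show ?thesis
      by (rule exI[of _ "a @ q # p # b"], rule exI[of _ v], rule exI[of _ "\<lambda>_. sg (deg V p * deg V q)"])
        (use swapw_at[of V a p q] in \<open>auto simp: ab\<close>)
  next
    case 2
    then obtain a p where ap: "u = a @ [p]" by (cases u rule: rev_cases) auto
    show ?thesis
      by (rule exI[of _ a], rule exI[of _ "p # v"], rule exI[of _ "\<lambda>d. sg (deg V p * d)"])
        (use 2 swapw_at[of V a p] in \<open>auto simp: ap\<close>)
  next
    case 3
    then obtain q b where qb: "v = q # b" by (cases v) auto
    show ?thesis
      by (rule exI[of _ "u @ [q]"], rule exI[of _ b], rule exI[of _ "\<lambda>d. sg (d * deg V q)"])
        (use 3 swapw_at[of V u _ q b] in \<open>auto simp: qb\<close>)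
  next
    case 4
    define j where "j = i - Suc (length u)"
    have j: "Suc j < length v" "i = Suc (length u + j)" using 4 by (auto simp: j_def)
    then have v: "v = take j v @ v ! j # v ! Suc j # drop (Suc (Suc j)) v"
      by (metis Cons_nth_drop_Suc Suc_lessD append_take_drop_id)
    define a p q b where "a = take j v" "p = v ! j" "q = v ! Suc j" "b = drop (Suc (Suc j)) v"
    then have ab: "v = a @ p # q # b" "j = length a" using v j by auto
    show ?thesis
      by (rule exI[of _ u], rule exI[of _ "a @ q # p # b"], rule exI[of _ "\<lambda>_. sg (deg V p * deg V q)"])
        (use swapw_at[of V "u @ _ # a" p q b] j in \<open>auto simp: ab\<close>)
  next
    case 5
    then show ?thesis
      by (intro exI[of _ u] exI[of _ v] exI[of _ "\<lambda>_. 1"]) (simp add: swapw_def)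
  qed
qed

context
  fixes V :: "'a dg"
  assumes V: "vsp V" "graded_closed V" "deg_unique V" "homog V \<subseteq> carrier V"
begin

lemma swapw_lists: "w \<in> lists (homog V) \<Longrightarrow> keys (swapw V i w) \<subseteq> lists (homog V)"
  by (auto simp: swapw_def dest!: subsetD[OF set_update_subset_insert])

text \<open>All terms of a relation are swapped with one common sign by \<open>swapw_letter\<close>, except those with a letter 0,
which are relations by themselves.\<close>

lemma swapw_trel:
  assumes p: "p \<in> trel V"
  shows "pext (swapw V i) p \<in> trel V"
proof -
  note S = subsp_trel[OF V(2), unfolded tword_def]
  have L: "lin (tword V) (tword V) (pext (swapw V i))" by (rule lin_pext_tword[OF swapw_lists])
  show ?thesis
  proof (rule lin_vspan_into[OF L tgens_sub[OF V(2)] subsp_trel[OF V(2)] _ p[unfolded trel_eq]])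
    show "pext (swapw V i) ` tgens V \<subseteq> trel V"
    proof (rule image_subsetI)
      fix p assume "p \<in> tgens V"
      then show "pext (swapw V i) p \<in> trel V"
      proof (cases rule: tgens_cases)
        case (add u v x y k)
        obtain u' v' e where e: "set u' \<union> set v' \<subseteq> set u \<union> set v"
          "\<And>z. swapw V i (u @ [z] @ v) = single (u' @ [z] @ v') (e (deg V z))"
          using swapw_letter[of u v V i] by blast
        have uv: "u' \<in> lists (homog V)" "v' \<in> lists (homog V)" using e(1) add(1,2) by auto
        have d: "single (u' @ [z] @ v') (e (deg V z)) - single (u' @ [z] @ v') (e k) \<in> trel V"
          if "z \<in> grade V k" for z
        proof (cases "z = \<zero>\<^bsub>V\<^esub>")
          case True
          show ?thesis
            using uv zero_word_trel[OF V(1,2), of "u' @ [z] @ v'"] homogI[OF that] True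
            by (auto simp flip: single_diff)
        next
          case False
          then show ?thesis using deg_eq[OF V(3) that] S by (simp add: subsp_free_iff)
        qed
        let ?s = "\<lambda>z. single (u' @ [z] @ v') (e (deg V z))" and ?t = "\<lambda>z. single (u' @ [z] @ v') (e k)"
        have xy: "x \<oplus>\<^bsub>V\<^esub> y \<in> grade V k" using graded_closedD(1)[OF V(2)] add by blast
        have "psc (e k) (single (u' @ [x \<oplus>\<^bsub>V\<^esub> y] @ v') 1 - single (u' @ [x] @ v') 1
          - single (u' @ [y] @ v') 1) \<in> trel V" (is "psc _ ?g \<in> _")
          using tgens_trel[OF tgens_addI[OF uv add(3,4)]] S unfolding subsp_free_iff by blast
        moreover have "psc (e k) ?g = ?t (x \<oplus>\<^bsub>V\<^esub> y) - ?t x - ?t y"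
          by (rule poly_mapping_eqI) (simp add: lookup_minus lookup_add lookup_single when_def algebra_simps)
        moreover have "pext (swapw V i) p = (?s (x \<oplus>\<^bsub>V\<^esub> y) - ?t (x \<oplus>\<^bsub>V\<^esub> y)) - (?s x - ?t x) - (?s y - ?t y) + (?t (x \<oplus>\<^bsub>V\<^esub> y) - ?t x - ?t y)"
          unfolding add(5) by (simp add: pext_diff e(2)[simplified])
        ultimately show ?thesis
          using S subsp_free_diff(1)[OF S subsp_free_diff(1)[OF S d[OF xy] d[OF add(3)]] d[OF add(4)]]
          by (simp only: subsp_free_iff)
      next
        case (smult u v x c)
        obtain u' v' e where e: "set u' \<union> set v' \<subseteq> set u \<union> set v"
          "\<And>z. swapw V i (u @ [z] @ v) = single (u' @ [z] @ v') (e (deg V z))"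
          using swapw_letter[of u v V i] by blast
        have uv: "u' \<in> lists (homog V)" "v' \<in> lists (homog V)" using e(1) smult(1,2) by auto
        let ?y = "c \<odot>\<^bsub>V\<^esub> x"
        have y: "?y \<in> grade V (deg V x)" using graded_closedD(2)[OF V(2) deg_mem[OF smult(3)]] .
        have g: "psc a (single (u' @ [?y] @ v') 1 - single (u' @ [x] @ v') c) \<in> trel V" for a
          using tgens_trel[OF tgens_smultI[OF uv smult(3)]] S unfolding subsp_free_iff by blast
        have g': "psc a (single (u' @ [?y] @ v') 1 - single (u' @ [x] @ v') c) =
            single (u' @ [?y] @ v') a - single (u' @ [x] @ v') (c * a)" for a
          by (rule poly_mapping_eqI) (simp add: lookup_minus lookup_single when_def algebra_simps)
        have sw: "pext (swapw V i) p = single (u' @ [?y] @ v') (e (deg V ?y)) - single (u' @ [x] @ v') (c * e (deg V x))"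
          unfolding smult(4) by (simp add: pext_diff e(2)[simplified])
        show ?thesis
        proof (cases "?y = \<zero>\<^bsub>V\<^esub>")
          case False
          then have "deg V ?y = deg V x" using deg_eq[OF V(3) y] by simp
          then show ?thesis using g[of "e (deg V x)"] unfolding g' sw by simp
        next
          case True
          have "single (u' @ [?y] @ v') a \<in> trel V" for a
            by (rule zero_word_trel[OF V(1,2)]) (use uv homogI[OF y] True in auto)
          from subsp_free_diff(1)[OF S this[of "e (deg V ?y)"] subsp_free_diff(1)[OF S this[of "e (deg V x)"] g[of "e (deg V x)"]]]
          show ?thesis unfolding g' sw by simp
        qed
      qed
    qed
  qed
qed

lemma cmap_swapw: "cmap (tword V) (trel V) (pext (swapw V i)) (tcls V p) = tcls V (pext (swapw V i) p)"
proof -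
  have "tcls V (pext (swapw V i) (t + p)) = tcls V (pext (swapw V i) p)" if "t \<in> trel V" for t
    by (rule tcls_cong[OF V(2)]) (simp add: pext_add swapw_trel[OF that])
  moreover have "0 \<in> trel V" using subsp_trel[OF V(2)] by (simp add: tword_def subsp_free_iff)
  moreover have "cmap (tword V) (trel V) (pext (swapw V i)) (tcls V p) = (\<Union>t\<in>trel V. tcls V (pext (swapw V i) (t + p)))"
    unfolding cmap_def tcls_eq[of V p] by (auto simp: tcls_def)
  ultimately show ?thesis by auto
qed

end

text \<open>The inversions of \<open>\<pi>\<close>, over which the Koszul sign of a permutation of homogeneous letters multiplies.\<close>

definition inv_pairs :: "nat \<Rightarrow> (nat \<Rightarrow> nat) \<Rightarrow> (nat \<times> nat) set" where
  "inv_pairs n \<pi> = {(i, j). i < j \<and> j < n \<and> \<pi> j < \<pi> i}"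

definition koszul :: "'a dg \<Rightarrow> 'a list \<Rightarrow> (nat \<Rightarrow> nat) \<Rightarrow> int" where
  "koszul V w \<pi> = (\<Sum>(i, j)\<in>inv_pairs (length w) \<pi>. deg V (w ! \<pi> i) * deg V (w ! \<pi> j))"

definition symz_word :: "'a dg \<Rightarrow> 'a list \<Rightarrow> ('a list \<Rightarrow>\<^sub>0 real)" where
  "symz_word V w = (\<Sum>\<pi> | \<pi> permutes {..<length w}.
     single (map (\<lambda>i. w ! \<pi> i) [0..<length w]) (sg (koszul V w \<pi>) / fact (length w)))"

lemma symz_eq: "symz V w = tcls V (symz_word V w)"
  by (simp add: symz_def symz_word_def koszul_def inv_pairs_def)

lemma finite_inv_pairs [simp]: "finite (inv_pairs n \<pi>)"
  by (rule finite_subset[of _ "{..<n} \<times> {..<n}"]) (auto simp: inv_pairs_def)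

text \<open>Composing with an adjacent transposition permutes the inversions other than \<open>(i, i + 1)\<close>, and toggles that
one.\<close>

lemma koszul_transpose:
  assumes \<pi>: "\<pi> permutes {..<length w}" and i: "Suc i < length w"
  shows "sg (koszul V w (\<pi> \<circ> Transposition.transpose i (Suc i))) =
    sg (koszul V w \<pi>) * sg (deg V (w ! \<pi> i) * deg V (w ! \<pi> (Suc i)))"
proof -
  let ?t = "Transposition.transpose i (Suc i)" and ?n = "length w"
  define D where "D = (\<lambda>(\<pi> :: nat \<Rightarrow> nat) (a :: nat, b :: nat). deg V (w ! \<pi> a) * deg V (w ! \<pi> b))"
  let ?m = "deg V (w ! \<pi> i) * deg V (w ! \<pi> (Suc i))"
  have inj: "\<pi> a = \<pi> b \<longleftrightarrow> a = b" for a b :: nat using permutes_inj[OF \<pi>] by (auto dest: injD)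
  have split: "sum (D \<sigma>) (inv_pairs ?n \<sigma>) = sum (D \<sigma>) (inv_pairs ?n \<sigma> - {(i, Suc i)}) + (if \<sigma> (Suc i) < \<sigma> i then D \<sigma> (i, Suc i) else 0)"
    for \<sigma> :: "nat \<Rightarrow> nat"
  proof (cases "\<sigma> (Suc i) < \<sigma> i")
    case True
    then have "(i, Suc i) \<in> inv_pairs ?n \<sigma>" using i by (simp add: inv_pairs_def)
    then show ?thesis using True by (simp add: sum.remove)
  next
    case False
    then have "inv_pairs ?n \<sigma> - {(i, Suc i)} = inv_pairs ?n \<sigma>" by (auto simp: inv_pairs_def)
    then show ?thesis using False by simp
  qed
  have mono: "?t a < ?t b \<longleftrightarrow> a < b" if "(a, b) \<noteq> (i, Suc i)" "(a, b) \<noteq> (Suc i, i)" for a b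
    using that by (auto simp: Transposition.transpose_def)
  have bound: "?t a < ?n \<longleftrightarrow> a < ?n" for a using i by (auto simp: Transposition.transpose_def)
  have "sum (D (\<pi> \<circ> ?t)) (inv_pairs ?n (\<pi> \<circ> ?t) - {(i, Suc i)}) = sum (D \<pi>) (inv_pairs ?n \<pi> - {(i, Suc i)})"
  proof (rule sum.reindex_bij_witness[of _ "map_prod ?t ?t" "map_prod ?t ?t"])
    fix x assume "x \<in> inv_pairs ?n \<pi> - {(i, Suc i)}"
    then obtain a b where x: "x = (a, b)" "a < b" "b < ?n" "\<pi> b < \<pi> a" "(a, b) \<noteq> (i, Suc i)" by (auto simp: inv_pairs_def)
    have "?t a < ?t b" using mono[of a b] x by auto
    moreover have "(?t a, ?t b) \<noteq> (i, Suc i)" using x(2) by (auto simp: Transposition.transpose_def split: if_splits)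
    ultimately show "map_prod ?t ?t x \<in> inv_pairs ?n (\<pi> \<circ> ?t) - {(i, Suc i)}" using x bound by (simp add: inv_pairs_def)
  next
    fix x assume "x \<in> inv_pairs ?n (\<pi> \<circ> ?t) - {(i, Suc i)}"
    then obtain a b where x: "x = (a, b)" "a < b" "b < ?n" "\<pi> (?t b) < \<pi> (?t a)" "(a, b) \<noteq> (i, Suc i)" by (auto simp: inv_pairs_def)
    have "?t a < ?t b" using mono[of a b] x by auto
    moreover have "(?t a, ?t b) \<noteq> (i, Suc i)" using x(2) by (auto simp: Transposition.transpose_def split: if_splits)
    ultimately show "map_prod ?t ?t x \<in> inv_pairs ?n \<pi> - {(i, Suc i)}" using x bound by (simp add: inv_pairs_def)
    show "D \<pi> (map_prod ?t ?t x) = D (\<pi> \<circ> ?t) x" using x by (simp add: D_def)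
  qed (auto simp: map_prod_def split: prod.splits)
  then have "koszul V w (\<pi> \<circ> ?t) + (if \<pi> (Suc i) < \<pi> i then ?m else 0) = koszul V w \<pi> + (if \<pi> i < \<pi> (Suc i) then ?m else 0)"
    using split[of "\<pi> \<circ> ?t"] split[of \<pi>] unfolding koszul_def D_def by (simp add: mult.commute)
  moreover have "\<pi> i < \<pi> (Suc i) \<longleftrightarrow> \<not> \<pi> (Suc i) < \<pi> i" using inj[of i "Suc i"] by auto
  ultimately have "koszul V w (\<pi> \<circ> ?t) = koszul V w \<pi> + ?m \<or> koszul V w (\<pi> \<circ> ?t) = koszul V w \<pi> + (- ?m)"
    by (auto split: if_splits)
  then show ?thesis by (elim disjE) (simp_all only: sg_add sg_minus)
qed

text \<open>An adjacent transposition multiplies the term of \<open>\<pi>\<close> by exactly the sign that relates it to the term of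
\<open>\<pi> \<circ> (i i+1)\<close>, so it permutes the terms.\<close>

lemma symz_word_symmetric: "pext (swapw V i) (symz_word V w) = symz_word V w"
proof (cases "Suc i < length w")
  case False
  have "pext (swapw V i) (symz_word V w) = pext (\<lambda>w. single w 1) (symz_word V w)"
  proof (rule pext_cong)
    fix v assume "v \<in> keys (symz_word V w)"
    moreover have "keys (symz_word V w) \<subseteq> {v. length v = length w}"
      unfolding symz_word_def by (rule keys_sum_sub) auto
    ultimately have "length v = length w" by auto
    then show "swapw V i v = single v 1" using False by (simp add: swapw_def)
  qed
  then show ?thesis by (simp add: pext_id)
next
  case True
  let ?t = "Transposition.transpose i (Suc i)" and ?n = "length w"
  let ?w = "\<lambda>\<pi>. map (\<lambda>i. w ! \<pi> i) [0..<?n]"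
  have t: "?t permutes {..<?n}" using True by (intro permutes_swap_id) auto
  have "pext (swapw V i) (symz_word V w) = (\<Sum>\<pi> | \<pi> permutes {..<?n}. psc (sg (koszul V w \<pi>) / fact ?n) (swapw V i (?w \<pi>)))"
    by (simp add: symz_word_def pext_sum)
  also have "\<dots> = (\<Sum>\<pi> | \<pi> permutes {..<?n}. single (?w (\<pi> \<circ> ?t)) (sg (koszul V w (\<pi> \<circ> ?t)) / fact ?n))"
  proof (rule sum.cong[OF refl])
    fix \<pi> assume "\<pi> \<in> {\<pi>. \<pi> permutes {..<?n}}"
    then have \<pi>: "\<pi> permutes {..<?n}" by simp
    have "swapw V i (?w \<pi>) = single (?w (\<pi> \<circ> ?t)) (sg (deg V (w ! \<pi> i) * deg V (w ! \<pi> (Suc i))))"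
    proof -
      have "(?w \<pi>)[i := w ! \<pi> (Suc i), Suc i := w ! \<pi> i] = ?w (\<pi> \<circ> ?t)"
        using True by (intro nth_equalityI) (auto simp: nth_list_update Transposition.transpose_def)
      then show ?thesis using True by (simp add: swapw_def)
    qed
    then show "psc (sg (koszul V w \<pi>) / fact ?n) (swapw V i (?w \<pi>)) = single (?w (\<pi> \<circ> ?t)) (sg (koszul V w (\<pi> \<circ> ?t)) / fact ?n)"
      by (simp add: koszul_transpose[OF \<pi> True])
  qed
  also have "\<dots> = symz_word V w"
    unfolding symz_word_def
    by (rule sum.reindex_bij_witness[of _ "\<lambda>\<pi>. \<pi> \<circ> ?t" "\<lambda>\<pi>. \<pi> \<circ> ?t"])
      (auto simp: comp_assoc intro: permutes_compose[OF t])
  finally show ?thesis .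
qed

lemma keys_symz_word:
  assumes "w \<in> lists (homog V)"
  shows "keys (symz_word V w) \<subseteq> {v \<in> lists (homog V). wdeg V v = wdeg V w \<and> length v = length w}"
  unfolding symz_word_def
proof (rule keys_sum_sub)
  fix \<pi> assume "\<pi> \<in> {\<pi>. \<pi> permutes {..<length w}}"
  then have \<pi>: "\<pi> permutes {..<length w}" by simp
  let ?v = "map (\<lambda>i. w ! \<pi> i) [0..<length w]"
  have "wdeg V ?v = (\<Sum>i<length w. deg V (w ! \<pi> i))"
    by (simp add: wdeg_def sum_list_sum_nth atLeast0LessThan)
  also have "\<dots> = (\<Sum>i<length w. deg V (w ! i))"
    by (rule sum.permute[OF \<pi>, symmetric, unfolded comp_def])
  also have "\<dots> = wdeg V w" by (simp add: wdeg_def sum_list_sum_nth atLeast0LessThan)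
  finally have "wdeg V ?v = wdeg V w" .
  moreover have "?v \<in> lists (homog V)"
    using assms permutes_in_image[OF \<pi>] by (auto simp: in_lists_conv_set)
  ultimately show "keys (single ?v (sg (koszul V w \<pi>) / fact (length w))) \<subseteq>
      {v \<in> lists (homog V). wdeg V v = wdeg V w \<and> length v = length w}" by simp
qed

lemma symz_singleton: "symz V [x] = tcls V (single [x] 1)"
proof -
  have "{\<pi>. \<pi> permutes {..<Suc 0}} = {id}" by (auto simp: lessThan_Suc)
  moreover have "inv_pairs 1 id = {}" by (auto simp: inv_pairs_def)
  ultimately show ?thesis by (simp add: symz_eq symz_word_def koszul_def sg_def)
qed

section \<open>Free graded Lie algebras and strictification\<close>

lemma lin_diff:
  assumes "lin (free_dg S m e d D) V f" "keys p \<subseteq> S" "keys q \<subseteq> S"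
  shows "f (p - q) = f p \<oplus>\<^bsub>V\<^esub> (-1) \<odot>\<^bsub>V\<^esub> f q"
  using lin_add[OF assms(1), of p "psc (-1) q"] lin_smult[OF assms(1), of q "-1"] keys_psc_sub[OF assms(3), of "-1"] assms
  by simp

abbreviation lwords :: "'a dg \<Rightarrow> 'a lword set" where
  "lwords V \<equiv> {w. set_lword w \<subseteq> homog V}"

text \<open>The sets whose intersection is the space of relations of the free Lie algebra.\<close>

definition lie_ideal :: "'a dg \<Rightarrow> ('a \<Rightarrow> ('a lword \<Rightarrow>\<^sub>0 real)) \<Rightarrow> ('a lword \<Rightarrow>\<^sub>0 real) set \<Rightarrow> bool" where
  "lie_ideal V D W \<longleftrightarrow> subsp W (lfree V D) \<and>
     (\<forall>p\<in>W. \<forall>q\<in>carrier (lfree V D). p \<otimes>\<^bsub>lfree V D\<^esub> q \<in> W \<and> q \<otimes>\<^bsub>lfree V D\<^esub> p \<in> W) \<and>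
     (\<forall>k. \<forall>x\<in>grade V k. \<forall>y\<in>grade V k.
        single (Gen (x \<oplus>\<^bsub>V\<^esub> y)) 1 - single (Gen x) 1 - single (Gen y) 1 \<in> W) \<and>
     (\<forall>c. \<forall>x\<in>homog V. single (Gen (c \<odot>\<^bsub>V\<^esub> x)) 1 - single (Gen x) c \<in> W) \<and>
     (\<forall>u v. set_lword u \<subseteq> homog V \<and> set_lword v \<subseteq> homog V \<longrightarrow>
        single (Br u v) 1 + single (Br v u) (sg (ldeg V u * ldeg V v)) \<in> W) \<and>
     (\<forall>u v w. set_lword u \<subseteq> homog V \<and> set_lword v \<subseteq> homog V \<and> set_lword w \<subseteq> homog V \<longrightarrow>
        single (Br u (Br v w)) 1 - single (Br (Br u v) w) 1
          - single (Br v (Br u w)) (sg (ldeg V u * ldeg V v)) \<in> W)"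

lemma lrel_eq: "lrel V D = \<Inter>{W. lie_ideal V D W}"
  by (simp add: lrel_def lie_ideal_def)

lemma lfree_simps [simp]:
  "carrier (lfree V D) = {p. keys p \<subseteq> lwords V}"
  "p \<oplus>\<^bsub>lfree V D\<^esub> q = p + q" "\<zero>\<^bsub>lfree V D\<^esub> = 0" "c \<odot>\<^bsub>lfree V D\<^esub> p = psc c p"
  "p \<otimes>\<^bsub>lfree V D\<^esub> q = pext (\<lambda>v. pext (\<lambda>w. single (Br v w) 1) q) p"
  "grade (lfree V D) k = {p. keys p \<subseteq> {w \<in> lwords V. ldeg V w = k}}"
  by (simp_all add: lfree_def)

lemma valg_lfree: "valg (lfree V D)"
  unfolding lfree_def by (rule valg_free) auto

lemma vsp_lfree: "vsp (lfree V D)"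
  by (rule valg_vsp[OF valg_lfree])

lemma subsp_grade_lfree: "subsp (grade (lfree V D) k) (lfree V D)"
  unfolding lfree_def by (rule subsp_grade_free)

text \<open>The universal property: a linear map \<open>\<phi>\<close> of degree 0 from the generators to a dg Lie algebra extends to bracketed
words by \<open>leval\<close>, and the extension descends to the free Lie algebra.\<close>

context
  fixes V :: "'b dg" and D :: "'b \<Rightarrow> ('b lword \<Rightarrow>\<^sub>0 real)" and g :: "'g dg" and \<phi> :: "'b \<Rightarrow> 'g"
  assumes g: "dg_lie g" and V: "graded_closed V" and \<phi>: "hlin V g \<phi>"
begin

private lemmas dD = dg_lieD[OF g] and dGL = glieD[OF dg_lie_glie[OF g]]

lemma leval_grade: "set_lword w \<subseteq> homog V \<Longrightarrow> leval g \<phi> w \<in> grade g (ldeg V w)"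
proof (induction w)
  case (Gen x)
  then show ?case using hlinD(1)[OF \<phi> deg_mem] by simp
next
  case (Br u v)
  then show ?case by (auto intro: dGL(4))
qed

lemma leval_homog: "set_lword w \<subseteq> homog V \<Longrightarrow> leval g \<phi> w \<in> homog g"
  by (rule homogI[OF leval_grade])

lemma leval_carrier: "w \<in> lwords V \<Longrightarrow> leval g \<phi> w \<in> carrier g"
  using leval_homog dGL(3) by auto

abbreviation evl :: "('b lword \<Rightarrow>\<^sub>0 real) \<Rightarrow> 'g" where
  "evl \<equiv> lext g (leval g \<phi>)"

lemma lin_evl: "lin (lfree V D) g evl"
  unfolding lfree_def by (rule lin_lext[OF dD(1) leval_carrier])

lemma evl_single: "set_lword w \<subseteq> homog V \<Longrightarrow> evl (single w c) = c \<odot>\<^bsub>g\<^esub> leval g \<phi> w"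
  by (rule lext_single[OF dD(1)]) (rule leval_carrier, simp)

lemma evl_mult:
  assumes p: "keys p \<subseteq> lwords V" and q: "keys q \<subseteq> lwords V"
  shows "evl (p \<otimes>\<^bsub>lfree V D\<^esub> q) = evl p \<otimes>\<^bsub>g\<^esub> evl q"
proof -
  have eq: "evl q \<in> carrier g" using lin_in[OF lin_evl] q by simp
  have c: "\<And>w. w \<in> keys q \<Longrightarrow> leval g \<phi> w \<in> carrier g"
      "\<And>w. w \<in> keys p \<Longrightarrow> leval g \<phi> w \<in> carrier g"
    using leval_carrier p q by blast+
  have 1: "evl (pext (\<lambda>w. single (Br v w) 1) q) = leval g \<phi> v \<otimes>\<^bsub>g\<^esub> evl q"
    if v: "v \<in> keys p" for v
  proof -
    have "evl (pext (\<lambda>w. single (Br v w) 1) q) = lext g (\<lambda>w. evl (single (Br v w) 1)) q"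
      by (rule lext_pext[OF dD(1) leval_carrier, where S = "lwords V"]) (use v p q in auto)
    also have "\<dots> = lext g (\<lambda>w. leval g \<phi> v \<otimes>\<^bsub>g\<^esub> leval g \<phi> w) q"
    proof (rule lext_cong[OF dD(1)])
      fix w assume w: "w \<in> keys q"
      show m: "leval g \<phi> v \<otimes>\<^bsub>g\<^esub> leval g \<phi> w \<in> carrier g" by (rule valg_mult[OF dD(3) c(2)[OF v] c(1)[OF w]])
      show "evl (single (Br v w) 1) = leval g \<phi> v \<otimes>\<^bsub>g\<^esub> leval g \<phi> w"
        using v w p q m by (subst evl_single) (auto simp: vsp_one[OF dD(1)])
    qed
    also have "\<dots> = leval g \<phi> v \<otimes>\<^bsub>g\<^esub> evl q"
      by (rule lin_lext_comp[OF lin_mult_left[OF dD(3) c(2)[OF v]] c(1), symmetric])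
    finally show ?thesis .
  qed
  have "evl (p \<otimes>\<^bsub>lfree V D\<^esub> q) = lext g (\<lambda>v. evl (pext (\<lambda>w. single (Br v w) 1) q)) p"
    unfolding lfree_simps
  proof (rule lext_pext[OF dD(1) leval_carrier, where S = "lwords V"])
    fix v assume "v \<in> keys p"
    then show "keys (pext (\<lambda>w. single (Br v w) 1) q) \<subseteq> lwords V"
      using p q by (intro keys_pext_sub) auto
  qed
  also have "\<dots> = lext g (\<lambda>v. leval g \<phi> v \<otimes>\<^bsub>g\<^esub> evl q) p"
    by (rule lext_cong[OF dD(1) 1]) (simp_all add: valg_mult[OF dD(3)] c eq)
  also have "\<dots> = evl p \<otimes>\<^bsub>g\<^esub> evl q"
    by (rule lin_lext_comp[OF lin_mult_right[OF dD(3) eq] c(2), symmetric])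
  finally show ?thesis .
qed

text \<open>Antisymmetry and the Jacobi identity of \<open>g\<close>, evaluated on words, say that the kernel of the extension is one
of the ideals whose intersection defines the relations.\<close>

lemma lie_ideal_kernel: "lie_ideal V D {p \<in> carrier (lfree V D). evl p = \<zero>\<^bsub>g\<^esub>}"
proof -
  let ?K = "{p \<in> carrier (lfree V D). evl p = \<zero>\<^bsub>g\<^esub>}"
  note S = vsp_simps[OF dD(1)] and L = linD[OF lin_evl]
  have Lc: "keys p \<subseteq> lwords V \<Longrightarrow> evl p \<in> carrier g" for p using L(3) by simp
  have diff: "evl (p - q) = evl p \<oplus>\<^bsub>g\<^esub> (-1) \<odot>\<^bsub>g\<^esub> evl q"
    if "keys p \<subseteq> lwords V" "keys q \<subseteq> lwords V" for p q
    by (rule lin_diff[OF lin_evl[unfolded lfree_def] that])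
  have subsp0: "subsp {\<zero>\<^bsub>g\<^esub>} g" by (rule subspI[OF dD(1)]) (auto simp: S)
  have "subsp ?K (lfree V D)" using lin_preimage_subsp[OF lin_evl subsp0] by simp
  moreover have "p \<otimes>\<^bsub>lfree V D\<^esub> q \<in> ?K \<and> q \<otimes>\<^bsub>lfree V D\<^esub> p \<in> ?K" if "p \<in> ?K" "q \<in> carrier (lfree V D)" for p q
    using that valg_mult[OF valg_lfree, of p V D q] valg_mult[OF valg_lfree, of q V D p] valg_zero[OF dD(3) Lc, of q]
    by (simp del: lfree_simps(5) add: evl_mult)
  moreover have "single (Gen (x \<oplus>\<^bsub>V\<^esub> y)) 1 - single (Gen x) 1 - single (Gen y) 1 \<in> ?K"
    if xy: "x \<in> grade V k" "y \<in> grade V k" for x y k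
  proof -
    have h: "x \<in> homog V" "y \<in> homog V" "x \<oplus>\<^bsub>V\<^esub> y \<in> homog V" using xy graded_closedD(1)[OF V xy] by (auto intro: homogI)
    have c: "\<phi> x \<in> carrier g" "\<phi> y \<in> carrier g" using h hlinD(2)[OF \<phi>] dGL(3) by auto
    have k: "keys (single (Gen (x \<oplus>\<^bsub>V\<^esub> y)) 1 - single (Gen x) (1::real)) \<subseteq> lwords V"
      by (intro keys_minus_sub) (use h in auto)
    have k2: "keys (single (Gen (x \<oplus>\<^bsub>V\<^esub> y)) 1 - single (Gen x) 1 - single (Gen y) (1::real)) \<subseteq> lwords V"
      by (intro keys_minus_sub) (use h in auto)
    have "evl (single (Gen (x \<oplus>\<^bsub>V\<^esub> y)) 1 - single (Gen x) 1 - single (Gen y) 1) =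
      (\<phi> x \<oplus>\<^bsub>g\<^esub> \<phi> y) \<oplus>\<^bsub>g\<^esub> (-1) \<odot>\<^bsub>g\<^esub> \<phi> x \<oplus>\<^bsub>g\<^esub> (-1) \<odot>\<^bsub>g\<^esub> \<phi> y"
      using h k c by (simp add: diff evl_single hlinD(3)[OF \<phi> xy] S)
    also have "\<dots> = (\<phi> x \<oplus>\<^bsub>g\<^esub> (-1) \<odot>\<^bsub>g\<^esub> \<phi> x) \<oplus>\<^bsub>g\<^esub> (\<phi> y \<oplus>\<^bsub>g\<^esub> (-1) \<odot>\<^bsub>g\<^esub> \<phi> y)"
      using c by (simp add: S(2-6))
    also have "\<dots> = \<zero>\<^bsub>g\<^esub>" using c by (simp only: vsp_neg2[OF dD(1)] S(1,7))
    finally show ?thesis using k2 by simp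
  qed
  moreover have "single (Gen (c \<odot>\<^bsub>V\<^esub> x)) 1 - single (Gen x) c \<in> ?K" if x: "x \<in> homog V" for c x
  proof -
    have h: "c \<odot>\<^bsub>V\<^esub> x \<in> homog V" by (rule graded_closedD(3)[OF V x])
    have cc: "\<phi> x \<in> carrier g" using x hlinD(2)[OF \<phi>] dGL(3) by auto
    have k: "keys (single (Gen (c \<odot>\<^bsub>V\<^esub> x)) 1 - single (Gen x) c) \<subseteq> lwords V"
      by (intro keys_minus_sub) (use h x in auto)
    have "evl (single (Gen (c \<odot>\<^bsub>V\<^esub> x)) 1 - single (Gen x) c) = c \<odot>\<^bsub>g\<^esub> \<phi> x \<oplus>\<^bsub>g\<^esub> (-1) \<odot>\<^bsub>g\<^esub> (c \<odot>\<^bsub>g\<^esub> \<phi> x)"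
      using h x cc by (simp add: diff evl_single hlinD(4)[OF \<phi> x] S(3,12))
    also have "\<dots> = \<zero>\<^bsub>g\<^esub>" by (rule vsp_neg2[OF dD(1) S(3)[OF cc]])
    finally show ?thesis using k by simp
  qed
  moreover have "single (Br u v) 1 + single (Br v u) (sg (ldeg V u * ldeg V v)) \<in> ?K"
    if uv: "set_lword u \<subseteq> homog V" "set_lword v \<subseteq> homog V" for u v
  proof -
    have c: "leval g \<phi> u \<in> carrier g" "leval g \<phi> v \<in> carrier g" using uv leval_carrier by auto
    let ?s = "sg (ldeg V u * ldeg V v)"
    note m = valg_mult[OF dD(3) c(2,1)]
    have "evl (single (Br u v) 1 + single (Br v u) ?s) =
       leval g \<phi> u \<otimes>\<^bsub>g\<^esub> leval g \<phi> v \<oplus>\<^bsub>g\<^esub> ?s \<odot>\<^bsub>g\<^esub> (leval g \<phi> v \<otimes>\<^bsub>g\<^esub> leval g \<phi> u)"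
      using L(4)[of "single (Br u v) 1" "single (Br v u) ?s"] uv c valg_mult[OF dD(3)]
      by (simp add: evl_single S)
    also have "leval g \<phi> u \<otimes>\<^bsub>g\<^esub> leval g \<phi> v = (- ?s) \<odot>\<^bsub>g\<^esub> (leval g \<phi> v \<otimes>\<^bsub>g\<^esub> leval g \<phi> u)"
      by (rule dD(6)[OF leval_grade leval_grade]) (use uv in auto)
    also have "\<dots> \<oplus>\<^bsub>g\<^esub> ?s \<odot>\<^bsub>g\<^esub> (leval g \<phi> v \<otimes>\<^bsub>g\<^esub> leval g \<phi> u) = \<zero>\<^bsub>g\<^esub>"
      using vsp_distl[OF dD(1) m, of "- ?s" ?s] vsp_null[OF dD(1) m] by simp
    finally have "evl (single (Br u v) 1 + single (Br v u) ?s) = \<zero>\<^bsub>g\<^esub>" .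
    moreover have "keys (single (Br u v) 1 + single (Br v u) ?s) \<subseteq> lwords V"
      by (intro keys_add_sub) (use uv in auto)
    ultimately show ?thesis by simp
  qed
  moreover have "single (Br u (Br v w)) 1 - single (Br (Br u v) w) 1
          - single (Br v (Br u w)) (sg (ldeg V u * ldeg V v)) \<in> ?K"
    if uv: "set_lword u \<subseteq> homog V" "set_lword v \<subseteq> homog V" "set_lword w \<subseteq> homog V" for u v w
  proof -
    let ?s = "sg (ldeg V u * ldeg V v)"
    define a b where "a = (leval g \<phi> u \<otimes>\<^bsub>g\<^esub> leval g \<phi> v) \<otimes>\<^bsub>g\<^esub> leval g \<phi> w"
      and "b = ?s \<odot>\<^bsub>g\<^esub> (leval g \<phi> v \<otimes>\<^bsub>g\<^esub> (leval g \<phi> u \<otimes>\<^bsub>g\<^esub> leval g \<phi> w))"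
    have c: "leval g \<phi> u \<in> carrier g" "leval g \<phi> v \<in> carrier g" "leval g \<phi> w \<in> carrier g" using uv leval_carrier by auto
    have ab: "a \<in> carrier g" "b \<in> carrier g" unfolding a_def b_def using c by (simp_all add: valg_mult[OF dD(3)] S(3))
    have j: "leval g \<phi> u \<otimes>\<^bsub>g\<^esub> (leval g \<phi> v \<otimes>\<^bsub>g\<^esub> leval g \<phi> w) = a \<oplus>\<^bsub>g\<^esub> b"
      unfolding a_def b_def by (rule dD(7)[OF leval_grade leval_grade leval_homog]) (use uv in auto)
    have k: "keys (single (Br u (Br v w)) 1 - single (Br (Br u v) w) (1::real)) \<subseteq> lwords V"
      by (intro keys_minus_sub) (use uv in auto)
    have k2: "keys (single (Br u (Br v w)) 1 - single (Br (Br u v) w) 1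
          - single (Br v (Br u w)) ?s) \<subseteq> lwords V"
      by (intro keys_minus_sub) (use uv in auto)
    have e: "evl (single (Br u (Br v w)) 1) = a \<oplus>\<^bsub>g\<^esub> b" "evl (single (Br (Br u v) w) 1) = a"
      "evl (single (Br v (Br u w)) ?s) = b"
      using uv ab by (simp_all add: evl_single j S(2,12) flip: a_def b_def)
    have "evl (single (Br u (Br v w)) 1 - single (Br (Br u v) w) 1 - single (Br v (Br u w)) ?s)
       = (a \<oplus>\<^bsub>g\<^esub> b) \<oplus>\<^bsub>g\<^esub> (-1) \<odot>\<^bsub>g\<^esub> a \<oplus>\<^bsub>g\<^esub> (-1) \<odot>\<^bsub>g\<^esub> b"
      using uv k by (simp add: diff e)
    also have "\<dots> = (a \<oplus>\<^bsub>g\<^esub> (-1) \<odot>\<^bsub>g\<^esub> a) \<oplus>\<^bsub>g\<^esub> (b \<oplus>\<^bsub>g\<^esub> (-1) \<odot>\<^bsub>g\<^esub> b)"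
      using ab by (simp add: S(2-6))
    also have "\<dots> = \<zero>\<^bsub>g\<^esub>" using ab by (simp only: vsp_neg2[OF dD(1)] S(1,7))
    finally show ?thesis using k2 by simp
  qed
  ultimately show ?thesis unfolding lie_ideal_def by blast
qed

lemma lrel_kernel: "p \<in> lrel V D \<Longrightarrow> evl p = \<zero>\<^bsub>g\<^esub>"
  using lie_ideal_kernel unfolding lrel_eq by blast

lemma videal_lrel: "videal (lrel V D) (lfree V D)"
proof -
  note K = lie_ideal_kernel
  have W: "subsp W (lfree V D)" "\<And>p q. p \<in> W \<Longrightarrow> q \<in> carrier (lfree V D) \<Longrightarrow> p \<otimes>\<^bsub>lfree V D\<^esub> q \<in> W \<and> q \<otimes>\<^bsub>lfree V D\<^esub> p \<in> W"
    if "lie_ideal V D W" for W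
    using that unfolding lie_ideal_def by blast+
  note WS = subspD[OF vsp_lfree W(1)]
  have "subsp (lrel V D) (lfree V D)"
  proof (rule subspI[OF vsp_lfree])
    show "lrel V D \<subseteq> carrier (lfree V D)" using K WS(1)[OF K] unfolding lrel_eq by blast
    show "\<zero>\<^bsub>lfree V D\<^esub> \<in> lrel V D" unfolding lrel_eq using WS(2) by blast
    show "x \<oplus>\<^bsub>lfree V D\<^esub> y \<in> lrel V D" if "x \<in> lrel V D" "y \<in> lrel V D" for x y
      using that WS(3) unfolding lrel_eq by blast
    show "c \<odot>\<^bsub>lfree V D\<^esub> x \<in> lrel V D" if "x \<in> lrel V D" for c x
      using that WS(4) unfolding lrel_eq by blast
  qed
  then show ?thesis unfolding videal_def using W(2) unfolding lrel_eq by blast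
qed

text \<open>The extension is constant on cosets, so its image of a coset is a singleton.\<close>

lemma evl_coset:
  assumes "keys p \<subseteq> lwords V"
  shows "the_elem (evl ` lcls V D p) = evl p"
proof -
  note S = videalD(1)[OF videal_lrel]
  have z: "0 \<in> lrel V D" "lrel V D \<subseteq> carrier (lfree V D)"
    using subsp_zero[OF vsp_lfree S] subsp_sub[OF vsp_lfree S] by simp_all
  have "evl (n + p) = evl p" if n: "n \<in> lrel V D" for n
    using lin_add[OF lin_evl, of n p] lin_in[OF lin_evl, of p] z(2) n assms
    by (auto simp: lrel_kernel vsp_l_zero[OF dD(1)])
  then have "evl ` lcls V D p = {evl p}"
    using z(1) by (auto simp: lcls_def coset_eq)
  then show ?thesis by simp
qed

lemma glie_free_lie: "glie (free_lie V D)"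
proof -
  let ?L = "free_lie V D"
  note N = videal_lrel and S = videalD(1)[OF videal_lrel]
  have L: "lin (lfree V D) ?L (\<lambda>p. lrel V D +>\<^bsub>lfree V D\<^esub> p)"
    unfolding free_lie_def by (rule lin_quot[OF vsp_lfree S])
  have gr: "grade ?L k = (\<lambda>p. lrel V D +>\<^bsub>lfree V D\<^esub> p) ` grade (lfree V D) k" for k
    by (simp only: free_lie_def quot_simps)
  have sub: "subsp (grade ?L k) ?L" for k
    unfolding gr by (rule lin_image_subsp[OF L subsp_grade_lfree])
  have m: "x \<otimes>\<^bsub>?L\<^esub> y \<in> grade ?L (i + j)" if xy: "x \<in> grade ?L i" "y \<in> grade ?L j" for x y i j
  proof -
    obtain p q where pq: "p \<in> grade (lfree V D) i" "q \<in> grade (lfree V D) j"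
      "x = lrel V D +>\<^bsub>lfree V D\<^esub> p" "y = lrel V D +>\<^bsub>lfree V D\<^esub> q"
      using xy unfolding gr by blast
    have "p \<in> carrier (lfree V D)" "q \<in> carrier (lfree V D)"
      using pq subsp_sub[OF vsp_lfree subsp_grade_lfree] by blast+
    then have "x \<otimes>\<^bsub>?L\<^esub> y = lrel V D +>\<^bsub>lfree V D\<^esub> (p \<otimes>\<^bsub>lfree V D\<^esub> q)"
      unfolding free_lie_def pq(3,4) by (rule quot_mult[OF valg_lfree N])
    moreover have "p \<otimes>\<^bsub>lfree V D\<^esub> q \<in> grade (lfree V D) (i + j)"
      unfolding lfree_simps mem_Collect_eq
      by (intro keys_pext_sub) (use pq(1,2) in auto)
    ultimately show ?thesis unfolding gr by blast
  qed
  show ?thesis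
    unfolding glie_def graded_closed_def
    using lin_cod[OF L] m subsp_sub[OF lin_cod[OF L] sub] subsp_add[OF lin_cod[OF L] sub] subsp_smult[OF lin_cod[OF L] sub]
    by simp
qed

end

section \<open>The counit of strictification\<close>

text \<open>The projection to tensors of length 1 is constant on cosets: in a multilinear relation all words have the same
length, and for length 1 the relation is the linearity of the identity.\<close>

lemma pr1_tcls:
  assumes V: "vsp V" "graded_closed V" "homog V \<subseteq> carrier V" and p: "keys p \<subseteq> lists (homog V)"
  shows "pr1 V (tcls V p) = lext V (\<lambda>w. if length w = 1 then hd w else \<zero>\<^bsub>V\<^esub>) p"
proof -
  let ?f = "\<lambda>w. if length w = 1 then hd w else \<zero>\<^bsub>V\<^esub>" and ?Z = "\<zero>\<^bsub>V\<^esub>"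
  note S = vsp_simps[OF V(1)]
  have c: "?f w \<in> carrier V" if "w \<in> lists (homog V)" for w
    using that V(3) S(1) by (cases w) auto
  have L: "lin (tword V) V (lext V ?f)" unfolding tword_def by (rule lin_lext[OF V(1) c])
  have diff: "lext V ?f (p - q) = lext V ?f p \<oplus>\<^bsub>V\<^esub> (-1) \<odot>\<^bsub>V\<^esub> lext V ?f q"
    if "keys p \<subseteq> lists (homog V)" "keys q \<subseteq> lists (homog V)" for p q
    by (rule lin_diff[OF L[unfolded tword_def] that])
  have single: "lext V ?f (single w c) = c \<odot>\<^bsub>V\<^esub> ?f w" if "w \<in> lists (homog V)" for w c
    by (rule lext_single[OF V(1)]) (rule c[OF that])
  have sub: "subsp {?Z} V" by (rule subspI[OF V(1)]) (auto simp: S)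
  have zero: "lext V ?f t = ?Z" if t: "t \<in> trel V" for t
  proof -
    have "lext V ?f t \<in> {?Z}"
    proof (rule lin_vspan_into[OF L tgens_sub[OF V(2)] sub _ t[unfolded trel_eq]])
      show "lext V ?f ` tgens V \<subseteq> {?Z}"
      proof (rule image_subsetI)
        fix p assume "p \<in> tgens V"
        then show "lext V ?f p \<in> {?Z}"
        proof (cases rule: tgens_cases)
          case (add u v x y k)
          have h: "x \<in> homog V" "y \<in> homog V" "x \<oplus>\<^bsub>V\<^esub> y \<in> homog V"
            using add(3,4) graded_closedD(1)[OF V(2) add(3,4)] by (auto intro: homogI)
          then have xc: "x \<in> carrier V" "y \<in> carrier V" using V(3) by auto
          let ?w = "\<lambda>z. u @ [z] @ v"
          have w: "?w x \<in> lists (homog V)" "?w y \<in> lists (homog V)" "?w (x \<oplus>\<^bsub>V\<^esub> y) \<in> lists (homog V)" using h add(1,2) by auto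
          have k: "keys (single (?w (x \<oplus>\<^bsub>V\<^esub> y)) 1 - single (?w x) (1::real)) \<subseteq> lists (homog V)"
            by (rule keys_diff_single[OF w(3,1)])
          have "lext V ?f p = lext V ?f (single (?w (x \<oplus>\<^bsub>V\<^esub> y)) 1 - single (?w x) 1) \<oplus>\<^bsub>V\<^esub> (-1) \<odot>\<^bsub>V\<^esub> lext V ?f (single (?w y) 1)"
            unfolding add(5) by (rule diff[OF k]) (use w(2) in simp)
          also have "lext V ?f (single (?w (x \<oplus>\<^bsub>V\<^esub> y)) 1 - single (?w x) 1) =
            lext V ?f (single (?w (x \<oplus>\<^bsub>V\<^esub> y)) 1) \<oplus>\<^bsub>V\<^esub> (-1) \<odot>\<^bsub>V\<^esub> lext V ?f (single (?w x) 1)"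
            by (rule diff) (use w in simp_all)
          also have "\<dots> = 1 \<odot>\<^bsub>V\<^esub> ?f (?w (x \<oplus>\<^bsub>V\<^esub> y)) \<oplus>\<^bsub>V\<^esub> (-1) \<odot>\<^bsub>V\<^esub> (1 \<odot>\<^bsub>V\<^esub> ?f (?w x))"
            by (simp only: single w)
          also have "lext V ?f (single (?w y) 1) = 1 \<odot>\<^bsub>V\<^esub> ?f (?w y)" by (rule single[OF w(2)])
          also have "1 \<odot>\<^bsub>V\<^esub> ?f (?w (x \<oplus>\<^bsub>V\<^esub> y)) \<oplus>\<^bsub>V\<^esub> (-1) \<odot>\<^bsub>V\<^esub> (1 \<odot>\<^bsub>V\<^esub> ?f (?w x)) \<oplus>\<^bsub>V\<^esub> (-1) \<odot>\<^bsub>V\<^esub> (1 \<odot>\<^bsub>V\<^esub> ?f (?w y)) = ?Z"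
          proof (cases "u = [] \<and> v = []")
            case True
            have "(x \<oplus>\<^bsub>V\<^esub> y) \<oplus>\<^bsub>V\<^esub> (-1) \<odot>\<^bsub>V\<^esub> x \<oplus>\<^bsub>V\<^esub> (-1) \<odot>\<^bsub>V\<^esub> y = (x \<oplus>\<^bsub>V\<^esub> (-1) \<odot>\<^bsub>V\<^esub> x) \<oplus>\<^bsub>V\<^esub> (y \<oplus>\<^bsub>V\<^esub> (-1) \<odot>\<^bsub>V\<^esub> y)"
              using xc by (simp add: S(2-6))
            also have "\<dots> = ?Z" using xc by (simp only: vsp_neg2[OF V(1)] S(1,7))
            finally show ?thesis using True xc by (simp add: S(2,12))
          next
            case False
            then show ?thesis by (auto simp: S)
          qed
          finally show ?thesis by simp
        next
          case (smult u v x c)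
          have h: "c \<odot>\<^bsub>V\<^esub> x \<in> homog V" by (rule graded_closedD(3)[OF V(2) smult(3)])
          have xc: "x \<in> carrier V" using smult(3) V(3) by auto
          let ?w = "\<lambda>z. u @ [z] @ v"
          have w: "?w x \<in> lists (homog V)" "?w (c \<odot>\<^bsub>V\<^esub> x) \<in> lists (homog V)" using h smult(1-3) by auto
          have "lext V ?f p = lext V ?f (single (?w (c \<odot>\<^bsub>V\<^esub> x)) 1) \<oplus>\<^bsub>V\<^esub> (-1) \<odot>\<^bsub>V\<^esub> lext V ?f (single (?w x) c)"
            unfolding smult(4) by (rule diff) (use w in auto)
          also have "\<dots> = 1 \<odot>\<^bsub>V\<^esub> ?f (?w (c \<odot>\<^bsub>V\<^esub> x)) \<oplus>\<^bsub>V\<^esub> (-1) \<odot>\<^bsub>V\<^esub> (c \<odot>\<^bsub>V\<^esub> ?f (?w x))"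
            by (simp only: single w)
          also have "\<dots> = ?Z"
            using vsp_neg2[OF V(1) S(3)[OF xc, of c]] xc by (cases "u = [] \<and> v = []") (auto simp: S(1,3,7,12,14))
          finally show ?thesis by simp
        qed
      qed
    qed
    then show ?thesis by simp
  qed
  have T: "0 \<in> trel V" "trel V \<subseteq> {p. keys p \<subseteq> lists (homog V)}"
    using subsp_trel[OF V(2)] by (simp_all add: tword_def subsp_free_iff)
  have "lext V ?f (t + p) = lext V ?f p" if t: "t \<in> trel V" for t
  proof -
    have tk: "keys t \<subseteq> lists (homog V)" using T(2) t by auto
    have "lext V ?f (t + p) = lext V ?f t \<oplus>\<^bsub>V\<^esub> lext V ?f p" using lin_add[OF L, of t p] tk p by simp
    moreover have "lext V ?f p \<in> carrier V" using lin_in[OF L, of p] p by simp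
    ultimately show ?thesis by (simp only: zero[OF t] S(7))
  qed
  then have "lext V ?f ` tcls V p = {lext V ?f p}" using T(1) by (auto simp: tcls_eq)
  then show ?thesis by (simp add: pr1_def)
qed

section \<open>Strictification of a dg Lie algebra\<close>

abbreviation "str_cls g \<equiv> lcls (str_gen g) (str_dif_gen g)"

context
  fixes g :: "'g dg"
  assumes g: "dg_lie g"
begin

private lemmas dgD = dg_lieD[OF g] and dgGL = glieD[OF dg_lie_glie[OF g]]

private lemma sg_facts:
  "vsp (susp g)" "graded_closed (susp g)" "deg_unique (susp g)" "homog (susp g) \<subseteq> carrier (susp g)"
  using susp_props(1)[OF dgD(1)] susp_props(2)[OF dgGL(2)] susp_props(3)[OF dgD(4)] dgGL(3) by simp_all

lemma str_gen_simps:
  "grade (str_gen g) k = grade (tens_alg (susp g)) (k - 1) \<inter> rsym_tens (susp g)"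
  "x \<oplus>\<^bsub>str_gen g\<^esub> y = x \<oplus>\<^bsub>tens_alg (susp g)\<^esub> y" "c \<odot>\<^bsub>str_gen g\<^esub> x = c \<odot>\<^bsub>tens_alg (susp g)\<^esub> x"
  by (auto simp: str_gen_def desusp_def rce_def restr_def ce_def rsym_tens_def)

lemma tens_smult_tcls:
  "keys p \<subseteq> lists (homog g) \<Longrightarrow> c \<odot>\<^bsub>tens_alg (susp g)\<^esub> tcls (susp g) p = tcls (susp g) (psc c p)"
  using lin_smult[OF lin_tcls[OF sg_facts(2)], of p c] by simp

text \<open>Transpositions are linear on representatives and compatible with the relations, so being fixed by them is
preserved by linear combinations.\<close>

lemma sym_tens_closed:
  assumes "x \<in> sym_tens (susp g)"
  shows "y \<in> sym_tens (susp g) \<Longrightarrow> x \<oplus>\<^bsub>tens_alg (susp g)\<^esub> y \<in> sym_tens (susp g)"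
    and "c \<odot>\<^bsub>tens_alg (susp g)\<^esub> x \<in> sym_tens (susp g)"
proof -
  note T = vsp_tens[OF sg_facts(2)]
  note cs = cmap_swapw[OF sg_facts]
  have rep: "\<exists>p. keys p \<subseteq> lists (homog g) \<and> x = tcls (susp g) p \<and>
      (\<forall>i. tcls (susp g) (pext (swapw (susp g) i) p) = tcls (susp g) p)" if "x \<in> sym_tens (susp g)" for x
  proof -
    have "x \<in> carrier (tens_alg (susp g))"
      and i: "\<And>i. cmap (tword (susp g)) (trel (susp g)) (pext (swapw (susp g) i)) x = x"
      using that by (simp_all add: sym_tens_def)
    then obtain p where p: "keys p \<subseteq> lists (homog g)" "x = tcls (susp g) p" by auto
    then show ?thesis using i cs by (intro exI[of _ p]) simp
  qed
  obtain p where p: "keys p \<subseteq> lists (homog g)" "x = tcls (susp g) p"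
      "\<And>i. tcls (susp g) (pext (swapw (susp g) i) p) = tcls (susp g) p" using rep[OF assms] by blast
  have sw: "keys (pext (swapw (susp g) i) p) \<subseteq> lists (homog g)" for i
    using swapw_lists[OF sg_facts] p(1) by (intro keys_pext_sub) auto
  have x: "x \<in> carrier (tens_alg (susp g))" using assms by (simp add: sym_tens_def)
  show "c \<odot>\<^bsub>tens_alg (susp g)\<^esub> x \<in> sym_tens (susp g)"
  proof -
    have "cmap (tword (susp g)) (trel (susp g)) (pext (swapw (susp g) i)) (c \<odot>\<^bsub>tens_alg (susp g)\<^esub> x) = c \<odot>\<^bsub>tens_alg (susp g)\<^esub> x" for i
      unfolding p(2) tens_smult_tcls[OF p(1)] cs pext_psc
      using tens_smult_tcls[OF sw[of i], of c] tens_smult_tcls[OF p(1), of c] p(3)[of i] by simp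
    then show ?thesis using vsp_smult[OF T x] by (simp add: sym_tens_def del: tens_alg_simps)
  qed
  assume y: "y \<in> sym_tens (susp g)"
  then obtain q where q: "y = tcls (susp g) q" "\<And>i. tcls (susp g) (pext (swapw (susp g) i) q) = tcls (susp g) q"
    using rep[OF y] by blast
  have yc: "y \<in> carrier (tens_alg (susp g))" using y by (simp add: sym_tens_def)
  have "cmap (tword (susp g)) (trel (susp g)) (pext (swapw (susp g) i)) (x \<oplus>\<^bsub>tens_alg (susp g)\<^esub> y) = x \<oplus>\<^bsub>tens_alg (susp g)\<^esub> y" for i
  proof -
    have "x \<oplus>\<^bsub>tens_alg (susp g)\<^esub> y = tcls (susp g) (p + q)"
      unfolding tens_alg_simps p(2) q(1) by (rule tcls_add[OF sg_facts(2)])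
    moreover have "tcls (susp g) (pext (swapw (susp g) i) (p + q)) = tcls (susp g) (p + q)"
      unfolding pext_add using tcls_add[OF sg_facts(2), of "pext (swapw (susp g) i) p" "pext (swapw (susp g) i) q"]
        tcls_add[OF sg_facts(2), of p q] p(3) q(2) by simp
    ultimately show ?thesis by (simp only: cs)
  qed
  then show "x \<oplus>\<^bsub>tens_alg (susp g)\<^esub> y \<in> sym_tens (susp g)"
    using vsp_add[OF T x yc] by (simp add: sym_tens_def del: tens_alg_simps)
qed

lemma subsp_tlen: "graded_closed V \<Longrightarrow> subsp (tlen V n) (tens_alg V)"
  unfolding tlen_def by (rule vspan_subsp[OF vsp_tens]) auto

lemma subsp_grade_tens: "graded_closed V \<Longrightarrow> subsp (grade (tens_alg V) k) (tens_alg V)"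
  unfolding tens_alg_simps(4) by (rule lin_image_subsp[OF lin_tcls subsp_grade_tword])

lemma graded_closed_str_gen: "graded_closed (str_gen g)"
proof -
  note T = vsp_tens[OF sg_facts(2)]
  note A = subsp_add[OF T] and B = subsp_smult[OF T]
  show ?thesis
    unfolding graded_closed_def str_gen_simps rsym_tens_def
    by (auto simp del: tens_alg_simps intro!: sym_tens_closed A[OF subsp_tlen[OF sg_facts(2)]]
      B[OF subsp_tlen[OF sg_facts(2)]] A[OF subsp_grade_tens[OF sg_facts(2)]] B[OF subsp_grade_tens[OF sg_facts(2)]])
qed

lemmas pr1_susp = pr1_tcls[OF sg_facts(1,2,4)]

text \<open>The two shifts, of \<open>g\<close> to \<open>sg\<close> and of the symmetric tensors to the generators, cancel on tensors of length 1,
so the projection has degree 0.\<close>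

lemma hlin_pr1: "hlin (str_gen g) g (pr1 (susp g))"
proof -
  let ?f = "\<lambda>w. if length w = 1 then hd w else \<zero>\<^bsub>susp g\<^esub>"
  note T = vsp_tens[OF sg_facts(2)]
  have L: "lin (tword (susp g)) (susp g) (lext (susp g) ?f)"
    unfolding tword_def
  proof (rule lin_lext[OF sg_facts(1)])
    fix w assume "w \<in> lists (homog (susp g))"
    then show "?f w \<in> carrier (susp g)" using sg_facts(4) vsp_zero[OF sg_facts(1)] by (cases w) auto
  qed
  have rep: "\<exists>p. keys p \<subseteq> {w \<in> lists (homog g). wdeg (susp g) w = k - 1} \<and> x = tcls (susp g) p"
    if "x \<in> grade (str_gen g) k" for x k
    using that by (auto simp: str_gen_simps)
  have gr: "pr1 (susp g) x \<in> grade g k" if "x \<in> grade (str_gen g) k" for x k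
  proof -
    obtain p where p: "keys p \<subseteq> {w \<in> lists (homog g). wdeg (susp g) w = k - 1}" "x = tcls (susp g) p"
      using rep[OF \<open>x \<in> grade (str_gen g) k\<close>] by blast
    have "lext (susp g) ?f p \<in> grade (susp g) (k - 1)"
    proof (rule lext_in_subsp[OF sg_facts(1)])
      show sub: "subsp (grade (susp g) (k - 1)) (susp g)"
        using subspI[OF sg_facts(1), of "grade g k"] subspD[OF dgD(1,2)] by simp
      fix w assume "w \<in> keys p"
      then have w: "w \<in> lists (homog g)" "wdeg (susp g) w = k - 1" using p(1) by auto
      show "?f w \<in> grade (susp g) (k - 1)"
      proof (cases "length w = 1")
        case True
        then obtain a where a: "w = [a]" by (auto simp: length_Suc_conv)
        have "a \<in> grade (susp g) (deg (susp g) a)" by (rule deg_mem) (use w a in auto)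
        then show ?thesis using w a by simp
      qed (use subsp_zero[OF sg_facts(1) sub] in simp)
    qed
    moreover have "pr1 (susp g) x = lext (susp g) ?f p"
      unfolding p(2) by (rule pr1_susp) (use p(1) in auto)
    ultimately show ?thesis by simp
  qed
  have h: "pr1 (susp g) (tcls (susp g) p) = lext (susp g) ?f p" if "keys p \<subseteq> lists (homog g)" for p
    using pr1_susp[of p] that by simp
  show ?thesis
    unfolding hlin_def
  proof (intro allI ballI conjI)
    fix k x assume x: "x \<in> grade (str_gen g) k"
    show "pr1 (susp g) x \<in> grade g k" by (rule gr[OF x])
    obtain p where p: "keys p \<subseteq> {w \<in> lists (homog g). wdeg (susp g) w = k - 1}" "x = tcls (susp g) p"
      using rep[OF x] by blast
    have pl: "keys p \<subseteq> lists (homog g)" using p by auto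
    show "pr1 (susp g) (c \<odot>\<^bsub>str_gen g\<^esub> x) = c \<odot>\<^bsub>g\<^esub> pr1 (susp g) x" for c
      unfolding str_gen_simps p(2) tens_smult_tcls[OF pl] h[OF pl] h[OF keys_psc_sub[OF pl]]
      using lin_smult[OF L, of p c] pl by simp
    fix y assume y: "y \<in> grade (str_gen g) k"
    obtain q where q: "keys q \<subseteq> {w \<in> lists (homog g). wdeg (susp g) w = k - 1}" "y = tcls (susp g) q"
      using rep[OF y] by blast
    have ql: "keys q \<subseteq> lists (homog g)" using q by auto
    have "x \<oplus>\<^bsub>str_gen g\<^esub> y = tcls (susp g) (p + q)"
      unfolding str_gen_simps tens_alg_simps p(2) q(2) by (rule tcls_add[OF sg_facts(2)])
    then show "pr1 (susp g) (x \<oplus>\<^bsub>str_gen g\<^esub> y) = pr1 (susp g) x \<oplus>\<^bsub>g\<^esub> pr1 (susp g) y"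
      using h[OF pl] h[OF ql] h[OF keys_add_sub[OF pl ql]] lin_add[OF L, of p q] pl ql p(2) q(2) by simp
  qed
qed

private lemmas FL = graded_closed_str_gen hlin_pr1

lemma rho_lcls:
  "keys p \<subseteq> lwords (str_gen g) \<Longrightarrow>
    rho g (str_cls g p) = lext g (leval g (pr1 (susp g))) p"
  unfolding rho_def by (rule evl_coset[OF g FL])

lemma glie_strict: "glie (strict g)"
  unfolding strict_def by (rule glie_free_lie[OF g FL])

lemma strict_rep:
  "x \<in> grade (strict g) k \<longleftrightarrow> (\<exists>p. keys p \<subseteq> {w \<in> lwords (str_gen g). ldeg (str_gen g) w = k} \<and>
     x = str_cls g p)"
  unfolding strict_def free_lie_def quot_simps lfree_simps lcls_def by blast

lemma lin_lcls: "lin (lfree (str_gen g) (str_dif_gen g)) (strict g) (str_cls g)"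
  unfolding strict_def free_lie_def lcls_def[abs_def]
  by (rule lin_quot[OF vsp_lfree videalD(1)[OF videal_lrel[OF g FL]]])

lemma lin_rho: "lin (strict g) g (rho g)"
proof (rule linI[OF glie_vsp[OF glie_strict] dgD(1)])
  note E = linD[OF lin_evl[OF g FL, where D = "str_dif_gen g"], unfolded lfree_simps mem_Collect_eq]
  note C = linD[OF lin_lcls, unfolded lfree_simps mem_Collect_eq]
  have rep: "\<exists>p. keys p \<subseteq> lwords (str_gen g) \<and> x = str_cls g p"
    if "x \<in> carrier (strict g)" for x
    using that unfolding strict_def free_lie_def quot_simps lfree_simps lcls_def by blast
  fix x assume "x \<in> carrier (strict g)"
  then obtain p where p: "keys p \<subseteq> lwords (str_gen g)" "x = str_cls g p"
    using rep by blast
  show "rho g x \<in> carrier g" unfolding p(2) rho_lcls[OF p(1)] by (rule E(3)[OF p(1)])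
  show "rho g (c \<odot>\<^bsub>strict g\<^esub> x) = c \<odot>\<^bsub>g\<^esub> rho g x" for c
    unfolding p(2) C(5)[OF p(1), symmetric] rho_lcls[OF p(1)] rho_lcls[OF keys_psc_sub[OF p(1)]] by (rule E(5)[OF p(1)])
  fix y assume "y \<in> carrier (strict g)"
  then obtain q where q: "keys q \<subseteq> lwords (str_gen g)" "y = str_cls g q"
    using rep by blast
  show "rho g (x \<oplus>\<^bsub>strict g\<^esub> y) = rho g x \<oplus>\<^bsub>g\<^esub> rho g y"
    unfolding p(2) q(2) C(4)[OF p(1) q(1), symmetric] rho_lcls[OF p(1)] rho_lcls[OF q(1)] rho_lcls[OF keys_add_sub[OF p(1) q(1)]]
    by (rule E(4)[OF p(1) q(1)])
qed

text \<open>The bracket of \<open>S(g)\<close> is induced by the bracketing of words, and \<open>\<rho>\<close> evaluates bracketed words.\<close>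

lemma strict_functor: "env_functor (strict g) g (rho g)"
proof
  show "glie (strict g)" by (rule glie_strict)
  show "glie g" "valg g" "deg_unique g" by (rule dgD(5) dgD(3) dgD(4))+
  note L = linD[OF lin_rho] and hs = glie_homog_sub[OF glie_strict]
  have gr: "rho g x \<in> grade g k" if x: "x \<in> grade (strict g) k" for x k
  proof -
    obtain p where p: "keys p \<subseteq> {w \<in> lwords (str_gen g). ldeg (str_gen g) w = k}"
      "x = str_cls g p" using x unfolding strict_rep by blast
    have pl: "keys p \<subseteq> lwords (str_gen g)" using p by auto
    have "lext g (leval g (pr1 (susp g))) p \<in> grade g k"
    proof (rule lext_in_subsp[OF dgD(1,2)])
      fix w assume "w \<in> keys p"
      then show "leval g (pr1 (susp g)) w \<in> grade g k"
        using leval_grade[OF g FL, of w] p(1) by auto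
    qed
    then show ?thesis by (simp add: p(2) rho_lcls[OF pl])
  qed
  have sc: "grade (strict g) k \<subseteq> carrier (strict g)" for k
    by (rule order_trans[OF _ hs]) (auto intro: homogI)
  show "hlin (strict g) g (rho g)"
    unfolding hlin_def using gr L(4)[OF subsetD[OF sc] subsetD[OF sc]] L(5)[OF subsetD[OF sc]] by blast
  show "rho g (x \<otimes>\<^bsub>strict g\<^esub> y) = rho g x \<otimes>\<^bsub>g\<^esub> rho g y" if xy: "x \<in> homog (strict g)" "y \<in> homog (strict g)" for x y
  proof -
    obtain p q where pq: "keys p \<subseteq> lwords (str_gen g)" "keys q \<subseteq> lwords (str_gen g)"
      "x = str_cls g p" "y = str_cls g q"
      using deg_mem[OF xy(1)] deg_mem[OF xy(2)] unfolding strict_rep by blast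
    have pqc: "p \<in> carrier (lfree (str_gen g) (str_dif_gen g))" "q \<in> carrier (lfree (str_gen g) (str_dif_gen g))" using pq by simp_all
    have "x \<otimes>\<^bsub>strict g\<^esub> y = str_cls g (p \<otimes>\<^bsub>lfree (str_gen g) (str_dif_gen g)\<^esub> q)"
      unfolding pq(3,4) lcls_def strict_def free_lie_def by (rule quot_mult[OF valg_lfree videal_lrel[OF g FL] pqc])
    moreover have "keys (p \<otimes>\<^bsub>lfree (str_gen g) (str_dif_gen g)\<^esub> q) \<subseteq> lwords (str_gen g)"
      using valg_mult[OF valg_lfree pqc] by simp
    ultimately show ?thesis
      using evl_mult[OF g FL pq(1,2), of "str_dif_gen g"] by (simp only: rho_lcls pq)
  qed
qed

text \<open>Makes \<open>\<eta>\<close> well defined: the symmetrization of a nonempty word is a symmetric tensor of positive length.\<close>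

lemma symz_gen:
  assumes "w \<in> lists (homog g)" "w \<noteq> []"
  shows "symz (susp g) w \<in> homog (str_gen g)"
proof -
  have w: "w \<in> lists (homog (susp g))" using assms by simp
  note k = keys_symz_word[OF w]
  have c: "keys (symz_word (susp g) w) \<subseteq> lists (homog (susp g))" using k by auto
  have "symz (susp g) w \<in> sym_tens (susp g)"
    unfolding sym_tens_def symz_eq using c by (simp add: cmap_swapw[OF sg_facts] symz_word_symmetric)
  moreover have "symz (susp g) w \<in> tlen (susp g) 1"
    unfolding tlen_eq[OF sg_facts(2)] symz_eq
    by (rule imageI) (use k assms(2) in \<open>auto simp: Suc_le_eq\<close>)
  moreover have "symz (susp g) w \<in> grade (tens_alg (susp g)) (wdeg (susp g) w + 1 - 1)"
    unfolding tens_alg_simps symz_eq by (rule imageI) (use k in auto)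
  ultimately have "symz (susp g) w \<in> grade (str_gen g) (wdeg (susp g) w + 1)"
    unfolding str_gen_simps rsym_tens_def by blast
  then show ?thesis by (rule homogI)
qed

lemma eta_homog:
  assumes "w \<in> lists (homog g)" "w \<noteq> []"
  shows "eta g w \<in> homog (strict g)"
proof -
  have "eta g w \<in> grade (strict g) (deg (str_gen g) (symz (susp g) w))"
    unfolding strict_rep eta_def
    by (rule exI[of _ "single (Gen (symz (susp g) w)) 1"]) (use symz_gen[OF assms] in simp)
  then show ?thesis by (rule homogI)
qed

text \<open>All words in the symmetrization of \<open>w\<close> have the length of \<open>w\<close>, and \<open>\<rho>\<close> projects to length 1.  This is the
triangle identity: \<open>\<rho> \<circ> \<eta>\<close> is the identity morphism, with linear component \<open>id\<close> and no higher ones.\<close>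

lemma rho_eta:
  assumes w: "w \<in> lists (homog g)" "w \<noteq> []"
  shows "rho g (eta g w) = (if length w = 1 then hd w else \<zero>\<^bsub>g\<^esub>)"
proof -
  let ?f = "\<lambda>w. if length w = 1 then hd w else \<zero>\<^bsub>susp g\<^esub>"
  let ?X = "symz (susp g) w"
  have wl: "w \<in> lists (homog (susp g))" using w by simp
  have c: "keys (symz_word (susp g) w) \<subseteq> lists (homog (susp g))"
    "keys (symz_word (susp g) w) \<subseteq> {v. length v = length w}" using keys_symz_word[OF wl] by auto
  have pc: "pr1 (susp g) ?X \<in> carrier g" using hlinD(2)[OF hlin_pr1 symz_gen[OF w]] dgGL(3) by auto
  have "rho g (eta g w) = lext g (leval g (pr1 (susp g))) (single (Gen ?X) 1)"
    unfolding eta_def by (rule rho_lcls) (use symz_gen[OF w] in simp)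
  also have "\<dots> = pr1 (susp g) ?X"
    using pc by (subst lext_single[OF dgD(1)]) (simp_all add: vsp_one[OF dgD(1)])
  also have "\<dots> = (if length w = 1 then hd w else \<zero>\<^bsub>g\<^esub>)"
  proof (cases "length w = 1")
    case True
    then obtain x where x: "w = [x]" by (auto simp: length_Suc_conv)
    have xc: "x \<in> carrier g" using w x dgGL(3) by auto
    have "pr1 (susp g) ?X = lext (susp g) ?f (single [x] 1)"
      unfolding x symz_singleton by (rule pr1_susp) (use wl x in simp)
    also have "\<dots> = x" using xc by (subst lext_single[OF sg_facts(1)]) (simp_all add: vsp_one[OF dgD(1)])
    finally show ?thesis using x by simp
  next
    case False
    have "pr1 (susp g) ?X = lext (susp g) ?f (symz_word (susp g) w)"
      unfolding symz_eq by (rule pr1_susp[OF c(1)])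
    also have "\<dots> \<in> {\<zero>\<^bsub>g\<^esub>}"
    proof (rule lext_in_subsp[OF sg_facts(1)])
      show "subsp {\<zero>\<^bsub>g\<^esub>} (susp g)"
        using subspI[OF sg_facts(1), of "{\<zero>\<^bsub>g\<^esub>}"] by (simp add: vsp_simps[OF dgD(1)])
    qed (use c(2) False in auto)
    finally show ?thesis using False by simp
  qed
  finally show ?thesis .
qed

text \<open>The letterwise lift \<open>x \<mapsto> \<eta>\<^sub>1(x)\<close> respects filtrations because \<open>\<eta>\<^sub>1(x)\<close> is the generator of the tensor \<open>x\<close> of length 1, of the same weight.\<close>

lemma eta_fil:
  assumes x: "x \<in> homog g" "x \<in> F l"
  shows "eta g [x] \<in> str_fil g F l"
proof -
  have X: "symz (susp g) [x] \<in> homog (str_gen g)" by (rule symz_gen) (use x in simp_all)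
  have "symz (susp g) [x] \<in> twt (susp g) F l"
    unfolding twt_eq[OF sg_facts(2)] symz_singleton
    by (rule imageI) (use x in \<open>auto simp: wt_words_def intro!: exI[of _ "[l]"]\<close>)
  moreover have "symz (susp g) [x] \<in> rsym_tens (susp g)"
    using X unfolding homog_def str_gen_simps by blast
  ultimately show ?thesis
    unfolding str_fil_def eta_def using X
    by (intro vspan_base CollectI exI[of _ "Gen (symz (susp g) [x])"]) simp
qed

lemma lie_filtrationD:
  assumes F: "lie_filtration g F"
  shows "\<And>k. subsp (F k) g" "\<And>i j x y. x \<in> F i \<Longrightarrow> y \<in> F j \<Longrightarrow> x \<otimes>\<^bsub>g\<^esub> y \<in> F (i + j)"
    "\<And>k. F (Suc k) \<subseteq> F k" "F 0 = carrier g"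
proof -
  note F' = F[unfolded lie_filtration_def]
  from F' have "\<forall>k. graded_subspace (F k) g \<and> (\<forall>x\<in>F k. dif g x \<in> F k \<and>
        (\<forall>y\<in>carrier g. x \<otimes>\<^bsub>g\<^esub> y \<in> F k \<and> y \<otimes>\<^bsub>g\<^esub> x \<in> F k))" by (elim conjE)
  then show "subsp (F k) g" for k unfolding graded_subspace_def by blast
  from F' have "\<forall>i j. \<forall>x\<in>F i. \<forall>y\<in>F j. x \<otimes>\<^bsub>g\<^esub> y \<in> F (i + j)" by (elim conjE)
  then show "x \<otimes>\<^bsub>g\<^esub> y \<in> F (i + j)" if "x \<in> F i" "y \<in> F j" for i j x y using that by blast
  from F' have "\<forall>k. F (Suc k) \<subseteq> F k" by (elim conjE)
  then show "F (Suc k) \<subseteq> F k" for k by blast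
  from F' show "F 0 = carrier g" by (elim conjE)
qed

text \<open>The projection to length 1 keeps only letters of at least the given weight, and brackets add weights in \<open>g\<close> as
they do for Lie monomials.\<close>

lemma rho_fil:
  assumes F: "lie_filtration g F" and x: "x \<in> str_fil g F l"
  shows "rho g x \<in> F l"
proof -
  note Fs = lie_filtrationD(1)[OF F] and Fm = lie_filtrationD(2)[OF F] and Fd = lie_filtrationD(3)[OF F]
  have Fa: "i \<le> j \<Longrightarrow> F j \<subseteq> F i" for i j by (rule lift_Suc_antimono_le[of F, OF Fd])
  have pr: "pr1 (susp g) X \<in> F k" if X: "X \<in> twt (susp g) F k" for X k
  proof -
    obtain p where p: "X = tcls (susp g) p" "keys p \<subseteq> wt_words (susp g) F k"
      using X unfolding twt_eq[OF sg_facts(2)] by auto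
    have "pr1 (susp g) X = lext (susp g) (\<lambda>w. if length w = 1 then hd w else \<zero>\<^bsub>susp g\<^esub>) p"
      unfolding p(1) by (rule pr1_susp) (use p(2) in \<open>auto simp: wt_words_def\<close>)
    also have "\<dots> \<in> F k"
    proof (rule lext_in_subsp[OF sg_facts(1)])
      show "subsp (F k) (susp g)" using subspI[OF sg_facts(1), of "F k"] subspD[OF dgD(1) Fs] by simp
      fix w assume "w \<in> keys p"
      then obtain l where l: "length l = length w" "\<forall>i<length w. w ! i \<in> F (l ! i)" "k \<le> sum_list l"
        using p(2) unfolding wt_words_def by blast
      show "(if length w = 1 then hd w else \<zero>\<^bsub>susp g\<^esub>) \<in> F k"
      proof (cases "length w = 1")
        case True
        then obtain a b where "w = [a]" "l = [b]" using l(1) by (auto simp: length_Suc_conv)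
        then show ?thesis using l Fa[of k b] by auto
      qed (use subsp_zero[OF dgD(1) Fs] in simp)
    qed
    finally show ?thesis .
  qed
  have lv: "leval g (pr1 (susp g)) w \<in> F k" if "lwt (\<lambda>k. rsym_tens (susp g) \<inter> twt (susp g) F k) w k" for w k
    using that
  proof (induction w arbitrary: k)
    case (Gen x)
    then show ?case using pr by simp
  next
    case (Br u v)
    then obtain i j where ij: "k \<le> i + j" "leval g (pr1 (susp g)) u \<in> F i" "leval g (pr1 (susp g)) v \<in> F j" by auto
    show ?case using Fm[OF ij(2,3)] Fa[OF ij(1)] by auto
  qed
  let ?G = "{str_cls g (single w 1) | w. set_lword w \<subseteq> homog (str_gen g) \<and>
        lwt (\<lambda>k. rsym_tens (susp g) \<inter> twt (susp g) F k) w l}"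
  show ?thesis
  proof (rule lin_vspan_into[OF lin_rho _ Fs _ x[unfolded str_fil_def]])
    show "?G \<subseteq> carrier (strict g)"
      using lin_in[OF lin_lcls] by auto
    show "rho g ` ?G \<subseteq> F l"
    proof (rule image_subsetI)
      fix X assume "X \<in> ?G"
      then obtain w where w: "X = str_cls g (single w 1)" "set_lword w \<subseteq> homog (str_gen g)"
        "lwt (\<lambda>k. rsym_tens (susp g) \<inter> twt (susp g) F k) w l" by blast
      have "rho g X = lext g (leval g (pr1 (susp g))) (single w 1)"
        unfolding w(1) by (rule rho_lcls) (use w(2) in simp)
      also have "\<dots> = leval g (pr1 (susp g)) w"
        using leval_carrier[OF g FL, of w] w(2) by (subst lext_single[OF dgD(1)]) (simp_all add: vsp_one[OF dgD(1)])
      finally show "rho g X \<in> F l" using lv[OF w(3)] by simp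
    qed
  qed
qed

end

section \<open>Differential forms as a graded vector space\<close>

lemma eventually_chart:
  assumes W: "openin (Euclidean_space n) W" and x: "x \<in> W" and i: "i < n"
  shows "\<forall>\<^sub>F s in nhds (x i). x(i := s) \<in> W"
proof -
  have x0: "x \<in> topspace (Euclidean_space n)" using openin_subset[OF W] x by auto
  have "continuous_map euclideanreal (Euclidean_space n) (\<lambda>s. x(i := s))"
    unfolding Euclidean_space_def continuous_map_in_subtopology continuous_map_componentwise_UNIV
  proof (intro conjI allI)
    show "continuous_map euclideanreal euclideanreal (\<lambda>s. (x(i := s)) k)" for k
      by (cases "k = i") auto
    show "(\<lambda>s. x(i := s)) \<in> topspace euclideanreal \<rightarrow> {x. \<forall>i\<ge>n. x i = 0}"
      using x0 i by (auto simp: topspace_Euclidean_space)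
  qed
  then have "openin euclideanreal {s \<in> topspace euclideanreal. x(i := s) \<in> W}"
    by (rule openin_continuous_map_preimage[OF _ W])
  then have "open {s. x(i := s) \<in> W}" by simp
  then show ?thesis using x by (auto simp: eventually_nhds)
qed

text \<open>Partial derivatives of higher order are derivatives of functions known on \<open>W\<close> only; as \<open>W\<close> is open, the
inductive formula holds near the point at which the next derivative is taken.\<close>

lemma partials_combination:
  assumes W: "openin (Euclidean_space n) W" and f: "smooth_fn n W f" and h: "smooth_fn n W h"
    and l: "ks \<in> lists {..<n}" and x: "x \<in> W"
  shows "partials ks (\<lambda>x. r * f x + s * h x) x = r * partials ks f x + s * partials ks h x"
  using l x
proof (induction ks arbitrary: x rule: list.induct)
  case (Cons i js)
  have i: "i < n" and js: "js \<in> lists {..<n}" using Cons.prems(1) by simp_all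
  let ?F = "\<lambda>f t. partials js f (x(i := t))"
  have "\<forall>\<^sub>F t in nhds (x i). ?F (\<lambda>x. r * f x + s * h x) t = r * ?F f t + s * ?F h t"
    using eventually_chart[OF W Cons.prems(2) i] by eventually_elim (rule Cons.IH[OF js])
  then have "partials (i # js) (\<lambda>x. r * f x + s * h x) x = deriv (\<lambda>t. r * ?F f t + s * ?F h t) (x i)"
    by (simp add: partial_def cong: deriv_cong_ev)
  also have "\<dots> = r * deriv (?F f) (x i) + s * deriv (?F h) (x i)"
  proof -
    have "?F f field_differentiable at (x i)" "?F h field_differentiable at (x i)"
      using f h js i Cons.prems(2) unfolding smooth_fn_def by blast+
    then have "(?F f has_field_derivative deriv (?F f) (x i)) (at (x i))" "(?F h has_field_derivative deriv (?F h) (x i)) (at (x i))"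
      by (simp_all add: field_differentiable_derivI)
    then have "((\<lambda>t. r * ?F f t + s * ?F h t) has_field_derivative r * deriv (?F f) (x i) + s * deriv (?F h) (x i)) (at (x i))"
      by (intro DERIV_add DERIV_cmult)
    then show ?thesis by (rule DERIV_imp_deriv)
  qed
  finally show ?case by (simp add: partial_def)
qed simp

lemma smooth_fn_combination:
  assumes W: "openin (Euclidean_space n) W" and f: "smooth_fn n W f" and h: "smooth_fn n W h"
  shows "smooth_fn n W (\<lambda>x. r * f x + s * h x)"
  unfolding smooth_fn_def
proof (intro ballI conjI allI impI)
  fix js assume js: "js \<in> lists {..<n}"
  note eq = partials_combination[OF W f h js]
  have WS: "W \<subseteq> topspace (Euclidean_space n)" by (rule openin_subset[OF W])
  have c: "continuous_map (subtopology (Euclidean_space n) W) euclideanreal (partials js f)"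
    "continuous_map (subtopology (Euclidean_space n) W) euclideanreal (partials js h)"
    using f h js unfolding smooth_fn_def by blast+
  show "continuous_map (subtopology (Euclidean_space n) W) euclideanreal (partials js (\<lambda>x. r * f x + s * h x))"
  proof (rule continuous_map_eq)
    show "continuous_map (subtopology (Euclidean_space n) W) euclideanreal (\<lambda>x. r * partials js f x + s * partials js h x)"
      by (intro continuous_intros c)
  qed (use eq in auto)
  fix i x assume i: "i < n" and x: "x \<in> W"
  let ?F = "\<lambda>f t. partials js f (x(i := t))"
  have "?F f field_differentiable at (x i)" "?F h field_differentiable at (x i)"
    using f h js i x unfolding smooth_fn_def by blast+
  then obtain u v where "(?F f has_field_derivative u) (at (x i))" "(?F h has_field_derivative v) (at (x i))"
    unfolding field_differentiable_def by blast
  then have "((\<lambda>t. r * ?F f t + s * ?F h t) has_field_derivative r * u + s * v) (at (x i))"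
    by (intro DERIV_add DERIV_cmult)
  moreover have "\<forall>\<^sub>F t in nhds (x i). ?F (\<lambda>x. r * f x + s * h x) t = r * ?F f t + s * ?F h t"
    using eventually_chart[OF W x i] by eventually_elim (rule eq)
  ultimately have "(?F (\<lambda>x. r * f x + s * h x) has_field_derivative r * u + s * v) (at (x i))"
    by (simp add: DERIV_cong_ev[OF refl _ refl])
  then show "?F (\<lambda>x. r * f x + s * h x) field_differentiable at (x i)"
    unfolding field_differentiable_def by blast
qed

lemma is_form_combination:
  assumes M: "smooth_manifold M" and a: "is_form M a" and b: "is_form M b"
  shows "is_form M (\<lambda>c js x. r * a c js x + s * b c js x)"
proof -
  have op: "openin (Euclidean_space (mdim M)) (snd c ` fst c)" if "c \<in> atlas M" for c
    using M that unfolding smooth_manifold_def by (auto simp: case_prod_beta)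
  note A = a[unfolded is_form_def] and B = b[unfolded is_form_def]
  note A1 = A[THEN conjunct1, rule_format] and B1 = B[THEN conjunct1, rule_format]
    and A2 = A[THEN conjunct2, THEN conjunct1, rule_format] and B2 = B[THEN conjunct2, THEN conjunct1, rule_format]
    and A3 = A[THEN conjunct2, THEN conjunct2, THEN conjunct1, rule_format]
    and B3 = B[THEN conjunct2, THEN conjunct2, THEN conjunct1, rule_format]
    and A4 = A[THEN conjunct2, THEN conjunct2, THEN conjunct2, rule_format]
    and B4 = B[THEN conjunct2, THEN conjunct2, THEN conjunct2, rule_format]
  show ?thesis
    unfolding is_form_def
  proof (intro conjI allI ballI impI)
    show "r * a c js x + s * b c js x = 0" if "\<not> in_chart M c js x" for c js x
      by (simp add: A1[OF that] B1[OF that])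
    show "r * a c (js[i := js ! Suc i, Suc i := js ! i]) x + s * b c (js[i := js ! Suc i, Suc i := js ! i]) x =
       - (r * a c js x + s * b c js x)" if "Suc i < length js" for c js x i
      unfolding A2[OF that] B2[OF that] by (simp add: algebra_simps)
    show "smooth_fn (mdim M) (snd c ` fst c) (\<lambda>x. r * a c js x + s * b c js x)" if c: "c \<in> atlas M" for c js
    proof (rule smooth_fn_combination[OF op[OF c]])
      show "smooth_fn (mdim M) (snd c ` fst c) (a c js)" "smooth_fn (mdim M) (snd c ` fst c) (b c js)"
        by (rule A3[OF c] B3[OF c])+
    qed
    fix c c' p js assume c: "c \<in> atlas M" "c' \<in> atlas M" "p \<in> fst c \<inter> fst c'" "set js \<subseteq> {..<mdim M}"
    let ?F = "\<lambda>y. snd c' (inv_into (fst c) (snd c) y)"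
    have "a c js (snd c p) = lpull (mdim M) ?F (a c') js (snd c p)" "b c js (snd c p) = lpull (mdim M) ?F (b c') js (snd c p)"
      by (rule A4[OF c] B4[OF c])+
    then show "r * a c js (snd c p) + s * b c js (snd c p) = lpull (mdim M) ?F (\<lambda>js x. r * a c' js x + s * b c' js x) js (snd c p)"
      by (simp add: lpull_def sum_distrib_left sum.distrib algebra_simps)
  qed
qed

lemma graded_closed_Omega:
  assumes "smooth_manifold M"
  shows "graded_closed (Omega M)"
proof -
  note F = is_form_combination[OF assms]
  have 1: "is_form M (\<lambda>c js x. a c js x + b c js x)" if "is_form M a" "is_form M b" for a b
    using F[OF that, of 1 1] by simp
  have 2: "is_form M (\<lambda>c js x. r * a c js x)" if "is_form M a" for a r
    using F[OF that that, of r 0] by simp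
  show ?thesis
    unfolding graded_closed_def by (auto simp: Omega_def 1 2) (metis add.right_neutral)
qed

lemma graded_closed_cochains: "graded_closed (cochains M)"
  unfolding graded_closed_def by (auto simp: cochains_def) (metis add.right_neutral)+

text \<open>Of the shuffles in the wedge product, only the one that gives all arguments to \<open>a\<close> leaves none for the function 1.\<close>

lemma Omega_mult_one:
  fixes M :: "'a manifold"
  assumes a: "a \<in> homog (Omega M)"
  shows "a \<otimes>\<^bsub>Omega M\<^esub> \<one>\<^bsub>Omega M\<^esub> = a"
proof (intro ext)
  fix c :: "'a chart" and js :: "nat list" and x :: pt
  have form: "is_form M a" using a by (auto simp: homog_def Omega_def)
  let ?one = "\<lambda>js x. if in_chart M c js x then lone js x else 0"
  let ?n = "length js" and ?I = "{..<length js}"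
  let ?t = "\<lambda>S. (-1) ^ card {(i, j). i \<in> S \<and> j \<in> ?I - S \<and> j < i} * a c (nths js S) x * ?one (nths js (- S)) x"
  have "?t S = 0" if "S \<in> Pow ?I - {?I}" for S
  proof -
    obtain i where "i < ?n" "i \<notin> S" using \<open>S \<in> Pow ?I - {?I}\<close> by auto
    then have "i \<in> {i. i < ?n \<and> i \<in> - S}" by simp
    then have "length (nths js (- S)) \<noteq> 0" unfolding length_nths by (subst card_0_eq) auto
    then have "nths js (- S) \<noteq> []" by auto
    then show ?thesis by (simp add: lone_def)
  qed
  then have "sum ?t (Pow ?I - {?I}) = 0" by (intro sum.neutral) blast
  moreover have "sum ?t (Pow ?I) = ?t ?I + sum ?t (Pow ?I - {?I})" by (rule sum.remove) auto
  ultimately have "sum ?t (Pow ?I) = ?t ?I" by linarith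
  also have "\<dots> = a c js x"
  proof -
    have "{i. i < ?n \<and> i \<in> - ?I} = {}" by auto
    then have "length (nths js (- ?I)) = 0" unfolding length_nths by simp
    then have n: "nths js (- ?I) = []" by simp
    have z: "{(i, j). i \<in> ?I \<and> j \<in> ?I - ?I \<and> j < i} = {}" by auto
    have "a c js x = 0" if "\<not> in_chart M c [] x"
    proof -
      have "\<not> in_chart M c js x" using that by (auto simp: in_chart_def)
      then show ?thesis using form unfolding is_form_def by blast
    qed
    then show ?thesis unfolding n z by (auto simp: nths_upt_eq_take lone_def)
  qed
  finally show "(a \<otimes>\<^bsub>Omega M\<^esub> \<one>\<^bsub>Omega M\<^esub>) c js x = a c js x"
    by (simp add: Omega_def lwedge_def)
qed

section \<open>Tensor products and their filtrations\<close>

definition pgens :: "'a dg \<Rightarrow> 'b dg \<Rightarrow> (('a \<times> 'b) \<Rightarrow>\<^sub>0 real) set" where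
  "pgens X A = {single (x \<oplus>\<^bsub>X\<^esub> y, a) 1 - single (x, a) 1 - single (y, a) 1
         | x y a k. x \<in> grade X k \<and> y \<in> grade X k \<and> a \<in> homog A} \<union>
      {single (x, a \<oplus>\<^bsub>A\<^esub> b) 1 - single (x, a) 1 - single (x, b) 1
         | x a b k. x \<in> homog X \<and> a \<in> grade A k \<and> b \<in> grade A k} \<union>
      {single (c \<odot>\<^bsub>X\<^esub> x, a) 1 - single (x, a) c
         | x a c. x \<in> homog X \<and> a \<in> homog A} \<union>
      {single (x, c \<odot>\<^bsub>A\<^esub> a) 1 - single (x, a) c
         | x a c. x \<in> homog X \<and> a \<in> homog A}"

lemma prel_eq: "prel X A = vspan (pword X A) (pgens X A)"
  by (simp add: prel_def pgens_def)

lemma pgens_cases [consumes 1, case_names add1 add2 smult1 smult2]: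
  assumes "p \<in> pgens X A"
  obtains x y a k where "x \<in> grade X k" "y \<in> grade X k" "a \<in> homog A"
      "p = single (x \<oplus>\<^bsub>X\<^esub> y, a) 1 - single (x, a) 1 - single (y, a) 1"
    | x a b k where "x \<in> homog X" "a \<in> grade A k" "b \<in> grade A k"
      "p = single (x, a \<oplus>\<^bsub>A\<^esub> b) 1 - single (x, a) 1 - single (x, b) 1"
    | x a c where "x \<in> homog X" "a \<in> homog A"
      "p = single (c \<odot>\<^bsub>X\<^esub> x, a) 1 - single (x, a) c"
    | x a c where "x \<in> homog X" "a \<in> homog A"
      "p = single (x, c \<odot>\<^bsub>A\<^esub> a) 1 - single (x, a) c"
  using assms unfolding pgens_def Un_iff
  by (elim disjE) blast+

lemma pgens_intros:
  "x \<in> grade X k \<Longrightarrow> y \<in> grade X k \<Longrightarrow> a \<in> homog A \<Longrightarrow>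
    single (x \<oplus>\<^bsub>X\<^esub> y, a) 1 - single (x, a) 1 - single (y, a) 1 \<in> pgens X A"
  "x \<in> homog X \<Longrightarrow> a \<in> grade A k \<Longrightarrow> b \<in> grade A k \<Longrightarrow>
    single (x, a \<oplus>\<^bsub>A\<^esub> b) 1 - single (x, a) 1 - single (x, b) 1 \<in> pgens X A"
  "x \<in> homog X \<Longrightarrow> a \<in> homog A \<Longrightarrow> single (c \<odot>\<^bsub>X\<^esub> x, a) 1 - single (x, a) c \<in> pgens X A"
  "x \<in> homog X \<Longrightarrow> a \<in> homog A \<Longrightarrow> single (x, c \<odot>\<^bsub>A\<^esub> a) 1 - single (x, a) c \<in> pgens X A"
  unfolding pgens_def by blast+

lemma pword_simps [simp]:
  "carrier (pword X A) = {p. keys p \<subseteq> homog X \<times> homog A}"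
  "p \<oplus>\<^bsub>pword X A\<^esub> q = p + q" "\<zero>\<^bsub>pword X A\<^esub> = 0" "c \<odot>\<^bsub>pword X A\<^esub> p = psc c p"
  by (simp_all add: pword_def)

lemma vsp_pword: "vsp (pword X A)"
  unfolding pword_def by (rule vsp_free)

lemma pgens_sub:
  assumes X: "graded_closed X" and A: "graded_closed A"
  shows "pgens X A \<subseteq> carrier (pword X A)"
proof
  fix p assume "p \<in> pgens X A"
  then have "keys p \<subseteq> homog X \<times> homog A"
  proof (cases rule: pgens_cases)
    case (add1 x y a k)
    then show ?thesis unfolding add1(4) using graded_closedD(1)[OF X add1(1,2)]
      by (intro keys_minus_sub) (auto intro: homogI)
  next
    case (add2 x a b k)
    then show ?thesis unfolding add2(4) using graded_closedD(1)[OF A add2(2,3)]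
      by (intro keys_minus_sub) (auto intro: homogI)
  next
    case (smult1 x a c)
    then show ?thesis unfolding smult1(3) using graded_closedD(3)[OF X]
      by (intro keys_minus_sub) auto
  next
    case (smult2 x a c)
    then show ?thesis unfolding smult2(3) using graded_closedD(3)[OF A]
      by (intro keys_minus_sub) auto
  qed
  then show "p \<in> carrier (pword X A)" by simp
qed

lemma subsp_prel: "graded_closed X \<Longrightarrow> graded_closed A \<Longrightarrow> subsp (prel X A) (pword X A)"
  unfolding prel_eq by (rule vspan_subsp[OF vsp_pword pgens_sub])

text \<open>The union of the cosets that form a step of the filtration.  Points of completions are sets of cosets, so all
computations with them are done with such subspaces of the free vector space on pure tensors.\<close>

definition pfil_rep :: "'a dg \<Rightarrow> 'b dg \<Rightarrow> (nat \<Rightarrow> 'a set) \<Rightarrow> nat \<Rightarrow> (('a \<times> 'b) \<Rightarrow>\<^sub>0 real) set" where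
  "pfil_rep X A F n = vspan (pword X A) (pgens X A \<union> {single (x, a) 1 | x a. x \<in> homog X \<inter> F n \<and> a \<in> homog A})"

context
  fixes X :: "'a dg" and A :: "'b dg"
  assumes X: "graded_closed X" and A: "graded_closed A"
begin

lemma pfil_gens_sub: "pgens X A \<union> {single (x, a) 1 | x a. x \<in> homog X \<inter> F n \<and> a \<in> homog A} \<subseteq> carrier (pword X A)"
  using pgens_sub[OF X A] by auto

lemma subsp_pfil_rep: "subsp (pfil_rep X A F n) (pword X A)"
  unfolding pfil_rep_def by (rule vspan_subsp[OF vsp_pword pfil_gens_sub])

lemma pfil_rep_subset: "pfil_rep X A F n \<subseteq> {p. keys p \<subseteq> homog X \<times> homog A}"
  using subsp_sub[OF vsp_pword subsp_pfil_rep] by simp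

lemma pfil_rep_zero: "0 \<in> pfil_rep X A F n"
  using subsp_zero[OF vsp_pword subsp_pfil_rep] by simp

lemma pfil_rep_add: "p \<in> pfil_rep X A F n \<Longrightarrow> q \<in> pfil_rep X A F n \<Longrightarrow> p + q \<in> pfil_rep X A F n"
  using subsp_add[OF vsp_pword subsp_pfil_rep] by simp

lemma prel_sub_pfil_rep: "prel X A \<subseteq> pfil_rep X A F n"
  unfolding prel_eq pfil_rep_def by (rule vspan_mono[OF vsp_pword _ pfil_gens_sub]) simp

lemma Union_pfil: "\<Union>(pfil X A F n) = pfil_rep X A F n"
proof -
  have "pfil X A F n = vspan (quot (pword X A) (vspan (pword X A) (pgens X A)))
      ((\<lambda>p. vspan (pword X A) (pgens X A) +>\<^bsub>pword X A\<^esub> p) ` {single (x, a) 1 | x a. x \<in> homog X \<inter> F n \<and> a \<in> homog A})"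
    unfolding pfil_def tprod_def pcls_def prel_eq
    by (rule arg_cong[of _ _ "vspan (quot (pword X A) (vspan (pword X A) (pgens X A)))"]) auto
  also have "\<Union>\<dots> = pfil_rep X A F n"
    unfolding pfil_rep_def by (rule Union_vspan_quot[OF vsp_pword pgens_sub[OF X A]]) auto
  finally show ?thesis .
qed

lemma tprod_add: "P \<oplus>\<^bsub>tprod X A\<^esub> Q = P <+>\<^bsub>pword X A\<^esub> Q"
  by (simp add: tprod_def quot_simps)

text \<open>Relations of the tensor product are representatives of the filtration, which absorb them.\<close>

lemma Union_pfil_coset:
  assumes Z: "Z = {t + q | t q. t \<in> prel X A \<and> q \<in> Q}"
  shows "\<Union>(pfil X A F n +>\<^bsub>tprod X A\<^esub> Z) = {e + q | e q. e \<in> pfil_rep X A F n \<and> q \<in> Q}"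
proof -
  have "\<Union>(pfil X A F n +>\<^bsub>tprod X A\<^esub> Z) = {y + z | y z. y \<in> \<Union>(pfil X A F n) \<and> z \<in> Z}"
    unfolding coset_eq tprod_add set_add_eq pword_simps by blast
  also have "\<dots> = {e + q | e q. e \<in> pfil_rep X A F n \<and> q \<in> Q}"
  proof
    show "{y + z | y z. y \<in> \<Union>(pfil X A F n) \<and> z \<in> Z} \<subseteq> {e + q | e q. e \<in> pfil_rep X A F n \<and> q \<in> Q}"
    proof
      fix r assume "r \<in> {y + z | y z. y \<in> \<Union>(pfil X A F n) \<and> z \<in> Z}"
      then obtain y t q where "y \<in> pfil_rep X A F n" "t \<in> prel X A" "q \<in> Q" "r = (y + t) + q"
        unfolding Z Union_pfil by (auto simp: add.assoc)
      then show "r \<in> {e + q | e q. e \<in> pfil_rep X A F n \<and> q \<in> Q}"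
        using pfil_rep_add[of y F n t] prel_sub_pfil_rep[of F n] by blast
    qed
    have "0 \<in> prel X A" using subsp_zero[OF vsp_pword subsp_prel[OF X A]] by simp
    then have "q \<in> Z" if "q \<in> Q" for q unfolding Z using that by force
    then show "{e + q | e q. e \<in> pfil_rep X A F n \<and> q \<in> Q} \<subseteq> {y + z | y z. y \<in> \<Union>(pfil X A F n) \<and> z \<in> Z}"
      unfolding Union_pfil by blast
  qed
  finally show ?thesis .
qed

lemma pcls_eq: "pcls X A p = {t + q | t q. t \<in> prel X A \<and> q \<in> {p}}"
  by (simp add: pcls_def coset_eq)

text \<open>The representatives of \<open>\<phi>\<^sub>*(\<alpha>)\<close> at index \<open>n\<close> come from all representatives of \<open>\<alpha>\<close> at index \<open>n\<close>.\<close>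

lemma Union_mc_push:
  "\<Union>(mc_push X A (pfil X A F) f \<alpha> n) =
    {e + (\<Sum>k = 1..n. tpow k p f) | e p. e \<in> pfil_rep X A F n \<and> p \<in> \<Union>(\<alpha> n)}"
proof -
  have "\<Union>(mc_push X A (pfil X A F) f \<alpha> n) =
      (\<Union>p\<in>\<Union>(\<alpha> n). \<Union>(pfil X A F n +>\<^bsub>tprod X A\<^esub> pcls X A (\<Sum>k = 1..n. tpow k p f)))"
    unfolding mc_push_def by blast
  also have "\<dots> = (\<Union>p\<in>\<Union>(\<alpha> n). {e + (\<Sum>k = 1..n. tpow k p f) | e. e \<in> pfil_rep X A F n})"
    unfolding Union_pfil_coset[OF pcls_eq] by simp
  finally show ?thesis by auto
qed

lemma Union_hat_pmap:
  "\<Union>(hat_map (tprod X A) (pfil X A F) (pmap X A f) \<alpha> n) =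
    {e + pext (\<lambda>(x, a). single (f x, a) 1) p | e p. e \<in> pfil_rep X A F n \<and> p \<in> \<Union>(\<alpha> n)}"
proof -
  let ?f = "pext (\<lambda>(x, a). single (f x, a) (1::real))"
  have "\<Union>(pfil X A F n +>\<^bsub>tprod X A\<^esub> pmap X A f P) = {e + q | e q. e \<in> pfil_rep X A F n \<and> q \<in> ?f ` P}" for P
    by (rule Union_pfil_coset) (auto simp: pmap_def cmap_def coset_eq)
  moreover have "\<Union>(hat_map (tprod X A) (pfil X A F) (pmap X A f) \<alpha> n) =
      (\<Union>P\<in>\<alpha> n. \<Union>(pfil X A F n +>\<^bsub>tprod X A\<^esub> pmap X A f P))"
    unfolding hat_map_def cmap_def by blast
  ultimately show ?thesis by auto
qed

end

text \<open>The map \<open>f \<otimes> id\<close> on representatives.\<close>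

abbreviation pw1 :: "('a \<Rightarrow> 'b) \<Rightarrow> (('a \<times> 'c) \<Rightarrow>\<^sub>0 real) \<Rightarrow> (('b \<times> 'c) \<Rightarrow>\<^sub>0 real)" where
  "pw1 f \<equiv> pext (\<lambda>(x, a). single (f x, a) 1)"

lemma lin_pw1: "hlin X Y f \<Longrightarrow> lin (pword X A) (pword Y A) (pw1 f)"
  unfolding pword_def by (rule lin_pext) (auto dest: hlinD(2))

lemma pw1_pgens:
  assumes f: "hlin X Y f" and p: "p \<in> pgens X A"
  shows "pw1 f p \<in> pgens Y A"
  using p
proof (cases rule: pgens_cases)
  case (add1 x y a k)
  show ?thesis unfolding add1(4)
    using pgens_intros(1)[OF hlinD(1)[OF f add1(1)] hlinD(1)[OF f add1(2)] add1(3)] hlinD(3)[OF f add1(1,2)] by (simp add: pext_diff)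
next
  case (add2 x a b k)
  show ?thesis unfolding add2(4)
    using pgens_intros(2)[OF hlinD(2)[OF f add2(1)] add2(2,3)] by (simp add: pext_diff)
next
  case (smult1 x a c)
  show ?thesis unfolding smult1(3)
    using pgens_intros(3)[OF hlinD(2)[OF f smult1(1)] smult1(2), of c] hlinD(4)[OF f smult1(1)] by (simp add: pext_diff)
next
  case (smult2 x a c)
  show ?thesis unfolding smult2(3)
    using pgens_intros(4)[OF hlinD(2)[OF f smult2(1)] smult2(2), of c] by (simp add: pext_diff)
qed

lemma pw1_pfil_rep:
  assumes f: "hlin X Y f" and X: "graded_closed X" and Y: "graded_closed Y" and A: "graded_closed A"
    and F: "\<And>x. x \<in> homog X \<Longrightarrow> x \<in> F n \<Longrightarrow> f x \<in> F' n" and e: "e \<in> pfil_rep X A F n"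
  shows "pw1 f e \<in> pfil_rep Y A F' n"
proof (rule lin_vspan_into[OF lin_pw1[OF f] pfil_gens_sub[OF X A, of F n] subsp_pfil_rep[OF Y A, of F' n] _ e[unfolded pfil_rep_def]])
  show "pw1 f ` (pgens X A \<union> {single (x, a) 1 | x a. x \<in> homog X \<inter> F n \<and> a \<in> homog A}) \<subseteq> pfil_rep Y A F' n"
  proof (rule image_subsetI)
    fix p assume "p \<in> pgens X A \<union> {single (x, a) 1 | x a. x \<in> homog X \<inter> F n \<and> a \<in> homog A}"
    then consider "p \<in> pgens X A" | x a where "x \<in> homog X" "x \<in> F n" "a \<in> homog A" "p = single (x, a) 1" by blast
    then have "pw1 f p \<in> pgens Y A \<union> {single (x, a) 1 | x a. x \<in> homog Y \<inter> F' n \<and> a \<in> homog A}"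
    proof cases
      case 1
      then show ?thesis using pw1_pgens[OF f] by blast
    next
      case (2 x a)
      then have "pw1 f p = single (f x, a) 1" "f x \<in> homog Y \<inter> F' n" using hlinD(2)[OF f] F by auto
      then show ?thesis using 2(3) by blast
    qed
    then show "pw1 f p \<in> pfil_rep Y A F' n" unfolding pfil_rep_def by (rule vspan_base)
  qed
qed

text \<open>Every generating relation of the target is the image of one of the source: it is determined by one or two letters
of the same degree, and these can be lifted separately.  The same holds for the pure tensors in the filtration.\<close>

lemma pw1_pfil_rep_onto:
  assumes f: "hlin X Y f" and X: "graded_closed X" and A: "graded_closed A"
    and s: "\<And>y k. y \<in> grade Y k \<Longrightarrow> \<exists>x\<in>grade X k. f x = y"
    and sF: "\<And>y k. y \<in> grade Y k \<Longrightarrow> y \<in> F' n \<Longrightarrow> \<exists>x\<in>grade X k \<inter> F n. f x = y"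
    and e: "e \<in> pfil_rep Y A F' n"
  shows "\<exists>e'\<in>pfil_rep X A F n. pw1 f e' = e"
proof -
  let ?G = "pgens X A \<union> {single (x, a) 1 | x a. x \<in> homog X \<inter> F n \<and> a \<in> homog A}"
  let ?G' = "pgens Y A \<union> {single (x, a) 1 | x a. x \<in> homog Y \<inter> F' n \<and> a \<in> homog A}"
  have sh: "\<exists>x\<in>homog X. f x = y" if "y \<in> homog Y" for y
    using s[OF deg_mem[OF that]] by (auto intro: homogI)
  have G: "?G' \<subseteq> pw1 f ` ?G"
  proof
    fix p assume "p \<in> ?G'"
    then consider "p \<in> pgens Y A" | y a where "y \<in> homog Y" "y \<in> F' n" "a \<in> homog A" "p = single (y, a) 1" by blast
    then show "p \<in> pw1 f ` ?G"
    proof cases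
      case 1
      then have "p \<in> pw1 f ` pgens X A"
      proof (cases rule: pgens_cases)
        case (add1 x y a k)
        obtain x' y' where "x' \<in> grade X k" "y' \<in> grade X k" "f x' = x" "f y' = y"
          using s[OF add1(1)] s[OF add1(2)] by blast
        then show ?thesis unfolding add1(4)
          using pgens_intros(1)[of x' X k y' a A] add1(3) hlinD(3)[OF f, of x' k y']
          by (intro image_eqI) (simp_all add: pext_diff)
      next
        case (add2 x a b k)
        obtain x' where "x' \<in> homog X" "f x' = x" using sh[OF add2(1)] by blast
        then show ?thesis unfolding add2(4)
          using pgens_intros(2)[of x' X a A k b] add2(2,3)
          by (intro image_eqI) (simp_all add: pext_diff)
      next
        case (smult1 x a c)
        obtain x' where "x' \<in> homog X" "f x' = x" using sh[OF smult1(1)] by blast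
        then show ?thesis unfolding smult1(3)
          using pgens_intros(3)[of x' X a A c] smult1(2) hlinD(4)[OF f, of x' c]
          by (intro image_eqI) (simp_all add: pext_diff)
      next
        case (smult2 x a c)
        obtain x' where "x' \<in> homog X" "f x' = x" using sh[OF smult2(1)] by blast
        then show ?thesis unfolding smult2(3)
          using pgens_intros(4)[of x' X a A c] smult2(2)
          by (intro image_eqI) (simp_all add: pext_diff)
      qed
      then show ?thesis by blast
    next
      case (2 y a)
      obtain x where x: "x \<in> grade X (deg Y y) \<inter> F n" "f x = y" using sF[OF deg_mem[OF 2(1)] 2(2)] by blast
      then have "x \<in> homog X" by (auto intro: homogI)
      then have "single (x, a) 1 \<in> ?G" using x 2(3) by blast
      moreover have "p = pw1 f (single (x, a) 1)" using x 2(4) by simp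
      ultimately show ?thesis by blast
    qed
  qed
  have "subsp (pw1 f ` vspan (pword X A) ?G) (pword Y A)"
    by (rule lin_image_subsp[OF lin_pw1[OF f] vspan_subsp[OF vsp_pword pfil_gens_sub[OF X A]]])
  moreover have "?G' \<subseteq> pw1 f ` vspan (pword X A) ?G"
    using G vspan_base[of _ ?G "pword X A"] by blast
  ultimately have "pfil_rep Y A F' n \<subseteq> pw1 f ` pfil_rep X A F n"
    unfolding pfil_rep_def by (rule vspan_least)
  then show ?thesis using e by auto
qed

section \<open>Tensor powers\<close>

lemma tpow_0: "tpow 0 p f = f []"
proof -
  have "{w. length w = 0 \<and> set w \<subseteq> keys p} = {[]}" by auto
  then show ?thesis by (simp add: tpow_def)
qed

lemma tpow_Suc: "tpow (Suc k) p f = pext (\<lambda>x. tpow k p (\<lambda>w. f (x # w))) p"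
proof -
  let ?K = "keys p" and ?c = "lookup p"
  let ?W = "\<lambda>k. {w. length w = k \<and> set w \<subseteq> ?K}"
  have fin: "finite (?W k)" for k using finite_lists_length_eq[of ?K k] by (simp add: conj_commute)
  have "tpow (Suc k) p f = (\<Sum>(x, w)\<in>?K \<times> ?W k. psc (\<Prod>y\<leftarrow>x # w. ?c y) (f (x # w)))"
    unfolding tpow_def
    by (rule sum.reindex_bij_witness[of _ "\<lambda>(x, w). x # w" "\<lambda>w. (hd w, tl w)"])
      (auto simp: length_Suc_conv)
  also have "\<dots> = (\<Sum>x\<in>?K. \<Sum>w\<in>?W k. psc (\<Prod>y\<leftarrow>x # w. ?c y) (f (x # w)))"
    by (rule sum.cartesian_product[symmetric])
  also have "\<dots> = pext (\<lambda>x. tpow k p (\<lambda>w. f (x # w))) p"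
    by (simp add: pext_def tpow_def psc_sum)
  finally show ?thesis .
qed

lemma keys_tpow:
  assumes "\<And>w. length w = k \<Longrightarrow> set w \<subseteq> keys p \<Longrightarrow> keys (f w) \<subseteq> S"
  shows "keys (tpow k p f) \<subseteq> S"
  unfolding tpow_def by (intro keys_sum_sub keys_psc_sub assms) auto

lemma pext_tpow: "pext h (tpow k p f) = tpow k p (\<lambda>w. pext h (f w))"
  by (simp add: tpow_def pext_sum pext_psc)

text \<open>The value at the \<open>k\<close>-th tensor power of \<open>p\<close> of the multilinear extension of \<open>F\<close>.  Processing one letter at a
time makes induction on \<open>k\<close> available.\<close>

primrec mlext :: "('a, 'm) dg_scheme \<Rightarrow> nat \<Rightarrow> ('u \<Rightarrow>\<^sub>0 real) \<Rightarrow> ('u list \<Rightarrow> 'a) \<Rightarrow> 'a" where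
  "mlext V 0 p F = F []"
| "mlext V (Suc k) p F = lext V (\<lambda>x. mlext V k p (\<lambda>w. F (x # w))) p"

context
  fixes V :: "('a, 'm) dg_scheme"
  assumes V: "vsp V"
begin

lemma mlext_carrier:
  "(\<And>w. set w \<subseteq> T \<Longrightarrow> F w \<in> carrier V) \<Longrightarrow> keys p \<subseteq> T \<Longrightarrow> mlext V k p F \<in> carrier V"
proof (induction k arbitrary: F)
  case (Suc k)
  show ?case
    unfolding mlext.simps
    by (rule lext_in_subsp[OF V subsp_carrier[OF V]], rule Suc.IH) (use Suc.prems in auto)
qed simp

lemma mlext_cong:
  "(\<And>w. set w \<subseteq> T \<Longrightarrow> F w = H w) \<Longrightarrow> (\<And>w. set w \<subseteq> T \<Longrightarrow> H w \<in> carrier V) \<Longrightarrow> keys p \<subseteq> T \<Longrightarrow>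
    mlext V k p F = mlext V k p H"
proof (induction k arbitrary: F H)
  case (Suc k)
  show ?case
    unfolding mlext.simps
    by (rule lext_cong[OF V], rule Suc.IH) (use Suc.prems in \<open>auto intro!: mlext_carrier[of T]\<close>)
qed simp

lemma lext_tpow:
  assumes th: "\<And>x. x \<in> S \<Longrightarrow> \<theta> x \<in> carrier V"
  shows "(\<And>w. set w \<subseteq> T \<Longrightarrow> keys (f w) \<subseteq> S) \<Longrightarrow> keys p \<subseteq> T \<Longrightarrow>
    lext V \<theta> (tpow k p f) = mlext V k p (\<lambda>w. lext V \<theta> (f w))"
proof (induction k arbitrary: f)
  case 0
  then show ?case by (simp add: tpow_0)
next
  case (Suc k)
  note L = lin_in[OF lin_lext[OF V th, of S], unfolded free_dg_simps mem_Collect_eq]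
  have k: "keys (tpow k p (\<lambda>w. f (x # w))) \<subseteq> S" if "x \<in> keys p" for x
  proof (rule keys_tpow)
    fix w assume "set w \<subseteq> keys p"
    then have "set (x # w) \<subseteq> T" using Suc.prems(2) that by auto
    then show "keys (f (x # w)) \<subseteq> S" by (rule Suc.prems(1))
  qed
  have "lext V \<theta> (tpow (Suc k) p f) = lext V (\<lambda>x. lext V \<theta> (tpow k p (\<lambda>w. f (x # w)))) p"
    unfolding tpow_Suc by (rule lext_pext[OF V th k])
  also have "\<dots> = lext V (\<lambda>x. mlext V k p (\<lambda>w. lext V \<theta> (f (x # w)))) p"
  proof (rule lext_cong[OF V])
    fix x assume x: "x \<in> keys p"
    show eq: "lext V \<theta> (tpow k p (\<lambda>w. f (x # w))) = mlext V k p (\<lambda>w. lext V \<theta> (f (x # w)))"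
    proof (rule Suc.IH[OF _ Suc.prems(2)])
      fix w assume "set w \<subseteq> T"
      then have "set (x # w) \<subseteq> T" using Suc.prems(2) x by auto
      then show "keys (f (x # w)) \<subseteq> S" by (rule Suc.prems(1))
    qed
    show "mlext V k p (\<lambda>w. lext V \<theta> (f (x # w))) \<in> carrier V"
      unfolding eq[symmetric] by (rule L[OF _ k[OF x]])
  qed
  finally show ?case by simp
qed

lemma mlext_push:
  "(\<And>w. set w \<subseteq> T' \<Longrightarrow> F w \<in> carrier V) \<Longrightarrow> \<phi> ` T \<subseteq> T' \<Longrightarrow> keys q \<subseteq> T \<Longrightarrow>
    mlext V k (pext (\<lambda>x. single (\<phi> x) 1) q) F = mlext V k q (\<lambda>w. F (map \<phi> w))"
proof (induction k arbitrary: F)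
  case (Suc k)
  let ?q = "pext (\<lambda>x. single (\<phi> x) 1) q"
  have kq: "keys ?q \<subseteq> T'" by (rule keys_pext_sub) (use Suc.prems in auto)
  have c: "mlext V k ?q (\<lambda>w. F (x # w)) \<in> carrier V" if "x \<in> T'" for x
    by (rule mlext_carrier[of T']) (use Suc.prems(1) that kq in auto)
  have "mlext V (Suc k) ?q F = lext V (\<lambda>x. lext V (\<lambda>x. mlext V k ?q (\<lambda>w. F (x # w))) (single (\<phi> x) 1)) q"
    unfolding mlext.simps by (rule lext_pext[OF V, of T']) (use c Suc.prems(2,3) in \<open>auto simp: image_subset_iff subset_iff\<close>)
  also have "\<dots> = lext V (\<lambda>x. mlext V k q (\<lambda>w. F (map \<phi> (x # w)))) q"
  proof (rule lext_cong[OF V])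
    fix x assume x: "x \<in> keys q"
    then have xT: "\<phi> x \<in> T'" using Suc.prems by auto
    have "lext V (\<lambda>x. mlext V k ?q (\<lambda>w. F (x # w))) (single (\<phi> x) 1) = mlext V k ?q (\<lambda>w. F (\<phi> x # w))"
      using c[OF xT] by (subst lext_single[OF V]) (simp_all add: vsp_one[OF V])
    also have "\<dots> = mlext V k q (\<lambda>w. F (\<phi> x # map \<phi> w))"
      by (rule Suc.IH[of "\<lambda>w. F (\<phi> x # w)"]) (use Suc.prems xT in auto)
    finally show "lext V (\<lambda>x. mlext V k ?q (\<lambda>w. F (x # w))) (single (\<phi> x) 1) = mlext V k q (\<lambda>w. F (map \<phi> (x # w)))"
      by simp
    show "mlext V k q (\<lambda>w. F (map \<phi> (x # w))) \<in> carrier V"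
    proof (rule mlext_carrier[OF _ Suc.prems(3)])
      fix w assume "set w \<subseteq> T"
      then have "set (map \<phi> (x # w)) \<subseteq> T'" using xT Suc.prems(2) by auto
      then show "F (map \<phi> (x # w)) \<in> carrier V" by (rule Suc.prems(1))
    qed
  qed
  finally show ?case by simp
qed simp

lemma mlext_zero:
  "(\<And>w. set w \<subseteq> T \<Longrightarrow> F w = \<zero>\<^bsub>V\<^esub>) \<Longrightarrow> keys q \<subseteq> T \<Longrightarrow> mlext V k q F = \<zero>\<^bsub>V\<^esub>"
proof (induction k arbitrary: F)
  case (Suc k)
  have sub: "subsp {\<zero>\<^bsub>V\<^esub>} V" by (rule subspI[OF V]) (auto simp: vsp_simps[OF V])
  have "mlext V (Suc k) q F \<in> {\<zero>\<^bsub>V\<^esub>}"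
    unfolding mlext.simps
    by (rule lext_in_subsp[OF V sub], subst Suc.IH) (use Suc.prems in auto)
  then show ?case by simp
qed simp

text \<open>In the expansion of the power of \<open>q + j\<close>, every term with a letter from \<open>j\<close> vanishes.\<close>

lemma mlext_annihilator:
  "(\<And>w. set w \<subseteq> T \<Longrightarrow> F w \<in> carrier V) \<Longrightarrow> (\<And>w. set w \<subseteq> T \<Longrightarrow> set w \<inter> Z \<noteq> {} \<Longrightarrow> F w = \<zero>\<^bsub>V\<^esub>) \<Longrightarrow>
    keys q \<subseteq> T \<Longrightarrow> keys j \<subseteq> Z \<Longrightarrow> Z \<subseteq> T \<Longrightarrow> mlext V k (q + j) F = mlext V k q F"
proof (induction k arbitrary: F)
  case (Suc k)
  let ?H = "\<lambda>q x. mlext V k q (\<lambda>w. F (x # w))"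
  have qj: "keys (q + j) \<subseteq> T" using Suc.prems by (intro keys_add_sub) auto
  have c: "?H q x \<in> carrier V" if "x \<in> T" for x
    by (rule mlext_carrier[of T]) (use Suc.prems that in auto)
  have IH: "?H (q + j) x = ?H q x" if "x \<in> T" for x
    by (rule Suc.IH) (use Suc.prems that in auto)
  have "mlext V (Suc k) (q + j) F = lext V (?H q) (q + j)"
    unfolding mlext.simps by (rule lext_cong[OF V]) (use qj IH c in auto)
  also have "\<dots> = lext V (?H q) q \<oplus>\<^bsub>V\<^esub> lext V (?H q) j"
    using lin_add[OF lin_lext[OF V c, where S = T], where x = q and y = j] Suc.prems by auto
  also have "lext V (?H q) j = \<zero>\<^bsub>V\<^esub>"
  proof -
    have sub: "subsp {\<zero>\<^bsub>V\<^esub>} V" by (rule subspI[OF V]) (auto simp: vsp_simps[OF V])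
    have "lext V (?H q) j \<in> {\<zero>\<^bsub>V\<^esub>}"
    proof (rule lext_in_subsp[OF V sub])
      fix x assume "x \<in> keys j"
      then have x: "x \<in> Z" "x \<in> T" using Suc.prems(4,5) by auto
      have "?H q x = \<zero>\<^bsub>V\<^esub>"
        by (rule mlext_zero[OF _ Suc.prems(3)], rule Suc.prems(2)) (use x in auto)
      then show "?H q x \<in> {\<zero>\<^bsub>V\<^esub>}" by simp
    qed
    then show ?thesis by simp
  qed
  also have "lext V (?H q) q \<oplus>\<^bsub>V\<^esub> \<zero>\<^bsub>V\<^esub> = mlext V (Suc k) q F"
    using lin_in[OF lin_lext[OF V c, where S = T], where x = q] Suc.prems by (simp add: vsp_r_zero[OF V])
  finally show ?case .
qed simp

end

lemma lin_mlext:
  assumes f: "lin V W f"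
  shows "(\<And>w. set w \<subseteq> T \<Longrightarrow> F w \<in> carrier V) \<Longrightarrow> keys q \<subseteq> T \<Longrightarrow>
    f (mlext V k q F) = mlext W k q (\<lambda>w. f (F w))"
proof (induction k arbitrary: F)
  case (Suc k)
  note V = lin_dom[OF f] and W = lin_cod[OF f]
  have c: "mlext V k q (\<lambda>w. F (x # w)) \<in> carrier V" if "x \<in> keys q" for x
    by (rule mlext_carrier[OF V, of T]) (use Suc.prems that in auto)
  have "f (mlext V (Suc k) q F) = lext W (\<lambda>x. f (mlext V k q (\<lambda>w. F (x # w)))) q"
    unfolding mlext.simps by (rule lin_lext_comp[OF f c])
  also have "\<dots> = mlext W (Suc k) q (\<lambda>w. f (F w))"
    unfolding mlext.simps
  proof (rule lext_cong[OF W])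
    fix x assume x: "x \<in> keys q"
    show "f (mlext V k q (\<lambda>w. F (x # w))) = mlext W k q (\<lambda>w. f (F (x # w)))"
      by (rule Suc.IH) (use Suc.prems x in auto)
    then show "mlext W k q (\<lambda>w. f (F (x # w))) \<in> carrier W" using lin_in[OF f c[OF x]] by simp
  qed
  finally show ?case .
qed simp

section \<open>Values of the holonomy\<close>

text \<open>The value at the simplex \<open>s\<close> of the pure tensor \<open>b \<otimes> f\<close>, as in \<open>pairing\<close>.\<close>

definition pair_fun :: "'b dg \<Rightarrow> 'm simp \<Rightarrow> 'b \<times> ('m simp \<Rightarrow> real) \<Rightarrow> 'b" where
  "pair_fun B s = (\<lambda>(b, f). (sg (int (fst s * (fst s + 1) div 2)) * f s) \<odot>\<^bsub>B\<^esub> b)"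

text \<open>The holonomy on the simplex \<open>s\<close> modulo the \<open>n\<close>-th step of the filtration, computed from a single
representative \<open>q\<close> of the connection in \<open>B \<otimes> \<Omega>(M)\<close>.\<close>

definition hol_val :: "'m manifold \<Rightarrow> 'b dg \<Rightarrow> 'm simp \<Rightarrow> nat \<Rightarrow> (('b \<times> 'm form) \<Rightarrow>\<^sub>0 real) \<Rightarrow> 'b" where
  "hol_val M B s n q = lext B (pair_fun B s) (\<Sum>k = 1..n. tpow k q (psi_word M B))"

definition hol_word :: "'m manifold \<Rightarrow> 'b dg \<Rightarrow> 'm simp \<Rightarrow> ('b \<times> 'm form) list \<Rightarrow> 'b" where
  "hol_word M B s w = lext B (pair_fun B s) (psi_word M B w)"

lemma lext_sum_eq:
  assumes f: "lin V W f" and th: "\<And>x. x \<in> S \<Longrightarrow> \<theta> x \<in> carrier V" and th': "\<And>x. x \<in> S' \<Longrightarrow> \<theta>' x \<in> carrier W"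
    and k: "\<And>k. k \<in> I \<Longrightarrow> keys (t k) \<subseteq> S" "\<And>k. k \<in> I \<Longrightarrow> keys (t' k) \<subseteq> S'"
    and e: "\<And>k. k \<in> I \<Longrightarrow> f (lext V \<theta> (t k)) = lext W \<theta>' (t' k)"
  shows "f (lext V \<theta> (sum t I)) = lext W \<theta>' (sum t' I)"
  using k e
proof (induction I rule: infinite_finite_induct)
  case (insert i I)
  have L: "lin (free_dg S (\<lambda>_ _. 0) 0 (\<lambda>_. 0) (\<lambda>_. 0)) V (lext V \<theta>)" by (rule lin_lext[OF lin_dom[OF f] th])
  have L': "lin (free_dg S' (\<lambda>_ _. 0) 0 (\<lambda>_. 0) (\<lambda>_. 0)) W (lext W \<theta>')" by (rule lin_lext[OF lin_cod[OF f] th'])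
  have s: "keys (sum t I) \<subseteq> S" "keys (sum t' I) \<subseteq> S'"
    by (rule keys_sum_sub, use insert.prems in simp)+
  have i: "keys (t i) \<subseteq> S" "keys (t' i) \<subseteq> S'" using insert.prems by simp_all
  have "f (lext V \<theta> (t i + sum t I)) = f (lext V \<theta> (t i)) \<oplus>\<^bsub>W\<^esub> f (lext V \<theta> (sum t I))"
    using lin_add[OF L, of "t i" "sum t I"] lin_add[OF f] lin_in[OF L] s i by simp
  also have "\<dots> = lext W \<theta>' (t' i) \<oplus>\<^bsub>W\<^esub> lext W \<theta>' (sum t' I)" using insert by simp
  also have "\<dots> = lext W \<theta>' (t' i + sum t' I)"
    using lin_add[OF L', of "t' i" "sum t' I"] s i by simp
  finally show ?case using insert.hyps by simp
qed (simp_all add: lext_zero[OF lin_dom[OF f]] lext_zero[OF lin_cod[OF f]] lin_zero[OF f])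

lemma lin_id: "vsp V \<Longrightarrow> lin V V (\<lambda>x. x)"
  by (rule linI) simp_all

context
  fixes h :: "'a dg" and M :: "'m manifold" and s :: "'m simp"
  assumes h: "glie h"
begin

private abbreviation "B \<equiv> env h"

private lemma pair_fun_carrier: "x \<in> carrier B \<times> UNIV \<Longrightarrow> pair_fun B s x \<in> carrier B"
  by (auto simp: pair_fun_def vsp_smult[OF vsp_env[OF h]])

private lemma fst_letters: "set w \<subseteq> homog B \<times> UNIV \<Longrightarrow> set (map fst w) \<subseteq> carrier B"
  using homog_env_sub[OF h] by auto

private lemma prod_carrier: "set w \<subseteq> homog B \<times> UNIV \<Longrightarrow> foldr (mult B) (map fst w) \<one>\<^bsub>B\<^esub> \<in> carrier B"
  by (rule foldr_mult_closed[OF ualg_env[OF h] fst_letters])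

lemma keys_psi_word: "set w \<subseteq> homog (env h) \<times> UNIV \<Longrightarrow> keys (psi_word M (env h) w) \<subseteq> carrier (env h) \<times> UNIV"
  using prod_carrier[of w] by (auto simp: psi_word_def)

lemma keys_psi_sum:
  assumes "keys q \<subseteq> homog (env h) \<times> UNIV"
  shows "keys (tpow k q (psi_word M (env h))) \<subseteq> carrier (env h) \<times> UNIV"
  by (intro keys_tpow keys_psi_word) (use assms in blast)

lemma hol_word_eq:
  assumes "set w \<subseteq> homog (env h) \<times> UNIV"
  shows "hol_word M (env h) s w = sg (\<Sum>(i, j)\<in>{(i, j). i < j \<and> j < length w}.
        (deg (Omega M) (snd (w ! i)) - 1) * deg (env h) (fst (w ! j))) \<odot>\<^bsub>env h\<^esub>
      ((sg (int (fst s * (fst s + 1) div 2)) * psi M (map snd w) s) \<odot>\<^bsub>env h\<^esub> foldr (mult (env h)) (map fst w) \<one>\<^bsub>env h\<^esub>)"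
  unfolding hol_word_def psi_word_def
  by (subst lext_single[OF vsp_env[OF h]])
    (simp_all add: pair_fun_def vsp_smult[OF vsp_env[OF h]] prod_carrier[OF assms])

lemma hol_word_carrier: "set w \<subseteq> homog (env h) \<times> UNIV \<Longrightarrow> hol_word M (env h) s w \<in> carrier (env h)"
  unfolding hol_word_eq by (intro vsp_smult[OF vsp_env[OF h]] prod_carrier)

lemma hol_word_zero:
  assumes "set w \<subseteq> homog (env h) \<times> UNIV" "set w \<inter> {\<zero>\<^bsub>env h\<^esub>} \<times> UNIV \<noteq> {}"
  shows "hol_word M (env h) s w = \<zero>\<^bsub>env h\<^esub>"
proof -
  have "\<zero>\<^bsub>B\<^esub> \<in> set (map fst w)" using assms(2) by force
  then have "foldr (mult B) (map fst w) \<one>\<^bsub>B\<^esub> = \<zero>\<^bsub>B\<^esub>"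
    by (rule foldr_mult_zero[OF ualg_env[OF h] fst_letters[OF assms(1)]])
  then show ?thesis unfolding hol_word_eq[OF assms(1)] by (simp add: vsp_rnull[OF vsp_env[OF h]])
qed

lemma lext_tpow_psi:
  assumes "keys q \<subseteq> homog (env h) \<times> UNIV"
  shows "lext (env h) (pair_fun (env h) s) (tpow k q (psi_word M (env h))) = mlext (env h) k q (hol_word M (env h) s)"
  unfolding hol_word_def
  by (rule lext_tpow[OF vsp_env[OF h] pair_fun_carrier keys_psi_word assms])

lemma zero_homog_env: "\<zero>\<^bsub>env h\<^esub> \<in> homog (env h)"
proof -
  have "ecls h 0 \<in> grade (env h) 0" unfolding env_simps by (rule imageI) simp
  then show ?thesis using lin_zero[OF lin_ecls[OF h]] by (auto intro: homogI)
qed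

text \<open>The terms \<open>0 \<otimes> a\<close> left over from the higher components of \<open>\<rho> \<circ> \<eta>\<close> contribute only products with a
factor 0.\<close>

lemma hol_val_zero_letters:
  assumes q: "keys q \<subseteq> homog (env h) \<times> UNIV" and j: "keys j \<subseteq> {\<zero>\<^bsub>env h\<^esub>} \<times> UNIV"
  shows "hol_val M (env h) s n (q + j) = hol_val M (env h) s n q"
proof -
  have z: "{\<zero>\<^bsub>B\<^esub>} \<times> UNIV \<subseteq> homog B \<times> UNIV" using zero_homog_env by auto
  have qj: "keys (q + j) \<subseteq> homog B \<times> UNIV" using keys_add_sub[OF q] j z by blast
  show ?thesis
    unfolding hol_val_def
  proof (rule lext_sum_eq[OF lin_id[OF vsp_env[OF h]] pair_fun_carrier pair_fun_carrier])
    show "keys (tpow k (q + j) (psi_word M B)) \<subseteq> carrier B \<times> UNIV"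
      "keys (tpow k q (psi_word M B)) \<subseteq> carrier B \<times> UNIV" for k
      by (rule keys_psi_sum[OF qj] keys_psi_sum[OF q])+
    show "lext B (pair_fun B s) (tpow k (q + j) (psi_word M B)) = lext B (pair_fun B s) (tpow k q (psi_word M B))" for k
      unfolding lext_tpow_psi[OF qj] lext_tpow_psi[OF q]
      by (rule mlext_annihilator[OF vsp_env[OF h] hol_word_carrier hol_word_zero q j z])
  qed
qed

lemma hol_val_carrier:
  assumes q: "keys q \<subseteq> homog (env h) \<times> UNIV"
  shows "hol_val M (env h) s n q \<in> carrier (env h)"
proof -
  have "keys (\<Sum>k = 1..n. tpow k q (psi_word M B)) \<subseteq> carrier B \<times> UNIV"
    by (rule keys_sum_sub) (rule keys_psi_sum[OF q])
  then show ?thesis unfolding hol_val_def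
    by (intro lext_in_subsp[OF vsp_env[OF h] subsp_carrier[OF vsp_env[OF h]]] pair_fun_carrier) blast
qed

text \<open>Pairing with a simplex is linear in the pure tensors, so it maps the filtration of \<open>B \<otimes> C\<^sup>\<bullet>(M)\<close> to that of \<open>B\<close>.  What
remains is one value for each representative \<open>q \<in> Q\<close> of the connection.\<close>

lemma pairing_hol_elem:
  assumes M: "smooth_manifold M" and K: "\<And>p. p \<in> \<Union>(\<alpha> n) \<Longrightarrow> keys p \<subseteq> homog h \<times> UNIV"
    and Q: "Q = {e + pw1 (to_env h) p | e p. e \<in> pfil_rep (env h) (Omega M) (env_fil h F) n \<and> p \<in> \<Union>(\<alpha> n)}"
  shows "pairing (env h) (env_fil h F) (hol_elem M h F \<alpha>) s n =
    (\<Union>q\<in>Q. env_fil h F n +>\<^bsub>env h\<^esub> hol_val M (env h) s n q)"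
    and "q \<in> Q \<Longrightarrow> keys q \<subseteq> homog (env h) \<times> UNIV"
proof -
  note BC = graded_closed_env[OF h] and CC = graded_closed_cochains and OC = graded_closed_Omega[OF M]
  note VB = vsp_env[OF h] and FS = subsp_env_fil[OF h, of F n]
  let ?T = "\<lambda>q. \<Sum>k = 1..n. tpow k q (psi_word M B)"
  let ?P = "pfil_rep B (cochains M) (env_fil h F) n"
  show Qk: "keys q \<subseteq> homog B \<times> UNIV" if qQ: "q \<in> Q" for q
  proof -
    obtain e p where q: "q = e + pw1 (to_env h) p" "e \<in> pfil_rep B (Omega M) (env_fil h F) n" "p \<in> \<Union>(\<alpha> n)"
      using qQ Q by blast
    have "keys e \<subseteq> homog B \<times> UNIV" using pfil_rep_subset[OF BC OC] q(2) by blast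
    moreover have "keys (pw1 (to_env h) p) \<subseteq> homog B \<times> UNIV"
      by (rule keys_pext_sub) (use K[OF q(3)] homogI[OF to_env_homog[OF h]] in auto)
    ultimately show ?thesis unfolding q(1) by (rule keys_add_sub)
  qed
  have Q': "\<Union>(hat_map (tprod B (Omega M)) (pfil B (Omega M) (env_fil h F)) (pmap B (Omega M) (to_env h)) \<alpha> n) = Q"
    unfolding Q by (rule Union_hat_pmap[OF BC OC])
  have U: "\<Union>(hol_elem M h F \<alpha> n) = {e + ?T q | e q. e \<in> ?P \<and> q \<in> Q}"
    unfolding hol_elem_def psi_star_def Union_mc_push[OF BC CC] Q' ..
  have lc: "lin (free_dg (carrier B \<times> UNIV) (\<lambda>_ _. 0) 0 (\<lambda>_. 0) (\<lambda>_. 0)) B (lext B (pair_fun B s))"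
    by (rule lin_lext[OF VB pair_fun_carrier])
  have ec: "keys e \<subseteq> carrier B \<times> UNIV" if "e \<in> ?P" for e
    using pfil_rep_subset[OF BC CC] that homog_env_sub[OF h] by blast
  have Tc: "keys (?T q) \<subseteq> carrier B \<times> UNIV" if "q \<in> Q" for q
    by (rule keys_sum_sub) (rule keys_psi_sum[OF Qk[OF that]])
  have lw: "lin (pword B (cochains M)) B (lext B (pair_fun B s))"
    unfolding pword_def by (rule lin_lext[OF VB pair_fun_carrier]) (use homog_env_sub[OF h] in blast)
  have single: "lext B (pair_fun B s) (single u c) = c \<odot>\<^bsub>B\<^esub> pair_fun B s u" if "fst u \<in> carrier B" for u c
    by (rule lext_single[OF VB]) (use pair_fun_carrier that in \<open>simp add: mem_Times_iff\<close>)
  have ef: "lext B (pair_fun B s) e \<in> env_fil h F n" if e: "e \<in> ?P" for e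
  proof (rule lin_vspan_into[OF lw pfil_gens_sub[OF BC CC, where F = "env_fil h F" and n = n] FS _ e[unfolded pfil_rep_def]])
    let ?S = "{single (x, a) 1 | x a. x \<in> homog B \<inter> env_fil h F n \<and> a \<in> homog (cochains M)}"
    have hc: "x \<in> carrier B" if "x \<in> homog B" for x using that homog_env_sub[OF h] by auto
    have z0: "\<zero>\<^bsub>B\<^esub> \<in> env_fil h F n" by (rule subsp_zero[OF VB FS])
    have dif: "lext B (pair_fun B s) (p - q) = lext B (pair_fun B s) p \<oplus>\<^bsub>B\<^esub> (-1) \<odot>\<^bsub>B\<^esub> lext B (pair_fun B s) q"
      if "keys p \<subseteq> carrier B \<times> UNIV" "keys q \<subseteq> carrier B \<times> UNIV" for p q
      by (rule lin_diff[OF lc that])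
    note SS = vsp_simps[OF VB]
    have three: "lext B (pair_fun B s) (single u 1 - single v 1 - single w 1) = \<zero>\<^bsub>B\<^esub>"
      if "fst u \<in> carrier B" "fst v \<in> carrier B" "fst w \<in> carrier B"
        "pair_fun B s u = pair_fun B s v \<oplus>\<^bsub>B\<^esub> pair_fun B s w" for u v w
    proof -
      define y z where "y = pair_fun B s v" and "z = pair_fun B s w"
      have yz: "y \<in> carrier B" "z \<in> carrier B" unfolding y_def z_def using that(2,3) by (auto intro!: pair_fun_carrier simp: mem_Times_iff)
      have k: "keys (single u 1 - single v (1::real)) \<subseteq> carrier B \<times> UNIV"
        by (rule keys_diff_single) (use that(1,2) in \<open>auto simp: mem_Times_iff\<close>)
      have "lext B (pair_fun B s) (single u 1 - single v 1 - single w 1)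
          = (y \<oplus>\<^bsub>B\<^esub> z) \<oplus>\<^bsub>B\<^esub> (-1) \<odot>\<^bsub>B\<^esub> y \<oplus>\<^bsub>B\<^esub> (-1) \<odot>\<^bsub>B\<^esub> z"
        using that k yz by (simp add: dif single SS(2,12) mem_Times_iff flip: y_def z_def)
      also have "\<dots> = (y \<oplus>\<^bsub>B\<^esub> (-1) \<odot>\<^bsub>B\<^esub> y) \<oplus>\<^bsub>B\<^esub> (z \<oplus>\<^bsub>B\<^esub> (-1) \<odot>\<^bsub>B\<^esub> z)"
        using yz by (simp add: SS(2-6))
      also have "\<dots> = \<zero>\<^bsub>B\<^esub>" using yz by (simp only: vsp_neg2[OF VB] SS(1,7))
      finally show ?thesis .
    qed
    have two: "lext B (pair_fun B s) (single u 1 - single v c) = \<zero>\<^bsub>B\<^esub>"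
      if "fst u \<in> carrier B" "fst v \<in> carrier B" "pair_fun B s u = c \<odot>\<^bsub>B\<^esub> pair_fun B s v" for u v c
    proof -
      define y where "y = c \<odot>\<^bsub>B\<^esub> pair_fun B s v"
      have y: "y \<in> carrier B" unfolding y_def using that(2) by (auto intro!: SS(3) pair_fun_carrier simp: mem_Times_iff)
      have "lext B (pair_fun B s) (single u 1 - single v c) = y \<oplus>\<^bsub>B\<^esub> (-1) \<odot>\<^bsub>B\<^esub> y"
        using that y by (simp add: dif single SS(12) mem_Times_iff flip: y_def)
      then show ?thesis using vsp_neg2[OF VB y] by simp
    qed
    show "lext B (pair_fun B s) ` (pgens B (cochains M) \<union> ?S) \<subseteq> env_fil h F n"
    proof (rule image_subsetI)
      fix p assume "p \<in> pgens B (cochains M) \<union> ?S"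
      then consider "p \<in> pgens B (cochains M)" | x a where "x \<in> homog B" "x \<in> env_fil h F n" "p = single (x, a) 1" by blast
      then show "lext B (pair_fun B s) p \<in> env_fil h F n"
      proof cases
        case 1
        then have "lext B (pair_fun B s) p = \<zero>\<^bsub>B\<^esub>"
        proof (cases rule: pgens_cases)
          case (add1 x y a k)
          have "x \<in> homog B" "y \<in> homog B" "x \<oplus>\<^bsub>B\<^esub> y \<in> homog B" using add1(1,2) graded_closedD(1)[OF BC add1(1,2)] by (auto intro: homogI)
          then show ?thesis unfolding add1(4) by (intro three) (auto simp: hc pair_fun_def SS(10))
        next
          case (add2 x a b k)
          then show ?thesis unfolding add2(4)
            by (intro three) (auto simp: hc pair_fun_def cochains_def distrib_left SS(9))
        next
          case (smult1 x a c)
          have "c \<odot>\<^bsub>B\<^esub> x \<in> homog B" by (rule graded_closedD(3)[OF BC smult1(1)])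
          then show ?thesis unfolding smult1(3) using smult1(1)
            by (intro two) (auto simp: hc pair_fun_def SS(11) mult_ac)
        next
          case (smult2 x a c)
          then show ?thesis unfolding smult2(3)
            by (intro two) (auto simp: hc pair_fun_def cochains_def SS(11) mult_ac)
        qed
        then show ?thesis using z0 by simp
      next
        case (2 x a)
        have "lext B (pair_fun B s) p = 1 \<odot>\<^bsub>B\<^esub> pair_fun B s (x, a)"
          unfolding 2(3) by (rule single) (simp add: hc 2(1))
        moreover have "pair_fun B s (x, a) \<in> env_fil h F n"
          using subsp_smult[OF VB FS 2(2)] by (simp add: pair_fun_def)
        ultimately show ?thesis using subsp_smult[OF VB FS] by simp
      qed
    qed
  qed
  have coset: "env_fil h F n +>\<^bsub>B\<^esub> lext B (pair_fun B s) (e + ?T q) = env_fil h F n +>\<^bsub>B\<^esub> hol_val M B s n q"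
    if e: "e \<in> ?P" and q: "q \<in> Q" for e q
  proof -
    have "lext B (pair_fun B s) (e + ?T q) = lext B (pair_fun B s) e \<oplus>\<^bsub>B\<^esub> hol_val M B s n q"
      using lin_add[OF lc, of e "?T q"] ec[OF e] Tc[OF q] by (simp add: hol_val_def)
    then show ?thesis
      using coset_mem[OF VB FS ef[OF e] hol_val_carrier[OF Qk[OF q]]] by simp
  qed
  have "pairing B (env_fil h F) (hol_elem M h F \<alpha>) s n =
      (\<Union>p\<in>\<Union>(hol_elem M h F \<alpha> n). env_fil h F n +>\<^bsub>B\<^esub> lext B (pair_fun B s) p)"
    unfolding pairing_def pair_fun_def by blast
  also have "\<dots> = (\<Union>e\<in>?P. \<Union>q\<in>Q. env_fil h F n +>\<^bsub>B\<^esub> lext B (pair_fun B s) (e + ?T q))"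
    unfolding U by blast
  also have "\<dots> = (\<Union>e\<in>?P. \<Union>q\<in>Q. env_fil h F n +>\<^bsub>B\<^esub> hol_val M B s n q)"
    by (intro SUP_cong refl coset)
  also have "\<dots> = (\<Union>q\<in>Q. env_fil h F n +>\<^bsub>B\<^esub> hol_val M B s n q)"
    using pfil_rep_zero[OF BC CC] by auto
  finally show "pairing B (env_fil h F) (hol_elem M h F \<alpha>) s n = (\<Union>q\<in>Q. env_fil h F n +>\<^bsub>B\<^esub> hol_val M B s n q)" .
qed

end

text \<open>The holonomy is natural because \<open>Uf\<close> is multiplicative and preserves degrees, and thereby the Koszul signs.  A
letter with image 0 has an image of arbitrary degree, but then the product vanishes.\<close>

lemma (in env_functor) Uf_hol_val:
  assumes q: "keys q \<subseteq> homog (env h) \<times> UNIV"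
  shows "Uf (hol_val M (env h) s n q) = hol_val M (env g) s n (pw1 Uf q)"
proof -
  let ?H = "homog (env h) \<times> UNIV" and ?G = "homog (env g) \<times> UNIV" and ?\<phi> = "map_prod Uf id"
  note Vh = vsp_env[OF h] and Vg = vsp_env[OF g(1)]
  have pw: "pw1 Uf q = pext (\<lambda>u. single (?\<phi> u) 1) q" by (rule pext_cong) auto
  have Uh: "Uf x \<in> homog (env g)" if "x \<in> homog (env h)" for x
    by (rule homogI[OF Uf_grade[OF deg_mem[OF that]]])
  have \<phi>: "?\<phi> ` ?H \<subseteq> ?G" using Uh by auto
  have kq: "keys (pw1 Uf q) \<subseteq> ?G" unfolding pw by (rule keys_pext_sub) (use q \<phi> in auto)
  have pf: "x \<in> carrier (env k) \<times> UNIV \<Longrightarrow> pair_fun (env k) s x \<in> carrier (env k)" if "glie k" for k :: "'c dg" and x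
    by (auto simp: pair_fun_def vsp_smult[OF vsp_env[OF that]])
  have word: "Uf (hol_word M (env h) s w) = hol_word M (env g) s (map ?\<phi> w)" if w: "set w \<subseteq> ?H" for w
  proof -
    have w': "set (map ?\<phi> w) \<subseteq> ?G" using w \<phi> by auto
    let ?a = "\<lambda>B w. sg (\<Sum>(i, j)\<in>{(i, j). i < j \<and> j < length w}. (deg (Omega M) (snd (w ! i)) - 1) * deg B (fst (w ! j)))"
    let ?b = "sg (int (fst s * (fst s + 1) div 2)) * psi M (map snd w) s"
    have fc: "set (map fst w) \<subseteq> carrier (env h)" using w homog_env_sub[OF h] by auto
    have pc: "foldr (mult (env h)) (map fst w) \<one>\<^bsub>env h\<^esub> \<in> carrier (env h)" by (rule foldr_mult_closed[OF ualg_env[OF h] fc])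
    let ?P = "foldr (mult (env g)) (map fst (map ?\<phi> w)) \<one>\<^bsub>env g\<^esub>"
    have P: "Uf (foldr (mult (env h)) (map fst w) \<one>\<^bsub>env h\<^esub>) = ?P"
      by (simp add: Uf_foldr[OF fc] comp_def)
    have sn: "map snd (map ?\<phi> w) = map snd w" by simp
    have L: "Uf (hol_word M (env h) s w) = ?a (env h) w \<odot>\<^bsub>env g\<^esub> (?b \<odot>\<^bsub>env g\<^esub> ?P)"
      unfolding hol_word_eq[OF h w] P[symmetric] using pc by (simp only: lin_smult[OF lin_Uf] vsp_smult[OF Vh])
    have R: "hol_word M (env g) s (map ?\<phi> w) = ?a (env g) (map ?\<phi> w) \<odot>\<^bsub>env g\<^esub> (?b \<odot>\<^bsub>env g\<^esub> ?P)"
      unfolding hol_word_eq[OF g(1) w'] sn ..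
    show ?thesis
    proof (cases "\<zero>\<^bsub>env g\<^esub> \<in> set (map fst (map ?\<phi> w))")
      case True
      have "?P = \<zero>\<^bsub>env g\<^esub>"
        by (rule foldr_mult_zero[OF ualg_env[OF g(1)] _ True]) (use w' homog_env_sub[OF g(1)] in fastforce)
      then show ?thesis unfolding L R by (simp add: vsp_rnull[OF Vg])
    next
      case False
      have "deg (env g) (fst (map ?\<phi> w ! j)) = deg (env h) (fst (w ! j))" if j: "j < length w" for j
      proof -
        have x: "fst (w ! j) \<in> homog (env h)" using w nth_mem[OF j] by auto
        have "Uf (fst (w ! j)) \<noteq> \<zero>\<^bsub>env g\<^esub>" using False nth_mem[OF j] by force
        then have "deg (env g) (Uf (fst (w ! j))) = deg (env h) (fst (w ! j))"
          by (rule deg_eq[OF deg_unique_env[OF g] Uf_grade[OF deg_mem[OF x]]])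
        then show ?thesis using j by simp
      qed
      then have "(\<Sum>(i, j)\<in>{(i, j). i < j \<and> j < length w}. (deg (Omega M) (snd (map ?\<phi> w ! i)) - 1) * deg (env g) (fst (map ?\<phi> w ! j))) =
        (\<Sum>(i, j)\<in>{(i, j). i < j \<and> j < length w}. (deg (Omega M) (snd (w ! i)) - 1) * deg (env h) (fst (w ! j)))"
        by (intro sum.cong) auto
      then show ?thesis unfolding L R by simp
    qed
  qed
  show ?thesis
    unfolding hol_val_def
  proof (rule lext_sum_eq[OF lin_Uf, where S = "carrier (env h) \<times> UNIV" and S' = "carrier (env g) \<times> UNIV"])
    show "x \<in> carrier (env h) \<times> UNIV \<Longrightarrow> pair_fun (env h) s x \<in> carrier (env h)"
      "x' \<in> carrier (env g) \<times> UNIV \<Longrightarrow> pair_fun (env g) s x' \<in> carrier (env g)" for x x'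
      by (auto simp: pair_fun_def vsp_smult[OF Vh] vsp_smult[OF Vg])
    show "keys (tpow k q (psi_word M (env h))) \<subseteq> carrier (env h) \<times> UNIV"
      "keys (tpow k (pw1 Uf q) (psi_word M (env g))) \<subseteq> carrier (env g) \<times> UNIV" for k
      by (rule keys_psi_sum[OF h q] keys_psi_sum[OF g(1) kq])+
    show "Uf (lext (env h) (pair_fun (env h) s) (tpow k q (psi_word M (env h)))) =
        lext (env g) (pair_fun (env g) s) (tpow k (pw1 Uf q) (psi_word M (env g)))" for k
    proof -
      have "Uf (mlext (env h) k q (hol_word M (env h) s)) = mlext (env g) k q (\<lambda>w. Uf (hol_word M (env h) s w))"
        by (rule lin_mlext[OF lin_Uf hol_word_carrier[OF h] q])
      also have "\<dots> = mlext (env g) k q (\<lambda>w. hol_word M (env g) s (map ?\<phi> w))"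
      proof (rule mlext_cong[OF Vg word _ q])
        show "hol_word M (env g) s (map ?\<phi> w) \<in> carrier (env g)" if "set w \<subseteq> ?H" for w
          by (rule hol_word_carrier[OF g(1)]) (use \<phi> that in auto)
      qed
      also have "\<dots> = mlext (env g) k (pw1 Uf q) (hol_word M (env g) s)"
        unfolding pw by (rule mlext_push[OF Vg hol_word_carrier[OF g(1)] \<phi> q, symmetric])
      finally show ?thesis
        unfolding lext_tpow_psi[OF h q] lext_tpow_psi[OF g(1) kq] .
    qed
  qed
qed

section \<open>Comparison of the two holonomies on a simplex\<close>

text \<open>A nonzero \<open>x\<close> has a single degree, which is the degree of the word \<open>[x]\<close>; the class of \<open>[0]\<close> is 0 and lies in every
component.\<close>

lemma hlin_to_env:
  assumes h: "glie h" and u: "deg_unique h"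
  shows "hlin h (env h) (to_env h)"
proof -
  note hD = glieD[OF h]
  note E = linD[OF lin_ecls[OF h], unfolded tword_simps mem_Collect_eq]
  have eq: "ecls h p = ecls h q" if "keys p \<subseteq> lists (homog h)" "keys q \<subseteq> lists (homog h)" "p - q \<in> trel h" for p q
    using ecls_eq_iff[OF h that(1,2)] that(3) trel_sub_urels[OF h] by auto
  have k: "keys (single [x] c) \<subseteq> lists (homog h)" if "x \<in> homog h" for x and c :: real
    using that by simp
  have gr: "to_env h x \<in> grade (env h) k" if x: "x \<in> grade h k" for x k
  proof (cases "x = \<zero>\<^bsub>h\<^esub>")
    case True
    have "ecls h (single [x] 1) = ecls h 0"
      by (rule eq) (use zero_word_trel[OF hD(1,2), of "[x]" 1] True homogI[OF x] in simp_all)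
    then show ?thesis unfolding to_env_eq env_simps by auto
  next
    case False
    then show ?thesis using to_env_homog[OF h homogI[OF x]] deg_eq[OF u x] by simp
  qed
  show ?thesis
    unfolding hlin_def
  proof (intro allI ballI conjI)
    fix k x assume x: "x \<in> grade h k"
    note xh = homogI[OF x]
    show "to_env h x \<in> grade (env h) k" by (rule gr[OF x])
    show "to_env h (c \<odot>\<^bsub>h\<^esub> x) = c \<odot>\<^bsub>env h\<^esub> to_env h x" for c
    proof -
      have "c \<odot>\<^bsub>h\<^esub> x \<in> homog h" by (rule graded_closedD(3)[OF hD(2) xh])
      moreover have "single ([] @ [c \<odot>\<^bsub>h\<^esub> x] @ []) 1 - single ([] @ [x] @ []) c \<in> trel h"
        by (rule tgens_trel[OF tgens_smultI]) (use xh in simp_all)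
      ultimately have "ecls h (single [c \<odot>\<^bsub>h\<^esub> x] 1) = ecls h (single [x] c)"
        using k[OF xh] by (intro eq) (simp_all add: k)
      then show ?thesis unfolding to_env_eq using E(5)[OF k[OF xh], of c 1] by simp
    qed
    fix y assume y: "y \<in> grade h k"
    note yh = homogI[OF y]
    have xy: "x \<oplus>\<^bsub>h\<^esub> y \<in> homog h" using graded_closedD(1)[OF hD(2) x y] by (rule homogI)
    have "single ([] @ [x \<oplus>\<^bsub>h\<^esub> y] @ []) 1 - single ([] @ [x] @ []) 1 - single ([] @ [y] @ []) 1 \<in> trel h"
      by (rule tgens_trel[OF tgens_addI]) (use x y in simp_all)
    then have "ecls h (single [x \<oplus>\<^bsub>h\<^esub> y] 1) = ecls h (single [x] 1 + single [y] 1)"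
      by (intro eq k[OF xy] keys_add_sub k[OF xh] k[OF yh]) (simp add: algebra_simps)
    then show "to_env h (x \<oplus>\<^bsub>h\<^esub> y) = to_env h x \<oplus>\<^bsub>env h\<^esub> to_env h y"
      unfolding to_env_eq using E(4)[OF k[OF xh] k[OF yh]] by simp
  qed
qed

lemma to_env_fil:
  assumes "glie h" "x \<in> homog h" "x \<in> F n"
  shows "to_env h x \<in> env_fil h F n"
  unfolding to_env_eq env_fil_eq[OF assms(1)]
  by (rule imageI) (use assms(2,3) in \<open>auto simp: wt_words_def intro!: exI[of _ "[n]"]\<close>)

text \<open>By \<open>rho_eta\<close> the term \<open>k = 1\<close> is \<open>p\<close> itself.  The terms with \<open>k > 1\<close> have first factors 0; they stay as \<open>j\<close>
because combinations of pure tensors are compared here, not their classes.\<close>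

lemma rho_eta_push:
  fixes M :: "'m manifold"
  assumes g: "dg_lie g" and p: "keys p \<subseteq> homog g \<times> homog (Omega M)" and n: "0 < n"
  shows "\<exists>j. pw1 (rho g) (\<Sum>k = 1..n. tpow k p (eta_word M g)) = p + j \<and> keys j \<subseteq> {\<zero>\<^bsub>g\<^esub>} \<times> UNIV"
proof -
  let ?T = "\<lambda>k. tpow k p (\<lambda>w. pw1 (rho g) (eta_word M g w))"
  have w: "map fst w \<in> lists (homog g)" if "set w \<subseteq> keys p" for w
    using that p by fastforce
  have "?T 1 = pext (\<lambda>x. single x 1) p"
    unfolding One_nat_def tpow_Suc tpow_0
  proof (rule pext_cong)
    fix x assume x: "x \<in> keys p"
    obtain y a where ya: "x = (y, a)" "y \<in> homog g" "a \<in> homog (Omega M)" using x p by auto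
    have r: "rho g (eta g [y]) = y" using rho_eta[OF g, of "[y]"] ya by simp
    have z: "(\<Sum>(i, j)\<in>{(i, j). i < j \<and> j < length [x]}. deg (Omega M) (snd ([x] ! i)) * (deg g (fst ([x] ! j)) + 1)) = 0"
      by (rule sum.neutral) auto
    have e: "eta_word M g [x] = single (eta g [y], a) 1"
      unfolding eta_word_def z using Omega_mult_one[OF ya(3)] by (simp add: ya(1) sg_def)
    show "pw1 (rho g) (eta_word M g [x]) = single x 1" unfolding e using r by (simp add: ya(1))
  qed
  then have T1: "?T 1 = p" by (simp add: pext_id)
  have Tk: "keys (?T k) \<subseteq> {\<zero>\<^bsub>g\<^esub>} \<times> UNIV" if k: "k \<in> {1..n} - {1}" for k
  proof (rule keys_tpow)
    fix v :: "('a \<times> 'm form) list" assume v: "length v = k" "set v \<subseteq> keys p"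
    have "v \<noteq> []" "length v \<noteq> 1" using v k by auto
    then have "rho g (eta g (map fst v)) = \<zero>\<^bsub>g\<^esub>" using rho_eta[OF g w[OF v(2)]] by simp
    then show "keys (pw1 (rho g) (eta_word M g v)) \<subseteq> {\<zero>\<^bsub>g\<^esub>} \<times> UNIV"
      unfolding eta_word_def by simp
  qed
  have "pw1 (rho g) (\<Sum>k = 1..n. tpow k p (eta_word M g)) = (\<Sum>k = 1..n. ?T k)"
    by (simp add: pext_sum pext_tpow)
  also have "\<dots> = ?T 1 + (\<Sum>k\<in>{1..n} - {1}. ?T k)" by (rule sum.remove) (use n in auto)
  finally have "pw1 (rho g) (\<Sum>k = 1..n. tpow k p (eta_word M g)) = p + (\<Sum>k\<in>{1..n} - {1}. ?T k)" unfolding T1 .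
  moreover have "keys (\<Sum>k\<in>{1..n} - {1}. ?T k) \<subseteq> {\<zero>\<^bsub>g\<^esub>} \<times> UNIV" by (rule keys_sum_sub[OF Tk])
  ultimately show ?thesis by blast
qed

text \<open>A connection is homogeneous, so each of its cosets has a representative by pure tensors.\<close>

lemma connection_rep:
  fixes M :: "'m manifold"
  assumes M: "smooth_manifold M" and g: "graded_closed g" and \<alpha>: "flat_connection M g F \<alpha>"
  shows "\<Union>(\<alpha> n) \<noteq> {}" and "p \<in> \<Union>(\<alpha> n) \<Longrightarrow> keys p \<subseteq> homog g \<times> homog (Omega M)"
proof -
  note O = graded_closed_Omega[OF M]
  have "\<alpha> n \<in> grade (quot (tprod g (Omega M)) (pfil g (Omega M) F n)) 1"
    using \<alpha> by (simp add: flat_connection_def Let_def hat_def)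
  then obtain r where r: "r \<in> grade (pword g (Omega M)) 1"
    and a: "\<alpha> n = pfil g (Omega M) F n +>\<^bsub>tprod g (Omega M)\<^esub> pcls g (Omega M) r"
    unfolding quot_simps tprod_def pcls_def by auto
  have rk: "keys r \<subseteq> homog g \<times> homog (Omega M)" using r by (auto simp: pword_def)
  have U: "\<Union>(\<alpha> n) = {e + q | e q. e \<in> pfil_rep g (Omega M) F n \<and> q \<in> {r}}"
    unfolding a by (rule Union_pfil_coset[OF g O pcls_eq[OF g O]])
  show "\<Union>(\<alpha> n) \<noteq> {}" unfolding U using pfil_rep_zero[OF g O] by blast
  show "keys p \<subseteq> homog g \<times> homog (Omega M)" if pU: "p \<in> \<Union>(\<alpha> n)"
  proof -
    obtain e where e: "p = e + r" "e \<in> pfil_rep g (Omega M) F n" using pU unfolding U by auto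
    have "keys e \<subseteq> homog g \<times> homog (Omega M)" using pfil_rep_subset[OF g O] e(2) by blast
    then show ?thesis unfolding e(1) by (rule keys_add_sub[OF _ rk])
  qed
qed

lemma cmap_Union: "cmap W N f (\<Union>i\<in>I. X i) = (\<Union>i\<in>I. cmap W N f (X i))"
  by (auto simp: cmap_def)

text \<open>Both sides are unions over representatives.  By naturality the left one becomes the union of the values in \<open>U(g)\<close> at
the images of the representatives in \<open>U(S(g)) \<otimes> \<Omega>(M)\<close>, and up to letters 0 these images are exactly the
representatives in \<open>U(g) \<otimes> \<Omega>(M)\<close>: by \<open>rho_eta_push\<close> they are \<open>\<alpha>\<close> up to the filtration, and every element of the
filtration occurs, since \<open>U(\<rho>)\<close> is onto in each degree and filtration step.\<close>

lemma hat_env_rho_pairing: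
  fixes M :: "'m manifold" and g :: "'g dg"
  assumes M: "smooth_manifold M" and gL: "dg_lie g" and F: "lie_filtration g F" and \<alpha>: "flat_connection M g F \<alpha>"
  shows "hat_env_rho g F (pairing (env (strict g)) (env_fil (strict g) (str_fil g F)) (hol_inf_elem M g F \<alpha>) s) =
      pairing (env g) (env_fil g F) (hol_elem M g F \<alpha>) s"
    and "pairing (env (strict g)) (env_fil (strict g) (str_fil g F)) (hol_inf_elem M g F \<alpha>) s n \<subseteq> carrier (env (strict g))"
proof -
  interpret env_functor "strict g" g "rho g" by (rule strict_functor[OF gL])
  note O = graded_closed_Omega[OF M]
  note BS = graded_closed_env[OF h] and Bg = graded_closed_env[OF g(1)]
  let ?S = "strict g" and ?FS = "str_fil g F" and ?O = "Omega M"
  let ?\<alpha> = "mc_push ?S ?O (pfil ?S ?O ?FS) (eta_word M g) \<alpha>"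
  let ?T = "\<lambda>n p. \<Sum>k = 1..n. tpow k p (eta_word M g)"
  have gl: "glie g" and gu: "deg_unique g" using dg_lieD(4,5)[OF gL] by blast+
  note Cg = glie_closed[OF gl] and CS = glie_closed[OF h]
  note R = connection_rep[OF M Cg \<alpha>]
  have U\<alpha>: "\<Union>(?\<alpha> n) = {e + ?T n p | e p. e \<in> pfil_rep ?S ?O ?FS n \<and> p \<in> \<Union>(\<alpha> n)}" for n
    by (rule Union_mc_push[OF CS O])
  have Tk: "keys (?T n p) \<subseteq> homog ?S \<times> UNIV" if p: "p \<in> \<Union>(\<alpha> n)" for n p
  proof (intro keys_sum_sub keys_tpow)
    fix k and w :: "('g \<times> 'm form) list" assume k: "k \<in> {1..n}" and w: "length w = k" "set w \<subseteq> keys p"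
    have "map fst w \<in> lists (homog g)" "map fst w \<noteq> []" using w k R(2)[OF p] by fastforce+
    then show "keys (eta_word M g w) \<subseteq> homog ?S \<times> UNIV"
      using eta_homog[OF gL] by (simp add: eta_word_def)
  qed
  have Ek: "keys e \<subseteq> homog ?S \<times> UNIV" if "e \<in> pfil_rep ?S ?O ?FS n" for e n
    using pfil_rep_subset[OF CS O] that by blast
  have KS: "keys p \<subseteq> homog ?S \<times> UNIV" if pU: "p \<in> \<Union>(?\<alpha> n)" for p n
  proof -
    obtain e r where p: "p = e + ?T n r" "e \<in> pfil_rep ?S ?O ?FS n" "r \<in> \<Union>(\<alpha> n)"
      using pU unfolding U\<alpha> by blast
    show ?thesis unfolding p(1) by (rule keys_add_sub[OF Ek[OF p(2)] Tk[OF p(3)]])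
  qed
  have Kg: "keys p \<subseteq> homog g \<times> UNIV" if "p \<in> \<Union>(\<alpha> n)" for p n
    using R(2)[OF that] by blast
  define QS where "QS n = {e + pw1 (to_env ?S) p | e p. e \<in> pfil_rep (env ?S) ?O (env_fil ?S ?FS) n \<and> p \<in> \<Union>(?\<alpha> n)}" for n
  define Qg where "Qg n = {e + pw1 (to_env g) p | e p. e \<in> pfil_rep (env g) ?O (env_fil g F) n \<and> p \<in> \<Union>(\<alpha> n)}" for n
  have PS: "pairing (env ?S) (env_fil ?S ?FS) (hol_elem M ?S ?FS ?\<alpha>) s n =
      (\<Union>q\<in>QS n. env_fil ?S ?FS n +>\<^bsub>env ?S\<^esub> hol_val M (env ?S) s n q)"
    "q \<in> QS n \<Longrightarrow> keys q \<subseteq> homog (env ?S) \<times> UNIV" for n q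
    by (rule pairing_hol_elem(1)[OF h M _ QS_def], erule KS) (rule pairing_hol_elem(2)[OF h M _ QS_def], erule KS)
  have Pg: "pairing (env g) (env_fil g F) (hol_elem M g F \<alpha>) s n =
      (\<Union>q\<in>Qg n. env_fil g F n +>\<^bsub>env g\<^esub> hol_val M (env g) s n q)"
    "q \<in> Qg n \<Longrightarrow> keys q \<subseteq> homog (env g) \<times> UNIV" for n q
    by (rule pairing_hol_elem(1)[OF gl M _ Qg_def], erule Kg) (rule pairing_hol_elem(2)[OF gl M _ Qg_def], erule Kg)
  let ?vS = "\<lambda>n q. hol_val M (env ?S) s n q" and ?vg = "\<lambda>n q. hol_val M (env g) s n q"
  note VS = vsp_env[OF h] and Vg = vsp_env[OF gl]
  have vS: "?vS n q \<in> carrier (env ?S)" if "q \<in> QS n" for n q by (rule hol_val_carrier[OF h PS(2)[OF that]])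
  have Ufil: "Uf x \<in> env_fil g F n" if "x \<in> env_fil ?S ?FS n" for x n
    by (rule Uf_fil[OF rho_fil[OF gL F] that])
  show sub: "pairing (env ?S) (env_fil ?S ?FS) (hol_inf_elem M g F \<alpha>) s n \<subseteq> carrier (env ?S)" for n
    unfolding hol_inf_elem_def PS(1) using coset_sub[OF VS subsp_env_fil[OF h] vS] by blast
  have Us: "hlin (env ?S) (env g) Uf"
    unfolding hlin_def
  proof (intro allI ballI conjI)
    fix k x assume x: "x \<in> grade (env ?S) k"
    have c: "y \<in> carrier (env ?S)" if "y \<in> grade (env ?S) k" for y using homogI[OF that] homog_env_sub[OF h] by blast
    show "Uf x \<in> grade (env g) k" by (rule Uf_grade[OF x])
    show "Uf (c \<odot>\<^bsub>env ?S\<^esub> x) = c \<odot>\<^bsub>env g\<^esub> Uf x" for c by (rule lin_smult[OF lin_Uf c[OF x]])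
    fix y assume "y \<in> grade (env ?S) k"
    then show "Uf (x \<oplus>\<^bsub>env ?S\<^esub> y) = Uf x \<oplus>\<^bsub>env g\<^esub> Uf y" by (intro lin_add[OF lin_Uf] c x)
  qed
  have lift: "\<exists>x\<in>grade (env ?S) k \<inter> env_fil ?S ?FS n. Uf x = y" if "y \<in> grade (env g) k" "y \<in> env_fil g F n" for y k n
    using Uf_lift[of "\<lambda>x. eta g [x]", OF _ _ eta_fil[OF gL] that] eta_homog[OF gL] rho_eta[OF gL] by simp
  \<comment> \<open>Index 0 of the filtration is everything, so \<open>lift\<close> at index 0 lifts all homogeneous elements.\<close>
  have all: "y \<in> env_fil g F 0" if "y \<in> grade (env g) k" for y k
  proof -
    have "lists (homog g) \<subseteq> wt_words g F 0"
    proof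
      fix w assume w: "w \<in> lists (homog g)"
      have "w ! i \<in> F 0" if "i < length w" for i
        using w nth_mem[OF that] lie_filtrationD(4)[OF gL F] glie_homog_sub[OF gl] by auto
      then show "w \<in> wt_words g F 0"
        using w unfolding wt_words_def by (auto intro!: exI[of _ "replicate (length w) 0"])
    qed
    then show ?thesis using that unfolding env_fil_eq[OF gl] env_simps by blast
  qed
  have ontoF: "\<exists>e'\<in>pfil_rep (env ?S) ?O (env_fil ?S ?FS) n. pw1 Uf e' = e" if "e \<in> pfil_rep (env g) ?O (env_fil g F) n" for e n
    by (rule pw1_pfil_rep_onto[OF Us BS O _ lift that]) (use lift all in blast)+
  have intoF: "pw1 Uf e \<in> pfil_rep (env g) ?O (env_fil g F) n" if "e \<in> pfil_rep (env ?S) ?O (env_fil ?S ?FS) n" for e n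
    by (rule pw1_pfil_rep[OF Us BS Bg O Ufil that])
  have comp: "pw1 Uf (pw1 (to_env ?S) p) = pw1 (to_env g) (pw1 (rho g) p)" if "keys p \<subseteq> homog ?S \<times> UNIV" for p :: "('g tens lie \<times> 'm form) \<Rightarrow>\<^sub>0 real"
    unfolding pext_pext by (rule pext_cong) (use that Uf_to_env in auto)
  have into2: "pw1 (to_env g) (pw1 (rho g) e) \<in> pfil_rep (env g) ?O (env_fil g F) n" if "e \<in> pfil_rep ?S ?O ?FS n" for e n
  proof (rule pw1_pfil_rep[OF hlin_to_env[OF gl gu] Cg Bg O])
    show "pw1 (rho g) e \<in> pfil_rep g ?O F n"
      by (rule pw1_pfil_rep[OF f CS Cg O rho_fil[OF gL F] that])
    show "to_env g x \<in> env_fil g F n" if "x \<in> homog g" "x \<in> F n" for x by (rule to_env_fil[of g x F n, OF gl that])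
  qed
  have e0: "to_env g \<zero>\<^bsub>g\<^esub> = \<zero>\<^bsub>env g\<^esub>"
  proof -
    have "\<zero>\<^bsub>g\<^esub> \<in> homog g"
      using homogI[OF subsp_zero[OF dg_lieD(1,2)[OF gL]]] .
    then have "to_env g (0 \<odot>\<^bsub>g\<^esub> \<zero>\<^bsub>g\<^esub>) = 0 \<odot>\<^bsub>env g\<^esub> to_env g \<zero>\<^bsub>g\<^esub>" "to_env g \<zero>\<^bsub>g\<^esub> \<in> carrier (env g)"
      using hlinD(2,4)[OF hlin_to_env[OF gl gu]] homog_env_sub[OF gl] by blast+
    then show ?thesis by (simp add: vsp_null[OF Vg] vsp_rnull[OF glie_vsp[OF gl]])
  qed
  \<comment> \<open>The sets of representatives agree only up to letters 0, so their values are compared.\<close>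
  have image: "?vg n ` pw1 Uf ` QS n = ?vg n ` Qg n" for n
  proof (cases "n = 0")
    case True
    \<comment> \<open>The sum over \<open>1 \<le> k \<le> n\<close> is empty, so the values are constant and it is enough that both index sets are inhabited.\<close>
    have v: "?vg n q = lext (env g) (pair_fun (env g) s) 0" for q unfolding hol_val_def True by simp
    obtain p where p: "p \<in> \<Union>(\<alpha> n)" using R(1)[of n] by blast
    have "0 + ?T n p \<in> \<Union>(?\<alpha> n)" unfolding U\<alpha> using p pfil_rep_zero[OF CS O] by blast
    then have "0 + pw1 (to_env ?S) (0 + ?T n p) \<in> QS n" unfolding QS_def using pfil_rep_zero[OF BS O] by blast
    moreover have "0 + pw1 (to_env g) p \<in> Qg n" unfolding Qg_def using p pfil_rep_zero[OF Bg O] by blast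
    ultimately show ?thesis by (auto simp: v)
  next
    case False
    then have n: "0 < n" by simp
    have push: "\<exists>j. pw1 Uf (e' + pw1 (to_env ?S) (e + ?T n p)) = (pw1 Uf e' + pw1 (to_env g) (pw1 (rho g) e)) + pw1 (to_env g) p + j
        \<and> keys j \<subseteq> {\<zero>\<^bsub>env g\<^esub>} \<times> UNIV"
      if e: "e \<in> pfil_rep ?S ?O ?FS n" and p: "p \<in> \<Union>(\<alpha> n)" for e' e p
    proof -
      obtain j where j: "pw1 (rho g) (?T n p) = p + j" "keys j \<subseteq> {\<zero>\<^bsub>g\<^esub>} \<times> UNIV"
        using rho_eta_push[OF gL R(2)[OF p] n] by blast
      have "pw1 Uf (e' + pw1 (to_env ?S) (e + ?T n p)) = (pw1 Uf e' + pw1 (to_env g) (pw1 (rho g) e)) + pw1 (to_env g) p + pw1 (to_env g) j"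
        unfolding pext_add comp[OF Ek[OF e]] comp[OF Tk[OF p]] j(1) by (simp add: add.assoc)
      moreover have "keys (pw1 (to_env g) j) \<subseteq> {\<zero>\<^bsub>env g\<^esub>} \<times> UNIV"
        by (rule keys_pext_sub) (use j(2) e0 in auto)
      ultimately show ?thesis by blast
    qed
    show ?thesis
    proof (intro equalityI subsetI)
      fix x assume "x \<in> ?vg n ` pw1 Uf ` QS n"
      then obtain e' e p where x: "x = ?vg n (pw1 Uf (e' + pw1 (to_env ?S) (e + ?T n p)))"
        and ep: "e' \<in> pfil_rep (env ?S) ?O (env_fil ?S ?FS) n" "e \<in> pfil_rep ?S ?O ?FS n" "p \<in> \<Union>(\<alpha> n)"
        unfolding QS_def U\<alpha> by blast
      define q where "q = (pw1 Uf e' + pw1 (to_env g) (pw1 (rho g) e)) + pw1 (to_env g) p"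
      obtain j where j: "pw1 Uf (e' + pw1 (to_env ?S) (e + ?T n p)) = q + j" "keys j \<subseteq> {\<zero>\<^bsub>env g\<^esub>} \<times> UNIV"
        using push[OF ep(2,3), of e'] unfolding q_def by blast
      have q: "q \<in> Qg n"
        unfolding Qg_def q_def using pfil_rep_add[OF Bg O intoF[OF ep(1)] into2[OF ep(2)]] ep(3) by blast
      have "x = ?vg n q" unfolding x j(1) by (rule hol_val_zero_letters[OF gl Pg(2)[OF q] j(2)])
      then show "x \<in> ?vg n ` Qg n" using q by blast
    next
      fix x assume "x \<in> ?vg n ` Qg n"
      then obtain e p where x: "x = ?vg n (e + pw1 (to_env g) p)" and ep: "e \<in> pfil_rep (env g) ?O (env_fil g F) n" "p \<in> \<Union>(\<alpha> n)"
        unfolding Qg_def by blast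
      obtain e' where e': "e' \<in> pfil_rep (env ?S) ?O (env_fil ?S ?FS) n" "pw1 Uf e' = e" using ontoF[OF ep(1)] by blast
      have z: "0 \<in> pfil_rep ?S ?O ?FS n" by (rule pfil_rep_zero[OF CS O])
      obtain j where j: "pw1 Uf (e' + pw1 (to_env ?S) (0 + ?T n p)) = (e + pw1 (to_env g) p) + j" "keys j \<subseteq> {\<zero>\<^bsub>env g\<^esub>} \<times> UNIV"
        using push[OF z ep(2), of e'] e'(2) by auto
      have "e + pw1 (to_env g) p \<in> Qg n" unfolding Qg_def using ep by blast
      then have "x = ?vg n (pw1 Uf (e' + pw1 (to_env ?S) (0 + ?T n p)))"
        unfolding x j(1) by (intro hol_val_zero_letters[OF gl Pg(2) j(2), symmetric])
      moreover have "e' + pw1 (to_env ?S) (0 + ?T n p) \<in> QS n" unfolding QS_def U\<alpha> using e'(1) z ep(2) by blast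
      ultimately show "x \<in> ?vg n ` pw1 Uf ` QS n" by blast
    qed
  qed
  show "hat_env_rho g F (pairing (env ?S) (env_fil ?S ?FS) (hol_inf_elem M g F \<alpha>) s) =
      pairing (env g) (env_fil g F) (hol_elem M g F \<alpha>) s"
  proof
    fix n
    have "hat_env_rho g F (pairing (env ?S) (env_fil ?S ?FS) (hol_inf_elem M g F \<alpha>) s) n =
       (\<Union>q\<in>QS n. cmap (env g) (env_fil g F n) Uf (env_fil ?S ?FS n +>\<^bsub>env ?S\<^esub> ?vS n q))"
      unfolding hat_env_rho_def hat_map_def hol_inf_elem_def PS(1) cmap_Union ..
    also have "\<dots> = (\<Union>q\<in>QS n. env_fil g F n +>\<^bsub>env g\<^esub> ?vg n (pw1 Uf q))"
    proof (intro SUP_cong refl)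
      fix q assume q: "q \<in> QS n"
      show "cmap (env g) (env_fil g F n) Uf (env_fil ?S ?FS n +>\<^bsub>env ?S\<^esub> ?vS n q) = env_fil g F n +>\<^bsub>env g\<^esub> ?vg n (pw1 Uf q)"
        unfolding Uf_hol_val[OF PS(2)[OF q], symmetric]
        by (rule cmap_coset[OF lin_Uf subsp_env_fil[OF h] subsp_env_fil[OF gl]]) (erule Ufil, rule vS[OF q])
    qed
    also have "\<dots> = (\<Union>x\<in>?vg n ` pw1 Uf ` QS n. env_fil g F n +>\<^bsub>env g\<^esub> x)" by simp
    also have "\<dots> = (\<Union>q\<in>Qg n. env_fil g F n +>\<^bsub>env g\<^esub> ?vg n q)" unfolding image by simp
    also have "\<dots> = pairing (env g) (env_fil g F) (hol_elem M g F \<alpha>) s n" unfolding Pg(1) ..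
    finally show "hat_env_rho g F (pairing (env ?S) (env_fil ?S ?FS) (hol_inf_elem M g F \<alpha>) s) n =
      pairing (env g) (env_fil g F) (hol_elem M g F \<alpha>) s n" .
  qed
qed

section \<open>The completed bar complex\<close>

lemma cmap_mono: "N \<subseteq> N' \<Longrightarrow> X \<subseteq> X' \<Longrightarrow> cmap W N f X \<subseteq> cmap W N' f X'"
  by (auto simp: cmap_def coset_eq)

lemma cmap_cmap:
  assumes f: "lin V W f" and N: "subsp N V" and N': "subsp N' W" and fN: "\<And>n. n \<in> N \<Longrightarrow> f n \<in> N'"
    and h: "\<And>x. x \<in> X \<Longrightarrow> h x \<in> carrier V"
  shows "cmap W N' f (cmap V N h X) = cmap W N' (\<lambda>x. f (h x)) X"
proof -
  have "cmap W N' f (cmap V N h X) = (\<Union>x\<in>X. cmap W N' f (N +>\<^bsub>V\<^esub> h x))"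
    by (auto simp: cmap_def)
  also have "\<dots> = (\<Union>x\<in>X. N' +>\<^bsub>W\<^esub> f (h x))"
    by (intro SUP_cong refl cmap_coset[OF f N N' fN h])
  finally show ?thesis by (simp add: cmap_def)
qed

text \<open>A homogeneous sequence satisfies the boundedness condition on points of the completion with the single degree
\<open>k\<close>, so only cosets and nesting are left to check.\<close>

lemma grade_hat_env:
  "s \<in> grade (hat_env h F) k \<longleftrightarrow>
    (\<forall>n. (\<exists>x\<in>grade (env h) k. s n = env_fil h F n +>\<^bsub>env h\<^esub> x) \<and> s (Suc n) \<subseteq> s n) \<and> s 1 = env_fil h F 1"
  if h: "glie h"
proof -
  have "\<exists>K. finite K \<and> (\<forall>n. s n \<inter> vspan (env h) (\<Union>k\<in>K. grade (env h) k) \<noteq> {})"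
    if s: "\<forall>n. \<exists>x\<in>grade (env h) k. s n = env_fil h F n +>\<^bsub>env h\<^esub> x"
  proof (intro exI[of _ "{k}"] conjI allI)
    fix n
    obtain x where x: "x \<in> grade (env h) k" "s n = env_fil h F n +>\<^bsub>env h\<^esub> x" using s by blast
    have "x \<in> carrier (env h)" using homog_env_sub[OF h] homogI[OF x(1)] by blast
    then have "x \<in> s n" unfolding x(2) by (rule coset_self[OF vsp_env[OF h] subsp_env_fil[OF h]])
    moreover have "x \<in> vspan (env h) (\<Union>k\<in>{k}. grade (env h) k)" by (rule vspan_base) (simp add: x(1))
    ultimately show "s n \<inter> vspan (env h) (\<Union>k\<in>{k}. grade (env h) k) \<noteq> {}" by blast
  qed simp
  moreover have "grade (env h) k \<subseteq> carrier (env h)" using homog_env_sub[OF h] by (auto intro: homogI)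
  ultimately show ?thesis
    unfolding hat_env_def hat_aug_def restr_def by (auto simp: hat_def quot_simps image_iff) blast+
qed

lemma hat_env_simps:
  "(s \<oplus>\<^bsub>hat_env h F\<^esub> t) = (\<lambda>n. s n <+>\<^bsub>env h\<^esub> t n)"
  "(c \<odot>\<^bsub>hat_env h F\<^esub> s) = (\<lambda>n. cmap (env h) (env_fil h F n) (\<lambda>x. c \<odot>\<^bsub>env h\<^esub> x) (s n))"
  by (simp_all add: hat_env_def hat_aug_def restr_def hat_def quot_def)

lemma graded_closed_hat_env:
  assumes h: "glie h"
  shows "graded_closed (hat_env h F)"
  unfolding graded_closed_def
proof (intro allI ballI conjI)
  note V = vsp_env[OF h] and N = subsp_env_fil[OF h, of F] and C = graded_closedD(1,2)[OF graded_closed_env[OF h]]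
  note gr = grade_hat_env[OF h]
  have gc: "x \<in> carrier (env h)" if "x \<in> grade (env h) k" for x k
    using homog_env_sub[OF h] homogI[OF that] by blast
  fix k s assume s: "s \<in> grade (hat_env h F) k"
  show "s \<oplus>\<^bsub>hat_env h F\<^esub> t \<in> grade (hat_env h F) k" if t: "t \<in> grade (hat_env h F) k" for t
    unfolding gr hat_env_simps
  proof (intro conjI allI)
    fix n
    obtain x y where xy: "x \<in> grade (env h) k" "s n = env_fil h F n +>\<^bsub>env h\<^esub> x" "y \<in> grade (env h) k" "t n = env_fil h F n +>\<^bsub>env h\<^esub> y"
      using s t unfolding gr by blast
    show "\<exists>x\<in>grade (env h) k. s n <+>\<^bsub>env h\<^esub> t n = env_fil h F n +>\<^bsub>env h\<^esub> x"
      unfolding xy(2,4) coset_add[OF V N gc[OF xy(1)] gc[OF xy(3)]] using C(1)[OF xy(1,3)] by blast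
    have "s (Suc n) \<subseteq> s n" "t (Suc n) \<subseteq> t n" using s t unfolding gr by blast+
    then show "s (Suc n) <+>\<^bsub>env h\<^esub> t (Suc n) \<subseteq> s n <+>\<^bsub>env h\<^esub> t n" by (auto simp: set_add_eq)
  next
    have "s 1 = env_fil h F 1" "t 1 = env_fil h F 1" using s t unfolding gr by blast+
    then show "s 1 <+>\<^bsub>env h\<^esub> t 1 = env_fil h F 1"
      using coset_add[OF V N vsp_zero[OF V] vsp_zero[OF V], of 1] coset_zero[OF V N subsp_zero[OF V N], of 1]
      by (simp add: vsp_l_zero[OF V vsp_zero[OF V]])
  qed
  show "c \<odot>\<^bsub>hat_env h F\<^esub> s \<in> grade (hat_env h F) k" for c
    unfolding gr hat_env_simps
  proof (intro conjI allI)
    have cm: "cmap (env h) (env_fil h F n) (\<lambda>x. c \<odot>\<^bsub>env h\<^esub> x) (env_fil h F n +>\<^bsub>env h\<^esub> x) = env_fil h F n +>\<^bsub>env h\<^esub> (c \<odot>\<^bsub>env h\<^esub> x)"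
      if "x \<in> carrier (env h)" for x n
      by (rule cmap_coset[OF lin_smult_map[OF V] N N subsp_smult[OF V N] that])
    fix n
    obtain x where x: "x \<in> grade (env h) k" "s n = env_fil h F n +>\<^bsub>env h\<^esub> x" using s unfolding gr by blast
    show "\<exists>x\<in>grade (env h) k. cmap (env h) (env_fil h F n) (\<lambda>x. c \<odot>\<^bsub>env h\<^esub> x) (s n) = env_fil h F n +>\<^bsub>env h\<^esub> x"
      unfolding x(2) cm[OF gc[OF x(1)]] using C(2)[OF x(1)] by blast
    have "s (Suc n) \<subseteq> s n" using s unfolding gr by blast
    then show "cmap (env h) (env_fil h F (Suc n)) (\<lambda>x. c \<odot>\<^bsub>env h\<^esub> x) (s (Suc n)) \<subseteq> cmap (env h) (env_fil h F n) (\<lambda>x. c \<odot>\<^bsub>env h\<^esub> x) (s n)"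
      by (intro cmap_mono env_fil_decreasing[OF h])
    have "s 1 = env_fil h F 1" using s unfolding gr by blast
    then have "s 1 = env_fil h F 1 +>\<^bsub>env h\<^esub> \<zero>\<^bsub>env h\<^esub>" using coset_zero[OF V N subsp_zero[OF V N]] by simp
    then show "cmap (env h) (env_fil h F 1) (\<lambda>x. c \<odot>\<^bsub>env h\<^esub> x) (s 1) = env_fil h F 1"
      using cm[OF vsp_zero[OF V], of 1] coset_zero[OF V N subsp_zero[OF V N], of 1] by (simp add: vsp_rnull[OF V])
  qed
qed

context env_functor
begin

text \<open>A filtered map acts on each coset through any representative, so linearity and degrees are inherited from \<open>Uf\<close> at
each index.\<close>

lemma hlin_hat_Uf:
  assumes F: "\<And>x n. x \<in> env_fil h F n \<Longrightarrow> Uf x \<in> env_fil g F' n"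
  shows "hlin (hat_env h F) (hat_env g F') (hat_map (env g) (env_fil g F') Uf)"
proof -
  note Vh = vsp_env[OF h] and Vg = vsp_env[OF g(1)] and Nh = subsp_env_fil[OF h, of F] and Ng = subsp_env_fil[OF g(1), of F']
  note grh = grade_hat_env[OF h] and grg = grade_hat_env[OF g(1)]
  have gc: "x \<in> carrier (env h)" if "x \<in> grade (env h) k" for x k
    using homog_env_sub[OF h] homogI[OF that] by blast
  have cm: "cmap (env g) (env_fil g F' n) Uf (env_fil h F n +>\<^bsub>env h\<^esub> x) = env_fil g F' n +>\<^bsub>env g\<^esub> Uf x"
    if "x \<in> carrier (env h)" for x n
    by (rule cmap_coset[OF lin_Uf Nh Ng F that])
  show ?thesis
    unfolding hlin_def hat_map_def
  proof (intro allI ballI conjI)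
    fix k s assume s: "s \<in> grade (hat_env h F) k"
    have rep: "\<exists>x\<in>grade (env h) k. s n = env_fil h F n +>\<^bsub>env h\<^esub> x" if "s \<in> grade (hat_env h F) k" for s n
      using that unfolding grh by blast
    show "(\<lambda>n. cmap (env g) (env_fil g F' n) Uf (s n)) \<in> grade (hat_env g F') k"
      unfolding grg
    proof (intro conjI allI)
      fix n
      obtain x where x: "x \<in> grade (env h) k" "s n = env_fil h F n +>\<^bsub>env h\<^esub> x" using rep[OF s] by blast
      show "\<exists>x\<in>grade (env g) k. cmap (env g) (env_fil g F' n) Uf (s n) = env_fil g F' n +>\<^bsub>env g\<^esub> x"
        unfolding x(2) cm[OF gc[OF x(1)]] using Uf_grade[OF x(1)] by blast
      have "s (Suc n) \<subseteq> s n" using s unfolding grh by blast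
      then show "cmap (env g) (env_fil g F' (Suc n)) Uf (s (Suc n)) \<subseteq> cmap (env g) (env_fil g F' n) Uf (s n)"
        by (intro cmap_mono env_fil_decreasing[OF g(1)])
      have "s 1 = env_fil h F 1" using s unfolding grh by blast
      then have "s 1 = env_fil h F 1 +>\<^bsub>env h\<^esub> \<zero>\<^bsub>env h\<^esub>" using coset_zero[OF Vh Nh subsp_zero[OF Vh Nh]] by simp
      then show "cmap (env g) (env_fil g F' 1) Uf (s 1) = env_fil g F' 1"
        using cm[OF vsp_zero[OF Vh], of 1] coset_zero[OF Vg Ng subsp_zero[OF Vg Ng], of 1] by (simp add: lin_zero[OF lin_Uf])
    qed
    show "(\<lambda>n. cmap (env g) (env_fil g F' n) Uf ((c \<odot>\<^bsub>hat_env h F\<^esub> s) n)) = c \<odot>\<^bsub>hat_env g F'\<^esub> (\<lambda>n. cmap (env g) (env_fil g F' n) Uf (s n))" for c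
    proof
      fix n
      obtain x where x: "x \<in> grade (env h) k" "s n = env_fil h F n +>\<^bsub>env h\<^esub> x" using rep[OF s] by blast
      note xc = gc[OF x(1)]
      have 1: "cmap (env h) (env_fil h F n) (\<lambda>x. c \<odot>\<^bsub>env h\<^esub> x) (env_fil h F n +>\<^bsub>env h\<^esub> x) = env_fil h F n +>\<^bsub>env h\<^esub> (c \<odot>\<^bsub>env h\<^esub> x)"
        by (rule cmap_coset[OF lin_smult_map[OF Vh] Nh Nh subsp_smult[OF Vh Nh] xc])
      have 2: "cmap (env g) (env_fil g F' n) (\<lambda>x. c \<odot>\<^bsub>env g\<^esub> x) (env_fil g F' n +>\<^bsub>env g\<^esub> Uf x) = env_fil g F' n +>\<^bsub>env g\<^esub> (c \<odot>\<^bsub>env g\<^esub> Uf x)"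
        by (rule cmap_coset[OF lin_smult_map[OF Vg] Ng Ng subsp_smult[OF Vg Ng] lin_in[OF lin_Uf xc]])
      show "cmap (env g) (env_fil g F' n) Uf ((c \<odot>\<^bsub>hat_env h F\<^esub> s) n) = (c \<odot>\<^bsub>hat_env g F'\<^esub> (\<lambda>n. cmap (env g) (env_fil g F' n) Uf (s n))) n"
        unfolding hat_env_simps x(2) 1 cm[OF xc] 2 cm[OF vsp_smult[OF Vh xc]] lin_smult[OF lin_Uf xc] ..
    qed
    fix t assume t: "t \<in> grade (hat_env h F) k"
    show "(\<lambda>n. cmap (env g) (env_fil g F' n) Uf ((s \<oplus>\<^bsub>hat_env h F\<^esub> t) n)) =
        (\<lambda>n. cmap (env g) (env_fil g F' n) Uf (s n)) \<oplus>\<^bsub>hat_env g F'\<^esub> (\<lambda>n. cmap (env g) (env_fil g F' n) Uf (t n))"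
    proof
      fix n
      obtain x y where xy: "x \<in> grade (env h) k" "s n = env_fil h F n +>\<^bsub>env h\<^esub> x" "y \<in> grade (env h) k" "t n = env_fil h F n +>\<^bsub>env h\<^esub> y"
        using rep[OF s] rep[OF t] by blast
      note c = gc[OF xy(1)] gc[OF xy(3)]
      show "cmap (env g) (env_fil g F' n) Uf ((s \<oplus>\<^bsub>hat_env h F\<^esub> t) n) =
        ((\<lambda>n. cmap (env g) (env_fil g F' n) Uf (s n)) \<oplus>\<^bsub>hat_env g F'\<^esub> (\<lambda>n. cmap (env g) (env_fil g F' n) Uf (t n))) n"
        unfolding hat_env_simps xy(2,4) coset_add[OF Vh Nh c] cm[OF c(1)] cm[OF c(2)] cm[OF vsp_add[OF Vh c]]
          coset_add[OF Vg Ng lin_in[OF lin_Uf c(1)] lin_in[OF lin_Uf c(2)]] lin_add[OF lin_Uf c] ..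
    qed
  qed
qed

text \<open>The sign \<open>-1\<close> in the map to the bar complex is applied to the holonomy on a simplex, which is known only as a
sequence of subsets, so this is stated for such sequences.\<close>

lemma hat_Uf_smult:
  assumes F: "\<And>x n. x \<in> env_fil h F n \<Longrightarrow> Uf x \<in> env_fil g F' n" and t: "\<And>n. t n \<subseteq> carrier (env h)"
  shows "hat_map (env g) (env_fil g F') Uf (c \<odot>\<^bsub>hat_env h F\<^esub> t) = c \<odot>\<^bsub>hat_env g F'\<^esub> hat_map (env g) (env_fil g F') Uf t"
proof
  fix n
  note Vh = vsp_env[OF h] and Vg = vsp_env[OF g(1)] and Nh = subsp_env_fil[OF h, of F] and Ng = subsp_env_fil[OF g(1), of F']
  have 1: "cmap (env g) (env_fil g F' n) Uf (cmap (env h) (env_fil h F n) (\<lambda>x. c \<odot>\<^bsub>env h\<^esub> x) (t n)) =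
      cmap (env g) (env_fil g F' n) (\<lambda>x. Uf (c \<odot>\<^bsub>env h\<^esub> x)) (t n)"
    by (rule cmap_cmap[OF lin_Uf Nh Ng F]) (use t vsp_smult[OF Vh] in blast)+
  have 2: "cmap (env g) (env_fil g F' n) (\<lambda>x. c \<odot>\<^bsub>env g\<^esub> x) (cmap (env g) (env_fil g F' n) Uf (t n)) =
      cmap (env g) (env_fil g F' n) (\<lambda>x. c \<odot>\<^bsub>env g\<^esub> Uf x) (t n)"
    by (rule cmap_cmap[OF lin_smult_map[OF Vg] Ng Ng subsp_smult[OF Vg Ng]]) (use t lin_in[OF lin_Uf] in blast)+
  have "cmap (env g) (env_fil g F' n) (\<lambda>x. Uf (c \<odot>\<^bsub>env h\<^esub> x)) (t n) = cmap (env g) (env_fil g F' n) (\<lambda>x. c \<odot>\<^bsub>env g\<^esub> Uf x) (t n)"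
    unfolding cmap_def using t[of n] by (intro SUP_cong refl) (auto simp: lin_smult[OF lin_Uf])
  then show "hat_map (env g) (env_fil g F') Uf (c \<odot>\<^bsub>hat_env h F\<^esub> t) n = (c \<odot>\<^bsub>hat_env g F'\<^esub> hat_map (env g) (env_fil g F') Uf t) n"
    unfolding hat_map_def hat_env_simps 1 2 .
qed

end

lemma hlin_susp: "hlin V W f \<Longrightarrow> hlin (susp V) (susp W) f"
  by (simp add: hlin_def)

lemma graded_closed_susp: "graded_closed V \<Longrightarrow> graded_closed (susp V)"
  by (rule susp_props(2))

lemma tlen_coset:
  assumes A: "graded_closed A"
  shows "tlen (susp A) n +>\<^bsub>bar A\<^esub> tcls (susp A) q =
    {tcls (susp A) (e + q) | e. keys e \<subseteq> {w \<in> lists (homog A). n \<le> length w}}"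
proof -
  note S = graded_closed_susp[OF A]
  have "tlen (susp A) n +>\<^bsub>bar A\<^esub> tcls (susp A) q = (\<lambda>X. X <+>\<^bsub>tword (susp A)\<^esub> tcls (susp A) q) ` tlen (susp A) n"
    unfolding coset_eq bar_def by auto
  also have "\<dots> = {tcls (susp A) (e + q) | e. keys e \<subseteq> {w \<in> lists (homog A). n \<le> length w}}"
    unfolding tlen_eq[OF S] image_image tcls_add[OF S] homog_susp by blast
  finally show ?thesis .
qed

text \<open>The bar construction applies \<open>f\<close> to each letter, and the letters of the image of a chain are the values of \<open>-\<phi>\<close> on
simplices.  The elements of tensor degree at least \<open>n\<close> by which representatives differ are absorbed by the target.\<close>

lemma hbar_map_to_hbar:
  assumes A: "graded_closed A" and A': "graded_closed A'" and f: "hlin A A' f"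
    and \<phi>: "\<And>s. f ((-1) \<odot>\<^bsub>A\<^esub> \<phi> s) = (-1) \<odot>\<^bsub>A'\<^esub> \<phi>' s"
  shows "hbar_map A' f (to_hbar A \<phi> c) = to_hbar A' \<phi>' c"
proof
  fix n
  let ?V = "susp A" and ?W = "susp A'"
  note S = graded_closed_susp[OF A] and S' = graded_closed_susp[OF A'] and sf = hlin_susp[OF f]
  let ?L = "\<lambda>A. {e. keys e \<subseteq> {w \<in> lists (homog A). n \<le> length w}} :: (_ list \<Rightarrow>\<^sub>0 real) set"
  let ?fw = "pext (\<lambda>w. single (map f w) (1::real))"
  let ?P = "\<lambda>A \<phi>. \<Sum>m<n. pext (\<lambda>s. pext (\<lambda>w. single (map (\<lambda>s. (-1) \<odot>\<^bsub>A\<^esub> \<phi> s) w) (1::real)) (aw m s)) c"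
  have P: "?fw (?P A \<phi>) = ?P A' \<phi>'"
    by (simp add: pext_sum pext_pext comp_def \<phi>)
  have fL: "?fw e \<in> ?L A'" if "e \<in> ?L A" for e
  proof -
    have "keys (?fw e) \<subseteq> {w \<in> lists (homog A'). n \<le> length w}"
    proof (rule keys_pext_sub)
      fix w assume "w \<in> keys e"
      then have "w \<in> lists (homog A)" "n \<le> length w" using that by auto
      then show "keys (single (map f w) (1::real)) \<subseteq> {w \<in> lists (homog A'). n \<le> length w}"
        using lists_map_hlin[OF f] by simp
    qed
    then show ?thesis by simp
  qed
  have "hbar_map A' f (to_hbar A \<phi> c) n =
      (\<Union>X\<in>tlen ?V n +>\<^bsub>bar A\<^esub> tcls ?V (?P A \<phi>). tlen ?W n +>\<^bsub>bar A'\<^esub> tmap ?W f X)"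
    unfolding hbar_map_def hat_map_def cmap_def to_hbar_def ..
  also have "\<dots> = (\<Union>e\<in>?L A. tlen ?W n +>\<^bsub>bar A'\<^esub> tcls ?W (?fw e + ?fw (?P A \<phi>)))"
  proof -
    have "tlen ?V n +>\<^bsub>bar A\<^esub> tcls ?V (?P A \<phi>) = (\<lambda>e. tcls ?V (e + ?P A \<phi>)) ` ?L A"
      unfolding tlen_coset[OF A] by blast
    then show ?thesis by (simp only: image_image tmap_tcls[OF sf S S'] pext_add)
  qed
  also have "\<dots> = (\<Union>e\<in>?L A. tlen ?W n +>\<^bsub>bar A'\<^esub> tcls ?W (?P A' \<phi>'))"
  proof (intro SUP_cong refl)
    fix e assume e: "e \<in> ?L A"
    have "{tcls ?W (e' + (?fw e + q)) | e'. e' \<in> ?L A'} = {tcls ?W (e' + q) | e'. e' \<in> ?L A'}" for q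
    proof (intro equalityI subsetI)
      fix X assume "X \<in> {tcls ?W (e' + (?fw e + q)) | e'. e' \<in> ?L A'}"
      then obtain e' where "e' \<in> ?L A'" "X = tcls ?W ((e' + ?fw e) + q)" by (auto simp: add.assoc)
      moreover have "e' + ?fw e \<in> ?L A'" using \<open>e' \<in> ?L A'\<close> fL[OF e] by (auto simp del: in_lists_conv_set dest: subsetD[OF keys_add])
      ultimately show "X \<in> {tcls ?W (e' + q) | e'. e' \<in> ?L A'}" by blast
    next
      fix X assume "X \<in> {tcls ?W (e' + q) | e'. e' \<in> ?L A'}"
      then obtain e' where "e' \<in> ?L A'" "X = tcls ?W ((e' - ?fw e) + (?fw e + q))" by auto
      moreover have "e' - ?fw e \<in> ?L A'"
        unfolding mem_Collect_eq by (rule keys_minus_sub) (use \<open>e' \<in> ?L A'\<close> fL[OF e] in simp_all)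
      ultimately show "X \<in> {tcls ?W (e' + (?fw e + q)) | e'. e' \<in> ?L A'}" by blast
    qed
    then show "tlen ?W n +>\<^bsub>bar A'\<^esub> tcls ?W (?fw e + ?fw (?P A \<phi>)) = tlen ?W n +>\<^bsub>bar A'\<^esub> tcls ?W (?P A' \<phi>')"
      unfolding tlen_coset[OF A'] P by (simp only: mem_Collect_eq)
  qed
  also have "\<dots> = to_hbar A' \<phi>' c n"
  proof -
    have "0 \<in> ?L A" by simp
    then show ?thesis unfolding to_hbar_def by blast
  qed
  finally show "hbar_map A' f (to_hbar A \<phi> c) n = to_hbar A' \<phi>' c n" .
qed

theorem proposition4p12:
  fixes M :: "'m manifold" and g :: "'g dg" and F :: "nat \<Rightarrow> 'g set"
    and \<alpha> :: "nat \<Rightarrow> ('g, 'm form) prd set"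
  assumes "smooth_manifold M"
    and "dg_lie g" and "lie_filtration g F"
    and "flat_connection M g F \<alpha>"
  shows "\<forall>c\<in>carrier (chains M).
    hbar_map (hat_env g F) (hat_env_rho g F) (hol_inf M g F \<alpha> c) = hol M g F \<alpha> c"
proof
  fix c
  interpret E: env_functor "strict g" g "rho g" by (rule strict_functor[OF assms(2)])
  note core = hat_env_rho_pairing[OF assms]
  have fil: "E.Uf x \<in> env_fil g F n" if "x \<in> env_fil (strict g) (str_fil g F) n" for x n
    by (rule E.Uf_fil[OF rho_fil[OF assms(2,3)] that])
  show "hbar_map (hat_env g F) (hat_env_rho g F) (hol_inf M g F \<alpha> c) = hol M g F \<alpha> c"
    unfolding hol_inf_def hol_def
  proof (rule hbar_map_to_hbar[OF graded_closed_hat_env[OF E.h] graded_closed_hat_env[OF E.g(1)]])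
    show "hlin (hat_env (strict g) (str_fil g F)) (hat_env g F) (hat_env_rho g F)"
      unfolding hat_env_rho_def[abs_def] by (rule E.hlin_hat_Uf[OF fil])
    show "hat_env_rho g F ((-1) \<odot>\<^bsub>hat_env (strict g) (str_fil g F)\<^esub>
        pairing (env (strict g)) (env_fil (strict g) (str_fil g F)) (hol_inf_elem M g F \<alpha>) s) =
      (-1) \<odot>\<^bsub>hat_env g F\<^esub> pairing (env g) (env_fil g F) (hol_elem M g F \<alpha>) s" for s
      unfolding core(1)[symmetric] unfolding hat_env_rho_def
      by (rule E.hat_Uf_smult[OF fil core(2)])
  qed
qed

end
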